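(* Let $n\geq 1$ and let $w_0$ denote the longest element of the hyperoctahedral group $W_n$. The equation $$\mathfrak C_{w_0}(X;Y,Z)=\sum_{\lambda\subset\delta_{n-1}}Q_{\delta_n+\lambda}(X)\,S^{(\delta^\vee_{n-1},\delta^\vee_{n-1})}_{\delta_{n-1}/\lambda'}(h(Y,-Z))$$ holds in $\Gamma[Y,Z]$, where the sum is over all partitions $\lambda$ whose diagram is contained in that of $\delta_{n-1}$, and $\lambda'$ is the conjugate of $\lambda$.
   Context: $X=(x_1,x_2,\ldots)$, $Y=(y_1,y_2,\ldots)$, $Z=(z_1,z_2,\ldots)$ are commuting independent variables; $-Z=(-z_1,-z_2,\ldots)$. $\delta_r=(r,r-1,\ldots,1)$ (empty for $r\leq 0$) and $\delta^\vee_{n-1}=(1,2,\ldots,n-1)$. $W_n$ is the group of signed permutations of $\{1,\ldots,n\}$, generated by $s_i=(i,i+1)$, $1\leq i\leq n-1$, and the sign change $s_0(1)=\overline 1$. Its nilCoxeter algebra $\mathcal W_n$ is the free associative unital algebra on $u_0,\ldots,u_{n-1}$ modulo $u_i^2=0$; $u_iu_j=u_ju_i$ for $|i-j|\geq 2$; $u_iu_{i+1}u_i=u_{i+1}u_iu_{i+1}$ for $i>0$; $u_0u_1u_0u_1=u_1u_0u_1u_0$. It has basis $u_w=u_{a_1}\cdots u_{a_\ell}$, $w\in W_n$, with $a_1\cdots a_\ell$ any reduced word of $w$; $\langle\xi,w\rangle$ denotes the coefficient of $u_w$ in $\xi$ (coefficients extended to include the variables). Set $A_i(t)=(1+tu_{n-1})\cdots(1+tu_i)$,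 $\tilde A_i(t)=(1-tu_i)\cdots(1-tu_{n-1})$, $C(t)=(1+tu_{n-1})\cdots(1+tu_1)(1+tu_0)(1+tu_0)(1+tu_1)\cdots(1+tu_{n-1})$, $C(X)=C(x_1)C(x_2)\cdots$. The type C double Schubert polynomial of $w\in W_n$ is $$\mathfrak C_w(X;Y,Z)=\langle\tilde A_{n-1}(z_{n-1})\cdots\tilde A_1(z_1)\,C(X)\,A_1(y_1)\cdots A_{n-1}(y_{n-1}),w\rangle.$$ Define $q_r(X)$ by $\prod_{i\geq1}\frac{1+x_it}{1-x_it}=\sum_{r\geq 0}q_r(X)t^r$ ($q_r=0$ for $r<0$), and $\Gamma=\mathbb Z[q_1(X),q_2(X),\ldots]$. For a finite integer sequence $\alpha$, $q_\alpha=\prod_iq_{\alpha_i}$ and $Q_\alpha(X)=R^\infty q_\alpha$, where $R^\infty=\prod_{i<j}\frac{1-R_{ij}}{1+R_{ij}}$ is expanded as a power series in the raising operators $R_{ij}\alpha=(\ldots,\alpha_i+1,\ldots,\alpha_j-1,\ldots)$, acting by $R\,q_\alpha=q_{R\alpha}$ (here $i<j$ range over the positions of $\alpha$). For strict partitions these are the Schur $Q$-functions. The flagged (skew) Schur polynomial is $$S^{(\delta^\vee_{n-1},\delta^\vee_{n-1})}_{\delta_{n-1}/\mu}(h(Y,-Z)):=\det\bigl(h_{(n-i)-\mu_j+j-i}(y_1,\ldots,y_i,-z_1,\ldots,-z_i)\bigr)_{1\leq i,j\leq n-1},$$ where $h_p$ is the complete homogeneous symmetric polynomial ($h_0=1$,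 $h_p=0$ for $p<0$); an empty determinant is $1$. *)

theory Defs
  imports
    Complex_Main
    "HOL-Library.Poly_Mapping"
    "HOL-Library.Groups_Big_Fun"
    "HOL-Combinatorics.Permutations"
    "HOL-Computational_Algebra.Formal_Power_Series"
    "Jordan_Normal_Form.Determinant"
begin

text \<open>
  A monomial is a finitely supported exponent function, a power series an arbitrary function on
  monomials.  The variable type may be infinite; series need not have bounded degree.
\<close>

typedef ('v, 'a) mps = "UNIV :: (('v \<Rightarrow>\<^sub>0 nat) \<Rightarrow> 'a) set"
  morphisms mps_nth Abs_mps ..

setup_lifting type_definition_mps

lemma mps_eqI: "(\<And>m. mps_nth f m = mps_nth g m) \<Longrightarrow> f = g"
  by (simp add: mps_nth_inject[symmetric] fun_eq_iff)

lemma finite_mono_le: "finite {a :: 'v \<Rightarrow>\<^sub>0 nat. \<exists>b. a + b = m}"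
proof -
  let ?K = "Poly_Mapping.keys m"
  let ?B = "{0..Max (insert 0 (Poly_Mapping.lookup m ` ?K))}"
  let ?F = "{f. (\<forall>x. (x \<in> ?K \<longrightarrow> f x \<in> ?B) \<and> (x \<notin> ?K \<longrightarrow> f x = (0::nat)))}"
  have "finite ?F"
    by (rule finite_set_of_finite_funs) auto
  moreover have "Poly_Mapping.lookup ` {a. \<exists>b. a + b = m} \<subseteq> ?F"
  proof clarify
    fix a b x
    show "(x \<in> Poly_Mapping.keys (a + b) \<longrightarrow> Poly_Mapping.lookup a x
              \<in> {0..Max (insert 0 (Poly_Mapping.lookup (a + b) ` Poly_Mapping.keys (a + b)))}) \<and>
          (x \<notin> Poly_Mapping.keys (a + b) \<longrightarrow> Poly_Mapping.lookup a x = (0::nat))"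
    proof (intro conjI impI)
      assume "x \<in> Poly_Mapping.keys (a + b)"
      then have "Poly_Mapping.lookup (a + b) x
          \<le> Max (insert 0 (Poly_Mapping.lookup (a + b) ` Poly_Mapping.keys (a + b)))"
        by (intro Max_ge) auto
      then show "Poly_Mapping.lookup a x
              \<in> {0..Max (insert 0 (Poly_Mapping.lookup (a + b) ` Poly_Mapping.keys (a + b)))}"
        by (simp add: lookup_add)
    next
      assume "x \<notin> Poly_Mapping.keys (a + b)"
      then show "Poly_Mapping.lookup a x = 0"
        by (simp add: Poly_Mapping.in_keys_iff lookup_add)
    qed
  qed
  ultimately have "finite (Poly_Mapping.lookup ` {a. \<exists>b. a + b = m})"
    by (rule finite_subset[rotated])
  then show ?thesis
    by (rule finite_imageD) (simp add: inj_on_def Poly_Mapping.lookup_inject)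
qed

lemma finite_mono_antidiag: "finite {(a, b). a + b = (m :: 'v \<Rightarrow>\<^sub>0 nat)}"
proof -
  have "{(a, b). a + b = m} \<subseteq> {a. \<exists>b. a + b = m} \<times> {a. \<exists>b. a + b = m}"
    by (auto; metis add.commute)
  then show ?thesis
    using finite_mono_le[of m] by (meson finite_SigmaI finite_subset)
qed

instantiation mps :: (type, comm_ring_1) comm_ring_1
begin

lift_definition zero_mps :: "('a, 'b) mps" is "\<lambda>_. 0" .
lift_definition one_mps :: "('a, 'b) mps" is "\<lambda>m. if m = 0 then 1 else 0" .
lift_definition plus_mps :: "('a, 'b) mps \<Rightarrow> ('a, 'b) mps \<Rightarrow> ('a, 'b) mps"
  is "\<lambda>f g m. f m + g m" .
lift_definition minus_mps :: "('a, 'b) mps \<Rightarrow> ('a, 'b) mps \<Rightarrow> ('a, 'b) mps"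
  is "\<lambda>f g m. f m - g m" .
lift_definition uminus_mps :: "('a, 'b) mps \<Rightarrow> ('a, 'b) mps"
  is "\<lambda>f m. - f m" .
lift_definition times_mps :: "('a, 'b) mps \<Rightarrow> ('a, 'b) mps \<Rightarrow> ('a, 'b) mps"
  is "\<lambda>f g m. \<Sum>(a, b) | a + b = m. f a * g b" .

instance
proof
  fix f g h :: "('a, 'b) mps"
  show "f + g + h = f + (g + h)" by transfer (simp add: fun_eq_iff add.assoc)
  show "f + g = g + f" by transfer (simp add: fun_eq_iff add.commute)
  show "0 + f = f" by transfer simp
  show "- f + f = 0" by transfer simp
  show "f - g = f + - g" by transfer simp
  show "(0::('a, 'b) mps) \<noteq> 1" by transfer (auto simp: fun_eq_iff)
  show "f * g = g * f"
  proof (transfer, rule ext)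
    fix f g :: "('a \<Rightarrow>\<^sub>0 nat) \<Rightarrow> 'b" and m
    show "(\<Sum>(a, b) | a + b = m. f a * g b) = (\<Sum>(a, b) | a + b = m. g a * f b)"
      by (rule sum.reindex_bij_witness[of _ prod.swap prod.swap])
        (auto simp: ac_simps)
  qed
  show "(f + g) * h = f * h + g * h"
    by transfer (simp add: fun_eq_iff distrib_right sum.distrib case_prod_unfold)
  show "1 * f = f"
  proof (transfer, rule ext)
    fix f :: "('a \<Rightarrow>\<^sub>0 nat) \<Rightarrow> 'b" and m
    have "(\<Sum>(a, b) | a + b = m. (if a = 0 then 1 else 0) * f b)
        = (\<Sum>(a, b) \<in> {(0 :: 'a \<Rightarrow>\<^sub>0 nat, m)}. (if a = 0 then 1 else 0) * f b)"
      by (rule sum.mono_neutral_right) (auto simp: finite_mono_antidiag split: if_split_asm)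
    then show "(\<Sum>(a, b) | a + b = m. (if a = 0 then 1 else 0) * f b) = f m"
      by simp
  qed
  show "f * g * h = f * (g * h)"
  proof (transfer, rule ext)
    fix f g h :: "('a \<Rightarrow>\<^sub>0 nat) \<Rightarrow> 'b" and m
    let ?D = "\<lambda>m :: 'a \<Rightarrow>\<^sub>0 nat. {(a, b). a + b = m}"
    have fin: "finite (?D k)" for k by (rule finite_mono_antidiag)
    have "(\<Sum>(a, b) \<in> ?D m. (\<Sum>(c, d) \<in> ?D a. f c * g d) * h b)
        = (\<Sum>p \<in> ?D m. \<Sum>q \<in> ?D (fst p). f (fst q) * g (snd q) * h (snd p))"
      by (simp add: case_prod_unfold sum_distrib_right)
    also have "\<dots> = (\<Sum>(p, q) \<in> (SIGMA p:?D m. ?D (fst p)). f (fst q) * g (snd q) * h (snd p))"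
      by (rule sum.Sigma) (auto simp: fin)
    also have "\<dots> = (\<Sum>(p, q) \<in> (SIGMA p:?D m. ?D (snd p)). f (fst p) * g (fst q) * h (snd q))"
      by (rule sum.reindex_bij_witness
          [of _ "\<lambda>((a, b), (c, d)). ((a + c, d), (a, c))" "\<lambda>((a, b), (c, d)). ((c, d + b), (d, b))"])
        (auto simp: ac_simps)
    also have "\<dots> = (\<Sum>p \<in> ?D m. \<Sum>q \<in> ?D (snd p). f (fst p) * g (fst q) * h (snd q))"
      by (rule sum.Sigma[symmetric]) (auto simp: fin)
    also have "\<dots> = (\<Sum>(a, b) \<in> ?D m. f a * (\<Sum>(c, d) \<in> ?D b. g c * h d))"
      by (simp add: case_prod_unfold sum_distrib_left mult.assoc)
    finally show "(\<Sum>(a, b) \<in> ?D m. (\<Sum>(c, d) \<in> ?D a. f c * g d) * h b)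
        = (\<Sum>(a, b) \<in> ?D m. f a * (\<Sum>(c, d) \<in> ?D b. g c * h d))" .
  qed
qed

end

definition mps_var :: "'v \<Rightarrow> ('v, 'a :: comm_ring_1) mps" where
  "mps_var v = Abs_mps (\<lambda>m. if m = Poly_Mapping.single v 1 then 1 else 0)"

text \<open>
  Coefficientwise limit: the coefficient of each monomial is the value at which the corresponding
  sequence of coefficients eventually becomes constant.  It is only used for sequences whose
  coefficients do stabilise.
\<close>

definition mps_lim :: "(nat \<Rightarrow> ('v, 'a) mps) \<Rightarrow> ('v, 'a) mps" where
  "mps_lim F = Abs_mps (\<lambda>m. THE c. \<forall>\<^sub>F N in sequentially. mps_nth (F N) m = c)"

lemma mps_lim_eqI:
  assumes "\<And>m. \<forall>\<^sub>F N in sequentially. mps_nth (F N) m = mps_nth g m"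
  shows "mps_lim F = g"
proof (rule mps_eqI)
  fix m
  have "(THE c. \<forall>\<^sub>F N in sequentially. mps_nth (F N) m = c) = mps_nth g m"
  proof (rule the_equality, rule assms)
    fix c assume "\<forall>\<^sub>F N in sequentially. mps_nth (F N) m = c"
    with assms[of m] have "\<forall>\<^sub>F N in sequentially. c = mps_nth g m"
      by eventually_elim simp
    then show "c = mps_nth g m" by simp
  qed
  then show "mps_nth (mps_lim F) m = mps_nth g m"
    by (simp add: mps_lim_def Abs_mps_inverse)
qed

text \<open>
  Division is not available over a general commutative ring; the inverse of a unit is described
  by its defining property.
\<close>

definition unit_inv :: "'a :: comm_ring_1 \<Rightarrow> 'a" where
  "unit_inv a = (THE b. a * b = 1)"

lemma unit_inv_eqI:
  assumes "a * b = (1 :: 'a :: comm_ring_1)"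
  shows "unit_inv a = b"
  unfolding unit_inv_def
proof (rule the_equality, rule assms)
  fix c assume "a * c = 1"
  have "c = c * (a * b)" using assms by simp
  also have "\<dots> = (a * c) * b" by (simp add: ac_simps)
  finally show "c = b" using \<open>a * c = 1\<close> by simp
qed

text \<open>
  Everything lives in the ring of integral power series in all the variables; the subring of
  polynomials over \<open>\<Gamma>\<close> in \<open>Y\<close> and \<open>Z\<close> is singled out below.  Variables are indexed from 1, and
  index 0 is never used.
\<close>

datatype xyz = VX nat | VY nat | VZ nat

type_synonym ser = "(xyz, int) mps"

definition x_var :: "nat \<Rightarrow> ser" where "x_var i = mps_var (VX i)"
definition y_var :: "nat \<Rightarrow> ser" where "y_var i = mps_var (VY i)"
definition z_var :: "nat \<Rightarrow> ser" where "z_var i = mps_var (VZ i)"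

definition q_fun :: "int \<Rightarrow> ser" where
  "q_fun r = (if r < 0 then 0 else
     mps_lim (\<lambda>N. fps_nth (\<Prod>i = 1..N. (1 + fps_const (x_var i) * fps_X)
                              * unit_inv (1 - fps_const (x_var i) * fps_X)) (nat r)))"

inductive_set subring_gen :: "'a :: comm_ring_1 set \<Rightarrow> 'a set" for S where
  gen: "a \<in> S \<Longrightarrow> a \<in> subring_gen S"
| one: "1 \<in> subring_gen S"
| diff: "a \<in> subring_gen S \<Longrightarrow> b \<in> subring_gen S \<Longrightarrow> a - b \<in> subring_gen S"
| mult: "a \<in> subring_gen S \<Longrightarrow> b \<in> subring_gen S \<Longrightarrow> a * b \<in> subring_gen S"

definition Gamma :: "ser set" where
  "Gamma = subring_gen (q_fun ` {1..})"

definition Gamma_YZ :: "ser set" where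
  "Gamma_YZ = subring_gen (Gamma \<union> y_var ` {1..} \<union> z_var ` {1..})"

text \<open>
  A signed permutation of \<open>{1..n}\<close> is an odd permutation of \<open>{-n..n} - {0}\<close>, where odd means
  \<open>w (-i) = - w i\<close>; as usual it is extended by the identity to all integers.
\<close>

definition signed_perms :: "nat \<Rightarrow> (int \<Rightarrow> int) set" where
  "signed_perms n = {w. w permutes ({- int n..int n} - {0}) \<and> (\<forall>i. w (- i) = - w i)}"

definition s_gen :: "nat \<Rightarrow> int \<Rightarrow> int" where
  "s_gen i = (if i = 0 then transpose 1 (- 1)
          else transpose (int i) (int i + 1) \<circ> transpose (- int i) (- (int i + 1)))"

definition word_prod :: "nat list \<Rightarrow> int \<Rightarrow> int" where
  "word_prod a = foldr (\<circ>) (map s_gen a) id"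

definition cox_length :: "nat \<Rightarrow> (int \<Rightarrow> int) \<Rightarrow> nat" where
  "cox_length n w = (LEAST l. \<exists>a. set a \<subseteq> {..<n} \<and> word_prod a = w \<and> length a = l)"

definition reduced_word :: "nat \<Rightarrow> nat list \<Rightarrow> (int \<Rightarrow> int) \<Rightarrow> bool" where
  "reduced_word n a w \<longleftrightarrow>
     set a \<subseteq> {..<n} \<and> word_prod a = w \<and> length a = cox_length n w"

text \<open>
  The free monoid on the letters \<open>0, 1, \<dots>\<close>, written additively so that finitely supported functions
  on it form, with their library multiplication, the free associative algebra.
\<close>

datatype fword = FWord (letters: "nat list")

instantiation fword :: monoid_add
begin

definition zero_fword :: fword where "0 = FWord []"
definition plus_fword :: "fword \<Rightarrow> fword \<Rightarrow> fword" where
  "v + w = FWord (letters v @ letters w)"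

instance
  by standard (auto simp: zero_fword_def plus_fword_def)

end

type_synonym 'a free_alg = "fword \<Rightarrow>\<^sub>0 'a"

definition scal :: "'a :: comm_ring_1 \<Rightarrow> 'a free_alg" where
  "scal c = Poly_Mapping.single 0 c"

definition u_gen :: "nat \<Rightarrow> 'a :: comm_ring_1 free_alg" where
  "u_gen i = Poly_Mapping.single (FWord [i]) 1"

definition free_carrier :: "nat \<Rightarrow> 'a :: comm_ring_1 free_alg set" where
  "free_carrier n = {\<xi>. \<forall>a \<in> Poly_Mapping.keys \<xi>. set (letters a) \<subseteq> {..<n}}"

definition nil_rels :: "nat \<Rightarrow> 'a :: comm_ring_1 free_alg set" where
  "nil_rels n =
     {u_gen i * u_gen i | i. i < n}
   \<union> {u_gen i * u_gen j - u_gen j * u_gen i | i j. i < n \<and> j < n \<and> (i + 2 \<le> j \<or> j + 2 \<le> i)}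
   \<union> {u_gen i * u_gen (i + 1) * u_gen i - u_gen (i + 1) * u_gen i * u_gen (i + 1) | i.
        0 < i \<and> i + 1 < n}
   \<union> (if 1 < n then {u_gen 0 * u_gen 1 * u_gen 0 * u_gen 1
                      - u_gen 1 * u_gen 0 * u_gen 1 * u_gen 0} else {})"

text \<open>
  Elements of the nilCoxeter algebra are represented by elements of the free algebra on
  \<open>u_gen 0, \<dots>, u_gen (n - 1)\<close>, two of which are identified iff they differ by an element
  of the two-sided ideal generated by the relations.
\<close>

inductive_set nil_ideal :: "nat \<Rightarrow> 'a :: comm_ring_1 free_alg set" for n where
  zero: "0 \<in> nil_ideal n"
| rel: "r \<in> nil_rels n \<Longrightarrow> a \<in> free_carrier n \<Longrightarrow> b \<in> free_carrier n \<Longrightarrow> a * r * b \<in> nil_ideal n"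
| add: "x \<in> nil_ideal n \<Longrightarrow> y \<in> nil_ideal n \<Longrightarrow> x + y \<in> nil_ideal n"

definition nil_eq :: "nat \<Rightarrow> 'a :: comm_ring_1 free_alg \<Rightarrow> 'a free_alg \<Rightarrow> bool" where
  "nil_eq n \<xi> \<eta> \<longleftrightarrow> \<xi> - \<eta> \<in> nil_ideal n"

definition u_elt :: "nat \<Rightarrow> (int \<Rightarrow> int) \<Rightarrow> 'a :: comm_ring_1 free_alg" where
  "u_elt n w = prod_list (map u_gen (SOME a. reduced_word n a w))"

text \<open>
  The coefficient of \<open>u_elt n w\<close> in the expansion of the class of \<open>\<xi>\<close> in the basis
  \<open>(u_elt n v)\<close>, where \<open>v\<close> ranges over \<open>signed_perms n\<close>.
\<close>

definition nil_coeff :: "nat \<Rightarrow> 'a :: comm_ring_1 free_alg \<Rightarrow> (int \<Rightarrow> int) \<Rightarrow> 'a" where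
  "nil_coeff n \<xi> = (THE c. (\<forall>v. v \<notin> signed_perms n \<longrightarrow> c v = 0) \<and>
                            nil_eq n \<xi> (\<Sum>v \<in> signed_perms n. scal (c v) * u_elt n v))"

definition lin_fac :: "'a :: comm_ring_1 \<Rightarrow> nat \<Rightarrow> 'a free_alg" where
  "lin_fac t i = 1 + scal t * u_gen i"

definition A_fac :: "nat \<Rightarrow> nat \<Rightarrow> 'a :: comm_ring_1 \<Rightarrow> 'a free_alg" where
  "A_fac n i t = prod_list (map (lin_fac t) (rev [i..<n]))"

definition A_fac_tilde :: "nat \<Rightarrow> nat \<Rightarrow> 'a :: comm_ring_1 \<Rightarrow> 'a free_alg" where
  "A_fac_tilde n i t = prod_list (map (lin_fac (- t)) [i..<n])"

definition C_fac :: "nat \<Rightarrow> 'a :: comm_ring_1 \<Rightarrow> 'a free_alg" where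
  "C_fac n t = prod_list (map (lin_fac t) (rev [0..<n])) * prod_list (map (lin_fac t) [0..<n])"

text \<open>
  The infinite product \<open>C(x\<^sub>1) C(x\<^sub>2) \<dots>\<close> has infinitely many words in its support, so it makes sense
  only in the nilCoxeter algebra, where it is the limit of the partial products coefficient by
  coefficient in the basis \<open>u_elt\<close>.
\<close>

definition CX :: "nat \<Rightarrow> ser free_alg" where
  "CX n = (\<Sum>v \<in> signed_perms n.
     scal (mps_lim (\<lambda>N. nil_coeff n (prod_list (map (\<lambda>k. C_fac n (x_var k)) [1..<Suc N])) v))
       * u_elt n v)"

definition double_schubert_C :: "nat \<Rightarrow> (int \<Rightarrow> int) \<Rightarrow> ser" where
  "double_schubert_C n w =
     nil_coeff n (prod_list (map (\<lambda>i. A_fac_tilde n i (z_var i)) (rev [1..<n])) * CX n *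
                  prod_list (map (\<lambda>i. A_fac n i (y_var i)) [1..<n])) w"

definition is_partition :: "nat list \<Rightarrow> bool" where
  "is_partition l \<longleftrightarrow> sorted_wrt (\<ge>) l \<and> 0 \<notin> set l"

definition part :: "nat list \<Rightarrow> nat \<Rightarrow> nat" where
  "part l i = (if 1 \<le> i \<and> i \<le> length l then l ! (i - 1) else 0)"

definition part_sub :: "nat list \<Rightarrow> nat list \<Rightarrow> bool" where
  "part_sub l m \<longleftrightarrow> (\<forall>i. part l i \<le> part m i)"

definition part_conj :: "nat list \<Rightarrow> nat list" where
  "part_conj l = map (\<lambda>j. card {i. 1 \<le> i \<and> j \<le> part l i}) [1..<Suc (part l 1)]"

definition part_add :: "nat list \<Rightarrow> nat list \<Rightarrow> nat list" where
  "part_add l m = map (\<lambda>i. part l i + part m i) [1..<Suc (max (length l) (length m))]"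

definition delta :: "nat \<Rightarrow> nat list" where
  "delta r = rev [1..<Suc r]"

definition q_seq :: "int list \<Rightarrow> ser" where
  "q_seq \<alpha> = prod_list (map q_fun \<alpha>)"

text \<open>Positions of sequences are counted from 0 here, so \<open>(i, j)\<close> indexes \<open>R\<^sub>i\<^sub>j\<close> for \<open>i < j < l\<close>.\<close>

definition raising_pairs :: "nat \<Rightarrow> (nat \<times> nat) set" where
  "raising_pairs l = {(i, j). i < j \<and> j < l}"

definition R_infinity :: "nat \<Rightarrow> (nat \<times> nat, int) mps" where
  "R_infinity l = (\<Prod>p \<in> raising_pairs l. (1 - mps_var p) * unit_inv (1 + mps_var p))"

text \<open>
  The action of a monomial in the commuting operators \<open>R\<^sub>i\<^sub>j\<close>: the entry at position \<open>k\<close> goes up by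
  the total exponent of the \<open>R\<^sub>k\<^sub>j\<close> and down by that of the \<open>R\<^sub>i\<^sub>k\<close>.
\<close>

definition raise_mono :: "(nat \<times> nat \<Rightarrow>\<^sub>0 nat) \<Rightarrow> int list \<Rightarrow> int list" where
  "raise_mono m \<alpha> = map (\<lambda>k. \<alpha> ! k + (\<Sum>j < length \<alpha>. int (Poly_Mapping.lookup m (k, j)))
                                 - (\<Sum>i < length \<alpha>. int (Poly_Mapping.lookup m (i, k))))
                       [0..<length \<alpha>]"

text \<open>
  Only finitely many terms of the sum are nonzero: \<open>q_fun r = 0\<close> for \<open>r < 0\<close> bounds the exponents of
  the \<open>R\<^sub>i\<^sub>j\<close>, starting with the largest \<open>j\<close>.
\<close>

definition Q_fun :: "int list \<Rightarrow> ser" where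
  "Q_fun \<alpha> = Sum_any (\<lambda>m. of_int (mps_nth (R_infinity (length \<alpha>)) m) * q_seq (raise_mono m \<alpha>))"

definition complete_h :: "int \<Rightarrow> 'a :: comm_ring_1 list \<Rightarrow> 'a" where
  "complete_h p xs = (if p < 0 then 0 else
     \<Sum>e | length e = length xs \<and> sum_list e = nat p. \<Prod>i < length xs. (xs ! i) ^ (e ! i))"

definition flag_vars :: "nat \<Rightarrow> ser list" where
  "flag_vars i = map y_var [1..<Suc i] @ map (\<lambda>k. - z_var k) [1..<Suc i]"

text \<open>Matrices are indexed from 0 in the library, hence the two successors.\<close>

definition flagged_schur :: "nat \<Rightarrow> nat list \<Rightarrow> ser" where
  "flagged_schur n \<mu> = det (mat (n - 1) (n - 1) (\<lambda>(i0, j0).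
     let i = Suc i0; j = Suc j0 in
       complete_h (int (n - i) - int (part \<mu> j) + int j - int i) (flag_vars i)))"

end

theory Submission
  imports Defs "HOL-Computational_Algebra.Polynomial_FPS" "HOL-Computational_Algebra.Fraction_Field"
begin

text \<open>
  Both sides are compared after all but finitely many of the \<open>x\<^sub>i\<close> are set to zero, inside the
  fraction field of the ring of power series.  There the variables are generic and can be moved
  freely, so that polynomial identities may be checked by interpolation.  A series is determined by
  these truncations, and each of them is a ring homomorphism, through which nilCoxeter coefficients,
  determinants and \<open>Q\<close>-functions pass.

  \<^bold>\<open>The coefficient of the longest element.\<close>  The nilCoxeter algebra acts faithfully on functions on
  the group, which makes the coefficient of \<open>u\<^sub>w\<close> a concrete linear form.  The longest element is
  minus the identity; it is central, so its coefficient is a trace and the factors in \<open>Z\<close> may be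
  moved behind those in \<open>Y\<close> (\<open>coeff_at_trace\<close>).

  \<^bold>\<open>The variables X.\<close>  The factors \<open>C(x)\<close> commute and satisfy \<open>C(x) C(-x) = 1\<close>.  Hence the
  coefficient of \<open>C(x\<^sub>1) \<dots> C(x\<^sub>N) \<xi>\<close> is a symmetric polynomial that loses a pair of variables
  whenever they cancel.  Together with a bound on the degree, obtained by counting the occurrences of
  \<open>u\<^sub>0\<close>, this determines it by interpolation from the case of \<open>n\<close> variables, where it is an explicit
  multiple of the coefficient \<open>psi\<close> of a product that no longer contains \<open>u\<^sub>0\<close>.  The
  result is an iterated residue sum over \<open>n\<close>-tuples of distinct variables \<open>s\<close>, with weights
  \<open>2 (x + y) / (x - y)\<close> (\<open>top_coeff_eq_res\<close>, \<open>res_eq_resid\<close>).  Schur \<open>Q\<close>-functions are residue sums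
  of the same kind: by partial fractions, \<open>Q\<^sub>\<alpha>\<close> is the residue sum of the monomial \<open>s\<^sup>\<alpha>\<close>
  (\<open>Q_sum_eq_resid\<close>).  What remains is an identity between integrands.

  \<^bold>\<open>The variables Y and Z.\<close>  The integrand is computed one row at a time: the factors with index \<open>k\<close>
  are eliminated by interpolation at the points \<open>y\<^sub>i\<close> and \<open>- z\<^sub>i\<close> with \<open>i \<le> k\<close>, at which factors
  cancel.  This gives a sum over choices of one such point \<open>f k\<close> in every row (\<open>psi_yz_factor\<close>).
  Multiplied by the Vandermonde product of \<open>s\<close>, the summands become Vandermonde products in the
  \<open>2 n - 1\<close> numbers \<open>s\<^sub>i\<close> and \<open>- f k\<close>.  Summation over \<open>f k\<close> replaces the powers of \<open>f k\<close> by divided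
  differences, that is by complete homogeneous polynomials in \<open>y\<^sub>1, \<dots>, y\<^sub>k, - z\<^sub>1, \<dots>, - z\<^sub>k\<close>.  Laplace
  expansion of the resulting determinant along the \<open>n\<close> rows of powers of the \<open>s\<^sub>i\<close> yields one term for
  every set of \<open>n\<close> columns.  The low rows vanish in their first columns, which leaves exactly the
  sets that encode partitions \<open>\<lambda>\<close> inside the staircase; the complementary minor is the flagged
  Schur polynomial, with the conjugate partition because the complement of the beta-numbers of \<open>\<lambda>\<close> is
  given by \<open>\<lambda>'\<close> (\<open>alternant_expansion\<close>).  Antisymmetry of the residue sum turns the alternants back
  into monomials, whose residue sums are the \<open>Q\<close>-functions (\<open>resid_yz_factor\<close>).
\<close>

section \<open>Words and the length function of the hyperoctahedral group\<close>

lemma word_prod_Nil [simp]: "word_prod [] = id"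
  by (simp add: word_prod_def)

lemma word_prod_Cons [simp]: "word_prod (i # a) = s_gen i \<circ> word_prod a"
  by (simp add: word_prod_def)

lemma word_prod_append [simp]: "word_prod (a @ b) = word_prod a \<circ> word_prod b"
  by (induction a) (auto simp: o_assoc)

lemma s_gen_odd: "s_gen i (- j) = - s_gen i j"
  by (auto simp: s_gen_def transpose_def)

lemma word_prod_odd: "word_prod a (- j) = - word_prod a j"
  by (induction a arbitrary: j) (auto simp: s_gen_odd)

lemma s_gen_apply:
  assumes "j > 0"
  shows "s_gen i j = (if i = 0 then if j = 1 then - 1 else j
          else if j = int i then int i + 1 else if j = int i + 1 then int i else j)"
  using assms by (auto simp: s_gen_def transpose_def)

lemma s_gen_s_gen [simp]: "s_gen i (s_gen i j) = j"
  by (auto simp: s_gen_def transpose_def)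

lemma s_gen_involution [simp]: "s_gen i \<circ> s_gen i = id"
  by (rule ext) simp

lemma word_prod_rev_left: "word_prod (rev a) \<circ> word_prod a = id"
proof (induction a)
  case (Cons i a)
  have "word_prod (rev (i # a)) \<circ> word_prod (i # a)
      = word_prod (rev a) \<circ> (s_gen i \<circ> s_gen i) \<circ> word_prod a"
    by (simp del: s_gen_involution add: comp_assoc)
  then show ?case using Cons by simp
qed simp

lemma word_prod_rev_right: "word_prod a \<circ> word_prod (rev a) = id"
  using word_prod_rev_left[of "rev a"] by simp

lemma inj_word_prod: "inj (word_prod a)"
  by (metis word_prod_rev_left inj_on_id inj_on_imageI2)

lemma odd_fun_eqI:
  assumes "\<And>j. f (- j) = - f j" "\<And>j. g (- j) = - g j" "\<And>j. j > 0 \<Longrightarrow> f j = (g j :: int)"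
  shows "f = (g :: int \<Rightarrow> int)"
proof
  fix j :: int
  consider "j > 0" | "j = 0" | "- j > 0" by linarith
  then show "f j = g j"
  proof cases
    case 2
    then show ?thesis using assms(1,2)[of 0] by simp
  next
    case 3
    then show ?thesis using assms(1,2)[of j] assms(3)[of "- j"] by simp
  qed (use assms in auto)
qed

lemma word_prod_eqI:
  assumes "\<And>j. j > 0 \<Longrightarrow> word_prod a j = word_prod b j"
  shows "word_prod a = word_prod b"
  by (rule odd_fun_eqI) (auto simp: word_prod_odd assms)

lemma s_gen_in_signed_perms:
  assumes "i < n"
  shows "s_gen i \<in> signed_perms n"
  unfolding signed_perms_def
proof (intro CollectI conjI allI)
  show "s_gen i permutes {- int n..int n} - {0}"
  proof (cases "i = 0")
    case True
    then show ?thesis using assms by (auto simp: s_gen_def intro!: permutes_swap_id)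
  next
    case False
    then show ?thesis using assms
      by (auto simp: s_gen_def intro!: permutes_compose permutes_swap_id)
  qed
qed (rule s_gen_odd)

lemma signed_perms_comp: "v \<in> signed_perms n \<Longrightarrow> w \<in> signed_perms n \<Longrightarrow> v \<circ> w \<in> signed_perms n"
  by (auto simp: signed_perms_def intro: permutes_compose)

lemma id_in_signed_perms: "id \<in> signed_perms n"
  by (auto simp: signed_perms_def permutes_id)

lemma word_prod_in_signed_perms:
  "set a \<subseteq> {..<n} \<Longrightarrow> word_prod a \<in> signed_perms n"
  by (induction a) (auto intro: id_in_signed_perms signed_perms_comp s_gen_in_signed_perms)

lemma finite_signed_perms: "finite (signed_perms n)"
  by (rule finite_subset[OF _ finite_permutations[of "{- int n..int n} - {0}"]])
    (auto simp: signed_perms_def)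

lemma cox_length_word_prod: "set a \<subseteq> {..<n} \<Longrightarrow> cox_length n (word_prod a) \<le> length a"
  unfolding cox_length_def by (rule Least_le) auto

lemma cox_length_id [simp]: "cox_length n id = 0"
  using cox_length_word_prod[of "[]" n] by simp

lemma reduced_wordE:
  assumes "set a \<subseteq> {..<n}" "word_prod a = w"
  obtains b where "reduced_word n b w"
proof -
  have "\<exists>b. set b \<subseteq> {..<n} \<and> word_prod b = w \<and> length b = cox_length n w"
    unfolding cox_length_def by (rule LeastI_ex) (use assms in auto)
  then show thesis using that by (auto simp: reduced_word_def)
qed

lemma cox_length_mult_le:
  assumes "set a \<subseteq> {..<n}"
  shows "cox_length n (w \<circ> word_prod a) \<le> cox_length n w + length a"
proof (cases "\<exists>b. set b \<subseteq> {..<n} \<and> word_prod b = w")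
  case True
  then obtain b where b: "reduced_word n b w" by (metis reduced_wordE)
  then show ?thesis
    using cox_length_word_prod[of "b @ a" n] assms by (auto simp: reduced_word_def)
next
  case False
  have "\<nexists>b. set b \<subseteq> {..<n} \<and> word_prod b = w \<circ> word_prod a"
  proof
    assume "\<exists>b. set b \<subseteq> {..<n} \<and> word_prod b = w \<circ> word_prod a"
    then obtain b where b: "set b \<subseteq> {..<n}" "word_prod b = w \<circ> word_prod a" by auto
    then have "word_prod (b @ rev a) = w" by (simp add: comp_assoc word_prod_rev_right)
    then show False using False b assms by (metis set_append set_rev le_sup_iff)
  qed
  \<comment> \<open>Outside the group both lengths are the same default value.\<close>
  then have "cox_length n (w \<circ> word_prod a) = cox_length n w"
    using False unfolding cox_length_def by metis
  then show ?thesis by simp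
qed

section \<open>The regular representation of the nilCoxeter algebra\<close>

text \<open>
  The nilCoxeter algebra is studied through its action on all functions on the group, in which
  \<open>u\<^sub>i\<close> sends \<open>\<phi>\<close> to \<open>w \<mapsto> \<phi>(w s\<^sub>i)\<close> where multiplication by \<open>s\<^sub>i\<close> raises the length, and to \<open>0\<close>
  elsewhere.  Linear operators under composition form a ring, so that no structure constants are
  needed, and equalities modulo the defining ideal become equalities of operators.
\<close>

typedef (overloaded) 'a lop =
  "{T :: ((int \<Rightarrow> int) \<Rightarrow> 'a :: comm_ring_1) \<Rightarrow> (int \<Rightarrow> int) \<Rightarrow> 'a.
     (\<forall>f g. T (\<lambda>w. f w + g w) = (\<lambda>w. T f w + T g w)) \<and> (\<forall>c f. T (\<lambda>w. c * f w) = (\<lambda>w. c * T f w))}"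
  by (rule exI[of _ id]) auto

setup_lifting type_definition_lop

instantiation lop :: (comm_ring_1) ring_1
begin

lift_definition zero_lop :: "'a lop" is "\<lambda>_ _. 0" by auto
lift_definition one_lop :: "'a lop" is "\<lambda>f. f" by auto
lift_definition plus_lop :: "'a lop \<Rightarrow> 'a lop \<Rightarrow> 'a lop" is "\<lambda>S T f w. S f w + T f w"
  by (auto simp: algebra_simps)
lift_definition minus_lop :: "'a lop \<Rightarrow> 'a lop \<Rightarrow> 'a lop" is "\<lambda>S T f w. S f w - T f w"
  by (auto simp: algebra_simps)
lift_definition uminus_lop :: "'a lop \<Rightarrow> 'a lop" is "\<lambda>S f w. - S f w"
  by (auto simp: algebra_simps)
lift_definition times_lop :: "'a lop \<Rightarrow> 'a lop \<Rightarrow> 'a lop" is "\<lambda>S T f. S (T f)"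
  by auto

instance
proof
  fix a b c :: "'a lop"
  show "(0 :: 'a lop) \<noteq> 1"
    by transfer (auto simp: fun_eq_iff intro!: exI[of _ "\<lambda>_. 1"])
  show "(a + b) * c = a * c + b * c" by transfer auto
  show "a * (b + c) = a * b + a * c" by transfer auto
  show "a - b = a + - b" by transfer auto
  show "a + b + c = a + (b + c)" by transfer (auto simp: algebra_simps)
  show "a + b = b + a" by transfer (auto simp: algebra_simps)
qed (transfer; auto)+

end

lift_definition lsc :: "'a :: comm_ring_1 \<Rightarrow> 'a lop" is "\<lambda>c f w. c * f w"
  by (auto simp: algebra_simps)

lemma lsc_0 [simp]: "lsc 0 = 0" by transfer auto
lemma lsc_1 [simp]: "lsc 1 = 1" by transfer auto
lemma lsc_add: "lsc (a + b) = lsc a + lsc b" by transfer (auto simp: algebra_simps)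
lemma lsc_diff: "lsc (a - b) = lsc a - lsc b" by transfer (auto simp: algebra_simps)

lemma lsc_mult: "lsc (a * b) = lsc a * lsc b" by transfer (auto simp: algebra_simps)
lemma lsc_commute: "T * lsc c = lsc c * T" by transfer auto
lemma lsc_left_commute: "T * (lsc c * S) = lsc c * (T * S)"
  by (metis lsc_commute mult.assoc)

lift_definition coeff_at :: "(int \<Rightarrow> int) \<Rightarrow> 'a :: comm_ring_1 lop \<Rightarrow> 'a"
  is "\<lambda>w T. T (\<lambda>v. if v = w then 1 else 0) id" .

lemma coeff_at_add: "coeff_at w (S + T) = coeff_at w S + coeff_at w T" by transfer auto

lemma coeff_at_0 [simp]: "coeff_at w 0 = 0" by transfer auto
lemma coeff_at_scale: "coeff_at w (lsc c * T) = c * coeff_at w T" by transfer auto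

lemma coeff_at_sum: "coeff_at w (\<Sum>x\<in>A. F x) = (\<Sum>x\<in>A. coeff_at w (F x))"
  by (induction A rule: infinite_finite_induct) (auto simp: coeff_at_add)

lift_definition U :: "nat \<Rightarrow> nat \<Rightarrow> 'a :: comm_ring_1 lop" is
  "\<lambda>n i f w. if i < n \<and> cox_length n (w \<circ> s_gen i) = Suc (cox_length n w) then f (w \<circ> s_gen i) else 0"
  by (auto simp: fun_eq_iff)

definition Uw :: "nat \<Rightarrow> nat list \<Rightarrow> 'a :: comm_ring_1 lop" where
  "Uw n a = prod_list (map (U n) a)"

lemma Uw_Nil [simp]: "Uw n [] = 1" by (simp add: Uw_def)
lemma Uw_Cons: "Uw n (i # a) = U n i * Uw n a" by (simp add: Uw_def)
lemma Uw_append: "Uw n (a @ b) = Uw n a * Uw n b" by (simp add: Uw_def)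
lemma Uw_single: "Uw n [i] = U n i" by (simp add: Uw_def)

lemma Uw_apply:
  assumes "set a \<subseteq> {..<n}"
  shows "Rep_lop (Uw n a) f w =
    (if cox_length n (w \<circ> word_prod a) = cox_length n w + length a then f (w \<circ> word_prod a) else 0)"
  using assms
proof (induction a arbitrary: w)
  case Nil
  then show ?case by (simp add: Uw_def one_lop.rep_eq)
next
  case (Cons i a)
  have a: "set a \<subseteq> {..<n}" and i: "i < n" using Cons.prems by auto
  define v where "v = w \<circ> s_gen i"
  obtain u where u: "v \<circ> word_prod a = u" by blast
  have "w \<circ> word_prod (i # a) = v \<circ> word_prod a"
    by (simp only: v_def comp_assoc word_prod_Cons)
  then have w: "w \<circ> word_prod (i # a) = u"
    unfolding u .
  have "Rep_lop (Uw n (i # a)) f w =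
     (if cox_length n v = Suc (cox_length n w) then Rep_lop (Uw n a) f v else 0)"
    using i by (simp add: Uw_Cons times_lop.rep_eq U.rep_eq v_def)
  moreover have "cox_length n u \<le> cox_length n v + length a"
    unfolding u[symmetric] by (rule cox_length_mult_le[OF a])
  moreover have "cox_length n v \<le> Suc (cox_length n w)"
    using cox_length_mult_le[of "[i]" n w] i by (simp add: v_def)
  moreover have "Rep_lop (Uw n a) f v = (if cox_length n u = cox_length n v + length a then f u else 0)"
    using Cons.IH[OF a, of v] unfolding u .
  ultimately show ?case unfolding w by auto
qed

text \<open>
  The operator of a word depends on the word only through its length and the group element it
  spells.  Hence every identity between products of generators used below, braid relations
  included, is a computation with signed permutations.
\<close>

lemma Uw_cong:
  assumes "set a \<subseteq> {..<n}" "set b \<subseteq> {..<n}" "length a = length b" "word_prod a = word_prod b"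
  shows "Uw n a = Uw n b"
  by (subst Rep_lop_inject[symmetric]) (auto simp: fun_eq_iff Uw_apply assms)

lemma coeff_at_Uw:
  assumes "set a \<subseteq> {..<n}"
  shows "coeff_at w (Uw n a) = (if word_prod a = w \<and> cox_length n w = length a then 1 else 0)"
  by (auto simp: coeff_at.rep_eq Uw_apply[OF assms])

lemma U_eq_0: "i \<ge> n \<Longrightarrow> U n i = 0"
  by transfer (auto simp: fun_eq_iff)

lemma U_square [simp]: "U n i * U n i = 0"
proof (cases "i < n")
  case True
  have "Uw n [i, i] = 0"
    by (subst Rep_lop_inject[symmetric])
      (auto simp: fun_eq_iff Uw_apply zero_lop.rep_eq True simp del: comp_apply)
  then show ?thesis by (simp add: Uw_def)
qed (simp add: U_eq_0)

lemma U_square_left [simp]: "U n i * (U n i * T) = 0"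
  by (simp add: mult.assoc[symmetric])

lemma U_commute:
  assumes "i + 2 \<le> j \<or> j + 2 \<le> i"
  shows "U n i * U n j = U n j * U n i"
proof (cases "i < n \<and> j < n")
  case True
  have "word_prod [i, j] = word_prod [j, i]"
    by (rule word_prod_eqI) (use assms in \<open>auto simp: s_gen_apply s_gen_odd\<close>)
  then have "Uw n [i, j] = Uw n [j, i]"
    by (intro Uw_cong) (use True in auto)
  then show ?thesis by (simp add: Uw_def)
qed (auto simp: U_eq_0)

lemma U_braid:
  assumes "i > 0"
  shows "U n i * U n (Suc i) * U n i = U n (Suc i) * U n i * U n (Suc i)"
proof (cases "Suc i < n")
  case True
  have "word_prod [i, Suc i, i] = word_prod [Suc i, i, Suc i]"
    by (rule word_prod_eqI) (use assms in \<open>auto simp: s_gen_apply s_gen_odd\<close>)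
  then have "Uw n [i, Suc i, i] = Uw n [Suc i, i, Suc i]"
    by (intro Uw_cong) (use True in auto)
  then show ?thesis by (simp add: Uw_def mult.assoc)
qed (auto simp: U_eq_0)

lemma U_braid4: "U n 0 * U n 1 * U n 0 * U n 1 = U n 1 * U n 0 * U n 1 * U n 0"
proof (cases "1 < n")
  case True
  have "word_prod [0, 1, 0, 1] = word_prod [1, 0, 1, 0]"
    by (rule word_prod_eqI) (auto simp: s_gen_apply s_gen_odd)
  then have "Uw n [0, 1, 0, 1] = Uw n [1, 0, 1, 0]"
    by (intro Uw_cong) (use True in auto)
  then show ?thesis by (simp add: Uw_def mult.assoc)
qed (auto simp: U_eq_0)

subsection \<open>Spans of words\<close>

inductive_set wspan :: "nat \<Rightarrow> (nat list \<Rightarrow> bool) \<Rightarrow> 'a :: comm_ring_1 lop set" for n P where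
  zero: "0 \<in> wspan n P"
| add: "P a \<Longrightarrow> set a \<subseteq> {..<n} \<Longrightarrow> x \<in> wspan n P \<Longrightarrow> lsc c * Uw n a + x \<in> wspan n P"

lemma wspan_plus: "x \<in> wspan n P \<Longrightarrow> y \<in> wspan n P \<Longrightarrow> x + y \<in> wspan n P"
  by (induction rule: wspan.induct) (auto simp: add.assoc intro: wspan.intros)

lemma wspan_word: "P a \<Longrightarrow> set a \<subseteq> {..<n} \<Longrightarrow> Uw n a \<in> wspan n P"
  using wspan.add[of P a n 0 1] by (simp add: wspan.zero)

lemma wspan_scale: "x \<in> wspan n P \<Longrightarrow> lsc c * x \<in> wspan n P"
proof (induction rule: wspan.induct)
  case (add a x d)
  then show ?case using wspan.add[of P a n "lsc c * x" "c * d"]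
    by (simp add: lsc_mult distrib_left mult.assoc)
qed (simp add: wspan.zero)

lemma wspan_mono: "x \<in> wspan n P \<Longrightarrow> (\<And>a. P a \<Longrightarrow> set a \<subseteq> {..<n} \<Longrightarrow> Q a) \<Longrightarrow> x \<in> wspan n Q"
  by (induction rule: wspan.induct) (auto intro: wspan.intros)

lemma wspan_mult:
  assumes "x \<in> wspan n P" "y \<in> wspan n Q"
    and "\<And>a b. P a \<Longrightarrow> Q b \<Longrightarrow> set a \<subseteq> {..<n} \<Longrightarrow> set b \<subseteq> {..<n} \<Longrightarrow> R (a @ b)"
  shows "x * y \<in> wspan n R"
  using assms(1)
proof (induction rule: wspan.induct)
  case (add a x c)
  have "Uw n a * y \<in> wspan n R"
    using assms(2)
  proof (induction rule: wspan.induct)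
    case (add b y d)
    have "lsc d * Uw n (a @ b) + Uw n a * y \<in> wspan n R"
      by (rule wspan.add) (use add assms(3) \<open>P a\<close> \<open>set a \<subseteq> {..<n}\<close> in auto)
    then show ?case by (simp add: Uw_append distrib_left lsc_left_commute)
  qed (simp add: wspan.zero)
  then show ?case using add
    by (simp add: distrib_right mult.assoc wspan_plus wspan_scale)
qed (simp add: wspan.zero)

lemma coeff_at_wspan_eq_0:
  assumes "x \<in> wspan n P" "\<And>a. P a \<Longrightarrow> set a \<subseteq> {..<n} \<Longrightarrow> word_prod a \<noteq> w"
  shows "coeff_at w x = 0"
  using assms(1) by (induction rule: wspan.induct)
    (auto simp: coeff_at_add coeff_at_scale coeff_at_Uw assms(2))

text \<open>
  If \<open>w\<close> is central, the coefficient of \<open>u\<^sub>w\<close> is a trace: \<open>v v' = w\<close> and \<open>v' v = w\<close> are then the same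
  condition.
\<close>

lemma coeff_at_trace:
  fixes x y :: "'a :: comm_ring_1 lop"
  assumes "\<And>i. i < n \<Longrightarrow> w \<circ> s_gen i = s_gen i \<circ> w"
    and "x \<in> wspan n (\<lambda>_. True)" "y \<in> wspan n (\<lambda>_. True)"
  shows "coeff_at w (x * y) = coeff_at w (y * x)"
proof -
  have comm: "w \<circ> word_prod a = word_prod a \<circ> w" if "set a \<subseteq> {..<n}" for a
    using that
  proof (induction a)
    case (Cons i a)
    have "set a \<subseteq> {..<n}" "i < n" using Cons.prems by auto
    note IH = Cons.IH[OF this(1)] and si = assms(1)[OF this(2)]
    show ?case by (simp only: word_prod_Cons o_assoc si) (simp only: comp_assoc IH)
  qed simp
  have eq: "word_prod a \<circ> word_prod b = w \<longleftrightarrow> word_prod b \<circ> word_prod a = w"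
    if ab: "set a \<subseteq> {..<n}" "set b \<subseteq> {..<n}" for a b
  proof -
    have *: "word_prod b \<circ> word_prod a = w"
      if w: "word_prod a \<circ> word_prod b = w" and a: "set a \<subseteq> {..<n}" for a b
    proof -
      have "word_prod b = word_prod (rev a) \<circ> w"
        by (simp add: w[symmetric] o_assoc word_prod_rev_left)
      then have "word_prod b \<circ> word_prod a = word_prod (rev a) \<circ> word_prod a \<circ> w"
        using comm[OF a] by (simp only: comp_assoc)
      then show ?thesis by (simp add: word_prod_rev_left)
    qed
    then show ?thesis using ab by blast
  qed
  have words: "coeff_at w (Uw n a * Uw n b :: 'a lop) = coeff_at w (Uw n b * Uw n a)"
    if "set a \<subseteq> {..<n}" "set b \<subseteq> {..<n}" for a b
    using that eq[OF that] by (simp add: Uw_append[symmetric] coeff_at_Uw add.commute)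
  have left: "coeff_at w (x * (lsc c * b + y)) = c * coeff_at w (x * b) + coeff_at w (x * y)"
    and right: "coeff_at w ((lsc c * b + y) * x) = c * coeff_at w (b * x) + coeff_at w (y * x)"
    for x y b :: "'a lop" and c
    by (simp_all add: distrib_left distrib_right coeff_at_add lsc_left_commute mult.assoc coeff_at_scale)
  have one: "coeff_at w (Uw n a * y) = coeff_at w (y * Uw n a)" if a: "set a \<subseteq> {..<n}" for a
    using assms(3)
  proof (induction rule: wspan.induct)
    case (add b y c)
    show ?case unfolding left right by (simp only: words[OF a add.hyps(2)] add.IH)
  qed simp
  show ?thesis
    using assms(2)
  proof (induction rule: wspan.induct)
    case (add b x c)
    show ?case unfolding left right by (simp only: one[OF add.hyps(2)] add.IH)
  qed simp
qed

section \<open>Normal forms of words\<close>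

text \<open>
  Two relations on words that mirror the defining relations: words that are equal in the
  nilCoxeter algebra by commutation and braid moves, and words that vanish there.
\<close>

inductive weq :: "nat \<Rightarrow> nat list \<Rightarrow> nat list \<Rightarrow> bool" for n where
  reflexive: "set a \<subseteq> {..<n} \<Longrightarrow> weq n a a"
| comm: "i + 2 \<le> j \<or> j + 2 \<le> i \<Longrightarrow> i < n \<Longrightarrow> j < n \<Longrightarrow> weq n [i, j] [j, i]"
| braid: "0 < i \<Longrightarrow> i + 1 < n \<Longrightarrow> weq n [i, i + 1, i] [i + 1, i, i + 1]"
| braid4: "1 < n \<Longrightarrow> weq n [0, 1, 0, 1] [1, 0, 1, 0]"
| symmetric: "weq n a b \<Longrightarrow> weq n b a"
| transitive: "weq n a b \<Longrightarrow> weq n b c \<Longrightarrow> weq n a c"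
| app: "weq n a b \<Longrightarrow> weq n c d \<Longrightarrow> weq n (a @ c) (b @ d)"

inductive wzero :: "nat \<Rightarrow> nat list \<Rightarrow> bool" for n where
  sq: "i < n \<Longrightarrow> wzero n [i, i]"
| app: "wzero n a \<Longrightarrow> set p \<subseteq> {..<n} \<Longrightarrow> set q \<subseteq> {..<n} \<Longrightarrow> wzero n (p @ a @ q)"
| weq: "weq n a b \<Longrightarrow> wzero n a \<Longrightarrow> wzero n b"

lemma weq_letters: "weq n a b \<Longrightarrow> set a \<subseteq> {..<n} \<and> set b \<subseteq> {..<n}"
  by (induction rule: weq.induct) auto

lemma weq_length: "weq n a b \<Longrightarrow> length a = length b"
  by (induction rule: weq.induct) auto

lemma weq_word_prod: "weq n a b \<Longrightarrow> word_prod a = word_prod b"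
proof (induction rule: weq.induct)
  case (comm i j)
  then show ?case by (intro word_prod_eqI) (auto simp: s_gen_apply s_gen_odd)
next
  case (braid i)
  then show ?case by (intro word_prod_eqI) (auto simp: s_gen_apply s_gen_odd)
next
  case braid4
  then show ?case by (intro word_prod_eqI) (auto simp: s_gen_apply s_gen_odd)
qed auto

lemma wzero_shorter:
  "wzero n a \<Longrightarrow> \<exists>b. set b \<subseteq> {..<n} \<and> word_prod b = word_prod a \<and> length b < length a"
proof (induction rule: wzero.induct)
  case (sq i)
  then show ?case by (intro exI[of _ "[]"]) auto
next
  case (app a p q)
  then obtain b where "set b \<subseteq> {..<n}" "word_prod b = word_prod a" "length b < length a" by auto
  then show ?case using app by (intro exI[of _ "p @ b @ q"]) auto
next
  case (weq a b)
  then show ?case using weq_length weq_word_prod by metis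
qed

lemma weq_context:
  assumes "weq n a b" "set p \<subseteq> {..<n}" "set q \<subseteq> {..<n}"
  shows "weq n (p @ a @ q) (p @ b @ q)"
  using assms by (intro weq.app weq.reflexive)

lemma weq_move_left:
  assumes "i < n" "set p \<subseteq> {..<n}" "\<And>j. j \<in> set p \<Longrightarrow> i + 2 \<le> j \<or> j + 2 \<le> i"
  shows "weq n (p @ [i]) (i # p)"
  using assms(2,3)
proof (induction p)
  case Nil
  then show ?case using assms by (auto intro: weq.reflexive)
next
  case (Cons j p)
  have "weq n (j # (p @ [i])) (j # i # p)"
    using weq.app[OF weq.reflexive[of "[j]"] Cons.IH] Cons.prems by auto
  moreover have "weq n ([j, i] @ p) ([i, j] @ p)"
    by (intro weq.app weq.comm weq.reflexive) (use Cons.prems assms(1) in force)+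
  ultimately show ?case by (auto intro: weq.transitive)
qed

lemma weq_move_left':
  assumes "i < n" "set p \<subseteq> {..<n}" "\<And>j. j \<in> set p \<Longrightarrow> i + 2 \<le> j \<or> j + 2 \<le> i"
    "set q \<subseteq> {..<n}" "set r \<subseteq> {..<n}"
  shows "weq n (q @ p @ [i] @ r) (q @ [i] @ p @ r)"
  using weq_context[OF weq_move_left[OF assms(1-3)] assms(4,5)] by simp

definition full_tail :: "nat \<Rightarrow> nat list" where
  "full_tail m = rev [0..<m] @ [1..<m]"

lemma length_full_tail: "m \<ge> 1 \<Longrightarrow> length (full_tail m) = 2 * m - 1"
  by (auto simp: full_tail_def)

lemma set_full_tail: "set (full_tail m) \<subseteq> {..<m}"
  by (auto simp: full_tail_def)

lemma take_full_tail_down: "k \<le> Suc m \<Longrightarrow> take k (full_tail (Suc m)) = rev [Suc m - k..<Suc m]"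
  by (simp add: full_tail_def take_rev del: upt_Suc)

lemma take_full_tail_up:
  assumes "e \<le> m"
  shows "take (Suc m + e) (full_tail (Suc m)) = rev [0..<Suc m] @ [1..<Suc e]"
  using assms by (auto simp: full_tail_def take_upt simp del: upt_Suc)

lemma upt_split3:
  "a \<le> i \<Longrightarrow> i < b \<Longrightarrow> [a..<b] = [a..<i] @ [i] @ [Suc i..<b]" for a b i :: nat
  by (metis append_Cons append_Nil less_imp_le_nat upt_conv_Cons upt_add_eq_append le_Suc_ex)

lemma weq_down:
  assumes "l < i" "i \<le> m" "2 \<le> i" "m < n"
  shows "weq n (rev [l..<Suc m] @ [i]) ((i - 1) # rev [l..<Suc m])"
proof -
  let ?hi = "rev [Suc i..<Suc m]" and ?lo = "rev [l..<i - 1]"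
  have "[l..<Suc m] = [l..<i - 1] @ [i - 1] @ [i..<Suc m]"
    using upt_split3[of l "i - 1" "Suc m"] assms by simp
  also have "[i..<Suc m] = [i] @ [Suc i..<Suc m]"
    using upt_split3[of i i "Suc m"] assms by simp
  finally have split: "rev [l..<Suc m] = ?hi @ [i, i - 1] @ ?lo" by simp
  have "weq n ((?hi @ [i, i - 1]) @ ?lo @ [i] @ []) ((?hi @ [i, i - 1]) @ [i] @ ?lo @ [])"
    by (intro weq_move_left') (use assms in auto)
  then have 1: "weq n (rev [l..<Suc m] @ [i]) (?hi @ [i, i - 1, i] @ ?lo)"
    unfolding split by simp
  have "weq n [i, i - 1, i] [i - 1, i, i - 1]"
    using weq.symmetric[OF weq.braid[of "i - 1" n]] assms by simp
  then have 2: "weq n (?hi @ [i, i - 1, i] @ ?lo) (?hi @ [i - 1, i, i - 1] @ ?lo)"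
    by (rule weq_context) (use assms in auto)
  have "weq n ([] @ ?hi @ [i - 1] @ ([i, i - 1] @ ?lo)) ([] @ [i - 1] @ ?hi @ ([i, i - 1] @ ?lo))"
    by (intro weq_move_left') (use assms in auto)
  then have 3: "weq n (?hi @ [i - 1, i, i - 1] @ ?lo) ((i - 1) # rev [l..<Suc m])"
    unfolding split by simp
  show ?thesis using 1 2 3 by (blast intro: weq.transitive)
qed

text \<open>
  Right multiplication of a prefix of \<open>m \<dots> 1 0 1 \<dots> m\<close> by a letter gives zero, a longer prefix, or
  a smaller letter times the same prefix.
\<close>

lemma prefix_times_letter:
  assumes "k \<le> Suc (2 * m)" "i \<le> m" "m < n"
  defines "p \<equiv> take k (full_tail (Suc m))"
  shows "wzero n (p @ [i]) \<or> (k \<le> 2 * m \<and> p @ [i] = take (Suc k) (full_tail (Suc m))) \<or>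
    (\<exists>j<m. weq n (p @ [i]) (j # p))"
proof (cases "k \<le> Suc m")
  case True
  define l where "l = Suc m - k"
  have p: "p = rev [l..<Suc m]" and k: "k = Suc m - l" and l: "l \<le> Suc m"
    using True by (auto simp: p_def take_full_tail_down l_def)
  have pn: "set p \<subseteq> {..<n}" using assms(3) by (auto simp: p)
  consider "Suc i = l" | "i = l" | "l = 0" "i = 1" | "l < i" "2 \<le> i" | "Suc i < l" by linarith
  then show ?thesis
  proof cases
    case 1
    have "p @ [i] = rev [i..<Suc m]"
      using upt_split3[of i i "Suc m"] assms(2) 1 by (simp add: p)
    also have "\<dots> = take (Suc k) (full_tail (Suc m))"
    proof -
      have "Suc m - Suc k = i" "Suc k \<le> Suc m" using assms(2) 1 k by linarith+
      then show ?thesis using take_full_tail_down[of "Suc k" m] by (simp del: upt_Suc)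
    qed
    finally show ?thesis using k 1 assms by auto
  next
    case 2
    have "p = rev [Suc i..<Suc m] @ [i]"
      using upt_split3[of i i "Suc m"] assms(2) 2 by (simp add: p)
    moreover have "set (rev [Suc i..<Suc m]) \<subseteq> {..<n}" "i < n" using assms by auto
    then have "wzero n (rev [Suc i..<Suc m] @ [i, i] @ [])" by (intro wzero.app wzero.sq) auto
    ultimately have "wzero n (p @ [i])" by simp
    then show ?thesis by blast
  next
    case 3
    have "p @ [i] = take (Suc m + 1) (full_tail (Suc m))"
      using take_full_tail_up[of 1 m] assms(2) 3 by (simp add: p)
    then show ?thesis using k 3 assms by auto
  next
    case 4
    then have "weq n (p @ [i]) ((i - 1) # p)" unfolding p using assms by (intro weq_down) auto
    moreover have "i - 1 < m" using 4 assms by linarith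
    ultimately show ?thesis by blast
  next
    case 5
    have "weq n (p @ [i]) (i # p)"
      by (rule weq_move_left) (use 5 assms pn in \<open>auto simp: p\<close>)
    then show ?thesis using 5 l by (intro disjI2 exI[of _ i]) auto
  qed
next
  case False
  define e where "e = k - Suc m"
  let ?D = "rev [0..<Suc m]"
  have e: "1 \<le> e" "e \<le> m" "k = Suc m + e" using False assms by (auto simp: e_def)
  have p: "p = ?D @ [1..<Suc e]"
    using take_full_tail_up[of e m] e by (simp add: p_def)
  consider "i = Suc e" | "i = e" | "Suc e < i" | "i < e" "1 \<le> i" | "i = 0" using e by linarith
  then show ?thesis
  proof cases
    case 1
    have "p @ [i] = ?D @ [1..<Suc (Suc e)]" using 1 by (simp add: p)
    then show ?thesis using take_full_tail_up[of "Suc e" m] e 1 assms by auto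
  next
    case 2
    then have "p = (?D @ [1..<e]) @ [i]" using e by (simp add: p)
    moreover have "set (?D @ [1..<e]) \<subseteq> {..<n}" "i < n" using assms e 2 by auto
    then have "wzero n ((?D @ [1..<e]) @ [i, i] @ [])" by (intro wzero.app wzero.sq) auto
    ultimately have "wzero n (p @ [i])" by simp
    then show ?thesis by blast
  next
    case 3
    have "weq n (?D @ [1..<Suc e] @ [i] @ []) (?D @ [i] @ [1..<Suc e] @ [])"
      by (intro weq_move_left') (use 3 assms e in auto)
    moreover have "weq n (?D @ [i]) ((i - 1) # ?D)"
      by (intro weq_down) (use 3 assms in auto)
    then have "weq n ((?D @ [i]) @ [1..<Suc e]) (((i - 1) # ?D) @ [1..<Suc e])"
      by (intro weq.app weq.reflexive) (use e assms in auto)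
    ultimately have "weq n (p @ [i]) ((i - 1) # p)" unfolding p by (auto intro: weq.transitive)
    then show ?thesis using 3 assms by (intro disjI2 exI[of _ "i - 1"]) auto
  next
    case 4
    let ?u = "[Suc (Suc i)..<Suc e]" and ?d = "[1..<i]"
    have "[1..<Suc e] = ?d @ [i] @ [Suc i..<Suc e]" using upt_split3[of 1 i "Suc e"] 4 by simp
    also have "[Suc i..<Suc e] = [Suc i] @ ?u" using upt_split3[of "Suc i" "Suc i" "Suc e"] 4 by simp
    finally have split: "[1..<Suc e] = ?d @ [i, Suc i] @ ?u" by simp
    have "weq n ((?D @ ?d @ [i, Suc i]) @ ?u @ [i] @ []) ((?D @ ?d @ [i, Suc i]) @ [i] @ ?u @ [])"
      by (intro weq_move_left') (use 4 assms e in auto)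
    then have 1: "weq n (p @ [i]) (?D @ ?d @ [i, Suc i, i] @ ?u)" unfolding p split by simp
    have "weq n [i, Suc i, i] [Suc i, i, Suc i]" using weq.braid[of i n] 4 e assms by simp
    then have "weq n ((?D @ ?d) @ [i, Suc i, i] @ ?u) ((?D @ ?d) @ [Suc i, i, Suc i] @ ?u)"
      by (rule weq_context) (use e assms 4 in auto)
    then have 2: "weq n (?D @ ?d @ [i, Suc i, i] @ ?u) (?D @ ?d @ [Suc i, i, Suc i] @ ?u)" by simp
    have "weq n (?D @ ?d @ [Suc i] @ ([i, Suc i] @ ?u)) (?D @ [Suc i] @ ?d @ ([i, Suc i] @ ?u))"
      by (intro weq_move_left') (use e assms 4 in auto)
    then have 3: "weq n (?D @ ?d @ [Suc i, i, Suc i] @ ?u) ((?D @ [Suc i]) @ [1..<Suc e])"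
      unfolding split by simp
    have "weq n (?D @ [Suc i]) (i # ?D)"
      using weq_down[of 0 "Suc i" m n] assms e 4 by auto
    then have "weq n ((?D @ [Suc i]) @ [1..<Suc e]) ((i # ?D) @ [1..<Suc e])"
      by (intro weq.app weq.reflexive) (use e assms in auto)
    then have "weq n (p @ [i]) (i # p)"
      using weq.transitive[OF 1 weq.transitive[OF 2 3]] unfolding p by (auto intro: weq.transitive)
    then show ?thesis using 4 e by (intro disjI2 exI[of _ i]) auto
  next
    case 5
    let ?u = "[2..<Suc e]" and ?h = "rev [2..<Suc m]"
    have split: "[1..<Suc e] = [1] @ ?u" "?D = ?h @ [1, 0]"
      using upt_split3[of 1 1 "Suc e"] upt_split3[of 0 0 "Suc m"] upt_split3[of 1 1 "Suc m"] e
      by (simp_all add: numeral_2_eq_2)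
    have "weq n ((?h @ [1, 0, 1]) @ ?u @ [0] @ []) ((?h @ [1, 0, 1]) @ [0] @ ?u @ [])"
      by (intro weq_move_left') (use assms e in auto)
    then have 1: "weq n (p @ [i]) (?h @ [1, 0, 1, 0] @ ?u)" unfolding p split 5 by simp
    have "weq n (?h @ [1, 0, 1, 0] @ ?u) (?h @ [0, 1, 0, 1] @ ?u)"
      by (rule weq_context[OF weq.symmetric[OF weq.braid4]]) (use assms e in auto)
    moreover have "weq n ([] @ ?h @ [0] @ ([1, 0, 1] @ ?u)) ([] @ [0] @ ?h @ ([1, 0, 1] @ ?u))"
      by (intro weq_move_left') (use assms e in auto)
    then have "weq n (?h @ [0, 1, 0, 1] @ ?u) (i # p)" unfolding p split 5 by simp
    ultimately have "weq n (p @ [i]) (i # p)" using 1 by (blast intro: weq.transitive)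
    then show ?thesis using e 5 by (intro disjI2 exI[of _ i]) auto
  qed
qed

fun canon :: "nat \<Rightarrow> nat list set" where
  "canon 0 = {[]}"
| "canon (Suc m) = {c @ take k (full_tail (Suc m)) | c k. c \<in> canon m \<and> k \<le> Suc (2 * m)}"

lemma canon_letters: "c \<in> canon m \<Longrightarrow> set c \<subseteq> {..<m}"
proof (induction m arbitrary: c)
  case (Suc m)
  then obtain c' k where c: "c = c' @ take k (full_tail (Suc m))" "c' \<in> canon m" by auto
  have "set (take k (full_tail (Suc m))) \<subseteq> {..<Suc m}"
    using set_full_tail set_take_subset by (rule order_trans[rotated])
  then show ?case using c Suc.IH[OF c(2)] by fastforce
qed simp

lemma canon_Nil: "[] \<in> canon m"
  by (induction m) force+

lemma canon_times_letter:
  assumes "c \<in> canon m" "i < m" "m \<le> n"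
  shows "wzero n (c @ [i]) \<or> (\<exists>c'\<in>canon m. weq n (c @ [i]) c')"
  using assms
proof (induction m arbitrary: c i)
  case (Suc m)
  then obtain c0 k where c: "c = c0 @ take k (full_tail (Suc m))" "c0 \<in> canon m" "k \<le> Suc (2 * m)"
    by auto
  let ?p = "take k (full_tail (Suc m))"
  have c0n: "set c0 \<subseteq> {..<n}" using canon_letters[OF c(2)] Suc.prems by fastforce
  have pn: "set ?p \<subseteq> {..<n}" using set_full_tail[of "Suc m"] set_take_subset[of k "full_tail (Suc m)"]
      Suc.prems by fastforce
  from prefix_times_letter[OF c(3), of i n] Suc.prems
  consider "wzero n (?p @ [i])" | "k \<le> 2 * m" "?p @ [i] = take (Suc k) (full_tail (Suc m))"
    | j where "j < m" "weq n (?p @ [i]) (j # ?p)" by fastforce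
  then show ?case
  proof cases
    case 1
    then have "wzero n (c0 @ (?p @ [i]) @ [])" using c0n by (intro wzero.app) auto
    then show ?thesis by (simp add: c)
  next
    case 2
    have "c @ [i] \<in> canon (Suc m)" using 2 c by fastforce
    moreover have "weq n (c @ [i]) (c @ [i])" using c0n pn Suc.prems c by (intro weq.reflexive) auto
    ultimately show ?thesis by blast
  next
    case 3
    have eq: "weq n (c @ [i]) ((c0 @ [j]) @ ?p)"
      using weq_context[OF 3(2) c0n, of "[]"] by (simp add: c)
    from Suc.IH[OF c(2) 3(1)] Suc.prems
    consider "wzero n (c0 @ [j])" | c' where "c' \<in> canon m" "weq n (c0 @ [j]) c'" by fastforce
    then show ?thesis
    proof cases
      case 1
      then have "wzero n ([] @ (c0 @ [j]) @ ?p)" using pn by (intro wzero.app) auto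
      then show ?thesis using weq.symmetric[OF eq] wzero.weq by auto
    next
      case (2 c')
      have "weq n ((c0 @ [j]) @ ?p) (c' @ ?p)" using 2 pn by (intro weq.app weq.reflexive)
      then have "weq n (c @ [i]) (c' @ ?p)" using eq by (rule weq.transitive[rotated])
      moreover have "c' @ ?p \<in> canon (Suc m)" using 2 c by auto
      ultimately show ?thesis by blast
    qed
  qed
qed simp

lemma word_normal_form:
  assumes "set a \<subseteq> {..<n}"
  shows "wzero n a \<or> (\<exists>c\<in>canon n. weq n a c)"
  using assms
proof (induction a rule: rev_induct)
  case Nil
  then show ?case using canon_Nil weq.reflexive by fastforce
next
  case (snoc i a)
  then have i: "i < n" and a: "set a \<subseteq> {..<n}" by auto
  from snoc consider "wzero n a" | c where "c \<in> canon n" "weq n a c" by auto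
  then show ?case
  proof cases
    case 1
    then show ?thesis using wzero.app[of n a "[]" "[i]"] i by auto
  next
    case 2
    have eq: "weq n (a @ [i]) (c @ [i])" using 2 i by (intro weq.app weq.reflexive) auto
    from canon_times_letter[OF 2(1) i order_refl] show ?thesis
      using wzero.weq[OF weq.symmetric[OF eq]] weq.transitive[OF eq] by blast
  qed
qed

subsection \<open>Normal forms enumerate the group\<close>

lemma word_prod_up:
  assumes "1 \<le> a" "a \<le> b" "j > 0"
  shows "word_prod [a..<b] j = (if j = int b then int a else if int a \<le> j \<and> j < int b then j + 1 else j)"
  using assms(2,3)
proof (induction b arbitrary: j rule: dec_induct)
  case (step b)
  have sj: "s_gen b j > 0" using step assms by (auto simp: s_gen_apply)
  have "word_prod [a..<Suc b] j = word_prod [a..<b] (s_gen b j)"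
    using step by simp
  then show ?case using step.IH[OF sj] step assms by (auto simp: s_gen_apply)
qed auto

lemma word_prod_down:
  assumes "1 \<le> a" "a \<le> b" "j > 0"
  shows "word_prod (rev [a..<b]) j = (if j = int a then int b else if int a < j \<and> j \<le> int b then j - 1 else j)"
  using assms(2)
proof (induction b rule: dec_induct)
  case (step b)
  have "word_prod (rev [a..<Suc b]) j = s_gen b (word_prod (rev [a..<b]) j)"
    using step by simp
  then show ?case using step assms by (auto simp: s_gen_apply)
qed (use assms in auto)

lemma word_prod_down0:
  assumes "j > 0"
  shows "word_prod (rev [0..<Suc b]) j = (if j = 1 then - int (Suc b) else if j \<le> int (Suc b) then j - 1 else j)"
proof -
  have "rev [0..<Suc b] = rev [1..<Suc b] @ [0]"
    by (subst upt_conv_Cons) auto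
  then have "word_prod (rev [0..<Suc b]) j = word_prod (rev [1..<Suc b]) (s_gen 0 j)"
    by (simp del: upt_Suc)
  then show ?thesis using assms word_prod_down[of 1 "Suc b" j] word_prod_down[of 1 "Suc b" 1]
    by (auto simp: s_gen_apply word_prod_odd simp del: upt_Suc)
qed

lemma word_prod_up0:
  assumes "j > 0"
  shows "word_prod [0..<Suc b] j = (if j = int (Suc b) then - 1 else if j < int (Suc b) then j + 1 else j)"
proof -
  have "word_prod [0..<Suc b] j = s_gen 0 (word_prod [1..<Suc b] j)"
    by (subst upt_conv_Cons) (auto simp del: upt_Suc)
  then show ?thesis using assms word_prod_up[of 1 "Suc b" j]
    by (auto simp: s_gen_apply simp del: upt_Suc)
qed

lemma word_prod_full_tail:
  assumes "j > 0"
  shows "word_prod (full_tail (Suc m)) j = (if j = int (Suc m) then - j else j)"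
proof -
  have "word_prod (full_tail (Suc m)) j = word_prod (rev [0..<Suc m]) (word_prod [1..<Suc m] j)"
    by (simp add: full_tail_def del: upt_Suc)
  moreover have "word_prod [1..<Suc m] j > 0"
    using word_prod_up[of 1 "Suc m" j] assms by (auto simp del: upt_Suc)
  ultimately show ?thesis
    using word_prod_up[of 1 "Suc m" j] word_prod_down0[of "word_prod [1..<Suc m] j" m] assms
    by (auto simp del: upt_Suc)
qed

definition tail_pos :: "nat \<Rightarrow> nat \<Rightarrow> int" where
  "tail_pos m k = (if k \<le> m then int (Suc m) - int k else - (int k - int m))"

lemma tail_pos:
  assumes "k \<le> Suc (2 * m)"
  shows "word_prod (rev (take k (full_tail (Suc m)))) (int (Suc m)) = tail_pos m k"
proof (cases "k \<le> Suc m")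
  case True
  show ?thesis
  proof (cases "k = Suc m")
    case True
    then show ?thesis
      using word_prod_up0[of "int (Suc m)" m] by (simp add: take_full_tail_down tail_pos_def del: upt_Suc)
  next
    case False
    then show ?thesis
      using word_prod_up[of "Suc m - k" "Suc m" "int (Suc m)"] True
      by (simp add: take_full_tail_down tail_pos_def del: upt_Suc)
  qed
next
  case False
  define e where "e = k - Suc m"
  have e: "e \<le> m" "k = Suc m + e" using False assms by (auto simp: e_def)
  have "word_prod (rev (take k (full_tail (Suc m)))) (int (Suc m))
      = word_prod (rev [1..<Suc e]) (word_prod [0..<Suc m] (int (Suc m)))"
    unfolding e(2) take_full_tail_up[OF e(1)] by (simp del: upt_Suc)
  also have "\<dots> = - int (Suc e)"
    using word_prod_up0[of "int (Suc m)" m] word_prod_down[of 1 "Suc e" 1]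
    by (simp add: word_prod_odd del: upt_Suc)
  finally show ?thesis using e by (simp add: tail_pos_def)
qed

lemma word_prod_fix_large:
  assumes "set a \<subseteq> {..<m}" "j > int m"
  shows "word_prod a j = j"
  using assms by (induction a) (auto simp: s_gen_apply)

lemma tail_pos_inj: "k \<le> Suc (2 * m) \<Longrightarrow> k' \<le> Suc (2 * m) \<Longrightarrow> tail_pos m k = tail_pos m k' \<Longrightarrow> k = k'"
  by (auto simp: tail_pos_def split: if_splits)

lemma tail_pos_surj:
  assumes "x \<in> {- int (Suc m)..int (Suc m)} - {0}"
  obtains k where "k \<le> Suc (2 * m)" "tail_pos m k = x"
proof (cases "x > 0")
  case True
  show ?thesis by (rule that[of "nat (int (Suc m) - x)"]) (use assms True in \<open>auto simp: tail_pos_def\<close>)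
next
  case False
  show ?thesis by (rule that[of "nat (int m - x)"]) (use assms False in \<open>auto simp: tail_pos_def\<close>)
qed

lemma canon_inj: "c \<in> canon m \<Longrightarrow> c' \<in> canon m \<Longrightarrow> word_prod c = word_prod c' \<Longrightarrow> c = c'"
proof (induction m arbitrary: c c')
  case (Suc m)
  from Suc.prems obtain d k d' k' where
    c: "c = d @ take k (full_tail (Suc m))" "d \<in> canon m" "k \<le> Suc (2 * m)" and
    c': "c' = d' @ take k' (full_tail (Suc m))" "d' \<in> canon m" "k' \<le> Suc (2 * m)"
    by auto
  have pos: "word_prod (rev (d @ take k (full_tail (Suc m)))) (int (Suc m)) = tail_pos m k"
    if "d \<in> canon m" "k \<le> Suc (2 * m)" for d k
    using word_prod_fix_large[of "rev d" m "int (Suc m)"] canon_letters[OF that(1)] tail_pos[OF that(2)]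
    by simp
  have "word_prod (rev c) = word_prod (rev c')"
    by (metis Suc.prems(3) comp_assoc comp_id fun.map_id id_comp word_prod_rev_left word_prod_rev_right)
  then have k: "k = k'"
    using pos[OF c(2,3)] pos[OF c'(2,3)] c c' tail_pos_inj by metis
  have "word_prod d = word_prod d'"
  proof -
    let ?p = "take k (full_tail (Suc m))"
    have "word_prod d \<circ> word_prod ?p = word_prod d' \<circ> word_prod ?p"
      using Suc.prems(3) unfolding c c' k word_prod_append .
    then have "word_prod d \<circ> word_prod ?p \<circ> word_prod (rev ?p)
        = word_prod d' \<circ> word_prod ?p \<circ> word_prod (rev ?p)"
      by (rule arg_cong)
    then show ?thesis by (simp only: comp_assoc word_prod_rev_right comp_id)
  qed
  then show ?case using Suc.IH c c' k by auto
qed simp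

lemma canon_surj: "w \<in> signed_perms m \<Longrightarrow> \<exists>c\<in>canon m. word_prod c = w"
proof (induction m arbitrary: w)
  case 0
  then have "w = id" by (auto simp: signed_perms_def permutes_def)
  then show ?case by simp
next
  case (Suc m)
  let ?S = "{- int (Suc m)..int (Suc m)} - {0}"
  have w: "w permutes ?S" "\<And>i. w (- i) = - w i" using Suc.prems by (auto simp: signed_perms_def)
  have "inv_into UNIV w (int (Suc m)) \<in> ?S"
    by (subst permutes_in_image[OF permutes_inv[OF w(1)]]) auto
  then obtain k where k: "k \<le> Suc (2 * m)" "tail_pos m k = inv_into UNIV w (int (Suc m))"
    by (metis tail_pos_surj)
  let ?p = "take k (full_tail (Suc m))"
  define v where "v = w \<circ> word_prod (rev ?p)"
  have top: "v (int (Suc m)) = int (Suc m)"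
    unfolding v_def comp_apply tail_pos[OF k(1)] k(2) by (rule permutes_inverses(1)[OF w(1)])
  have p: "set ?p \<subseteq> {..<Suc m}" by (meson set_full_tail set_take_subset subset_trans)
  have v: "v \<in> signed_perms (Suc m)"
    unfolding v_def by (intro signed_perms_comp Suc.prems word_prod_in_signed_perms) (use p in auto)
  then have vp: "v permutes ?S" "\<And>i. v (- i) = - v i" by (auto simp: signed_perms_def)
  have "v permutes ({- int m..int m} - {0})"
  proof (rule permutes_superset[OF vp(1)])
    fix x assume "x \<in> ?S - ({- int m..int m} - {0})"
    then have "x = int (Suc m) \<or> x = - int (Suc m)" by auto
    then show "v x = x" using top vp(2)[of "int (Suc m)"] by auto
  qed
  then obtain c where c: "c \<in> canon m" "word_prod c = v"
    using Suc.IH[of v] vp(2) by (auto simp: signed_perms_def)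
  have "word_prod (c @ ?p) = w \<circ> (word_prod (rev ?p) \<circ> word_prod ?p)"
    by (simp add: c v_def comp_assoc)
  then have "word_prod (c @ ?p) = w" by (simp only: word_prod_rev_left comp_id)
  moreover have "c @ ?p \<in> canon (Suc m)" using c k by auto
  ultimately show ?case by blast
qed

lemma signed_perm_reduced_word:
  assumes "w \<in> signed_perms n"
  obtains a where "reduced_word n a w"
proof -
  from canon_surj[OF assms] obtain c where c: "c \<in> canon n" "word_prod c = w" by blast
  then show thesis using reduced_wordE[OF canon_letters[OF c(1)] c(2)] that by blast
qed

lemma reduced_not_wzero:
  assumes "reduced_word n a w"
  shows "\<not> wzero n a"
proof
  assume "wzero n a"
  then obtain b where "set b \<subseteq> {..<n}" "word_prod b = word_prod a" "length b < length a"
    using wzero_shorter by blast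
  then show False
    using assms cox_length_word_prod[of b n] by (simp add: reduced_word_def)
qed

lemma canon_reduced:
  assumes "c \<in> canon n"
  shows "reduced_word n c (word_prod c)"
proof -
  have cn: "set c \<subseteq> {..<n}" using canon_letters[OF assms] .
  then obtain a where a: "reduced_word n a (word_prod c)" using reduced_wordE by blast
  have "\<not> wzero n a" using reduced_not_wzero[OF a] .
  then obtain c' where c': "c' \<in> canon n" "weq n a c'"
    using word_normal_form[of a n] a by (auto simp: reduced_word_def)
  then have "c' = c"
    using a assms weq_word_prod by (intro canon_inj) (auto simp: reduced_word_def)
  then show ?thesis using c' weq_length a cn by (auto simp: reduced_word_def)
qed

lemma nonreduced_wzero:
  assumes "set a \<subseteq> {..<n}" "\<not> reduced_word n a (word_prod a)"
  shows "wzero n a"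
proof (rule ccontr)
  assume "\<not> wzero n a"
  then obtain c where c: "c \<in> canon n" "weq n a c" using word_normal_form[of a n] assms by blast
  then have "reduced_word n a (word_prod a)"
    using canon_reduced[OF c(1)] weq_length[OF c(2)] weq_word_prod[OF c(2)] assms(1)
    by (auto simp: reduced_word_def)
  then show False using assms by simp
qed

lemma reduced_words_weq:
  assumes "reduced_word n a w" "reduced_word n b w"
  shows "weq n a b"
proof -
  have *: "\<exists>c\<in>canon n. weq n a c \<and> word_prod c = w" if a: "reduced_word n a w" for a
  proof -
    have "\<not> wzero n a" using reduced_not_wzero[OF a] .
    then obtain c where "c \<in> canon n" "weq n a c"
      using word_normal_form[of a n] a by (auto simp: reduced_word_def)
    then show ?thesis using a weq_word_prod by (auto simp: reduced_word_def)
  qed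
  from *[OF assms(1)] *[OF assms(2)] show ?thesis
    using canon_inj weq.symmetric weq.transitive by metis
qed

subsection \<open>The longest element\<close>

definition negate :: "nat \<Rightarrow> int \<Rightarrow> int" where
  "negate n j = (if \<bar>j\<bar> \<le> int n then - j else j)"

fun longest_word :: "nat \<Rightarrow> nat list" where
  "longest_word 0 = []"
| "longest_word (Suc m) = longest_word m @ full_tail (Suc m)"

lemma longest_word_canon: "longest_word n \<in> canon n"
proof (induction n)
  case (Suc m)
  have "take (Suc (2 * m)) (full_tail (Suc m)) = full_tail (Suc m)"
    using length_full_tail[of "Suc m"] by simp
  then show ?case using Suc by force
qed simp

lemma length_longest_word: "length (longest_word n) = n\<^sup>2"
  by (induction n) (auto simp: length_full_tail power2_eq_square)

lemma canon_length:
  "c \<in> canon n \<Longrightarrow> length c \<le> n\<^sup>2 \<and> (length c = n\<^sup>2 \<longrightarrow> c = longest_word n)"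
proof (induction n arbitrary: c)
  case (Suc m)
  then obtain d k where c: "c = d @ take k (full_tail (Suc m))" "d \<in> canon m" "k \<le> Suc (2 * m)" by auto
  have len: "length c = length d + k"
    using c length_full_tail[of "Suc m"] by simp
  have sq: "(Suc m)\<^sup>2 = m\<^sup>2 + Suc (2 * m)" by (simp add: power2_eq_square)
  have "c = longest_word (Suc m)" if "length c = (Suc m)\<^sup>2"
  proof -
    have "length d = m\<^sup>2" "k = Suc (2 * m)"
      using that len sq c(3) Suc.IH[OF c(2)] by linarith+
    then show ?thesis using Suc.IH[OF c(2)] c length_full_tail[of "Suc m"] by simp
  qed
  then show ?case using len sq c(3) Suc.IH[OF c(2)] by auto
qed simp

lemma word_prod_longest_word: "word_prod (longest_word n) = negate n"
proof (rule odd_fun_eqI)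
  fix j :: int assume "j > 0"
  then show "word_prod (longest_word n) j = negate n j"
  proof (induction n arbitrary: j)
    case (Suc m)
    show ?case
    proof (cases "j = int (Suc m)")
      case True
      moreover have "set (longest_word m) \<subseteq> {..<m}" using canon_letters longest_word_canon by blast
      ultimately show ?thesis
        using word_prod_full_tail[of j m] word_prod_fix_large[of "longest_word m" m j] Suc.prems
          word_prod_odd[of "longest_word m" j] by (simp add: negate_def)
    next
      case False
      then show ?thesis
        using word_prod_full_tail[of j m] Suc.prems Suc.IH[of j] by (auto simp: negate_def)
    qed
  qed (simp add: negate_def)
qed (auto simp: negate_def word_prod_odd)

lemma cox_length_negate: "cox_length n (negate n) = n\<^sup>2"
  using canon_reduced[OF longest_word_canon[of n]] length_longest_word[of n]
  by (simp add: reduced_word_def word_prod_longest_word)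

lemma negate_in_signed_perms: "negate n \<in> signed_perms n"
  using word_prod_in_signed_perms[OF canon_letters[OF longest_word_canon]] word_prod_longest_word
  by metis

lemma longest_element_unique:
  assumes "is_arg_max (cox_length n) (\<lambda>w. w \<in> signed_perms n) w0"
  shows "w0 = negate n"
proof -
  from assms have w0: "w0 \<in> signed_perms n" "\<And>v. v \<in> signed_perms n \<Longrightarrow> \<not> cox_length n w0 < cox_length n v"
    by (auto simp: is_arg_max_def)
  from canon_surj[OF w0(1)] obtain c where c: "c \<in> canon n" "word_prod c = w0" by blast
  have "length c = cox_length n w0"
    using canon_reduced[OF c(1)] c(2) by (simp add: reduced_word_def)
  moreover have "n\<^sup>2 \<le> cox_length n w0"
    using w0(2)[OF negate_in_signed_perms] cox_length_negate[of n] by simp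
  ultimately have "c = longest_word n" using canon_length[OF c(1)] by simp
  then show ?thesis using c word_prod_longest_word by metis
qed

lemma negate_central: "negate n \<circ> s_gen i = s_gen i \<circ> negate n" if "i < n"
proof (rule odd_fun_eqI)
  fix j :: int assume "j > 0"
  then show "(negate n \<circ> s_gen i) j = (s_gen i \<circ> negate n) j"
    using that s_gen_odd[of i "int i + 1"] by (auto simp: negate_def s_gen_apply s_gen_odd)
qed (auto simp: negate_def s_gen_odd)

lemma lsc_lsc: "lsc a * (lsc b * S) = lsc (a * b) * S"
  by (simp add: lsc_mult mult.assoc)

lemma Uw_lsc: "Uw n a * (lsc c * S) = lsc c * (Uw n a * S)" "Uw n a * lsc c = lsc c * Uw n a"
  by (rule lsc_left_commute, rule lsc_commute)

lemma U_lsc: "U n i * (lsc c * S) = lsc c * (U n i * S)" "U n i * lsc c = lsc c * U n i"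
  by (rule lsc_left_commute, rule lsc_commute)

section \<open>Coefficients in the nilCoxeter algebra\<close>

abbreviation wmon :: "nat list \<Rightarrow> 'a :: comm_ring_1 free_alg" where
  "wmon a \<equiv> Poly_Mapping.single (FWord a) 1"

lemma FWord_add: "FWord a + FWord b = FWord (a @ b)"
  by (simp add: plus_fword_def)

lemma wmon_append: "wmon (a @ b) = wmon a * wmon b"
  by (simp add: mult_single FWord_add)

lemma wmon_Nil: "wmon [] = 1"
  by (simp flip: zero_fword_def)

lemma prod_list_u_gen: "prod_list (map u_gen a) = (wmon a :: 'a :: comm_ring_1 free_alg)"
proof (induction a)
  case (Cons i a)
  have "prod_list (map u_gen (i # a)) = (wmon [i] * wmon a :: 'a free_alg)"
    by (simp only: list.map prod_list.Cons Cons u_gen_def[of i])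
  also have "\<dots> = wmon ([i] @ a)" by (rule wmon_append[symmetric])
  finally show ?case by simp
qed (simp add: wmon_Nil)

lemma single_eq_scal: "Poly_Mapping.single (FWord a) c = scal c * wmon a"
  by (simp add: scal_def mult_single)

lemma poly_mapping_sum_singles:
  "(\<Sum>w\<in>Poly_Mapping.keys x. Poly_Mapping.single w (Poly_Mapping.lookup x w)) = x"
  by (rule poly_mapping_eqI) (auto simp: lookup_sum lookup_single when_def in_keys_iff)

lemma scal_0 [simp]: "scal 0 = 0" by (simp add: scal_def)
lemma scal_1 [simp]: "scal 1 = 1" by (simp add: scal_def)
lemma scal_add: "scal (a + b) = scal a + scal b" by (simp add: scal_def single_add)

subsection \<open>The free algebra and the defining ideal\<close>

lemma free_carrier_single: "set a \<subseteq> {..<n} \<Longrightarrow> Poly_Mapping.single (FWord a) c \<in> free_carrier n"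
  by (auto simp: free_carrier_def)

lemma free_carrier_0: "0 \<in> free_carrier n"
  by (simp add: free_carrier_def)

lemma free_carrier_add: "x \<in> free_carrier n \<Longrightarrow> y \<in> free_carrier n \<Longrightarrow> x + y \<in> free_carrier n"
  using Poly_Mapping.keys_add[of x y] by (auto simp: free_carrier_def)

lemma free_carrier_sum: "(\<And>i. i \<in> I \<Longrightarrow> f i \<in> free_carrier n) \<Longrightarrow> sum f I \<in> free_carrier n"
  by (induction I rule: infinite_finite_induct) (auto intro: free_carrier_0 free_carrier_add)

lemma free_carrier_mult: "x \<in> free_carrier n \<Longrightarrow> y \<in> free_carrier n \<Longrightarrow> x * y \<in> free_carrier n"
  using keys_mult[of x y] by (fastforce simp: free_carrier_def plus_fword_def)

lemma free_carrier_scal: "scal c \<in> free_carrier n"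
  using free_carrier_single[of "[]" n c] by (simp add: scal_def zero_fword_def)

lemma free_carrier_1: "1 \<in> free_carrier n"
  using free_carrier_scal[of 1] by simp

lemma free_carrier_prod_list:
  "(\<And>x. x \<in> set xs \<Longrightarrow> x \<in> free_carrier n) \<Longrightarrow> prod_list xs \<in> free_carrier n"
  by (induction xs) (auto intro: free_carrier_1 free_carrier_mult)

lemma nil_ideal_left: "x \<in> nil_ideal n \<Longrightarrow> c \<in> free_carrier n \<Longrightarrow> c * x \<in> nil_ideal n"
proof (induction rule: nil_ideal.induct)
  case (rel r a b)
  then show ?case using nil_ideal.rel[of r n "c * a" b] by (simp add: mult.assoc free_carrier_mult)
qed (auto simp: distrib_left intro: nil_ideal.intros)

lemma nil_ideal_right: "x \<in> nil_ideal n \<Longrightarrow> c \<in> free_carrier n \<Longrightarrow> x * c \<in> nil_ideal n"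
proof (induction rule: nil_ideal.induct)
  case (rel r a b)
  then show ?case using nil_ideal.rel[of r n a "b * c"] by (simp add: mult.assoc free_carrier_mult)
qed (auto simp: distrib_right intro: nil_ideal.intros)

lemma nil_ideal_minus: "x \<in> nil_ideal n \<Longrightarrow> - x \<in> nil_ideal n"
  using nil_ideal_left[OF _ free_carrier_scal[of "- 1" n]]
  by (simp add: scal_def single_uminus)

lemma nil_ideal_generator: "r \<in> nil_rels n \<Longrightarrow> r \<in> nil_ideal n"
  using nil_ideal.rel[of r n 1 1] by (simp add: free_carrier_1)

lemma nil_eq_refl: "nil_eq n x x"
  by (simp add: nil_eq_def nil_ideal.zero)

lemma nil_eq_sym: "nil_eq n x y \<Longrightarrow> nil_eq n y x"
  using nil_ideal_minus[of "x - y" n] by (simp add: nil_eq_def)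

lemma nil_eq_trans: "nil_eq n x y \<Longrightarrow> nil_eq n y z \<Longrightarrow> nil_eq n x z"
  using nil_ideal.add[of "x - y" n "y - z"] by (simp add: nil_eq_def)

lemma nil_eq_add: "nil_eq n x y \<Longrightarrow> nil_eq n x' y' \<Longrightarrow> nil_eq n (x + x') (y + y')"
  using nil_ideal.add[of "x - y" n "x' - y'"] by (simp add: nil_eq_def algebra_simps)

lemma nil_eq_mult:
  assumes "nil_eq n x y" "nil_eq n x' y'" "x' \<in> free_carrier n" "y \<in> free_carrier n"
  shows "nil_eq n (x * x') (y * y')"
proof -
  have "(x - y) * x' + y * (x' - y') \<in> nil_ideal n"
    using assms by (intro nil_ideal.add nil_ideal_left nil_ideal_right) (auto simp: nil_eq_def)
  then show ?thesis by (simp add: nil_eq_def algebra_simps)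
qed

lemma weq_nil_eq: "weq n a b \<Longrightarrow> nil_eq n (wmon a :: 'a :: comm_ring_1 free_alg) (wmon b)"
proof (induction rule: weq.induct)
  case (comm i j)
  then have "u_gen i * u_gen j - u_gen j * u_gen i \<in> (nil_rels n :: 'a free_alg set)"
    unfolding nil_rels_def by blast
  then show ?case
    using nil_ideal_generator by (fastforce simp: nil_eq_def u_gen_def mult_single FWord_add)
next
  case (braid i)
  then have "u_gen i * u_gen (i + 1) * u_gen i - u_gen (i + 1) * u_gen i * u_gen (i + 1)
      \<in> (nil_rels n :: 'a free_alg set)"
    unfolding nil_rels_def by blast
  then show ?case
    using nil_ideal_generator by (fastforce simp: nil_eq_def u_gen_def mult_single FWord_add)
next
  case braid4
  then have "u_gen 0 * u_gen 1 * u_gen 0 * u_gen 1 - u_gen 1 * u_gen 0 * u_gen 1 * u_gen 0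
      \<in> (nil_rels n :: 'a free_alg set)"
    unfolding nil_rels_def by simp
  then show ?case
    using nil_ideal_generator by (fastforce simp: nil_eq_def u_gen_def mult_single FWord_add)
next
  case (app a b c d)
  then show ?case
    unfolding wmon_append using weq_letters[OF app.hyps(1)] weq_letters[OF app.hyps(2)]
    by (intro nil_eq_mult free_carrier_single) auto
qed (auto intro: nil_eq_refl nil_eq_sym nil_eq_trans)

lemma wzero_nil_ideal: "wzero n a \<Longrightarrow> (wmon a :: 'a :: comm_ring_1 free_alg) \<in> nil_ideal n"
proof (induction rule: wzero.induct)
  case (sq i)
  then have "u_gen i * u_gen i \<in> (nil_rels n :: 'a free_alg set)"
    unfolding nil_rels_def by blast
  then show ?case
    using nil_ideal_generator by (fastforce simp: u_gen_def mult_single FWord_add)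
next
  case (app a p q)
  then show ?case
    unfolding wmon_append by (intro nil_ideal_left nil_ideal_right free_carrier_single) auto
next
  case (weq a b)
  then have "nil_eq n (wmon b) (wmon a :: 'a free_alg)" using weq_nil_eq nil_eq_sym by blast
  then have "(wmon b - wmon a) + wmon a \<in> (nil_ideal n :: 'a free_alg set)"
    using weq.IH by (intro nil_ideal.add) (auto simp: nil_eq_def)
  then show ?case by simp
qed

definition chosen_word :: "nat \<Rightarrow> (int \<Rightarrow> int) \<Rightarrow> nat list" where
  "chosen_word n w = (SOME a. reduced_word n a w)"

lemma u_elt_eq: "u_elt n w = wmon (chosen_word n w)"
  by (simp add: u_elt_def chosen_word_def prod_list_u_gen)

lemma chosen_word: "w \<in> signed_perms n \<Longrightarrow> reduced_word n (chosen_word n w) w"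
  unfolding chosen_word_def by (metis signed_perm_reduced_word someI)

lemma u_elt_carrier: "w \<in> signed_perms n \<Longrightarrow> u_elt n w \<in> free_carrier n"
  using chosen_word by (auto simp: u_elt_eq reduced_word_def intro: free_carrier_single)

lemma word_class:
  assumes "set a \<subseteq> {..<n}"
  shows "nil_eq n (wmon a) (if reduced_word n a (word_prod a) then u_elt n (word_prod a) else 0)"
proof (cases "reduced_word n a (word_prod a)")
  case True
  then have "weq n a (chosen_word n (word_prod a))"
    using reduced_words_weq chosen_word word_prod_in_signed_perms[OF assms] by blast
  then show ?thesis using True weq_nil_eq by (simp add: u_elt_eq)
next
  case False
  then show ?thesis using wzero_nil_ideal[OF nonreduced_wzero[OF assms False]] by (simp add: nil_eq_def)
qed

lemma basis_expansion_exists: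
  assumes "\<xi> \<in> free_carrier n"
  shows "\<exists>c. (\<forall>v. v \<notin> signed_perms n \<longrightarrow> c v = 0) \<and>
             nil_eq n \<xi> (\<Sum>v \<in> signed_perms n. scal (c v) * u_elt n v)"
proof -
  let ?S = "signed_perms n"
  define good where "good \<xi> \<longleftrightarrow> (\<exists>c. (\<forall>v. v \<notin> ?S \<longrightarrow> c v = 0) \<and>
      nil_eq n \<xi> (\<Sum>v \<in> ?S. scal (c v) * u_elt n v))" for \<xi> :: "'a free_alg"
  have good_0: "good 0"
    unfolding good_def by (rule exI[of _ "\<lambda>_. 0"]) (simp add: nil_eq_refl)
  have good_add: "good (x + y)" if x: "good x" and y: "good y" for x y
  proof -
    obtain c d where "\<forall>v. v \<notin> ?S \<longrightarrow> c v = 0" "nil_eq n x (\<Sum>v \<in> ?S. scal (c v) * u_elt n v)"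
      "\<forall>v. v \<notin> ?S \<longrightarrow> d v = 0" "nil_eq n y (\<Sum>v \<in> ?S. scal (d v) * u_elt n v)"
      using x y unfolding good_def by blast
    then show ?thesis
      unfolding good_def by (intro exI[of _ "\<lambda>v. c v + d v"])
        (simp add: scal_add distrib_right sum.distrib nil_eq_add)
  qed
  have good_single: "good (Poly_Mapping.single (FWord a) d)" if a: "set a \<subseteq> {..<n}" for a d
  proof -
    let ?w = "word_prod a"
    define e where "e = (if reduced_word n a ?w then d else 0)"
    have w: "?w \<in> ?S" by (rule word_prod_in_signed_perms[OF a])
    have "nil_eq n (scal d * wmon a) (scal d * (if reduced_word n a ?w then u_elt n ?w else 0))"
      by (intro nil_eq_mult nil_eq_refl word_class free_carrier_single free_carrier_scal a)
    also have "scal d * (if reduced_word n a ?w then u_elt n ?w else 0) = scal e * u_elt n ?w"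
      by (simp add: e_def)
    also have "\<dots> = (\<Sum>v \<in> ?S. scal (if v = ?w then e else 0) * u_elt n v)"
    proof -
      have "(\<Sum>v \<in> ?S. scal (if v = ?w then e else 0) * u_elt n v)
          = (\<Sum>v \<in> ?S. if v = ?w then scal e * u_elt n v else 0)"
        by (rule sum.cong) auto
      then show ?thesis using w by (simp add: finite_signed_perms)
    qed
    finally have "good (scal d * wmon a)"
      unfolding good_def using w by (intro exI[of _ "\<lambda>v. if v = ?w then e else 0"]) auto
    then show ?thesis by (simp only: single_eq_scal[symmetric])
  qed
  have "good (\<Sum>w\<in>I. Poly_Mapping.single w (Poly_Mapping.lookup \<xi> w))"
    if "I \<subseteq> Poly_Mapping.keys \<xi>" "finite I" for I
    using that(2,1)
  proof (induction I rule: finite_induct)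
    case (insert w I)
    have "set (letters w) \<subseteq> {..<n}" using insert assms by (auto simp: free_carrier_def)
    then have "good (Poly_Mapping.single w (Poly_Mapping.lookup \<xi> w))"
      using good_single[of "letters w"] by simp
    then show ?case using insert good_add by simp
  qed (simp add: good_0)
  from this[OF order_refl finite_keys] have "good \<xi>"
    by (simp only: poly_mapping_sum_singles)
  then show ?thesis unfolding good_def .
qed

subsection \<open>Evaluation in the regular representation\<close>

text \<open>
  Scalars may be moved along a ring homomorphism: this is how coefficients that are power series
  are later compared inside a field.
\<close>

locale scalar_hom =
  fixes \<iota> :: "'a :: comm_ring_1 \<Rightarrow> 'k :: comm_ring_1"
  assumes hom_add: "\<iota> (a + b) = \<iota> a + \<iota> b"
    and hom_mult: "\<iota> (a * b) = \<iota> a * \<iota> b"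
    and hom_one [simp]: "\<iota> 1 = 1"
begin

lemma hom_zero [simp]: "\<iota> 0 = 0"
  using hom_add[of 0 0] by simp

lemma hom_minus: "\<iota> (- a) = - \<iota> a"
  using hom_add[of a "- a"] by (simp add: eq_neg_iff_add_eq_0 add.commute)

lemma hom_diff: "\<iota> (a - b) = \<iota> a - \<iota> b"
  using hom_add[of a "- b"] by (simp add: hom_minus)

lemma hom_sum: "\<iota> (sum f I) = (\<Sum>i\<in>I. \<iota> (f i))"
  by (induction I rule: infinite_finite_induct) (auto simp: hom_add)

lemma hom_prod: "\<iota> (prod f I) = (\<Prod>i\<in>I. \<iota> (f i))"
  by (induction I rule: infinite_finite_induct) (auto simp: hom_mult)

lemma hom_power: "\<iota> (a ^ k) = \<iota> a ^ k"
  by (induction k) (auto simp: hom_mult)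

definition ev :: "nat \<Rightarrow> 'a free_alg \<Rightarrow> 'k lop" where
  "ev n \<xi> = (\<Sum>w\<in>Poly_Mapping.keys \<xi>. lsc (\<iota> (Poly_Mapping.lookup \<xi> w)) * Uw n (letters w))"

lemma ev_superset:
  assumes "finite S" "Poly_Mapping.keys \<xi> \<subseteq> S"
  shows "ev n \<xi> = (\<Sum>w\<in>S. lsc (\<iota> (Poly_Mapping.lookup \<xi> w)) * Uw n (letters w))"
  unfolding ev_def using assms by (intro sum.mono_neutral_left) (auto simp: in_keys_iff)

lemma ev_0 [simp]: "ev n 0 = 0" by (simp add: ev_def)

lemma ev_add: "ev n (x + y) = ev n x + ev n y"
proof -
  let ?S = "Poly_Mapping.keys x \<union> Poly_Mapping.keys y"
  show ?thesis
    using Poly_Mapping.keys_add[of x y]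
    by (simp add: ev_superset[of ?S] lookup_add hom_add lsc_add distrib_right sum.distrib)
qed

lemma ev_single: "ev n (Poly_Mapping.single (FWord a) c) = lsc (\<iota> c) * Uw n a"
  by (subst ev_superset[of "{FWord a}"]) auto

lemma ev_sum: "ev n (sum f I) = (\<Sum>i\<in>I. ev n (f i))"
  by (induction I rule: infinite_finite_induct) (auto simp: ev_add)

lemma ev_mult: "ev n (x * y) = ev n x * ev n y"
proof -
  have single: "ev n (Poly_Mapping.single v c * Poly_Mapping.single w d)
      = ev n (Poly_Mapping.single v c) * ev n (Poly_Mapping.single w d)" for v w c d
    by (cases v; cases w)
      (simp add: mult_single FWord_add ev_single hom_mult Uw_append mult.assoc Uw_lsc lsc_lsc)
  have x: "x = (\<Sum>w\<in>Poly_Mapping.keys x. Poly_Mapping.single w (Poly_Mapping.lookup x w))" for x :: "'a free_alg"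
    by (rule poly_mapping_sum_singles[symmetric])
  have "ev n (x * y) = (\<Sum>v\<in>Poly_Mapping.keys x. \<Sum>w\<in>Poly_Mapping.keys y.
      ev n (Poly_Mapping.single v (Poly_Mapping.lookup x v) * Poly_Mapping.single w (Poly_Mapping.lookup y w)))"
    by (subst x[of x], subst x[of y]) (simp only: sum_distrib_left sum_distrib_right ev_sum, rule sum.swap)
  also have "\<dots> = (\<Sum>v\<in>Poly_Mapping.keys x. ev n (Poly_Mapping.single v (Poly_Mapping.lookup x v))) *
      (\<Sum>w\<in>Poly_Mapping.keys y. ev n (Poly_Mapping.single w (Poly_Mapping.lookup y w)))"
    by (simp only: single sum_product)
  also have "\<dots> = ev n x * ev n y" by (simp only: ev_sum[symmetric] x[symmetric])
  finally show ?thesis .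
qed

lemma ev_scal: "ev n (scal c) = lsc (\<iota> c)"
  using ev_single[of n "[]" c] by (simp add: scal_def zero_fword_def)

lemma ev_1 [simp]: "ev n 1 = 1"
  using ev_scal[of n 1] by simp

lemma ev_minus: "ev n (- x) = - ev n x"
  using ev_add[of n x "- x"] by (simp add: eq_neg_iff_add_eq_0 add.commute)

lemma ev_diff: "ev n (x - y) = ev n x - ev n y"
  using ev_add[of n x "- y"] by (simp add: ev_minus)

lemma ev_u_gen: "ev n (u_gen i) = U n i"
  using ev_single[of n "[i]" 1] by (simp add: u_gen_def Uw_def)

lemma ev_prod_list: "ev n (prod_list xs) = prod_list (map (ev n) xs)"
  by (induction xs) (auto simp: ev_mult)

lemma ev_nil_ideal: "x \<in> nil_ideal n \<Longrightarrow> ev n x = 0"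
proof (induction rule: nil_ideal.induct)
  case (rel r a b)
  have "ev n r = 0"
    using rel(1) U_braid4[of n]
    by (auto simp: nil_rels_def ev_diff ev_mult ev_u_gen U_braid U_commute split: if_splits)
  then show ?case by (simp add: ev_mult)
qed (simp_all add: ev_add)

lemma ev_u_elt:
  assumes "v \<in> signed_perms n"
  shows "coeff_at w (ev n (u_elt n v)) = (if v = w then 1 else 0)"
  using chosen_word[OF assms]
  by (auto simp: u_elt_eq ev_single coeff_at_Uw reduced_word_def)

lemma coeff_at_expansion:
  assumes "\<forall>v. v \<notin> signed_perms n \<longrightarrow> c v = 0"
    "nil_eq n \<xi> (\<Sum>v \<in> signed_perms n. scal (c v) * u_elt n v)"
  shows "\<iota> (c w) = coeff_at w (ev n \<xi>)"
proof -
  have "ev n \<xi> = ev n (\<Sum>v \<in> signed_perms n. scal (c v) * u_elt n v)"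
    using ev_nil_ideal[of "\<xi> - (\<Sum>v \<in> signed_perms n. scal (c v) * u_elt n v)" n] assms(2)
    by (simp add: nil_eq_def ev_diff)
  then have "coeff_at w (ev n \<xi>) = (\<Sum>v \<in> signed_perms n. \<iota> (c v) * coeff_at w (ev n (u_elt n v)))"
    by (simp add: ev_sum ev_mult ev_scal coeff_at_sum coeff_at_scale)
  also have "\<dots> = (\<Sum>v \<in> signed_perms n. if v = w then \<iota> (c v) else 0)"
    by (rule sum.cong) (auto simp: ev_u_elt)
  also have "\<dots> = \<iota> (c w)" using assms(1) by (simp add: finite_signed_perms)
  finally show ?thesis by simp
qed

end

lemma nil_coeff_expansion:
  assumes "\<xi> \<in> free_carrier n"
  shows "(\<forall>v. v \<notin> signed_perms n \<longrightarrow> nil_coeff n \<xi> v = 0) \<and>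
    nil_eq n \<xi> (\<Sum>v \<in> signed_perms n. scal (nil_coeff n \<xi> v) * u_elt n v)"
proof -
  have id_hom: "scalar_hom (\<lambda>x :: 'a. x)" by unfold_locales auto
  have "\<exists>!c. (\<forall>v. v \<notin> signed_perms n \<longrightarrow> c v = 0) \<and>
             nil_eq n \<xi> (\<Sum>v \<in> signed_perms n. scal (c v) * u_elt n v)"
  proof (rule ex_ex1I[OF basis_expansion_exists[OF assms]])
    fix c d assume c: "(\<forall>v. v \<notin> signed_perms n \<longrightarrow> c v = 0) \<and>
             nil_eq n \<xi> (\<Sum>v \<in> signed_perms n. scal (c v) * u_elt n v)"
      and d: "(\<forall>v. v \<notin> signed_perms n \<longrightarrow> d v = 0) \<and>
             nil_eq n \<xi> (\<Sum>v \<in> signed_perms n. scal (d v) * u_elt n v)"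
    show "c = d"
    proof
      fix w
      show "c w = d w"
        using scalar_hom.coeff_at_expansion[OF id_hom conjunct1[OF c] conjunct2[OF c], of w]
          scalar_hom.coeff_at_expansion[OF id_hom conjunct1[OF d] conjunct2[OF d], of w]
        by simp
    qed
  qed
  from theI'[OF this] show ?thesis unfolding nil_coeff_def .
qed

lemma (in scalar_hom) hom_nil_coeff:
  "\<xi> \<in> free_carrier n \<Longrightarrow> \<iota> (nil_coeff n \<xi> w) = coeff_at w (ev n \<xi>)"
  using nil_coeff_expansion coeff_at_expansion by blast

section \<open>Commuting products of linear factors\<close>

definition H :: "nat \<Rightarrow> nat \<Rightarrow> 'a :: comm_ring_1 \<Rightarrow> 'a lop" where
  "H n i x = 1 + lsc x * U n i"

text \<open>\<open>Up n k x\<close> is the inverse of \<open>Dn n k (- x)\<close>.\<close>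

definition Dn :: "nat \<Rightarrow> nat \<Rightarrow> 'a :: comm_ring_1 \<Rightarrow> 'a lop" where
  "Dn n k x = prod_list (map (\<lambda>i. H n i x) (rev [k..<n]))"

definition Up :: "nat \<Rightarrow> nat \<Rightarrow> 'a :: comm_ring_1 \<Rightarrow> 'a lop" where
  "Up n k x = prod_list (map (\<lambda>i. H n i x) [k..<n])"

definition Cc :: "nat \<Rightarrow> 'a :: comm_ring_1 \<Rightarrow> 'a lop" where
  "Cc n x = Dn n 1 x * H n 0 (2 * x) * Up n 1 x"

lemma H_mult: "H n i x * H n i y = H n i (x + y)"
  by (simp add: H_def distrib_left distrib_right mult.assoc lsc_add U_lsc lsc_lsc)

lemma H_0 [simp]: "H n i 0 = 1" by (simp add: H_def)

lemma H_cancel [simp]: "H n i x * H n i (- x) = 1" "H n i (- x) * H n i x = 1"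
  by (simp_all add: H_mult)

lemma H_commute_U:
  assumes "i + 2 \<le> j \<or> j + 2 \<le> i"
  shows "H n i x * U n j = U n j * H n i x"
  by (simp add: H_def distrib_left distrib_right mult.assoc U_lsc U_commute[OF assms])

lemma H_yang_baxter:
  assumes "i > 0"
  shows "H n i x * H n (Suc i) (x + y) * H n i y = H n (Suc i) y * H n i (x + y) * H n (Suc i) x"
  by (simp add: H_def distrib_left distrib_right mult.assoc U_lsc lsc_lsc lsc_add algebra_simps
      U_braid[OF assms, unfolded mult.assoc])

text \<open>The reflection equation, the analogue of the Yang--Baxter equation at the node \<open>0\<close>.\<close>

lemma H_reflection:
  "H n 1 (x - y) * H n 0 (2 * x) * H n 1 (x + y) * H n 0 (2 * y) =
   H n 0 (2 * y) * H n 1 (x + y) * H n 0 (2 * x) * H n 1 (x - y)"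
  by (simp add: H_def distrib_left distrib_right mult.assoc U_lsc lsc_lsc
      U_braid4[unfolded mult.assoc One_nat_def])
    (simp add: algebra_simps lsc_add lsc_diff)

lemma Dn_ge [simp]: "n \<le> k \<Longrightarrow> Dn n k x = 1" by (simp add: Dn_def)
lemma Up_ge [simp]: "n \<le> k \<Longrightarrow> Up n k x = 1" by (simp add: Up_def)

lemma Dn_step: "k < n \<Longrightarrow> Dn n k x = Dn n (Suc k) x * H n k x"
  by (simp add: Dn_def upt_conv_Cons)

lemma Up_step: "k < n \<Longrightarrow> Up n k x = H n k x * Up n (Suc k) x"
  by (simp add: Up_def upt_conv_Cons)

lemma H_ge: "n \<le> i \<Longrightarrow> H n i x = 1"
  by (simp add: H_def U_eq_0)

lemma Dn_Suc: "Dn n k x = Dn n (Suc k) x * H n k x"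
  by (cases "k < n") (auto simp: Dn_step H_ge)

lemma Up_Suc: "Up n k x = H n k x * Up n (Suc k) x"
  by (cases "k < n") (auto simp: Up_step H_ge)

lemma prod_list_H_commute:
  assumes "\<And>i. i \<in> set xs \<Longrightarrow> i + 2 \<le> j \<or> j + 2 \<le> i"
  shows "prod_list (map (\<lambda>i. H n i x) xs) * U n j = U n j * prod_list (map (\<lambda>i. H n i x) xs)"
  using assms
proof (induction xs)
  case (Cons i xs)
  have "H n i x * U n j = U n j * H n i x" by (rule H_commute_U) (use Cons in auto)
  moreover have "prod_list (map (\<lambda>i. H n i x) xs) * U n j = U n j * prod_list (map (\<lambda>i. H n i x) xs)"
    using Cons by auto
  ultimately show ?case by (simp add: mult.assoc) (simp add: mult.assoc[symmetric])
qed simp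

lemma Dn_U_commute: "j + 2 \<le> k \<Longrightarrow> Dn n k x * U n j = U n j * Dn n k x"
  unfolding Dn_def by (rule prod_list_H_commute) auto

lemma Up_U_commute: "j + 2 \<le> k \<Longrightarrow> Up n k x * U n j = U n j * Up n k x"
  unfolding Up_def by (rule prod_list_H_commute) auto

lemma Dn_H_commute: "j + 2 \<le> k \<Longrightarrow> Dn n k x * H n j y = H n j y * Dn n k x"
  using Dn_U_commute[of j k n x]
  by (simp add: H_def distrib_left distrib_right mult.assoc lsc_left_commute[of _ y] lsc_commute[of _ y])

lemma Up_H_commute: "j + 2 \<le> k \<Longrightarrow> Up n k x * H n j y = H n j y * Up n k x"
  using Up_U_commute[of j k n x]
  by (simp add: H_def distrib_left distrib_right mult.assoc lsc_left_commute[of _ y] lsc_commute[of _ y])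

lemma Dn_Up_cancel [simp]: "Dn n k x * Up n k (- x) = 1"
proof (induction "n - k" arbitrary: k)
  case (Suc d)
  have "Dn n k x * Up n k (- x) = Dn n (Suc k) x * (H n k x * H n k (- x)) * Up n (Suc k) (- x)"
    by (simp only: Dn_Suc[of n k] Up_Suc[of n k] mult.assoc)
  then show ?case using Suc(1)[of "Suc k"] Suc(2) by simp
qed simp

lemma Up_Dn_cancel [simp]: "Up n k x * Dn n k (- x) = 1"
proof (induction "n - k" arbitrary: k)
  case (Suc d)
  have "Up n k x * Dn n k (- x) = H n k x * (Up n (Suc k) x * Dn n (Suc k) (- x)) * H n k (- x)"
    by (simp only: Dn_Suc[of n k] Up_Suc[of n k] mult.assoc)
  then show ?case using Suc(1)[of "Suc k"] Suc(2) by simp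
qed simp

lemma Dn_Up_cancel' [simp]: "Dn n k (- x) * Up n k x = 1" "Up n k (- x) * Dn n k x = 1"
  using Dn_Up_cancel[of n k "- x"] Up_Dn_cancel[of n k "- x"] by simp_all

text \<open>Fomin and Stanley's argument: push the factors past each other by the Yang--Baxter equation.\<close>

lemma Dn_commute: "k \<ge> 1 \<Longrightarrow> Dn n k x * Dn n k y = Dn n k y * Dn n k x"
proof (induction "n - k" arbitrary: k)
  case (Suc d)
  let ?A = "\<lambda>x. Dn n (Suc k) x" and ?B = "\<lambda>x. Dn n (Suc (Suc k)) x"
  let ?g = "\<lambda>x. H n k x" and ?h = "\<lambda>x. H n (Suc k) x"
  have comm: "?A x * ?A y = ?A y * ?A x" using Suc(1)[of "Suc k"] Suc(2) by simp
  have B: "?A z * ?h (- z) = ?B z" for z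
    by (simp only: Dn_Suc[of n "Suc k"] mult.assoc H_cancel mult_1_right)
  have gB: "?g z * ?B w = ?B w * ?g z" for z w by (rule Dn_H_commute[symmetric]) simp
  have yb: "?g x * ?h y * ?g y = ?h (y - x) * ?g y * ?h x * ?g x"
  proof -
    have "?g x * ?h (x + (y - x)) * ?g (y - x) = ?h (y - x) * ?g (x + (y - x)) * ?h x"
      by (rule H_yang_baxter) (use Suc in auto)
    then have "?g x * ?h y * (?g (y - x) * ?g x) = ?h (y - x) * ?g y * ?h x * ?g x"
      by (simp add: mult.assoc[symmetric])
    then show ?thesis by (simp add: H_mult)
  qed
  have "Dn n k x * Dn n k y = ?A x * (?g x * ?B y) * ?h y * ?g y"
    by (simp only: Dn_Suc[of n k] Dn_Suc[of n "Suc k" y] mult.assoc)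
  also have "\<dots> = ?A x * ?B y * (?g x * ?h y * ?g y)"
    by (simp only: gB mult.assoc)
  also have "\<dots> = ?A x * (?A y * ?h (- y)) * (?h (y - x) * ?g y * ?h x * ?g x)"
    by (simp only: yb B)
  also have "\<dots> = ?A x * ?A y * (?h (- y) * ?h (y - x)) * ?g y * ?h x * ?g x"
    by (simp only: mult.assoc)
  also have "\<dots> = ?A y * (?A x * ?h (- x)) * ?g y * ?h x * ?g x"
    by (simp only: H_mult comm mult.assoc) simp
  also have "\<dots> = ?A y * (?g y * ?B x) * ?h x * ?g x"
    by (simp only: B gB mult.assoc)
  also have "\<dots> = Dn n k y * Dn n k x"
    by (simp only: Dn_Suc[of n k] Dn_Suc[of n "Suc k" x] mult.assoc)
  finally show ?case .
qed simp

lemma inverse_commute: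
  fixes a b c :: "'a :: monoid_mult"
  assumes "a * b = b * a" "a * c = 1" "c * a = 1"
  shows "c * b = b * c"
proof -
  have "c * b = c * (b * a) * c" by (simp only: mult.assoc assms mult_1_right)
  also have "\<dots> = (c * a) * b * c" by (simp only: assms(1)[symmetric] mult.assoc)
  finally show ?thesis by (simp add: assms)
qed

lemma Up_Dn_commute: "k \<ge> 1 \<Longrightarrow> Up n k x * Dn n k y = Dn n k y * Up n k x"
  by (rule inverse_commute[of "Dn n k (- x)"]) (simp_all add: Dn_commute)

lemma Up_commute: "k \<ge> 1 \<Longrightarrow> Up n k x * Up n k y = Up n k y * Up n k x"
  by (rule inverse_commute[of "Dn n k (- x)"]) (simp_all add: Up_Dn_commute)

lemma Cc_cancel [simp]: "Cc n x * Cc n (- x) = 1"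
proof -
  have "Cc n x * Cc n (- x) = Dn n 1 x * H n 0 (2 * x) * (Up n 1 x * Dn n 1 (- x)) * H n 0 (- (2 * x)) * Up n 1 (- x)"
    by (simp only: Cc_def mult.assoc mult_minus_right)
  also have "\<dots> = Dn n 1 x * (H n 0 (2 * x) * H n 0 (- (2 * x))) * Up n 1 (- x)"
    by (simp only: Up_Dn_cancel mult_1_right mult.assoc)
  finally show ?thesis by simp
qed

lemma Cc_times_Dn: "Cc n x * Dn n 1 (- x) = Dn n 1 x * H n 0 (2 * x)"
  by (simp only: Cc_def mult.assoc Up_Dn_cancel mult_1_right)

text \<open>
  Conjugating by the commuting factors \<open>Dn\<close> and \<open>Up\<close> reduces the commutation of \<open>C(x)\<close> and \<open>C(y)\<close>
  to the reflection equation in \<open>u\<^sub>0\<close> and \<open>u\<^sub>1\<close>.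
\<close>

lemma Cc_commute: "Cc n x * Cc n y = Cc n y * Cc n x"
proof -
  let ?D = "Dn n 1" and ?E = "Up n 1" and ?D2 = "Dn n 2" and ?E2 = "Up n 2"
  let ?h = "H n 1" and ?g = "H n 0"
  have D: "?D z = ?D2 z * ?h z" and E: "?E z = ?h z * ?E2 z" for z
    using Dn_Suc[of n 1 z] Up_Suc[of n 1 z] by (simp_all add: numeral_2_eq_2)
  have core: "Cc n x * Cc n y = ?D x * ?D y *
      (?h (- y) * ?g (2 * x) * ?h (x + y) * ?g (2 * y) * ?h (- x)) * (?E x * ?E y)" for x y
  proof -
    have gD: "?g z * ?D2 w = ?D2 w * ?g z" and gE: "?E2 w * ?g z = ?g z * ?E2 w" for z w
      using Dn_H_commute[of 0 2 n w z] Up_H_commute[of 0 2 n w z] by simp_all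
    have D2: "?D y * ?h (- y) = ?D2 y" by (simp only: D mult.assoc H_cancel mult_1_right)
    have E2: "?h (- x) * ?E x = ?E2 x" by (simp only: E mult.assoc[symmetric] H_cancel mult_1_left)
    have "Cc n x * Cc n y = ?D x * ?g (2 * x) * (?E x * ?D y) * ?g (2 * y) * ?E y"
      by (simp only: Cc_def mult.assoc)
    also have "?E x * ?D y = ?D y * ?E x" by (rule Up_Dn_commute) simp
    also have "?D y * ?E x = ?D2 y * (?h y * ?h x) * ?E2 x" by (simp only: D E mult.assoc)
    also have "?h y * ?h x = ?h (x + y)" by (simp add: H_mult add.commute)
    also have "?D x * ?g (2 * x) * (?D2 y * ?h (x + y) * ?E2 x) * ?g (2 * y) * ?E y
        = ?D x * (?g (2 * x) * ?D2 y) * ?h (x + y) * (?E2 x * ?g (2 * y)) * ?E y"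
      by (simp only: mult.assoc)
    also have "\<dots> = ?D x * (?D y * ?h (- y)) * ?g (2 * x) * ?h (x + y) * ?g (2 * y) * (?h (- x) * ?E x) * ?E y"
      by (simp only: gD gE D2 E2 mult.assoc)
    finally show ?thesis by (simp only: mult.assoc)
  qed
  have "?h (- y) * ?g (2 * x) * ?h (x + y) * ?g (2 * y) * ?h (- x)
      = ?h (- x) * (?h (x - y) * ?g (2 * x) * ?h (x + y) * ?g (2 * y)) * ?h (- x)"
    by (simp add: mult.assoc[symmetric] H_mult)
  also have "\<dots> = ?h (- x) * (?g (2 * y) * ?h (x + y) * ?g (2 * x) * ?h (x - y)) * ?h (- x)"
    by (simp only: H_reflection)
  also have "\<dots> = ?h (- x) * ?g (2 * y) * ?h (y + x) * ?g (2 * x) * ?h (- y)"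
    by (simp add: mult.assoc H_mult add.commute)
  finally have "?h (- y) * ?g (2 * x) * ?h (x + y) * ?g (2 * y) * ?h (- x)
      = ?h (- x) * ?g (2 * y) * ?h (y + x) * ?g (2 * x) * ?h (- y)" .
  moreover have "?D x * ?D y = ?D y * ?D x" "?E x * ?E y = ?E y * ?E x"
    by (simp_all add: Dn_commute Up_commute)
  ultimately show ?thesis by (simp only: core[of x y] core[of y x])
qed

text \<open>Products over lists of pairwise commuting factors may be reordered.\<close>

definition prodl :: "('b \<Rightarrow> 'a :: monoid_mult) \<Rightarrow> 'b list \<Rightarrow> 'a" where
  "prodl f xs = prod_list (map f xs)"

lemma prodl_Nil [simp]: "prodl f [] = 1" by (simp add: prodl_def)
lemma prodl_Cons [simp]: "prodl f (x # xs) = f x * prodl f xs" by (simp add: prodl_def)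
lemma prodl_append: "prodl f (xs @ ys) = prodl f xs * prodl f ys" by (simp add: prodl_def)

lemma prodl_commute1:
  assumes "\<And>x. x \<in> set xs \<Longrightarrow> f x * b = b * f x"
  shows "prodl f xs * b = b * prodl f xs"
  using assms
proof (induction xs)
  case (Cons x xs)
  then have "prodl f xs * b = b * prodl f xs" "f x * b = b * f x" by auto
  then show ?case by (simp add: mult.assoc) (simp add: mult.assoc[symmetric])
qed simp

lemma prodl_remove1:
  assumes "\<And>x y. f x * f y = f y * f x" "x \<in> set xs"
  shows "prodl f xs = f x * prodl f (remove1 x xs)"
  using assms(2)
proof (induction xs)
  case (Cons y xs)
  show ?case
  proof (cases "y = x")
    case False
    then have "prodl f (y # xs) = (f y * f x) * prodl f (remove1 x xs)" using Cons by (simp add: mult.assoc)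
    then show ?thesis using False by (simp only: assms(1)[of y x]) (simp add: mult.assoc)
  qed simp
qed simp

lemma prodl_perm:
  assumes comm: "\<And>x y. f x * f y = f y * f x" and "mset xs = mset ys"
  shows "prodl f xs = prodl f ys"
  using assms(2)
proof (induction xs arbitrary: ys)
  case (Cons x xs)
  have x: "x \<in> set ys" using Cons.prems by (metis list.set_intros(1) mset_eq_setD)
  have "mset xs = mset (remove1 x ys)" using Cons.prems[symmetric] by simp
  from Cons.IH[OF this] show ?case using prodl_remove1[of f, OF comm x] by simp
qed simp

lemma prodl_Up_Dn_cancel:
  assumes "k \<ge> 1"
  shows "prodl (Up n k) xs * prodl (\<lambda>x. Dn n k (- x)) xs = 1"
proof (induction xs)
  case (Cons x xs)
  have comm: "prodl (Up n k) xs * Dn n k (- x) = Dn n k (- x) * prodl (Up n k) xs"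
    by (rule prodl_commute1) (rule Up_Dn_commute[OF assms])
  have "prodl (Up n k) (x # xs) * prodl (\<lambda>x. Dn n k (- x)) (x # xs)
      = Up n k x * (prodl (Up n k) xs * Dn n k (- x)) * prodl (\<lambda>x. Dn n k (- x)) xs"
    by (simp only: prodl_Cons mult.assoc)
  also have "\<dots> = (Up n k x * Dn n k (- x)) * (prodl (Up n k) xs * prodl (\<lambda>x. Dn n k (- x)) xs)"
    by (simp only: comm mult.assoc)
  finally show ?case using Cons by simp
qed simp

subsection \<open>Spans containing the factors\<close>

lemma wspan_one: "P [] \<Longrightarrow> 1 \<in> wspan n P"
  using wspan_word[of P "[]" n] by simp

lemma H_wspan: "P [] \<Longrightarrow> P [i] \<Longrightarrow> H n i x \<in> wspan n P"
proof (cases "i < n")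
  case True
  assume "P []" "P [i]"
  then show ?thesis
    unfolding H_def using True
    by (intro wspan_plus wspan_one wspan_scale) (auto simp: Uw_single[symmetric] intro: wspan_word)
qed (simp add: H_ge wspan_one)

lemma Dn_letters: "Dn n k x \<in> wspan n (\<lambda>a. set a \<subseteq> {k..<n})"
proof (induction "n - k" arbitrary: k)
  case 0
  then show ?case by (simp add: wspan_one)
next
  case (Suc d)
  have "Dn n (Suc k) x \<in> wspan n (\<lambda>a. set a \<subseteq> {Suc k..<n})" using Suc(1)[of "Suc k"] Suc(2) by simp
  moreover have "H n k x \<in> wspan n (\<lambda>a. set a \<subseteq> {k})" by (rule H_wspan) auto
  ultimately show ?case
    unfolding Dn_Suc[of n k] by (rule wspan_mult) (use Suc(2) in fastforce)
qed

lemma Up_letters: "Up n k x \<in> wspan n (\<lambda>a. set a \<subseteq> {k..<n})"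
proof (induction "n - k" arbitrary: k)
  case 0
  then show ?case by (simp add: wspan_one)
next
  case (Suc d)
  have "Up n (Suc k) x \<in> wspan n (\<lambda>a. set a \<subseteq> {Suc k..<n})" using Suc(1)[of "Suc k"] Suc(2) by simp
  moreover have "H n k x \<in> wspan n (\<lambda>a. set a \<subseteq> {k})" by (rule H_wspan) auto
  ultimately show ?case
    unfolding Up_Suc[of n k] by (intro wspan_mult[of "H n k x"]) (use Suc(2) in fastforce)+
qed

section \<open>Interpolation\<close>

lemma linear_factors_dvd:
  fixes p :: "'k :: field poly"
  assumes "finite X" "\<And>x. x \<in> X \<Longrightarrow> poly p x = 0"
  shows "(\<Prod>x\<in>X. [:- x, 1:]) dvd p"
  using assms
proof (induction X arbitrary: p rule: finite_induct)
  case (insert a X)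
  then obtain q where q: "p = [:- a, 1:] * q" by (metis insertI1 poly_eq_0_iff_dvd dvdE)
  have "poly q x = 0" if "x \<in> X" for x
    using insert.prems[of x] insert.hyps that by (auto simp: q)
  then have "(\<Prod>x\<in>X. [:- x, 1:]) dvd q" by (rule insert.IH)
  then show ?case using insert.hyps by (simp add: q mult_dvd_mono del: mult_pCons_left)
qed simp

text \<open>A polynomial of degree at most \<open>|X|\<close> that vanishes on \<open>- X\<close> is determined by its value at \<open>0\<close>.\<close>

lemma poly_with_roots:
  fixes p :: "'k :: field poly"
  assumes "finite X" "Polynomial.degree p \<le> card X" "0 \<notin> X" "\<And>x. x \<in> X \<Longrightarrow> poly p (- x) = 0"
  shows "poly p t * (\<Prod>x\<in>X. x) = poly p 0 * (\<Prod>x\<in>X. t + x)"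
proof -
  define q where "q = smult (poly p 0) (\<Prod>x\<in>X. [:x, 1:])"
  define p' where "p' = smult (\<Prod>x\<in>X. x) p"
  have "Polynomial.degree (\<Prod>x\<in>X. [:x, 1:]) \<le> card X"
    using degree_prod_sum_le[of X "\<lambda>x. [:x, 1:]"] assms(1) by simp
  then have deg: "Polynomial.degree q \<le> card X" "Polynomial.degree p' \<le> card X"
    using degree_smult_le[of "poly p 0" "\<Prod>x\<in>X. [:x, 1:]"] degree_smult_le[of "\<Prod>x\<in>X. x" p] assms(2)
    by (auto simp: q_def p'_def)
  have "p' = q"
  proof (rule poly_eqI_degree)
    fix y assume "y \<in> insert 0 (uminus ` X)"
    then consider "y = 0" | x where "x \<in> X" "y = - x" by auto
    then show "poly p' y = poly q y"
    proof cases
      case 1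
      then show ?thesis by (simp add: p'_def q_def poly_prod)
    next
      case (2 x)
      have "(\<Prod>z\<in>X. z - x) = 0" using 2 assms(1) by (intro prod_zero) auto
      then show ?thesis using assms(4) 2 by (simp add: p'_def q_def poly_prod)
    qed
  next
    have "card (insert 0 (uminus ` X)) = Suc (card X)"
      using assms(1,3) by (subst card_insert_disjoint) (auto simp: card_image inj_on_def)
    then show "card (insert 0 (uminus ` X)) > Polynomial.degree p'"
      "card (insert 0 (uminus ` X)) > Polynomial.degree q" using deg by auto
  qed
  then have "poly p' t = poly q t" by simp
  then show ?thesis by (simp add: p'_def q_def poly_prod ac_simps)
qed

lemma Diff_right_commute: "V - A - B = V - B - (A :: 'a set)"
  by blast

definition hsum :: "nat \<Rightarrow> 'k :: field set \<Rightarrow> 'k" where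
  "hsum c V = (\<Sum>v\<in>V. v ^ c / (\<Prod>u\<in>V - {v}. v - u))"

lemma hsum_rec:
  assumes "finite V" "a \<in> V"
  shows "hsum (Suc c) V = a * hsum c V + hsum c (V - {a})"
proof -
  have "hsum (Suc c) V - a * hsum c V = (\<Sum>v\<in>V. v ^ c * (v - a) / (\<Prod>u\<in>V - {v}. v - u))"
    unfolding hsum_def sum_distrib_left sum_subtractf[symmetric]
    by (rule sum.cong) (auto simp: algebra_simps diff_divide_distrib)
  also have "\<dots> = (\<Sum>v\<in>V - {a}. v ^ c * (v - a) / (\<Prod>u\<in>V - {v}. v - u))"
  proof (rule sum.mono_neutral_right[OF assms(1)])
    show "\<forall>v\<in>V - (V - {a}). v ^ c * (v - a) / (\<Prod>u\<in>V - {v}. v - u) = 0"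
    proof
      fix v assume "v \<in> V - (V - {a})"
      then have "v = a" by blast
      then show "v ^ c * (v - a) / (\<Prod>u\<in>V - {v}. v - u) = 0" by simp
    qed
  qed blast
  also have "\<dots> = hsum c (V - {a})"
    unfolding hsum_def
  proof (rule sum.cong)
    fix v assume v: "v \<in> V - {a}"
    have "(\<Prod>u\<in>V - {v}. v - u) = (v - a) * (\<Prod>u\<in>V - {v} - {a}. v - u)"
      by (rule prod.remove) (use assms v in auto)
    then show "v ^ c * (v - a) / (\<Prod>u\<in>V - {v}. v - u) = v ^ c / (\<Prod>u\<in>V - {a} - {v}. v - u)"
      using v by (simp add: Diff_right_commute[of V "{a}"])
  qed simp
  finally show ?thesis by (simp add: algebra_simps)
qed

lemma hsum_low:
  assumes "finite V"
  shows "(Suc c < card V \<longrightarrow> hsum c V = 0) \<and> (Suc c = card V \<longrightarrow> hsum c V = (1 :: 'k :: field))"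
  using assms
proof (induction c arbitrary: V)
  case 0
  show ?case using 0
  proof (induction "card V" arbitrary: V rule: less_induct)
    case less
    show ?case
    proof (cases "card V \<ge> 2")
      case True
      then obtain a b where ab: "a \<in> V" "b \<in> V" "a \<noteq> b"
        by (metis card_le_Suc0_iff_eq less.prems not_less_eq_eq numeral_2_eq_2)
      have eq: "hsum 0 (V - {a}) = hsum 0 (V - {b})"
        using less.hyps[of "V - {a}"] less.hyps[of "V - {b}"] ab less.prems True
        by (cases "card V = 2") auto
      have "a * hsum 0 V = b * hsum 0 V"
        using hsum_rec[OF less.prems ab(1), of 0] hsum_rec[OF less.prems ab(2), of 0] eq by (metis add_right_cancel)
      then have "hsum 0 V = 0" using ab(3) by simp
      then show ?thesis using True by auto
    next
      case False
      have "hsum 0 V = 1" if "card V = 1" using that by (auto simp: card_1_singleton_iff hsum_def)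
      then show ?thesis using False by auto
    qed
  qed
next
  case (Suc c)
  show ?case
  proof (cases "V = {}")
    case False
    then obtain a where "a \<in> V" by auto
    then show ?thesis
      using hsum_rec[OF Suc.prems, of a c] Suc.IH[OF Suc.prems] Suc.IH[of "V - {a}"] Suc.prems by auto
  qed simp
qed

section \<open>The coefficient of the longest element as a function of the variables X\<close>

text \<open>
  \<open>sgn_word r\<close> is a reduced word of the signed permutation that negates and reverses \<open>1, \<dots>, r\<close>.
\<close>

fun sgn_word :: "nat \<Rightarrow> nat list" where
  "sgn_word 0 = []"
| "sgn_word (Suc r) = [0..<Suc r] @ sgn_word r"

lemma sgn_word_letters: "set (sgn_word r) \<subseteq> {..<r}"
  by (induction r) (auto simp del: upt_Suc)

lemma word_prod_sgn_word:
  assumes "j > 0"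
  shows "word_prod (sgn_word r) j = (if j \<le> int r then - (int r + 1 - j) else j)"
  using assms
proof (induction r)
  case (Suc r)
  have "word_prod (sgn_word (Suc r)) j = word_prod [0..<Suc r] (word_prod (sgn_word r) j)"
    by (simp del: upt_Suc)
  also have "\<dots> = (if j \<le> int r then - word_prod [0..<Suc r] (int r + 1 - j) else word_prod [0..<Suc r] j)"
    using Suc word_prod_odd[of "[0..<Suc r]" "int r + 1 - j"] by (simp del: upt_Suc)
  finally show ?case
    using Suc.prems word_prod_up0[of "int r + 1 - j" r] word_prod_up0[of j r] by auto
qed simp

definition G :: "nat \<Rightarrow> nat \<Rightarrow> 'a :: comm_ring_1 lop" where
  "G n r = Uw n (sgn_word r)"

lemma G_0 [simp]: "G n 0 = 1" by (simp add: G_def)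

lemma G_Suc: "G n (Suc r) = Uw n [0..<Suc r] * G n r"
  by (simp add: G_def Uw_append del: upt_Suc)

lemma U_G_reflect:
  assumes "1 \<le> i" "i < r" "r \<le> n"
  shows "U n i * G n r = G n r * U n (r - i)"
proof -
  have "word_prod ([i] @ sgn_word r) = word_prod (sgn_word r @ [r - i])"
  proof (rule word_prod_eqI)
    fix j :: int assume j: "j > 0"
    have s: "s_gen (r - i) j > 0" using j assms by (auto simp: s_gen_apply)
    have "word_prod (sgn_word r @ [r - i]) j = word_prod (sgn_word r) (s_gen (r - i) j)" by simp
    moreover have "word_prod ([i] @ sgn_word r) j = (if j \<le> int r then - s_gen i (int r + 1 - j) else s_gen i j)"
      using word_prod_sgn_word[OF j, of r] s_gen_odd[of i "int r + 1 - j"] by simp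
    ultimately show "word_prod ([i] @ sgn_word r) j = word_prod (sgn_word r @ [r - i]) j"
      using assms j word_prod_sgn_word[OF s, of r]
      by (auto simp: s_gen_apply of_nat_diff)
  qed
  then have "Uw n ([i] @ sgn_word r) = Uw n (sgn_word r @ [r - i])"
    by (intro Uw_cong) (use sgn_word_letters[of r] assms in auto)
  then show ?thesis by (simp only: Uw_append Uw_single G_def)
qed

lemma U_G_commute:
  assumes "r < i"
  shows "(U n i * G n r :: 'a :: comm_ring_1 lop) = G n r * U n i"
proof -
  have "(U n i * Uw n a :: 'a lop) = Uw n a * U n i" if "\<forall>j\<in>set a. j + 2 \<le> i" for a
    using that
  proof (induction a)
    case (Cons j a)
    have "(U n i * U n j :: 'a lop) = U n j * U n i" by (rule U_commute) (use Cons in auto)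
    then have "(U n i * Uw n (j # a) :: 'a lop) = U n j * (U n i * Uw n a)"
      by (simp only: Uw_Cons mult.assoc[symmetric])
    then show ?case using Cons by (simp add: Uw_Cons mult.assoc)
  qed simp
  then show ?thesis using sgn_word_letters[of r] assms unfolding G_def by force
qed

lemma H_G_reflect: "1 \<le> i \<Longrightarrow> i < r \<Longrightarrow> r \<le> n \<Longrightarrow> H n i x * G n r = G n r * H n (r - i) x"
  by (simp add: H_def distrib_left distrib_right mult.assoc U_G_reflect lsc_commute
      lsc_left_commute[of "G n r"])

lemma H_G_commute: "r < i \<Longrightarrow> H n i x * G n r = G n r * H n i x"
  by (simp add: H_def distrib_left distrib_right mult.assoc U_G_commute lsc_commute
      lsc_left_commute[of "G n r"])

lemma U0_G: "1 \<le> r \<Longrightarrow> U n 0 * G n r = 0"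
  by (cases r) (simp_all add: G_Suc upt_conv_Cons Uw_Cons mult.assoc del: upt_Suc)

lemma prefix_G:
  assumes "1 \<le> j" "j \<le> r" "r \<le> n"
  shows "(Uw n [0..<j] * G n r :: 'a :: comm_ring_1 lop) = 0"
proof -
  have ex: "\<exists>Y. (Uw n a * G n r :: 'a lop) = G n r * Y" if "set a \<subseteq> {1..<r}" for a
    using that
  proof (induction a)
    case Nil
    then show ?case by (intro exI[of _ 1]) simp
  next
    case (Cons i a)
    then obtain Y where "(Uw n a * G n r :: 'a lop) = G n r * Y" by auto
    then have "(Uw n (i # a) * G n r :: 'a lop) = (U n i * G n r) * Y" by (simp add: Uw_Cons mult.assoc)
    also have "(U n i * G n r :: 'a lop) = G n r * U n (r - i)"
      by (rule U_G_reflect) (use Cons assms in auto)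
    finally show ?case by (auto simp: mult.assoc)
  qed
  obtain Y where Y: "(Uw n [1..<j] * G n r :: 'a lop) = G n r * Y"
    using ex[of "[1..<j]"] assms by auto
  have "[0..<j] = 0 # [1..<j]" using assms by (simp add: upt_conv_Cons)
  then have "(Uw n [0..<j] * G n r :: 'a lop) = U n 0 * (Uw n [1..<j] * G n r)" by (simp add: Uw_Cons mult.assoc)
  also have "\<dots> = (U n 0 * G n r) * Y" by (simp only: Y mult.assoc)
  finally show ?thesis using U0_G[of r n, where 'a = 'a] assms by simp
qed

definition Hs :: "nat \<Rightarrow> nat list \<Rightarrow> 'a :: comm_ring_1 \<Rightarrow> 'a lop" where
  "Hs n a x = prod_list (map (\<lambda>i. H n i x) a)"

lemma Hs_append: "Hs n (a @ b) x = Hs n a x * Hs n b x" by (simp add: Hs_def)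
lemma Hs_Nil [simp]: "Hs n [] x = 1" by (simp add: Hs_def)
lemma Hs_Cons: "Hs n (i # a) x = H n i x * Hs n a x" by (simp add: Hs_def)

lemma Up_split: "1 \<le> r \<Longrightarrow> r \<le> n \<Longrightarrow> Up n 1 x = Hs n [1..<r] x * Up n r x"
  unfolding Hs_def Up_def by (metis map_append prod_list.append upt_add_eq_append le_Suc_ex)

lemma Dn_split: "1 \<le> r \<Longrightarrow> r \<le> n \<Longrightarrow> Dn n 1 x = Dn n r x * Hs n (rev [1..<r]) x"
  unfolding Hs_def Dn_def by (metis map_append prod_list.append rev_append upt_add_eq_append le_Suc_ex)

lemma Hs_rev_cancel: "Hs n a x * Hs n (rev a) (- x) = 1"
proof (induction a)
  case (Cons i a)
  have "Hs n (i # a) x * Hs n (rev (i # a)) (- x) = H n i x * (Hs n a x * Hs n (rev a) (- x)) * H n i (- x)"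
    by (simp add: Hs_Cons Hs_append mult.assoc)
  then show ?case using Cons by simp
qed simp

text \<open>
  Between \<open>u\<^sub>0\<close> and \<open>G n r\<close> only the full product \<open>u\<^sub>1 \<dots> u\<^sub>r\<close> survives: if the factor \<open>u\<^sub>j\<close> is
  missing, the later factors commute with \<open>u\<^sub>0 \<dots> u\<^bsub>j - 1\<^esub>\<close>, which kills \<open>G n r\<close>.
\<close>

lemma U0_Hs_G:
  assumes "1 \<le> j" "j \<le> Suc r" "r < n"
  shows "Uw n [0..<j] * Hs n [j..<Suc r] x * G n r = lsc (x ^ (Suc r - j)) * G n (Suc r)"
  using assms(2,1)
proof (induction rule: inc_induct)
  case base
  then show ?case by (simp add: G_Suc del: upt_Suc)
next
  case (step j)
  have split: "Hs n [j..<Suc r] x = H n j x * Hs n [Suc j..<Suc r] x"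
    using step by (simp add: upt_conv_Cons Hs_Cons del: upt_Suc)
  have comm: "Uw n [0..<j] * Hs n a x = Hs n a x * Uw n [0..<j]" if "set a \<subseteq> {Suc j..}" for a
    using that
  proof (induction a)
    case (Cons i a)
    have "Uw n b * H n i x = H n i x * Uw n b" if "set b \<subseteq> {..<j}" for b
      using that
    proof (induction b)
      case (Cons k b)
      have k: "H n i x * U n k = U n k * H n i x"
        by (rule H_commute_U) (use Cons \<open>set (i # a) \<subseteq> {Suc j..}\<close> in auto)
      have "Uw n (k # b) * H n i x = U n k * (H n i x * Uw n b)" using Cons by (simp add: Uw_Cons mult.assoc)
      also have "\<dots> = H n i x * Uw n (k # b)" by (simp only: mult.assoc[symmetric] k Uw_Cons)
      finally show ?case .
    qed simp
    then have "Uw n [0..<j] * H n i x = H n i x * Uw n [0..<j]" by force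
    then have "Uw n [0..<j] * Hs n (i # a) x = H n i x * (Uw n [0..<j] * Hs n a x)"
      by (simp only: Hs_Cons mult.assoc[symmetric])
    then show ?case using Cons by (simp add: Hs_Cons mult.assoc)
  qed simp
  have "Uw n [0..<j] * Hs n [j..<Suc r] x * G n r =
      Uw n [0..<j] * Hs n [Suc j..<Suc r] x * G n r +
      lsc x * (Uw n [0..<j] * U n j * Hs n [Suc j..<Suc r] x * G n r)"
    by (simp add: split H_def distrib_left distrib_right mult.assoc lsc_left_commute[of "Uw n [0..<j]"] del: upt_Suc)
  also have "Uw n [0..<j] * Hs n [Suc j..<Suc r] x * G n r = Hs n [Suc j..<Suc r] x * (Uw n [0..<j] * G n r)"
    by (subst comm) (auto simp: mult.assoc)
  also have "Uw n [0..<j] * G n r = 0" by (rule prefix_G) (use step assms in auto)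
  also have "Uw n [0..<j] * U n j = Uw n [0..<Suc j]" by (simp add: Uw_append Uw_single)
  finally show ?case using step by (simp add: lsc_lsc Suc_diff_le)
qed

lemma Hs_rev_G:
  assumes "r < n" "j \<le> r"
  shows "Hs n (rev [1..<Suc j]) x * G n (Suc r) = G n (Suc r) * Hs n [Suc r - j..<Suc r] x"
  using assms(2)
proof (induction j)
  case (Suc j)
  have "Hs n (rev [1..<Suc (Suc j)]) x * G n (Suc r) = H n (Suc j) x * (Hs n (rev [1..<Suc j]) x * G n (Suc r))"
    by (simp add: Hs_Cons mult.assoc)
  also have "\<dots> = (H n (Suc j) x * G n (Suc r)) * Hs n [Suc r - j..<Suc r] x"
    using Suc by (simp add: mult.assoc del: upt_Suc)
  also have "H n (Suc j) x * G n (Suc r) = G n (Suc r) * H n (Suc r - Suc j) x"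
    by (rule H_G_reflect) (use Suc assms in auto)
  also have "G n (Suc r) * H n (Suc r - Suc j) x * Hs n [Suc r - j..<Suc r] x
      = G n (Suc r) * Hs n [Suc r - Suc j..<Suc r] x"
  proof -
    have "[Suc r - Suc j..<Suc r] = (Suc r - Suc j) # [Suc r - j..<Suc r]"
      using Suc.prems by (subst upt_conv_Cons) (auto simp: Suc_diff_le simp del: upt_Suc)
    then show ?thesis by (simp only: Hs_Cons mult.assoc)
  qed
  finally show ?case .
qed simp

text \<open>
  The part of \<open>C(x)\<close> that involves \<open>u\<^sub>0\<close> has, after multiplication by \<open>Dn n 1 (- x)\<close>, only the degree
  \<open>n - r - 1\<close> in \<open>x\<close> beyond an explicit monomial.
\<close>

lemma Cc_G:
  assumes "r < n"
  shows "Cc n x * G n r * Dn n 1 (- x) =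
    Dn n 1 x * Hs n [1..<Suc r] x * G n r * Hs n (rev [1..<Suc r]) (- x) +
    lsc (2 * x ^ Suc r) * (Dn n (Suc r) x * G n (Suc r))"
proof -
  let ?L = "Hs n [1..<Suc r] x" and ?L' = "Hs n (rev [1..<Suc r]) (- x)"
  have comm: "Up n (Suc r) x * G n r = G n r * Up n (Suc r) x"
  proof -
    have "Hs n a x * G n r = G n r * Hs n a x" if "set a \<subseteq> {Suc r..}" for a
      using that
    proof (induction a)
      case (Cons i a)
      have "Hs n (i # a) x * G n r = (H n i x * G n r) * Hs n a x" using Cons by (simp add: Hs_Cons mult.assoc)
      also have "H n i x * G n r = G n r * H n i x" by (rule H_G_commute) (use Cons in auto)
      finally show ?case by (simp add: Hs_Cons mult.assoc)
    qed simp
    then show ?thesis unfolding Up_def Hs_def by force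
  qed
  have "Cc n x * G n r * Dn n 1 (- x) = Dn n 1 x * H n 0 (2 * x) * ?L *
      (Up n (Suc r) x * G n r) * Dn n (Suc r) (- x) * ?L'"
    using assms by (simp only: Cc_def Up_split[of "Suc r" n] Dn_split[of "Suc r" n "- x"] mult.assoc Suc_le_eq)
  also have "\<dots> = Dn n 1 x * H n 0 (2 * x) * ?L * G n r * (Up n (Suc r) x * Dn n (Suc r) (- x)) * ?L'"
    by (simp only: comm mult.assoc)
  also have "\<dots> = Dn n 1 x * H n 0 (2 * x) * ?L * G n r * ?L'" by simp
  also have "\<dots> = Dn n 1 x * ?L * G n r * ?L' + lsc (2 * x) * (Dn n 1 x * (U n 0 * ?L * G n r) * ?L')"
    by (simp add: H_def distrib_left distrib_right mult.assoc lsc_left_commute[of "Dn n (Suc 0) x"] del: upt_Suc)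
  also have "U n 0 * ?L * G n r = lsc (x ^ r) * G n (Suc r)"
  proof -
    have "[0..<1] = [0]" by simp
    then show ?thesis using U0_Hs_G[of 1 r n x] assms by (simp only: Uw_single) simp
  qed
  also have "Dn n 1 x * (lsc (x ^ r) * G n (Suc r)) * ?L'
      = lsc (x ^ r) * (Dn n (Suc r) x * (Hs n (rev [1..<Suc r]) x * G n (Suc r)) * ?L')"
  proof -
    have "Dn n 1 x = Dn n (Suc r) x * Hs n (rev [1..<Suc r]) x"
      by (rule Dn_split) (use assms in auto)
    then show ?thesis
      by (simp only: mult.assoc lsc_left_commute[of "Dn n (Suc r) x"]
          lsc_left_commute[of "Hs n (rev [1..<Suc r]) x"])
  qed
  also have "Hs n (rev [1..<Suc r]) x * G n (Suc r) = G n (Suc r) * ?L"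
    using Hs_rev_G[OF assms order_refl, of x] by simp
  also have "Dn n (Suc r) x * (G n (Suc r) * ?L) * ?L' = Dn n (Suc r) x * G n (Suc r)"
    by (simp only: mult.assoc Hs_rev_cancel mult_1_right)
  finally show ?thesis by (simp add: lsc_lsc mult.assoc)
qed

subsection \<open>Counting sign changes\<close>

definition few_zeros :: "nat \<Rightarrow> nat \<Rightarrow> 'a :: comm_ring_1 lop set" where
  "few_zeros n r = wspan n (\<lambda>a. count_list a 0 \<le> r)"

lemma few_zeros_mult:
  "x \<in> few_zeros n r \<Longrightarrow> y \<in> few_zeros n s \<Longrightarrow> r + s \<le> t \<Longrightarrow> x * y \<in> few_zeros n t"
  unfolding few_zeros_def by (erule (1) wspan_mult) (auto simp: count_list_append)

lemma few_zeros_1: "1 \<in> few_zeros n r"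
  unfolding few_zeros_def by (rule wspan_one) simp

lemma H_few_zeros: "1 \<le> i \<Longrightarrow> H n i x \<in> few_zeros n 0"
  unfolding few_zeros_def by (rule H_wspan) auto

lemma Hs_few_zeros: "0 \<notin> set a \<Longrightarrow> Hs n a x \<in> few_zeros n 0"
proof (induction a)
  case (Cons i a)
  then show ?case
    unfolding Hs_Cons by (intro few_zeros_mult[of _ n 0 _ 0]) (auto intro: H_few_zeros)
qed (simp add: few_zeros_1)

lemma Dn_few_zeros: "1 \<le> k \<Longrightarrow> Dn n k x \<in> few_zeros n 0"
  using Hs_few_zeros[of "rev [k..<n]" n x] by (simp add: Hs_def Dn_def)

lemma Up_few_zeros: "1 \<le> k \<Longrightarrow> Up n k x \<in> few_zeros n 0"
  using Hs_few_zeros[of "[k..<n]" n x] by (simp add: Hs_def Up_def)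

lemma H0_few_zeros: "H n 0 x \<in> few_zeros n 1"
  unfolding few_zeros_def by (rule H_wspan) auto

lemma Cc_few_zeros: "Cc n x \<in> few_zeros n 1"
  unfolding Cc_def
  by (rule few_zeros_mult[of _ n 1 _ 0], rule few_zeros_mult[of _ n 0 _ 1])
    (auto intro: Dn_few_zeros Up_few_zeros H0_few_zeros simp del: One_nat_def)

lemma prodl_Cc_few_zeros: "prodl (Cc n) xs \<in> few_zeros n (length xs)"
  by (induction xs) (auto simp: few_zeros_1 intro: few_zeros_mult[OF Cc_few_zeros])

lemma prodl_few_zeros_0:
  "(\<And>x. x \<in> set xs \<Longrightarrow> f x \<in> few_zeros n 0) \<Longrightarrow> prodl f xs \<in> few_zeros n 0"
  by (induction xs) (auto simp: few_zeros_1 intro: few_zeros_mult)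

lemma count_sgn_word: "count_list (sgn_word r) 0 = r"
proof (induction r)
  case (Suc r)
  have "count_list [0..<Suc r] 0 = 1"
    by (subst upt_conv_Cons) (auto simp: count_list_0_iff simp del: upt_Suc)
  then show ?case using Suc by (simp add: count_list_append del: upt_Suc)
qed simp

lemma G_few_zeros: "r \<le> n \<Longrightarrow> G n r \<in> few_zeros n r"
  unfolding few_zeros_def G_def
  by (rule wspan_word) (use sgn_word_letters[of r] in \<open>auto simp: count_sgn_word\<close>)

lemma few_zeros_words: "x \<in> few_zeros n r \<Longrightarrow> x \<in> wspan n (\<lambda>_. True)"
  unfolding few_zeros_def by (erule wspan_mono) simp

lemma card_negative_le:
  "card {j \<in> {1..int n}. word_prod a j < 0} \<le> count_list a 0"
proof (induction a)
  case Nil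
  have "{j \<in> {1..int n}. word_prod [] j < 0} = {}" by auto
  then show ?case by (simp only: card.empty)
next
  case (Cons i a)
  let ?N = "\<lambda>a. {j \<in> {1..int n}. word_prod a j < 0}"
  have fin: "finite (?N a)" by (rule finite_subset[of _ "{1..int n}"]) auto
  show ?case
  proof (cases "i = 0")
    case True
    have sub: "{j. word_prod a j = 1} \<subseteq> {inv_into UNIV (word_prod a) 1}"
      using inj_word_prod[of a] by auto (metis inv_f_f)
    have "card {j. word_prod a j = 1} \<le> 1" using card_mono[OF _ sub] by simp
    moreover have "finite {j. word_prod a j = 1}" using finite_subset[OF sub] by simp
    moreover have "?N (i # a) \<subseteq> ?N a \<union> {j. word_prod a j = 1}"
      using True by (auto simp: s_gen_def transpose_def split: if_splits)
    ultimately have "card (?N (i # a)) \<le> card (?N a) + 1"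
      using card_mono[of "?N a \<union> {j. word_prod a j = 1}" "?N (i # a)"]
        card_Un_le[of "?N a" "{j. word_prod a j = 1}"] fin by (meson finite_UnI le_trans add_left_mono)
    then show ?thesis using Cons True by simp
  next
    case False
    have "?N (i # a) \<subseteq> ?N a"
      using False by (auto simp: s_gen_def transpose_def split: if_splits)
    then have "card (?N (i # a)) \<le> card (?N a)" by (rule card_mono[OF fin])
    then show ?thesis using Cons False by simp
  qed
qed

lemma few_zeros_coeff: "x \<in> few_zeros n r \<Longrightarrow> r < n \<Longrightarrow> coeff_at (negate n) x = 0"
  unfolding few_zeros_def
proof (erule coeff_at_wspan_eq_0)
  fix a :: "nat list" assume r: "r < n" and a: "count_list a 0 \<le> r"
  show "word_prod a \<noteq> negate n"
  proof
    assume "word_prod a = negate n"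
    then have "{j \<in> {1..int n}. word_prod a j < 0} = {1..int n}" by (auto simp: negate_def)
    then show False using card_negative_le[of n a] a r by simp
  qed
qed

subsection \<open>Dependence on one variable\<close>

lemma Dn_0 [simp]: "Dn n k 0 = 1"
proof -
  have "prod_list (map (\<lambda>i. H n i 0) a) = 1" for a by (induction a) auto
  then show ?thesis unfolding Dn_def .
qed

lemma Dn_poly:
  fixes a b :: "'k :: field lop"
  shows "\<exists>p. Polynomial.degree p \<le> n - k \<and> (\<forall>x. poly p x = coeff_at w (a * Dn n k x * b))"
proof (induction "n - k" arbitrary: k b)
  case 0
  then show ?case by (intro exI[of _ "[:coeff_at w (a * b):]"]) simp
next
  case (Suc d)
  have d: "d = n - Suc k" using Suc(2) by simp
  obtain p where p: "Polynomial.degree p \<le> d" "\<And>x. poly p x = coeff_at w (a * Dn n (Suc k) x * b)"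
    using Suc(1)[OF d, of b] d by auto
  obtain q where q: "Polynomial.degree q \<le> d" "\<And>x. poly q x = coeff_at w (a * Dn n (Suc k) x * (U n k * b))"
    using Suc(1)[OF d, of "U n k * b"] d by auto
  have "poly (p + pCons 0 q) x = coeff_at w (a * Dn n k x * b)" for x
  proof -
    have "a * Dn n k x * b = a * Dn n (Suc k) x * b + lsc x * (a * Dn n (Suc k) x * (U n k * b))"
      by (simp only: Dn_Suc[of n k] H_def mult.assoc distrib_left distrib_right mult_1_left
          lsc_left_commute[of "Dn n (Suc k) x"] lsc_left_commute[of a])
    then show ?thesis by (simp add: p q coeff_at_add coeff_at_scale)
  qed
  moreover have "Polynomial.degree (p + pCons 0 q) \<le> n - k"
    using p(1) q(1) Suc(2) d by (intro degree_add_le) (auto intro: order_trans[OF degree_pCons_le])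
  ultimately show ?case by blast
qed

lemma Dn_H0_poly:
  fixes a b :: "'k :: field lop"
  assumes "1 \<le> n"
  shows "\<exists>p. Polynomial.degree p \<le> n \<and> (\<forall>x. poly p x = coeff_at w (a * Dn n 1 x * H n 0 (2 * x) * b))"
proof -
  obtain p where p: "Polynomial.degree p \<le> n - 1" "\<And>x. poly p x = coeff_at w (a * Dn n 1 x * b)"
    using Dn_poly[of n 1 w a b] by auto
  obtain q where q: "Polynomial.degree q \<le> n - 1" "\<And>x. poly q x = coeff_at w (a * Dn n 1 x * (U n 0 * b))"
    using Dn_poly[of n 1 w a "U n 0 * b"] by auto
  have "poly (p + smult 2 (pCons 0 q)) x = coeff_at w (a * Dn n 1 x * H n 0 (2 * x) * b)" for x
  proof -
    have "a * Dn n 1 x * H n 0 (2 * x) * b = a * Dn n 1 x * b + lsc (2 * x) * (a * Dn n 1 x * (U n 0 * b))"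
      by (simp only: H_def mult.assoc distrib_left distrib_right mult_1_left
          lsc_left_commute[of "Dn n 1 x"] lsc_left_commute[of a])
    then show ?thesis by (simp only: coeff_at_add coeff_at_scale) (simp add: p q)
  qed
  moreover have "Polynomial.degree (p + smult 2 (pCons 0 q)) \<le> n"
    using p(1) q(1) assms
    by (intro degree_add_le order_trans[OF degree_smult_le] order_trans[OF degree_pCons_le]) auto
  ultimately show ?thesis by blast
qed

lemma prodl_Cc_rotate: "prodl (Cc n) (x # xs) = prodl (Cc n) xs * Cc n x"
  using prodl_commute1[of xs "Cc n" "Cc n x", OF Cc_commute] by simp

lemma prodl_Cc_remove:
  assumes "y \<in> set xs"
  shows "prodl (Cc n) xs * Cc n (- y) = prodl (Cc n) (remove1 y xs)"
proof -
  have "prodl (Cc n) xs = prodl (Cc n) (remove1 y xs) * Cc n y"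
    using prodl_remove1[of "Cc n" y xs, OF Cc_commute assms] prodl_Cc_rotate[of n y "remove1 y xs"] by simp
  then show ?thesis by (simp add: mult.assoc)
qed

definition top_coeff :: "nat \<Rightarrow> 'a :: comm_ring_1 lop \<Rightarrow> 'a" where
  "top_coeff n T = coeff_at (negate n) T"

definition psi :: "nat \<Rightarrow> 'a :: comm_ring_1 lop \<Rightarrow> 'a" where
  "psi n \<xi> = top_coeff n (G n n * \<xi>)"

fun pair_prod :: "'a :: comm_monoid_mult list \<Rightarrow> ('a \<Rightarrow> 'a \<Rightarrow> 'a) \<Rightarrow> 'a" where
  "pair_prod [] g = 1"
| "pair_prod (x # xs) g = prod_list (map (g x) xs) * pair_prod xs g"

lemma distinct_prod_list: "distinct xs \<Longrightarrow> prod_list (map f xs) = (\<Prod>x\<in>set xs. f x)"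
  by (induction xs) auto

text \<open>
  As many variables as sign changes: every \<open>C(x)\<close> must contribute \<open>u\<^sub>0\<close>, hence the coefficient
  vanishes if two variables cancel.  The degree found in \<open>Cc_G\<close> leaves no room for further factors.
\<close>

lemma top_coeff_few_variables:
  fixes \<xi> :: "'k :: field_char_0 lop"
  assumes "length xs = n - r" "r \<le> n" "distinct xs" "0 \<notin> set xs" "\<xi> \<in> few_zeros n 0"
  shows "top_coeff n (prodl (Cc n) xs * G n r * \<xi>) =
    2 ^ (n - r) * prod_list xs ^ Suc r * pair_prod xs (+) * psi n (prodl (Up n 1) xs * \<xi>)"
  using assms
proof (induction xs arbitrary: r \<xi>)
  case Nil
  then show ?case by (simp add: psi_def)
next
  case (Cons x xs)
  then have r: "r < n" and len: "length xs = n - Suc r" and dist: "distinct xs" and x0: "x \<noteq> 0"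
    and nz: "0 \<notin> set xs" by auto
  define \<zeta> where "\<zeta> = Up n 1 x * \<xi>"
  have \<zeta>: "\<zeta> \<in> few_zeros n 0"
    unfolding \<zeta>_def using Cons.prems by (intro few_zeros_mult[OF Up_few_zeros]) auto
  define g where "g t = top_coeff n (prodl (Cc n) xs * Dn n (Suc r) t * G n (Suc r) * \<zeta>)" for t
  have expand: "top_coeff n (prodl (Cc n) xs * Cc n t * G n r * Dn n 1 (- t) * \<zeta>) = 2 * t ^ Suc r * g t" for t
  proof -
    let ?Z = "Dn n 1 t * Hs n [1..<Suc r] t * G n r * Hs n (rev [1..<Suc r]) (- t)"
    have "?Z \<in> few_zeros n r"
      by (rule few_zeros_mult[of _ n r _ 0], rule few_zeros_mult[of _ n 0 _ r], rule few_zeros_mult[of _ n 0 _ 0])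
        (use r in \<open>auto intro: Dn_few_zeros Hs_few_zeros G_few_zeros simp del: upt_Suc One_nat_def\<close>)
    then have "prodl (Cc n) xs * ?Z \<in> few_zeros n (n - 1)"
      by (rule few_zeros_mult[OF prodl_Cc_few_zeros]) (use len r in linarith)
    then have "prodl (Cc n) xs * ?Z * \<zeta> \<in> few_zeros n (n - 1)"
      by (rule few_zeros_mult[OF _ \<zeta>]) simp
    then have zero: "top_coeff n (prodl (Cc n) xs * ?Z * \<zeta>) = 0"
      unfolding top_coeff_def by (rule few_zeros_coeff) (use r in linarith)
    have "prodl (Cc n) xs * Cc n t * G n r * Dn n 1 (- t) * \<zeta>
        = prodl (Cc n) xs * (Cc n t * G n r * Dn n 1 (- t)) * \<zeta>" by (simp only: mult.assoc)
    also have "\<dots> = prodl (Cc n) xs * ?Z * \<zeta> +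
        lsc (2 * t ^ Suc r) * (prodl (Cc n) xs * Dn n (Suc r) t * G n (Suc r) * \<zeta>)"
      unfolding Cc_G[OF r] distrib_left distrib_right
      by (simp only: mult.assoc lsc_left_commute[of "prodl (Cc n) xs"])
    finally show ?thesis
      using zero unfolding top_coeff_def g_def by (simp only: coeff_at_add coeff_at_scale) simp
  qed
  obtain p where p: "Polynomial.degree p \<le> n - Suc r" "\<And>t. poly p t = g t"
    using Dn_poly[of n "Suc r" "negate n" "prodl (Cc n) xs" "G n (Suc r) * \<zeta>"]
    by (auto simp: g_def top_coeff_def mult.assoc)
  have g0: "g 0 = 2 ^ (n - Suc r) * prod_list xs ^ Suc (Suc r) * pair_prod xs (+) * psi n (prodl (Up n 1) xs * \<zeta>)"
  proof -
    have "g 0 = top_coeff n (prodl (Cc n) xs * G n (Suc r) * \<zeta>)" by (simp add: g_def)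
    also have "\<dots> = 2 ^ (n - Suc r) * prod_list xs ^ Suc (Suc r) * pair_prod xs (+) * psi n (prodl (Up n 1) xs * \<zeta>)"
      by (rule Cons.IH) (use len dist nz \<zeta> r in auto)
    finally show ?thesis .
  qed
  have roots: "g (- y) = 0" if y: "y \<in> set xs" for y
  proof -
    have "prodl (Cc n) xs * Cc n (- y) = prodl (Cc n) (remove1 y xs)" by (rule prodl_Cc_remove[OF y])
    moreover have "prodl (Cc n) (remove1 y xs) * G n r \<in> few_zeros n (n - 1)"
      by (rule few_zeros_mult[OF prodl_Cc_few_zeros G_few_zeros]) (use len r y in \<open>auto simp: length_remove1\<close>)
    then have "prodl (Cc n) (remove1 y xs) * G n r * Dn n 1 y * \<zeta> \<in> few_zeros n (n - 1)"
      by (intro few_zeros_mult[OF few_zeros_mult[OF _ Dn_few_zeros] \<zeta>]) auto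
    ultimately have "top_coeff n (prodl (Cc n) xs * Cc n (- y) * G n r * Dn n 1 (- (- y)) * \<zeta>) = 0"
      unfolding top_coeff_def using r by (simp add: few_zeros_coeff)
    then have "2 * (- y) ^ Suc r * g (- y) = 0" by (simp only: expand)
    moreover have "y \<noteq> 0" using nz y by auto
    ultimately show ?thesis by simp
  qed
  have "g x * (\<Prod>y\<in>set xs. y) = g 0 * (\<Prod>y\<in>set xs. x + y)"
    using poly_with_roots[of "set xs" p x] p roots nz len dist by (simp add: distinct_card)
  then have gx: "g x * prod_list xs = g 0 * prod_list (map ((+) x) xs)"
    using distinct_prod_list[OF dist, of "\<lambda>y. y"] distinct_prod_list[OF dist, of "(+) x"] by simp
  have nzp: "prod_list xs \<noteq> 0" using nz by (simp add: prod_list_zero_iff)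
  have "Dn n 1 (- x) * \<zeta> = \<xi>" by (simp add: \<zeta>_def mult.assoc[symmetric])
  then have "top_coeff n (prodl (Cc n) (x # xs) * G n r * \<xi>) = 2 * x ^ Suc r * g x"
    using expand[of x] by (simp only: prodl_Cc_rotate mult.assoc)
  also have "g x = 2 ^ (n - Suc r) * prod_list xs ^ Suc r * pair_prod xs (+) * psi n (prodl (Up n 1) xs * \<zeta>) *
      prod_list (map ((+) x) xs)"
    using gx nzp unfolding g0 by (simp add: field_simps)
  also have "prodl (Up n 1) xs * \<zeta> = prodl (Up n 1) (x # xs) * \<xi>"
  proof -
    have "prodl (Up n 1) xs * Up n 1 x = Up n 1 x * prodl (Up n 1) xs"
      by (rule prodl_commute1) (rule Up_commute, simp)
    then show ?thesis by (simp add: \<zeta>_def mult.assoc[symmetric])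
  qed
  finally show ?case
    using r by (simp add: power_mult_distrib Suc_diff_Suc[symmetric] mult.assoc mult.left_commute)
qed

subsection \<open>The residue recursion\<close>

text \<open>
  \<open>res n k X \<xi>\<close> takes the shape of the iterated residue formula for Schur \<open>Q\<close>-functions.  It is
  shown to satisfy the same interpolation properties as the coefficient of the longest element.
\<close>

fun res :: "nat \<Rightarrow> nat \<Rightarrow> 'k :: field set \<Rightarrow> 'k lop \<Rightarrow> 'k" where
  "res n 0 X \<xi> = psi n \<xi>"
| "res n (Suc k) X \<xi> = (\<Sum>x\<in>X. 2 * x ^ Suc k * (\<Prod>y\<in>X - {x}. (x + y) / (x - y)) *
      res n k (X - {x}) (Up n 1 x * \<xi>))"

lemma res_few: "finite X \<Longrightarrow> card X < k \<Longrightarrow> res n k X \<xi> = 0"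
proof (induction k arbitrary: X \<xi>)
  case (Suc k)
  have "res n k (X - {x}) (Up n 1 x * \<xi>) = 0" if "x \<in> X" for x
    using that Suc.prems card_Diff1_less[of X x] by (intro Suc.IH) auto
  then show ?case by simp
qed simp

lemma res_insert_0: "finite X \<Longrightarrow> 0 \<notin> X \<Longrightarrow> res n k (insert 0 X) \<xi> = res n k X \<xi>"
proof (induction k arbitrary: X \<xi>)
  case (Suc k)
  have "res n (Suc k) (insert 0 X) \<xi> = (\<Sum>x\<in>X. 2 * x ^ Suc k * (\<Prod>y\<in>insert 0 X - {x}. (x + y) / (x - y)) *
      res n k (insert 0 X - {x}) (Up n 1 x * \<xi>))"
    using Suc.prems by simp
  also have "\<dots> = res n (Suc k) X \<xi>"
    unfolding res.simps
  proof (rule sum.cong)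
    fix x assume x: "x \<in> X"
    then have eq: "insert 0 X - {x} = insert 0 (X - {x})" using Suc.prems by auto
    have "(\<Prod>y\<in>insert 0 (X - {x}). (x + y) / (x - y)) = (\<Prod>y\<in>X - {x}. (x + y) / (x - y))"
      using Suc.prems x by (subst prod.insert) auto
    moreover have "res n k (insert 0 (X - {x})) (Up n 1 x * \<xi>) = res n k (X - {x}) (Up n 1 x * \<xi>)"
      using Suc.prems by (intro Suc.IH) auto
    ultimately show "2 * x ^ Suc k * (\<Prod>y\<in>insert 0 X - {x}. (x + y) / (x - y)) *
        res n k (insert 0 X - {x}) (Up n 1 x * \<xi>) =
      2 * x ^ Suc k * (\<Prod>y\<in>X - {x}. (x + y) / (x - y)) * res n k (X - {x}) (Up n 1 x * \<xi>)"
      unfolding eq by simp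
  qed simp
  finally show ?case .
qed simp

lemma res_cancel: "finite X \<Longrightarrow> a \<in> X \<Longrightarrow> - a \<notin> X \<Longrightarrow> res n k (insert (- a) X) \<xi> = res n k (X - {a}) \<xi>"
proof (induction k arbitrary: X \<xi>)
  case (Suc k)
  let ?t = "\<lambda>X x. 2 * x ^ Suc k * (\<Prod>y\<in>X - {x}. (x + y) / (x - y)) * res n k (X - {x}) (Up n 1 x * \<xi>)"
  have z: "(\<Prod>y\<in>insert (- a) X - {x}. (x + y) / (x - y)) = 0" if "x = a \<or> x = - a" for x
  proof -
    have "a \<noteq> - a" using Suc.prems by metis
    then have "- x \<in> insert (- a) X - {x}" using that Suc.prems by auto
    then have "\<exists>y\<in>insert (- a) X - {x}. (x + y) / (x - y) = 0" by (rule bexI[rotated]) simp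
    then show ?thesis using Suc.prems by (intro prod_zero) auto
  qed
  have "(\<Sum>x\<in>insert (- a) X. ?t (insert (- a) X) x) = (\<Sum>x\<in>X - {a}. ?t (insert (- a) X) x)"
  proof (rule sum.mono_neutral_right)
    show "\<forall>x\<in>insert (- a) X - (X - {a}). ?t (insert (- a) X) x = 0"
    proof
      fix x assume "x \<in> insert (- a) X - (X - {a})"
      then show "?t (insert (- a) X) x = 0" using z[of x] by auto
    qed
  qed (use Suc.prems in auto)
  also have "\<dots> = (\<Sum>x\<in>X - {a}. ?t (X - {a}) x)"
  proof (rule sum.cong)
    fix x assume x: "x \<in> X - {a}"
    then have xm: "x \<noteq> - a" "x \<noteq> a" using Suc.prems by auto
    then have xa: "x + a \<noteq> 0" "x - a \<noteq> 0" by (auto simp: add_eq_0_iff2)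
    have eq: "insert (- a) X - {x} = insert (- a) (X - {x})" using xm by auto
    have "(\<Prod>y\<in>insert (- a) (X - {x}). (x + y) / (x - y))
        = (x - a) / (x + a) * ((x + a) / (x - a) * (\<Prod>y\<in>X - {x} - {a}. (x + y) / (x - y)))"
      using Suc.prems xm by (subst prod.insert, simp, simp, subst prod.remove[of "X - {x}" a]) auto
    also have "\<dots> = (\<Prod>y\<in>X - {a} - {x}. (x + y) / (x - y))"
      using xa by (simp add: Diff_right_commute[of X "{a}"])
    finally have 1: "(\<Prod>y\<in>insert (- a) (X - {x}). (x + y) / (x - y)) = (\<Prod>y\<in>X - {a} - {x}. (x + y) / (x - y))" .
    have "res n k (insert (- a) (X - {x})) (Up n 1 x * \<xi>) = res n k (X - {x} - {a}) (Up n 1 x * \<xi>)"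
      using Suc.prems x by (intro Suc.IH) auto
    then show "?t (insert (- a) X) x = ?t (X - {a}) x"
      unfolding eq 1 by (simp only: Diff_right_commute[of X "{a}"])
  qed simp
  finally show ?case by simp
qed simp

lemma flip_fraction:
  fixes t x :: "'k :: field"
  assumes "Q \<noteq> 0" "t - x \<noteq> 0"
  shows "- (w * (t + x) * Q * p) / ((t - x) * Q) = (x + t) / (x - t) * w * p"
proof -
  have *: "x - t = - (t - x)" by simp
  show ?thesis unfolding * using assms by (simp add: field_simps)
qed

text \<open>
  Both terms of the recursion with a pole at \<open>x \<in> X\<close> have opposite residues there, so that the
  coefficients of \<open>res n k\<close> are polynomials in a new variable.
\<close>

lemma res_poly:
  fixes \<xi> :: "'k :: field_char_0 lop"
  assumes "finite X"
  shows "\<exists>p. Polynomial.degree p \<le> max (n - 1) k \<and>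
    (\<forall>t. t \<notin> X \<longrightarrow> poly p t = res n k (insert t X) (Dn n 1 (- t) * \<xi>))"
  using assms
proof (induction k arbitrary: X \<xi>)
  case 0
  obtain p where p: "Polynomial.degree p \<le> n - 1" "\<And>x. poly p x = coeff_at (negate n) (G n n * Dn n 1 x * \<xi>)"
    using Dn_poly[of n 1 "negate n" "G n n" \<xi>] by auto
  have "Polynomial.degree (pcompose p [:0, - 1:]) \<le> n - 1"
    using p(1) by (simp add: degree_pcompose)
  moreover have "poly (pcompose p [:0, - 1:]) t = psi n (Dn n 1 (- t) * \<xi>)" for t
    by (simp add: poly_pcompose p psi_def top_coeff_def mult.assoc)
  ultimately show ?case by (intro exI[of _ "pcompose p [:0, - 1:]"]) auto
next
  case (Suc k)
  let ?N = "card X" and ?w = "\<lambda>x. \<Prod>y\<in>X - {x}. (x + y) / (x - y)"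
  have "\<forall>x\<in>X. \<exists>p. Polynomial.degree p \<le> max (n - 1) k \<and>
    (\<forall>t. t \<notin> X - {x} \<longrightarrow> poly p t = res n k (insert t (X - {x})) (Dn n 1 (- t) * (Up n 1 x * \<xi>)))"
    using Suc by blast
  then obtain P where P: "\<And>x. x \<in> X \<Longrightarrow> Polynomial.degree (P x) \<le> max (n - 1) k"
    "\<And>x t. x \<in> X \<Longrightarrow> t \<notin> X - {x} \<Longrightarrow>
      poly (P x) t = res n k (insert t (X - {x})) (Dn n 1 (- t) * (Up n 1 x * \<xi>))"
    by metis
  define R where "R = res n k X \<xi>"
  define D where "D = (\<Prod>x\<in>X. [:- x, 1:])"
  define M where "M = smult (2 * R) (monom 1 (Suc k) * (\<Prod>x\<in>X. [:x, 1:])) -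
    (\<Sum>x\<in>X. smult (2 * x ^ Suc k * ?w x) ([:x, 1:] * (\<Prod>y\<in>X - {x}. [:- y, 1:]) * P x))"
  have polyM: "poly M t = 2 * R * t ^ Suc k * (\<Prod>x\<in>X. t + x) -
      (\<Sum>x\<in>X. 2 * x ^ Suc k * ?w x * (t + x) * (\<Prod>y\<in>X - {x}. t - y) * poly (P x) t)" for t
    by (simp add: M_def poly_monom poly_prod poly_sum algebra_simps)
  have "D dvd M"
    unfolding D_def
  proof (rule linear_factors_dvd[OF Suc.prems])
    fix a assume a: "a \<in> X"
    define F where "F x = 2 * x ^ Suc k * ?w x * (a + x) * (\<Prod>y\<in>X - {x}. a - y) * poly (P x) a" for x
    have "F x = 0" if "x \<in> X - {a}" for x
    proof -
      have "(\<Prod>y\<in>X - {x}. a - y) = 0" using that a Suc.prems by (intro prod_zero) auto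
      then show ?thesis by (simp add: F_def)
    qed
    then have "(\<Sum>x\<in>X. F x) = F a" using sum.remove[OF Suc.prems a, of F] by simp
    also have "F a = 2 * a ^ Suc k * ?w a * (a + a) * (\<Prod>y\<in>X - {a}. a - y) * poly (P a) a"
      by (simp add: F_def)
    also have "poly (P a) a = R"
    proof -
      have "Dn n 1 (- a) * (Up n 1 a * \<xi>) = \<xi>"
        by (simp only: mult.assoc[symmetric] Dn_Up_cancel' mult_1_left)
      then have "poly (P a) a = res n k (insert a (X - {a})) \<xi>"
        using P(2)[OF a, of a] by simp
      then show ?thesis using a by (simp add: R_def insert_absorb)
    qed
    also have "2 * a ^ Suc k * ?w a * (a + a) * (\<Prod>y\<in>X - {a}. a - y) * R
        = 2 * R * a ^ Suc k * ((a + a) * (?w a * (\<Prod>y\<in>X - {a}. a - y)))"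
      by (simp only: mult_ac)
    also have "?w a * (\<Prod>y\<in>X - {a}. a - y) = (\<Prod>y\<in>X - {a}. a + y)"
      unfolding prod.distrib[symmetric] by (rule prod.cong) auto
    also have "(a + a) * (\<Prod>y\<in>X - {a}. a + y) = (\<Prod>x\<in>X. a + x)"
      by (rule prod.remove[OF Suc.prems a, symmetric])
    finally show "poly M a = 0" unfolding polyM F_def by simp
  qed
  then obtain p where p: "M = D * p" by (elim dvdE)
  have D0: "D \<noteq> 0" using Suc.prems by (simp add: D_def)
  have degD: "Polynomial.degree D = ?N"
    unfolding D_def by (subst degree_prod_eq_sum_degree) auto
  have "Polynomial.degree M \<le> ?N + max (n - 1) (Suc k)"
  proof -
    have "Polynomial.degree (monom (1 :: 'k) (Suc k) * (\<Prod>x\<in>X. [:x, 1:])) \<le> Suc k + ?N"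
      using degree_mult_le[of "monom (1 :: 'k) (Suc k)" "\<Prod>x\<in>X. [:x, 1:]"]
        degree_prod_sum_le[OF Suc.prems, of "\<lambda>x. [:x, 1 :: 'k:]"] by (simp add: degree_monom_eq)
    moreover have "Polynomial.degree ([:x, 1:] * (\<Prod>y\<in>X - {x}. [:- y, 1:]) * P x) \<le> ?N + max (n - 1) k"
      if x: "x \<in> X" for x
    proof -
      have "Polynomial.degree (\<Prod>y\<in>X - {x}. [:- y, 1 :: 'k:]) \<le> card (X - {x})"
        using degree_prod_sum_le[of "X - {x}" "\<lambda>y. [:- y, 1 :: 'k:]"] Suc.prems by simp
      moreover have "card (X - {x}) = ?N - 1" "?N > 0" using x Suc.prems by (auto simp: card_gt_0_iff)
      ultimately show ?thesis
        using degree_mult_le[of "[:x, 1:] * (\<Prod>y\<in>X - {x}. [:- y, 1:])" "P x"]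
          degree_mult_le[of "[:x, 1:]" "\<Prod>y\<in>X - {x}. [:- y, 1:]"] P(1)[OF x] by simp
    qed
    ultimately show ?thesis
      unfolding M_def
      by (intro degree_diff_le degree_sum_le Suc.prems order_trans[OF degree_smult_le]) (fastforce)+
  qed
  then have "Polynomial.degree p \<le> max (n - 1) (Suc k)"
    using p D0 degD by (cases "p = 0") (auto simp: degree_mult_eq)
  moreover have "poly p t = res n (Suc k) (insert t X) (Dn n 1 (- t) * \<xi>)" if t: "t \<notin> X" for t
  proof -
    have Dt: "poly D t = (\<Prod>y\<in>X. t - y)" "poly D t \<noteq> 0"
      using t Suc.prems by (auto simp: D_def poly_prod)
    have first: "(\<Prod>y\<in>X. t + y) / (\<Prod>y\<in>X. t - y) = (\<Prod>y\<in>insert t X - {t}. (t + y) / (t - y))"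
      using t by (simp add: prod_dividef)
    have inv: "Up n 1 t * (Dn n 1 (- t) * \<xi>) = \<xi>" by (simp add: mult.assoc[symmetric])
    have other: "- (?w x * (t + x) * (\<Prod>y\<in>X - {x}. t - y) * poly (P x) t) / (\<Prod>y\<in>X. t - y)
        = (\<Prod>y\<in>insert t X - {x}. (x + y) / (x - y)) * res n k (insert t X - {x}) (Up n 1 x * (Dn n 1 (- t) * \<xi>))"
      if x: "x \<in> X" for x
    proof -
      have eq: "insert t X - {x} = insert t (X - {x})" using x t by auto
      have comm: "Up n 1 x * (Dn n 1 (- t) * \<xi>) = Dn n 1 (- t) * (Up n 1 x * \<xi>)"
        using Up_Dn_commute[of 1 n x "- t"] by (simp add: mult.assoc[symmetric])
      have tx: "t - x \<noteq> 0" "x - t \<noteq> 0" using x t by auto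
      have "(\<Prod>y\<in>X. t - y) = (t - x) * (\<Prod>y\<in>X - {x}. t - y)"
        by (rule prod.remove[OF Suc.prems x])
      moreover have "(\<Prod>y\<in>X - {x}. t - y) \<noteq> 0" using t Suc.prems by auto
      ultimately have A: "- (?w x * (t + x) * (\<Prod>y\<in>X - {x}. t - y) * poly (P x) t) / (\<Prod>y\<in>X. t - y)
          = (x + t) / (x - t) * ?w x * poly (P x) t"
        using flip_fraction[of "\<Prod>y\<in>X - {x}. t - y" t x] tx by simp
      have B: "(x + t) / (x - t) * ?w x = (\<Prod>y\<in>insert t (X - {x}). (x + y) / (x - y))"
        using Suc.prems t by (subst prod.insert) auto
      have C: "poly (P x) t = res n k (insert t (X - {x})) (Up n 1 x * (Dn n 1 (- t) * \<xi>))"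
        unfolding comm using t by (intro P(2) x) auto
      show ?thesis by (subst A) (simp only: B C eq)
    qed
    have "poly p t = poly M t / poly D t" using Dt by (simp add: p)
    also have "\<dots> = 2 * R * t ^ Suc k * ((\<Prod>y\<in>X. t + y) / (\<Prod>y\<in>X. t - y)) +
        (\<Sum>x\<in>X. 2 * x ^ Suc k * (- (?w x * (t + x) * (\<Prod>y\<in>X - {x}. t - y) * poly (P x) t) / (\<Prod>y\<in>X. t - y)))"
      unfolding polyM Dt(1) by (simp add: diff_divide_distrib sum_divide_distrib sum_negf[symmetric] mult.assoc)
    also have "(\<Sum>x\<in>X. 2 * x ^ Suc k * (- (?w x * (t + x) * (\<Prod>y\<in>X - {x}. t - y) * poly (P x) t) / (\<Prod>y\<in>X. t - y)))
      = (\<Sum>x\<in>X. 2 * x ^ Suc k * ((\<Prod>y\<in>insert t X - {x}. (x + y) / (x - y)) *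
          res n k (insert t X - {x}) (Up n 1 x * (Dn n 1 (- t) * \<xi>))))"
      by (rule sum.cong) (simp_all only: other)
    also have "2 * R * t ^ Suc k * ((\<Prod>y\<in>X. t + y) / (\<Prod>y\<in>X. t - y)) + \<dots>
      = res n (Suc k) (insert t X) (Dn n 1 (- t) * \<xi>)"
      unfolding first res.simps sum.insert[OF Suc.prems t] using t
      by (simp add: inv R_def mult_ac del: One_nat_def)
    finally show ?thesis .
  qed
  ultimately show ?case by blast
qed

lemma pair_prod_remove1:
  fixes xs :: "'a :: comm_ring_1 list"
  assumes "x \<in> set xs"
  shows "pair_prod xs (+) = prod_list (map ((+) x) (remove1 x xs)) * pair_prod (remove1 x xs) (+)"
  using assms
proof (induction xs)
  case (Cons y xs)
  show ?case
  proof (cases "y = x")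
    case False
    then have x: "x \<in> set xs" using Cons by simp
    have "prod_list (map ((+) y) xs) = (y + x) * prod_list (map ((+) y) (remove1 x xs))"
      using x by (induction xs) auto
    then show ?thesis using False Cons.IH[OF x] by (simp add: mult_ac add.commute)
  qed simp
qed simp

lemma res_full:
  fixes \<xi> :: "'k :: field_char_0 lop"
  assumes "distinct xs"
  shows "res n (length xs) (set xs) \<xi> =
    2 ^ length xs * prod_list xs * pair_prod xs (+) * psi n (prodl (Up n 1) xs * \<xi>)"
  using assms
proof (induction "length xs" arbitrary: xs \<xi>)
  case (Suc k)
  let ?X = "set xs"
  have summand: "2 * x ^ Suc k * (\<Prod>y\<in>?X - {x}. (x + y) / (x - y)) * res n k (?X - {x}) (Up n 1 x * \<xi>)
      = 2 ^ Suc k * prod_list xs * pair_prod xs (+) * psi n (prodl (Up n 1) xs * \<xi>) *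
        (x ^ k / (\<Prod>y\<in>?X - {x}. x - y))" if x: "x \<in> ?X" for x
  proof -
    let ?ys = "remove1 x xs"
    have ys: "set ?ys = ?X - {x}" "distinct ?ys" "length ?ys = k"
      using Suc(2,3) x by (auto simp: length_remove1)
    have IH: "res n k (?X - {x}) (Up n 1 x * \<xi>) =
      2 ^ k * prod_list ?ys * pair_prod ?ys (+) * psi n (prodl (Up n 1) ?ys * (Up n 1 x * \<xi>))"
      using Suc(1)[of ?ys "Up n 1 x * \<xi>"] ys by simp
    have comm: "prodl (Up n 1) ?ys * Up n 1 x = Up n 1 x * prodl (Up n 1) ?ys"
      by (rule prodl_commute1) (rule Up_commute, simp)
    have "prodl (Up n 1) xs = Up n 1 x * prodl (Up n 1) ?ys"
      by (rule prodl_remove1) (use x in \<open>auto intro: Up_commute\<close>)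
    then have up: "prodl (Up n 1) ?ys * (Up n 1 x * \<xi>) = prodl (Up n 1) xs * \<xi>"
      by (simp only: comm mult.assoc[symmetric])
    have px: "prod_list xs = x * prod_list ?ys"
      using prodl_remove1[of "\<lambda>x. x" x xs] x by (simp add: prodl_def mult.commute)
    have pp: "pair_prod xs (+) = (\<Prod>y\<in>?X - {x}. x + y) * pair_prod ?ys (+)"
      using pair_prod_remove1[OF x] distinct_prod_list[OF ys(2), of "(+) x"] ys(1) by simp
    show ?thesis unfolding IH up px pp by (simp add: prod_dividef mult_ac)
  qed
  have "res n (length xs) (set xs) \<xi> = (\<Sum>x\<in>?X. 2 ^ Suc k * prod_list xs * pair_prod xs (+) *
      psi n (prodl (Up n 1) xs * \<xi>) * (x ^ k / (\<Prod>y\<in>?X - {x}. x - y)))"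
    unfolding Suc(2)[symmetric] res.simps by (rule sum.cong) (simp_all only: summand)
  also have "\<dots> = 2 ^ Suc k * prod_list xs * pair_prod xs (+) * psi n (prodl (Up n 1) xs * \<xi>) * hsum k ?X"
    by (simp only: hsum_def sum_distrib_left)
  also have "hsum k ?X = 1"
    using hsum_low[of ?X k] distinct_card[OF Suc(3)] Suc(2) by simp
  finally show ?case using Suc(2) by simp
qed simp

text \<open>
  With more than \<open>n\<close> variables, both sides are polynomials of degree at most \<open>n\<close> in one variable \<open>x\<close>,
  known by induction at \<open>x = 0\<close> and wherever \<open>x\<close> cancels another variable.
\<close>

theorem top_coeff_eq_res:
  fixes \<xi> :: "'k :: field_char_0 lop"
  assumes "1 \<le> n" "distinct xs" "0 \<notin> set xs" "\<And>x y. x \<in> set xs \<Longrightarrow> y \<in> set xs \<Longrightarrow> x + y \<noteq> 0"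
    and "\<xi> \<in> few_zeros n 0"
  shows "top_coeff n (prodl (Cc n) xs * \<xi>) = res n n (set xs) \<xi>"
  using assms(2-)
proof (induction "length xs" arbitrary: xs \<xi> rule: less_induct)
  case less
  consider "length xs < n" | "length xs = n" | "length xs > n" by linarith
  then show ?case
  proof cases
    case 1
    have "prodl (Cc n) xs * \<xi> \<in> few_zeros n (length xs)"
      by (rule few_zeros_mult[OF prodl_Cc_few_zeros less.prems(4)]) simp
    then show ?thesis
      using 1 res_few[of "set xs" n n \<xi>] card_length[of xs]
      by (simp add: top_coeff_def few_zeros_coeff)
  next
    case 2
    then show ?thesis
      using top_coeff_few_variables[of xs n 0 \<xi>] res_full[OF less.prems(1), of n \<xi>] less.prems by simp
  next
    case 3
    then obtain x ys where xs: "xs = x # ys" by (cases xs) auto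
    have ys: "distinct ys" "0 \<notin> set ys" "x \<notin> set ys" "length ys \<ge> n" using less.prems 3 xs by auto
    have gen: "\<And>u v. u \<in> set ys \<Longrightarrow> v \<in> set ys \<Longrightarrow> u + v \<noteq> 0" using less.prems(3) xs by auto
    define \<zeta> where "\<zeta> = Up n 1 x * \<xi>"
    have \<zeta>: "\<zeta> \<in> few_zeros n 0"
      unfolding \<zeta>_def using less.prems by (intro few_zeros_mult[OF Up_few_zeros]) auto
    have inv: "Dn n 1 (- x) * \<zeta> = \<xi>" by (simp add: \<zeta>_def mult.assoc[symmetric])
    obtain p where p: "Polynomial.degree p \<le> n"
      "\<And>t. poly p t = top_coeff n (prodl (Cc n) ys * Dn n 1 t * H n 0 (2 * t) * \<zeta>)"
      using Dn_H0_poly[OF assms(1), of "negate n" "prodl (Cc n) ys" \<zeta>] by (auto simp: top_coeff_def)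
    have p_eq: "poly p t = top_coeff n (prodl (Cc n) ys * Cc n t * (Dn n 1 (- t) * \<zeta>))" for t
    proof -
      have "prodl (Cc n) ys * Dn n 1 t * H n 0 (2 * t) * \<zeta> = prodl (Cc n) ys * (Cc n t * Dn n 1 (- t)) * \<zeta>"
        by (simp only: Cc_times_Dn mult.assoc)
      then show ?thesis unfolding p by (simp only: mult.assoc)
    qed
    obtain q where q: "Polynomial.degree q \<le> n"
      "\<And>t. t \<notin> set ys \<Longrightarrow> poly q t = res n n (insert t (set ys)) (Dn n 1 (- t) * \<zeta>)"
      using res_poly[of "set ys" n n \<zeta>] by auto
    have "p = q"
    proof (rule poly_eqI_degree)
      fix t assume "t \<in> insert 0 (uminus ` set ys)"
      then consider "t = 0" | y where "y \<in> set ys" "t = - y" by auto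
      then show "poly p t = poly q t"
      proof cases
        case 1
        have "poly p 0 = top_coeff n (prodl (Cc n) ys * \<zeta>)" by (simp add: p)
        also have "\<dots> = res n n (set ys) \<zeta>" by (rule less.hyps) (use xs ys gen \<zeta> in auto)
        also have "\<dots> = poly q 0"
          using q(2)[of 0] ys res_insert_0[of "set ys" n n \<zeta>] by simp
        finally show ?thesis using 1 by simp
      next
        case (2 y)
        have my: "- y \<notin> set ys" using gen[of y "- y"] 2 by auto
        have "poly p t = top_coeff n (prodl (Cc n) (remove1 y ys) * (Dn n 1 y * \<zeta>))"
          using 2 by (simp add: p_eq prodl_Cc_remove)
        also have "\<dots> = res n n (set (remove1 y ys)) (Dn n 1 y * \<zeta>)"
          by (rule less.hyps) (use xs ys gen \<zeta> in \<open>auto simp: length_remove1 intro: few_zeros_mult[OF Dn_few_zeros]\<close>)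
        also have "\<dots> = poly q t"
          using q(2)[OF my] res_cancel[of "set ys" y n n "Dn n 1 y * \<zeta>"] 2 my ys by simp
        finally show ?thesis .
      qed
    next
      have "card (insert 0 (uminus ` set ys)) = Suc (length ys)"
        using ys by (subst card_insert_disjoint) (auto simp: card_image inj_on_def distinct_card)
      then show "card (insert 0 (uminus ` set ys)) > Polynomial.degree p"
        "card (insert 0 (uminus ` set ys)) > Polynomial.degree q" using p(1) q(1) ys by auto
    qed
    then have "poly p x = poly q x" by simp
    then show ?thesis using p_eq[of x] q(2)[of x] ys by (simp add: inv xs prodl_Cc_rotate del: prodl_Cons One_nat_def)
  qed
qed

section \<open>The coefficient as a function of Y and Z\<close>

text \<open>
  \<open>flag_word n k\<close> spells the signed permutation that negates \<open>1, \<dots>, k - 1\<close>, and negates and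
  reverses \<open>k, \<dots>, n\<close>.  For \<open>k = n\<close> it is a reduced word of the longest element.
\<close>

definition flag_word :: "nat \<Rightarrow> nat \<Rightarrow> nat list" where
  "flag_word n k = sgn_word n @ concat (map (\<lambda>i. rev [i..<n]) [1..<k])"

lemma flag_word_1 [simp]: "flag_word n (Suc 0) = sgn_word n"
  by (simp add: flag_word_def)

lemma flag_word_Suc: "1 \<le> k \<Longrightarrow> flag_word n (Suc k) = flag_word n k @ rev [k..<n]"
  by (simp add: flag_word_def)

lemma flag_word_letters: "set (flag_word n k) \<subseteq> {..<n}"
  using sgn_word_letters[of n] by (auto simp: flag_word_def)

lemma word_prod_flag_word:
  assumes "1 \<le> k" "k \<le> n" "j > 0"
  shows "word_prod (flag_word n k) j =
    (if j < int k then - j else if j \<le> int n then - (int n + int k - j) else j)"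
  using assms
proof (induction k arbitrary: j rule: dec_induct)
  case base
  then show ?case by (auto simp: word_prod_sgn_word)
next
  case (step k)
  have "word_prod (flag_word n (Suc k)) j = word_prod (flag_word n k) (word_prod (rev [k..<n]) j)"
    using step by (simp add: flag_word_Suc)
  moreover have "word_prod (rev [k..<n]) j > 0"
    using word_prod_down[of k n j] step by auto
  ultimately show ?case using step word_prod_down[of k n j] by auto
qed

lemma length_sgn_word: "2 * length (sgn_word r) = r * Suc r"
  by (induction r) (auto simp: algebra_simps)

lemma length_flag_word:
  assumes "1 \<le> k" "k \<le> n"
  shows "length (flag_word n k) + (n - k) * (n - k + 1) div 2 = n\<^sup>2"
  using assms
proof (induction k rule: dec_induct)
  case base
  obtain m where n: "n = Suc m" using base assms by (cases n) auto
  have "2 * (length (sgn_word n) + (n - 1) * (n - 1 + 1) div 2) = 2 * n\<^sup>2"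
    using length_sgn_word[of n] n by (simp add: power2_eq_square)
  then show ?case by simp
next
  case (step k)
  obtain m where n: "n = Suc (m + k)" using step by (metis less_iff_Suc_add Suc_le_lessD add.commute)
  have "(m + 1) * (m + 1 + 1) div 2 = (m + 1) + m * (m + 1) div 2" by simp
  then show ?case using step n by (simp add: flag_word_Suc algebra_simps)
qed

lemma word_prod_flag_word_last: "1 \<le> n \<Longrightarrow> word_prod (flag_word n n) = negate n"
  by (rule odd_fun_eqI) (auto simp: word_prod_odd negate_def word_prod_flag_word)

definition psik :: "nat \<Rightarrow> nat \<Rightarrow> 'a :: comm_ring_1 lop \<Rightarrow> 'a" where
  "psik n k \<xi> = top_coeff n (Uw n (flag_word n k) * \<xi>)"

lemma psik_1: "psik n 1 = psi n"
  by (auto simp: psik_def psi_def G_def fun_eq_iff)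

lemma psik_last: "1 \<le> n \<Longrightarrow> psik n n 1 = 1"
  using length_flag_word[of n n]
  by (simp add: psik_def top_coeff_def coeff_at_Uw[OF flag_word_letters] word_prod_flag_word_last
      cox_length_negate)

lemma psik_step: "1 \<le> k \<Longrightarrow> psik n (Suc k) \<xi> = psik n k (Uw n (rev [k..<n]) * \<xi>)"
  by (simp add: psik_def flag_word_Suc Uw_append mult.assoc)

lemma psik_add: "psik n k (S + T) = psik n k S + psik n k T"
  by (simp add: psik_def top_coeff_def distrib_left coeff_at_add)

lemma psik_scale: "psik n k (lsc c * T) = c * psik n k T"
  unfolding psik_def top_coeff_def lsc_left_commute[of "Uw n (flag_word n k)"] by (rule coeff_at_scale)

text \<open>A word can contribute only if it moves \<open>k\<close> to \<open>n\<close>.\<close>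

lemma psik_eq_0:
  assumes "x \<in> wspan n (\<lambda>a. 0 < word_prod a (int k) \<and> word_prod a (int k) < int n)" "1 \<le> k" "k \<le> n"
  shows "psik n k x = 0"
  unfolding psik_def top_coeff_def
proof (rule coeff_at_wspan_eq_0)
  let ?P = "\<lambda>a. 0 < word_prod a (int k) \<and> word_prod a (int k) < int n"
  have "Uw n (flag_word n k) \<in> wspan n (\<lambda>a. a = flag_word n k)"
    by (rule wspan_word) (use flag_word_letters in auto)
  then show "Uw n (flag_word n k) * x \<in> wspan n (\<lambda>a. \<exists>b. a = flag_word n k @ b \<and> ?P b)"
    using assms(1) by (rule wspan_mult) auto
next
  fix a assume "\<exists>b. a = flag_word n k @ b \<and> 0 < word_prod b (int k) \<and> word_prod b (int k) < int n"
  then obtain b where b: "a = flag_word n k @ b" "0 < word_prod b (int k)" "word_prod b (int k) < int n" by auto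
  then have "word_prod a (int k) \<noteq> - int k"
    using word_prod_flag_word[OF assms(2,3) b(2)] by auto
  then show "word_prod a \<noteq> negate n" using assms by (auto simp: negate_def)
qed

lemma U_flag_word:
  assumes "1 \<le> k" "k \<le> j" "j < n"
  shows "(U n j * Uw n (flag_word n k) :: 'a :: comm_ring_1 lop) = Uw n (flag_word n k) * U n (n + k - 1 - j)"
proof -
  let ?i = "n + k - 1 - j" and ?w = "word_prod (flag_word n k)"
  have i: "int ?i = int n + int k - 1 - int j" "k \<le> ?i" "?i < n" using assms by auto
  have "word_prod ([j] @ flag_word n k) = word_prod (flag_word n k @ [?i])"
  proof (rule word_prod_eqI)
    fix m :: int assume m: "m > 0"
    have s: "s_gen ?i m > 0" using m assms i by (auto simp: s_gen_apply)
    have w: "?w m = (if m < int k then - m else if m \<le> int n then - (int n + int k - m) else m)"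
      if "m > 0" for m
      using word_prod_flag_word[of k n m] assms that by auto
    have "word_prod ([j] @ flag_word n k) m = (if m < int k then - s_gen j m
        else if m \<le> int n then - s_gen j (int n + int k - m) else s_gen j m)"
      using w[OF m] s_gen_odd[of j m] s_gen_odd[of j "int n + int k - m"] by simp
    moreover have "word_prod (flag_word n k @ [?i]) m = ?w (s_gen ?i m)" by simp
    ultimately show "word_prod ([j] @ flag_word n k) m = word_prod (flag_word n k @ [?i]) m"
      using w[OF s] s_gen_apply[OF m, of ?i] i assms m
      by (auto simp: s_gen_apply)
  qed
  then have "(Uw n ([j] @ flag_word n k) :: 'a lop) = Uw n (flag_word n k @ [?i])"
    by (intro Uw_cong) (use flag_word_letters[of n k] i assms in auto)
  then show ?thesis by (simp only: Uw_append Uw_single)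
qed

text \<open>
  The trace property moves a factor from the right end to the left one; passing \<open>flag_word n k\<close>
  reverses the order of the letters \<open>k, \<dots>, n - 1\<close> and turns \<open>Up\<close> into \<open>Dn\<close>.
\<close>

lemma psik_trace:
  fixes \<zeta> :: "'a :: comm_ring_1 lop"
  assumes "1 \<le> k" "\<zeta> \<in> wspan n (\<lambda>_. True)"
  shows "psik n k (\<zeta> * Up n k x) = psik n k (Dn n k x * \<zeta>)"
proof -
  let ?W = "Uw n (flag_word n k)"
  have W: "?W \<in> wspan n (\<lambda>_. True)" by (rule wspan_word) (use flag_word_letters in auto)
  have one: "psik n k (\<zeta> * H n j x) = psik n k (H n (n + k - 1 - j) x * \<zeta>)"
    if j: "k \<le> j" "j < n" and \<zeta>: "\<zeta> \<in> wspan n (\<lambda>_. True)" for j and \<zeta> :: "'a lop"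
  proof -
    have U: "U n j \<in> wspan n (\<lambda>_. True)" unfolding Uw_single[symmetric] by (rule wspan_word) (use j in auto)
    have W\<zeta>: "?W * \<zeta> \<in> wspan n (\<lambda>_. True)" by (rule wspan_mult[OF W \<zeta>]) simp
    have "top_coeff n ((?W * \<zeta>) * U n j) = top_coeff n (U n j * (?W * \<zeta>))"
      unfolding top_coeff_def by (rule coeff_at_trace[OF _ W\<zeta> U]) (rule negate_central)
    then have "psik n k (\<zeta> * U n j) = psik n k (U n (n + k - 1 - j) * \<zeta>)"
      by (simp only: psik_def mult.assoc[symmetric] U_flag_word[OF assms(1) j])
    then show ?thesis
      by (simp add: H_def distrib_left distrib_right psik_add psik_scale mult.assoc lsc_left_commute[of \<zeta>])
  qed
  have "psik n k (\<zeta> * Hs n a x) = psik n k (Hs n (map (\<lambda>j. n + k - 1 - j) a) x * \<zeta>)"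
    if "set a \<subseteq> {k..<n}" "\<zeta> \<in> wspan n (\<lambda>_. True)" for a \<zeta>
    using that
  proof (induction a arbitrary: \<zeta> rule: rev_induct)
    case (snoc j a)
    have "psik n k (\<zeta> * Hs n (a @ [j]) x) = psik n k ((\<zeta> * Hs n a x) * H n j x)"
      by (simp add: Hs_append Hs_Cons mult.assoc)
    also have "\<dots> = psik n k (H n (n + k - 1 - j) x * (\<zeta> * Hs n a x))"
    proof (rule one)
      have "Hs n a x \<in> wspan n (\<lambda>_. True)"
        using snoc.prems assms by (intro few_zeros_words[OF Hs_few_zeros]) auto
      then show "\<zeta> * Hs n a x \<in> wspan n (\<lambda>_. True)"
        using snoc.prems by (intro wspan_mult[where P = "\<lambda>_. True" and Q = "\<lambda>_. True"]) auto
    qed (use snoc.prems in auto)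
    also have "\<dots> = psik n k ((H n (n + k - 1 - j) x * \<zeta>) * Hs n a x)" by (simp only: mult.assoc)
    also have "\<dots> = psik n k (Hs n (map (\<lambda>j. n + k - 1 - j) a) x * (H n (n + k - 1 - j) x * \<zeta>))"
    proof (rule snoc.IH)
      have "H n (n + k - 1 - j) x \<in> wspan n (\<lambda>_. True)" by (rule H_wspan) auto
      then show "H n (n + k - 1 - j) x * \<zeta> \<in> wspan n (\<lambda>_. True)"
        using snoc.prems by (intro wspan_mult[where P = "\<lambda>_. True" and Q = "\<lambda>_. True"]) auto
    qed (use snoc.prems in auto)
    finally show ?case by (simp add: Hs_append Hs_Cons mult.assoc)
  qed simp
  from this[of "[k..<n]" \<zeta>] assms(2)
  have "psik n k (\<zeta> * Hs n [k..<n] x) = psik n k (Hs n (map (\<lambda>j. n + k - 1 - j) [k..<n]) x * \<zeta>)" by simp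
  also have "map (\<lambda>j. n + k - 1 - j) [k..<n] = rev [k..<n]"
    by (rule nth_equalityI) (auto simp: rev_nth)
  finally show ?thesis by (simp add: Up_def Dn_def Hs_def)
qed

subsection \<open>Words that move k to n\<close>

definition climbs :: "nat \<Rightarrow> nat list \<Rightarrow> bool" where
  "climbs p a \<longleftrightarrow> (\<forall>j>0. 0 < word_prod a j \<and> word_prod a j \<le> j + int p)"

lemma climbs_append: "climbs p a \<Longrightarrow> climbs q b \<Longrightarrow> climbs (p + q) (a @ b)"
  by (force simp: climbs_def)

lemma word_prod_fix_small:
  assumes "set a \<subseteq> {m..}" "0 < j" "j < int m"
  shows "word_prod a j = j"
  using assms(1) by (induction a) (use assms in \<open>auto simp: s_gen_apply\<close>)

lemma Up_climbs: "1 \<le> k \<Longrightarrow> Up n k x \<in> wspan n (\<lambda>a. set a \<subseteq> {k..} \<and> climbs 1 a)"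
proof (induction "n - k" arbitrary: k)
  case 0
  then show ?case by (simp add: wspan_one climbs_def)
next
  case (Suc d)
  have "H n k x \<in> wspan n (\<lambda>a. a = [] \<or> a = [k])" by (rule H_wspan) auto
  moreover have "Up n (Suc k) x \<in> wspan n (\<lambda>a. set a \<subseteq> {Suc k..} \<and> climbs 1 a)"
    using Suc(1)[of "Suc k"] Suc(2,3) by simp
  ultimately show ?case
    unfolding Up_Suc[of n k]
  proof (rule wspan_mult)
    fix a b assume a: "a = [] \<or> a = [k]" and b: "set b \<subseteq> {Suc k..} \<and> climbs 1 b"
    have "0 < s_gen k (word_prod b j) \<and> s_gen k (word_prod b j) \<le> j + 1" if j: "j > 0" for j
    proof -
      have pos: "0 < word_prod b j" "word_prod b j \<le> j + 1" using b j by (auto simp: climbs_def)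
      have fix_: "word_prod b i = i" if "0 < i" "i \<le> int k" for i
        using word_prod_fix_small[of b "Suc k" i] b that by auto
      have "j = int k" if "word_prod b j = int k"
        using injD[OF inj_word_prod[of b], of j "int k"] fix_[of "int k"] that Suc(3) by auto
      moreover have "j \<ge> int k + 1" if "word_prod b j = int k + 1"
        using fix_[of j] that j by (cases "j \<le> int k") auto
      ultimately show ?thesis using pos Suc(3) by (auto simp: s_gen_apply)
    qed
    then have "climbs 1 (k # b)" by (auto simp: climbs_def)
    then show "set (a @ b) \<subseteq> {k..} \<and> climbs 1 (a @ b)" using a b by auto
  qed
qed

lemma prodl_Up_climbs:
  assumes "1 \<le> k"
  shows "prodl (Up n k) xs \<in> wspan n (climbs (length xs))"
proof (induction xs)
  case (Cons x xs)
  have "Up n k x \<in> wspan n (climbs 1)" by (rule wspan_mono[OF Up_climbs[OF assms]]) auto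
  then have "Up n k x * prodl (Up n k) xs \<in> wspan n (climbs (1 + length xs))"
    using Cons by (rule wspan_mult) (rule climbs_append)
  then show ?case by simp
qed (simp add: wspan_one climbs_def)

definition upper :: "nat \<Rightarrow> nat \<Rightarrow> 'a :: comm_ring_1 lop set" where
  "upper n k = wspan n (\<lambda>a. set a \<subseteq> {k..})"

lemma upper_mult: "x \<in> upper n k \<Longrightarrow> y \<in> upper n k \<Longrightarrow> x * y \<in> upper n k"
  unfolding upper_def by (erule (1) wspan_mult) auto

lemma upper_1: "1 \<in> upper n k"
  unfolding upper_def by (rule wspan_one) simp

lemma upper_mono: "x \<in> upper n k \<Longrightarrow> l \<le> k \<Longrightarrow> x \<in> upper n l"
  unfolding upper_def by (erule wspan_mono) auto

lemma Dn_upper: "Dn n k x \<in> upper n k"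
  unfolding upper_def by (rule wspan_mono[OF Dn_letters]) auto

lemma Up_upper: "Up n k x \<in> upper n k"
  unfolding upper_def by (rule wspan_mono[OF Up_letters]) auto

lemma prodl_upper: "(\<And>x. x \<in> set xs \<Longrightarrow> f x \<in> upper n k) \<Longrightarrow> prodl f xs \<in> upper n k"
  by (induction xs) (auto simp: upper_1 intro: upper_mult)

lemma upper_few_zeros: "x \<in> upper n k \<Longrightarrow> 1 \<le> k \<Longrightarrow> x \<in> few_zeros n 0"
  unfolding upper_def few_zeros_def by (erule wspan_mono) (auto simp: count_list_0_iff)

lemma psik_few_Up:
  assumes "1 \<le> k" "k \<le> n" "length xs < n - k" "\<eta> \<in> upper n (Suc k)"
  shows "psik n k (prodl (Up n k) xs * \<eta>) = 0"
proof (rule psik_eq_0[OF _ assms(1,2)])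
  show "prodl (Up n k) xs * \<eta> \<in> wspan n (\<lambda>a. 0 < word_prod a (int k) \<and> word_prod a (int k) < int n)"
    using prodl_Up_climbs[OF assms(1)] assms(4) unfolding upper_def
  proof (rule wspan_mult)
    fix a b :: "nat list" assume a: "climbs (length xs) a" and b: "set b \<subseteq> {Suc k..}"
    have "word_prod b (int k) = int k" using word_prod_fix_small[OF b, of "int k"] assms by simp
    moreover have "0 < word_prod a (int k)" "word_prod a (int k) \<le> int k + int (length xs)"
      using a assms(1) by (auto simp: climbs_def)
    ultimately show "0 < word_prod (a @ b) (int k) \<and> word_prod (a @ b) (int k) < int n"
      using assms(3) by auto
  qed
qed

lemma word_prod_block:
  assumes "set a \<subseteq> {1..} - {m}" "0 < j" "j \<le> int m"
  shows "0 < word_prod a j \<and> word_prod a j \<le> int m"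
  using assms(1) by (induction a) (use assms in \<open>auto simp: s_gen_apply\<close>)

lemma psik_Dn:
  assumes "1 \<le> k" "k \<le> n" "\<eta> \<in> upper n (Suc k)"
  shows "psik n k (Dn n k v * \<eta>) = v ^ (n - k) * psik n (Suc k) \<eta>"
proof -
  have "psik n k (Dn n j v * Uw n (rev [k..<j]) * \<eta>) = v ^ (n - j) * psik n (Suc k) \<eta>"
    if "k \<le> j" "j \<le> n" for j
    using that(2,1)
  proof (induction rule: inc_induct)
    case base
    then show ?case using assms(1) by (simp add: psik_step)
  next
    case (step j)
    have zero: "psik n k (Dn n (Suc j) v * Uw n (rev [k..<j]) * \<eta>) = 0"
    proof (rule psik_eq_0[OF _ assms(1,2)])
      have "Dn n (Suc j) v \<in> wspan n (\<lambda>a. set a \<subseteq> {1..} - {j})"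
        by (rule wspan_mono[OF Dn_letters]) auto
      moreover have "Uw n (rev [k..<j]) \<in> wspan n (\<lambda>a. set a \<subseteq> {1..} - {j})"
        by (rule wspan_word) (use step assms in auto)
      ultimately have "Dn n (Suc j) v * Uw n (rev [k..<j]) \<in> wspan n (\<lambda>a. set a \<subseteq> {1..} - {j})"
        by (rule wspan_mult) auto
      then show "Dn n (Suc j) v * Uw n (rev [k..<j]) * \<eta> \<in>
          wspan n (\<lambda>a. 0 < word_prod a (int k) \<and> word_prod a (int k) < int n)"
        using assms(3) unfolding upper_def
      proof (rule wspan_mult)
        fix a b :: "nat list" assume a: "set a \<subseteq> {1..} - {j}" and b: "set b \<subseteq> {Suc k..}"
        have "word_prod b (int k) = int k" using word_prod_fix_small[OF b, of "int k"] assms by simp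
        then show "0 < word_prod (a @ b) (int k) \<and> word_prod (a @ b) (int k) < int n"
          using word_prod_block[OF a, of "int k"] step assms by auto
      qed
    qed
    have "Dn n j v * Uw n (rev [k..<j]) * \<eta> = Dn n (Suc j) v * Uw n (rev [k..<j]) * \<eta> +
        lsc v * (Dn n (Suc j) v * (U n j * Uw n (rev [k..<j])) * \<eta>)"
      by (simp only: Dn_Suc[of n j] H_def mult.assoc distrib_left distrib_right mult_1_left
          lsc_left_commute[of "Dn n (Suc j) v"])
    also have "U n j * Uw n (rev [k..<j]) = Uw n (rev [k..<Suc j])"
      using step by (simp add: Uw_Cons)
    finally show ?case using step zero by (simp add: psik_add psik_scale Suc_diff_Suc[symmetric])
  qed
  from this[of k] assms(2) show ?thesis by simp
qed

subsection \<open>Removing one row\<close>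

text \<open>
  \<open>strip n k xs vs \<eta>\<close> is of degree one in each of the variables \<open>xs\<close>, because of
  \<open>Up n k x = H n k x * Up n (k + 1) x\<close>; at \<open>x = - v\<close> the factors of \<open>x\<close> and \<open>v\<close> cancel.
\<close>

definition strip :: "nat \<Rightarrow> nat \<Rightarrow> 'k :: comm_ring_1 list \<Rightarrow> 'k list \<Rightarrow> 'k lop \<Rightarrow> 'k" where
  "strip n k xs vs \<eta> = psik n k (prodl (Up n k) xs * prodl (Dn n k) vs *
     (prodl (\<lambda>x. Dn n (Suc k) (- x)) xs * \<eta>))"

lemma strip_linear:
  assumes "1 \<le> k"
  shows "\<exists>a b. \<forall>x. strip n k (x # xs) vs \<eta> = a + b * x"
proof -
  let ?L = "prodl (Up n k) xs * prodl (Dn n k) vs" and ?R = "prodl (\<lambda>x. Dn n (Suc k) (- x)) xs * \<eta>"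
  have "strip n k (x # xs) vs \<eta> = psik n k (?L * ?R) + psik n k (?L * (U n k * ?R)) * x" for x
  proof -
    have c1: "prodl (Up n k) xs * Up n k x = Up n k x * prodl (Up n k) xs"
      by (rule prodl_commute1) (rule Up_commute[OF assms])
    have c2: "prodl (Dn n k) vs * Up n k x = Up n k x * prodl (Dn n k) vs"
      by (rule prodl_commute1) (rule Up_Dn_commute[OF assms, symmetric])
    have h: "Up n k x * Dn n (Suc k) (- x) = H n k x"
      by (simp only: Up_Suc[of n k] mult.assoc Up_Dn_cancel mult_1_right)
    have "prodl (Up n k) (x # xs) * prodl (Dn n k) vs * (prodl (\<lambda>x. Dn n (Suc k) (- x)) (x # xs) * \<eta>)
        = ((Up n k x * prodl (Up n k) xs) * prodl (Dn n k) vs) * (Dn n (Suc k) (- x) * ?R)"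
      by (simp only: prodl_Cons mult.assoc)
    also have "\<dots> = prodl (Up n k) xs * (Up n k x * prodl (Dn n k) vs) * (Dn n (Suc k) (- x) * ?R)"
      by (simp only: c1[symmetric] mult.assoc)
    also have "\<dots> = ?L * ((Up n k x * Dn n (Suc k) (- x)) * ?R)"
      by (simp only: c2[symmetric] mult.assoc)
    also have "\<dots> = ?L * ?R + lsc x * (?L * (U n k * ?R))"
      by (simp only: h H_def distrib_left distrib_right mult_1_left mult.assoc[of "lsc x"] lsc_left_commute[of ?L])
    finally show ?thesis by (simp only: strip_def psik_add psik_scale mult.commute)
  qed
  then show ?thesis by blast
qed

lemma strip_cancel:
  assumes "1 \<le> k" "v \<in> set vs"
  shows "strip n k ((- v) # xs) vs \<eta> = strip n k xs (remove1 v vs) (Dn n (Suc k) v * \<eta>)"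
proof -
  have c1: "prodl (Up n k) xs * Up n k (- v) = Up n k (- v) * prodl (Up n k) xs"
    by (rule prodl_commute1) (rule Up_commute[OF assms(1)])
  have c2: "prodl (\<lambda>x. Dn n (Suc k) (- x)) xs * Dn n (Suc k) v = Dn n (Suc k) v * prodl (\<lambda>x. Dn n (Suc k) (- x)) xs"
    by (rule prodl_commute1) (rule Dn_commute, simp)
  have vs: "prodl (Dn n k) vs = Dn n k v * prodl (Dn n k) (remove1 v vs)"
    by (rule prodl_remove1[OF Dn_commute assms(2)]) (rule assms(1))
  have "prodl (Up n k) ((- v) # xs) * prodl (Dn n k) vs * (prodl (\<lambda>x. Dn n (Suc k) (- x)) ((- v) # xs) * \<eta>)
      = (Up n k (- v) * prodl (Up n k) xs) * Dn n k v * prodl (Dn n k) (remove1 v vs) *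
        ((Dn n (Suc k) v * prodl (\<lambda>x. Dn n (Suc k) (- x)) xs) * \<eta>)"
    by (simp only: prodl_Cons vs mult.assoc minus_minus)
  also have "\<dots> = prodl (Up n k) xs * (Up n k (- v) * Dn n k v) * prodl (Dn n k) (remove1 v vs) *
        ((prodl (\<lambda>x. Dn n (Suc k) (- x)) xs * Dn n (Suc k) v) * \<eta>)"
    by (simp only: c1[symmetric] c2[symmetric] mult.assoc)
  finally show ?thesis by (simp only: strip_def Dn_Up_cancel' mult_1_right mult.assoc)
qed

lemma strip_upper: "\<eta> \<in> upper n (Suc k) \<Longrightarrow> prodl (\<lambda>x. Dn n (Suc k) (- x)) xs * \<eta> \<in> upper n (Suc k)"
  by (intro upper_mult prodl_upper Dn_upper)

lemma strip_one:
  fixes v :: "'k :: field"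
  assumes "1 \<le> k" "k < n" "v \<noteq> 0" "\<eta> \<in> upper n (Suc k)" "length xs = n - k"
  shows "strip n k xs [v] \<eta> = prod_list (map (\<lambda>x. x + v) xs) * psik n (Suc k) \<eta>"
proof -
  have "strip n k xs [v] \<eta> * v ^ length xs = prod_list (map (\<lambda>x. x + v) xs) * strip n k [] [v] \<eta>"
    if "length xs \<le> n - k" for xs
    using that
  proof (induction xs)
    case (Cons x xs)
    obtain a b where ab: "\<And>x. strip n k (x # xs) [v] \<eta> = a + b * x"
      using strip_linear[OF assms(1)] by metis
    have "strip n k ((- v) # xs) [v] \<eta> = strip n k xs [] (Dn n (Suc k) v * \<eta>)"
      using strip_cancel[OF assms(1), of v "[v]"] by simp
    also have "\<dots> = 0"
      unfolding strip_def using Cons.prems assms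
      by (simp del: mult.assoc) (intro psik_few_Up strip_upper upper_mult[OF Dn_upper], auto)
    finally have "a = b * v" using ab[of "- v"] by simp
    moreover have "strip n k (0 # xs) [v] \<eta> = strip n k xs [v] \<eta>"
      by (simp add: strip_def Up_def Dn_def)
        (simp add: H_def map_replicate_const)
    ultimately have eq: "strip n k (x # xs) [v] \<eta> * v = (x + v) * strip n k xs [v] \<eta>"
      using ab[of 0] ab[of x] by (simp add: algebra_simps)
    have "strip n k (x # xs) [v] \<eta> * v ^ length (x # xs) = (strip n k (x # xs) [v] \<eta> * v) * v ^ length xs"
      by simp
    also have "\<dots> = (x + v) * (strip n k xs [v] \<eta> * v ^ length xs)" by (simp only: eq mult.assoc)
    also have "strip n k xs [v] \<eta> * v ^ length xs = prod_list (map (\<lambda>x. x + v) xs) * strip n k [] [v] \<eta>"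
      using Cons by simp
    finally show ?case by (simp add: mult.assoc)
  qed simp
  from this[of xs] have "strip n k xs [v] \<eta> * v ^ (n - k)
      = prod_list (map (\<lambda>x. x + v) xs) * psik n (Suc k) \<eta> * v ^ (n - k)"
    using psik_Dn[of k n \<eta> v] assms by (simp add: strip_def)
  then show ?thesis using assms(3) by simp
qed

lemma strip_formula:
  fixes vs :: "'k :: field list"
  assumes "1 \<le> k" "k < n" "0 \<notin> set vs" "distinct vs" "\<eta> \<in> upper n (Suc k)" "vs \<noteq> []"
    "length xs = n - k - 1 + length vs"
  shows "strip n k xs vs \<eta> = (\<Sum>v\<in>set vs. prod_list (map (\<lambda>x. x + v) xs) / (\<Prod>u\<in>set vs - {v}. v - u) *
    psik n (Suc k) (prodl (Dn n (Suc k)) (remove1 v vs) * \<eta>))"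
  using assms(3-)
proof (induction "length vs" arbitrary: vs xs \<eta>)
  case (Suc m)
  show ?case
  proof (cases "m = 0")
    case True
    then obtain v where "vs = [v]" using Suc(2) by (cases vs) auto
    then show ?thesis using strip_one[OF assms(1,2), of v \<eta> xs] Suc.prems assms by simp
  next
    case False
    then obtain a b ws where vs: "vs = a # b # ws" using Suc(2)
      by (metis One_nat_def Suc_length_conv length_0_conv neq_Nil_conv nat.inject)
    then have ab: "a \<in> set vs" "b \<in> set vs" "a \<noteq> b" using Suc.prems by auto
    obtain x xs' where xs: "xs = x # xs'" using Suc.prems(5) vs by (cases xs) auto
    let ?S = "set vs"
    define T where "T v = psik n (Suc k) (prodl (Dn n (Suc k)) (remove1 v vs) * \<eta>)" for v
    define E where "E v = prod_list (map (\<lambda>x. x + v) xs')" for v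
    define W where "W v = (\<Prod>u\<in>?S - {v}. v - u)" for v
    have at: "strip n k ((- c) # xs') vs \<eta> = (\<Sum>v\<in>?S. E v * (v - c) / W v * T v)" if c: "c \<in> ?S" for c
    proof -
      have S: "set (remove1 c vs) = ?S - {c}" using Suc.prems by simp
      have "strip n k ((- c) # xs') vs \<eta> = strip n k xs' (remove1 c vs) (Dn n (Suc k) c * \<eta>)"
        by (rule strip_cancel[OF assms(1) c])
      also have "\<dots> = (\<Sum>v\<in>set (remove1 c vs). prod_list (map (\<lambda>x. x + v) xs') /
          (\<Prod>u\<in>set (remove1 c vs) - {v}. v - u) *
          psik n (Suc k) (prodl (Dn n (Suc k)) (remove1 v (remove1 c vs)) * (Dn n (Suc k) c * \<eta>)))"
      proof (rule Suc(1))
        show "remove1 c vs \<noteq> []" using vs by auto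
        show "Dn n (Suc k) c * \<eta> \<in> upper n (Suc k)" by (intro upper_mult Dn_upper Suc.prems)
      qed (use Suc(2) Suc.prems c xs False in \<open>auto simp: length_remove1\<close>)
      also have "\<dots> = (\<Sum>v\<in>?S - {c}. E v * (v - c) / W v * T v)"
        unfolding S
      proof (rule sum.cong)
        fix v assume v: "v \<in> ?S - {c}"
        have "(\<Prod>u\<in>?S - {v}. v - u) = (v - c) * (\<Prod>u\<in>?S - {v} - {c}. v - u)"
          by (rule prod.remove) (use c v in auto)
        then have W: "W v = (v - c) * (\<Prod>u\<in>?S - {c} - {v}. v - u)"
          by (simp only: W_def Diff_right_commute[of ?S "{c}"])
        have "prodl (Dn n (Suc k)) (remove1 v vs) = Dn n (Suc k) c * prodl (Dn n (Suc k)) (remove1 c (remove1 v vs))"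
          by (rule prodl_remove1) (use c v in \<open>auto intro: Dn_commute\<close>)
        also have "\<dots> = prodl (Dn n (Suc k)) (remove1 v (remove1 c vs)) * Dn n (Suc k) c"
          unfolding remove1_commute[of c] by (rule prodl_commute1[symmetric]) (rule Dn_commute, simp)
        finally have "T v = psik n (Suc k) (prodl (Dn n (Suc k)) (remove1 v (remove1 c vs)) * (Dn n (Suc k) c * \<eta>))"
          by (simp only: T_def mult.assoc)
        then show "prod_list (map (\<lambda>x. x + v) xs') / (\<Prod>u\<in>?S - {c} - {v}. v - u) *
          psik n (Suc k) (prodl (Dn n (Suc k)) (remove1 v (remove1 c vs)) * (Dn n (Suc k) c * \<eta>))
          = E v * (v - c) / W v * T v"
          using v by (simp add: W E_def)
      qed simp
      also have "\<dots> = (\<Sum>v\<in>?S. E v * (v - c) / W v * T v)"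
        by (rule sum.mono_neutral_left) auto
      finally show ?thesis .
    qed
    obtain p q where pq: "\<And>x. strip n k (x # xs') vs \<eta> = p + q * x"
      using strip_linear[OF assms(1)] by metis
    have "(b - a) * strip n k xs vs \<eta> =
        (x + b) * strip n k ((- a) # xs') vs \<eta> - (x + a) * strip n k ((- b) # xs') vs \<eta>"
      unfolding xs pq by (simp add: algebra_simps)
    also have "\<dots> = (\<Sum>v\<in>?S. (x + b) * (E v * (v - a) / W v * T v) - (x + a) * (E v * (v - b) / W v * T v))"
      by (simp only: at[OF ab(1)] at[OF ab(2)] sum_distrib_left sum_subtractf)
    also have "\<dots> = (\<Sum>v\<in>?S. (b - a) * ((x + v) * E v / W v * T v))"
    proof (rule sum.cong)
      fix v
      have "(x + b) * (E v * (v - a) / W v * T v) - (x + a) * (E v * (v - b) / W v * T v)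
          = ((x + b) * (v - a) - (x + a) * (v - b)) * (E v / W v * T v)"
      proof -
        have "(x + d) * (E v * (v - c) / W v * T v) = (x + d) * (v - c) * (E v / W v * T v)" for c d
          by simp
        then show ?thesis by (simp only: left_diff_distrib[of "(x + b) * (v - a)"])
      qed
      also have "(x + b) * (v - a) - (x + a) * (v - b) = (b - a) * (x + v)" by (simp add: algebra_simps)
      finally show "(x + b) * (E v * (v - a) / W v * T v) - (x + a) * (E v * (v - b) / W v * T v)
          = (b - a) * ((x + v) * E v / W v * T v)" by simp
    qed simp
    also have "\<dots> = (b - a) * (\<Sum>v\<in>?S. (x + v) * E v / W v * T v)" by (simp only: sum_distrib_left)
    finally have "strip n k xs vs \<eta> = (\<Sum>v\<in>?S. (x + v) * E v / W v * T v)" using ab by simp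
    then show ?thesis by (simp add: xs E_def W_def T_def)
  qed
qed simp

lemma psik_row:
  fixes vs :: "'k :: field list"
  assumes "1 \<le> k" "k < n" "0 \<notin> set vs" "distinct vs" "\<eta> \<in> upper n (Suc k)" "vs \<noteq> []"
    "length xs = n - k - 1 + length vs"
  shows "psik n k (prodl (Up n k) xs * prodl (Dn n k) vs * \<eta>) =
    (\<Sum>v\<in>set vs. prod_list (map (\<lambda>x. x + v) xs) / (\<Prod>u\<in>set vs - {v}. v - u) *
      psik n (Suc k) (prodl (Up n (Suc k)) xs * prodl (Dn n (Suc k)) (remove1 v vs) * \<eta>))"
proof -
  let ?U = "prodl (Up n (Suc k)) xs"
  have "prodl (\<lambda>x. Dn n (Suc k) (- x)) xs * ?U = ?U * prodl (\<lambda>x. Dn n (Suc k) (- x)) xs"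
    by (intro prodl_commute1 prodl_commute1[symmetric]) (simp add: Up_Dn_commute)
  then have inv: "prodl (\<lambda>x. Dn n (Suc k) (- x)) xs * (?U * \<eta>) = \<eta>"
    by (simp only: mult.assoc[symmetric]) (simp add: prodl_Up_Dn_cancel)
  have comm: "prodl (Dn n (Suc k)) ws * ?U = ?U * prodl (Dn n (Suc k)) ws" for ws
    by (intro prodl_commute1 prodl_commute1[symmetric]) (simp add: Up_Dn_commute)
  have "psik n k (prodl (Up n k) xs * prodl (Dn n k) vs * \<eta>) = strip n k xs vs (?U * \<eta>)"
    by (simp only: strip_def inv)
  also have "\<dots> = (\<Sum>v\<in>set vs. prod_list (map (\<lambda>x. x + v) xs) / (\<Prod>u\<in>set vs - {v}. v - u) *
      psik n (Suc k) (prodl (Dn n (Suc k)) (remove1 v vs) * (?U * \<eta>)))"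
    by (rule strip_formula) (use assms in \<open>auto intro: upper_mult prodl_upper Up_upper\<close>)
  also have "\<dots> = (\<Sum>v\<in>set vs. prod_list (map (\<lambda>x. x + v) xs) / (\<Prod>u\<in>set vs - {v}. v - u) *
      psik n (Suc k) (?U * prodl (Dn n (Suc k)) (remove1 v vs) * \<eta>))"
    by (simp only: mult.assoc[symmetric] comm)
  finally show ?thesis .
qed

subsection \<open>All rows\<close>

definition flag_set :: "(nat \<Rightarrow> 'k :: field) \<Rightarrow> (nat \<Rightarrow> 'k) \<Rightarrow> nat \<Rightarrow> 'k set" where
  "flag_set y z k = y ` {1..k} \<union> (\<lambda>i. - z i) ` {1..k}"

definition yz_factor :: "(nat \<Rightarrow> 'k :: field) \<Rightarrow> (nat \<Rightarrow> 'k) \<Rightarrow> nat \<Rightarrow> nat \<Rightarrow> 'k lop" where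
  "yz_factor y z n k = prod_list (map (\<lambda>i. Dn n i (y i)) [k..<n]) *
     prod_list (map (\<lambda>i. Up n i (- z i)) (rev [k..<n]))"

lemma yz_factor_last [simp]: "yz_factor y z n n = 1"
  by (simp add: yz_factor_def)

lemma yz_factor_step:
  "k < n \<Longrightarrow> yz_factor y z n k = Dn n k (y k) * yz_factor y z n (Suc k) * Up n k (- z k)"
  by (simp add: yz_factor_def upt_conv_Cons mult.assoc)

lemma yz_factor_upper: "1 \<le> k \<Longrightarrow> yz_factor y z n k \<in> upper n k"
proof -
  have *: "prod_list (map (\<lambda>i. Dn n i (y i)) a) \<in> upper n k" "prod_list (map (\<lambda>i. Up n i (- z i)) a) \<in> upper n k"
    if "set a \<subseteq> {k..}" for a
    using that by (induction a) (auto simp: upper_1 intro!: upper_mult upper_mono[OF Dn_upper] upper_mono[OF Up_upper])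
  show ?thesis unfolding yz_factor_def by (intro upper_mult *) auto
qed

locale generic_flag =
  fixes y z :: "nat \<Rightarrow> 'k :: field_char_0" and n :: nat
  assumes y_inj: "inj_on y {1..<n}" and z_inj: "inj_on z {1..<n}"
    and yz: "\<And>i j. i \<in> {1..<n} \<Longrightarrow> j \<in> {1..<n} \<Longrightarrow> y i \<noteq> - z j"
    and y_nz: "\<And>i. i \<in> {1..<n} \<Longrightarrow> y i \<noteq> 0" and z_nz: "\<And>i. i \<in> {1..<n} \<Longrightarrow> z i \<noteq> 0"
    and n_pos: "1 \<le> n"
begin

abbreviation V :: "nat \<Rightarrow> 'k set" where "V \<equiv> flag_set y z"

lemma finite_V: "finite (V k)" by (simp add: flag_set_def)

lemma V_0: "V 0 = {}" by (simp add: flag_set_def)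

lemma V_Suc: "V (Suc k) = insert (y (Suc k)) (insert (- z (Suc k)) (V k))"
  by (auto simp: flag_set_def atLeastAtMostSuc_conv)

lemma V_nz: "k < n \<Longrightarrow> 0 \<notin> V k"
  using y_nz z_nz by (force simp: flag_set_def)

lemma V_new:
  assumes "Suc k < n"
  shows "y (Suc k) \<notin> V k \<and> - z (Suc k) \<notin> V k \<and> y (Suc k) \<noteq> - z (Suc k)"
proof -
  have 1: "y (Suc k) \<noteq> y i \<and> - z (Suc k) \<noteq> - z i" if "i \<in> {1..k}" for i
    using inj_onD[OF y_inj, of "Suc k" i] inj_onD[OF z_inj, of "Suc k" i] that assms by auto
  have 2: "y i \<noteq> - z j \<and> - z j \<noteq> y i" if "i \<in> {1..Suc k}" "j \<in> {1..Suc k}" for i j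
    using yz[of i j] that assms by force
  have "{1..k} \<subseteq> {1..Suc k}" "Suc k \<in> {1..Suc k}" by auto
  then show ?thesis unfolding flag_set_def Un_iff image_iff using 1 2 by blast
qed

lemma card_V: "k < n \<Longrightarrow> card (V k) = 2 * k"
proof (induction k)
  case (Suc k)
  then show ?case using V_new[of k] finite_V[of k] by (simp add: V_Suc)
qed (simp add: V_0)

text \<open>The chosen elements \<open>c\<close> drop out of later rows, which the factors \<open>v - l\<close> express.\<close>

fun row_sum :: "('k \<Rightarrow> 'k) \<Rightarrow> nat \<Rightarrow> 'k list \<Rightarrow> 'k" where
  "row_sum E 0 c = 1"
| "row_sum E (Suc d) c = (\<Sum>v\<in>V (n - Suc d). E v / (\<Prod>u\<in>V (n - Suc d) - {v}. v - u) *
      prod_list (map (\<lambda>l. v - l) c) * row_sum E d (v # c))"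

lemma psik_row_sum:
  assumes "d < n" "distinct c" "set c \<subseteq> V (n - d - 1)" "distinct vs" "set vs = V (n - d - 1) - set c"
    "length vs = n - d - 1" "length xs = n"
  shows "psik n (n - d) (prodl (Up n (n - d)) xs * prodl (Dn n (n - d)) vs * yz_factor y z n (n - d)) =
    row_sum (\<lambda>v. prod_list (map (\<lambda>x. x + v) xs)) d c"
  using assms(1-6)
proof (induction d arbitrary: c vs)
  case 0
  have "prodl (\<lambda>_. 1 :: 'k lop) a = 1" for a :: "'k list" by (induction a) auto
  then show ?case using psik_last[OF n_pos] by simp
next
  case (Suc d)
  define k where "k = n - Suc d"
  have k: "n - d = Suc k" "1 \<le> k" "k < n" "n - Suc d - 1 = k - 1" "Suc (k - 1) = k"
    using Suc.prems(1) by (auto simp: k_def)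
  let ?E = "\<lambda>v. prod_list (map (\<lambda>x. x + v) xs)"
  let ?W = "(- z k) # y k # vs" and ?U = "prodl (Up n k) xs" and ?D = "prodl (Dn n k)"
  have Vk: "V k = insert (y k) (insert (- z k) (V (k - 1)))" using V_Suc[of "k - 1"] k by simp
  have new: "y k \<notin> V (k - 1)" "- z k \<notin> V (k - 1)" "y k \<noteq> - z k" using V_new[of "k - 1"] k by auto
  have W: "distinct ?W" "set ?W = V k - set c" "length ?W = Suc k" "0 \<notin> set ?W"
    using Suc.prems new Vk k V_nz[of k] by (auto simp: k_def[symmetric])
  have words: "?U * ?D vs * (Dn n k (y k) * yz_factor y z n (Suc k)) \<in> wspan n (\<lambda>_. True)"
  proof (rule few_zeros_words[where r = 0], rule upper_few_zeros[of _ n k])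
    show "?U * ?D vs * (Dn n k (y k) * yz_factor y z n (Suc k)) \<in> upper n k"
      by (intro upper_mult prodl_upper Up_upper Dn_upper upper_mono[OF yz_factor_upper]) auto
  qed (rule k)
  have comm: "?U * Dn n k (- z k) = Dn n k (- z k) * ?U" "?D vs * Dn n k (y k) = Dn n k (y k) * ?D vs"
    by (rule prodl_commute1, rule Up_Dn_commute[OF k(2)]) (rule prodl_commute1, rule Dn_commute[OF k(2)])
  have "psik n k (?U * ?D vs * yz_factor y z n k)
      = psik n k (?U * ?D vs * (Dn n k (y k) * yz_factor y z n (Suc k)) * Up n k (- z k))"
    by (simp only: yz_factor_step[OF k(3)] mult.assoc)
  also have "\<dots> = psik n k (Dn n k (- z k) * (?U * ?D vs * (Dn n k (y k) * yz_factor y z n (Suc k))))"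
    by (rule psik_trace[OF k(2) words])
  also have "Dn n k (- z k) * (?U * ?D vs * (Dn n k (y k) * yz_factor y z n (Suc k)))
      = (Dn n k (- z k) * ?U) * (?D vs * Dn n k (y k)) * yz_factor y z n (Suc k)"
    by (simp only: mult.assoc)
  also have "\<dots> = ?U * ?D ?W * yz_factor y z n (Suc k)"
    by (simp only: comm(1)[symmetric] comm(2) prodl_Cons mult.assoc)
  also have "psik n k (?U * ?D ?W * yz_factor y z n (Suc k)) =
    (\<Sum>v\<in>set ?W. ?E v / (\<Prod>u\<in>set ?W - {v}. v - u) *
      psik n (Suc k) (prodl (Up n (Suc k)) xs * prodl (Dn n (Suc k)) (remove1 v ?W) * yz_factor y z n (Suc k)))"
    using W k assms(7) by (intro psik_row yz_factor_upper) auto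
  also have "\<dots> = (\<Sum>v\<in>V k - set c. ?E v / (\<Prod>u\<in>V k - set c - {v}. v - u) * row_sum ?E d (v # c))"
  proof (rule sum.cong)
    fix v assume "v \<in> V k - set c"
    then have v: "v \<in> V k" "v \<notin> set c" "v \<in> set ?W" using W by auto
    have "psik n (n - d) (prodl (Up n (n - d)) xs * prodl (Dn n (n - d)) (remove1 v ?W) * yz_factor y z n (n - d))
        = row_sum ?E d (v # c)"
    proof (rule Suc.IH)
      show "set (v # c) \<subseteq> V (n - d - 1)" using v Suc.prems Vk k by auto
      show "distinct (remove1 v ?W)" using W(1) by (rule distinct_remove1)
      show "set (remove1 v ?W) = V (n - d - 1) - set (v # c)"
        using W(1,2) k by (auto simp: set_remove1_eq)
      have "length (remove1 v ?W) = length ?W - 1" using v(3) by (simp only: length_remove1 if_True)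
      then show "length (remove1 v ?W) = n - d - 1" using W(3) k by simp
    qed (use v Suc.prems in auto)
    then show "?E v / (\<Prod>u\<in>set ?W - {v}. v - u) *
        psik n (Suc k) (prodl (Up n (Suc k)) xs * prodl (Dn n (Suc k)) (remove1 v ?W) * yz_factor y z n (Suc k))
      = ?E v / (\<Prod>u\<in>V k - set c - {v}. v - u) * row_sum ?E d (v # c)"
      unfolding W(2) k(1) by simp
  qed (rule W(2))
  also have "\<dots> = (\<Sum>v\<in>V k - set c. ?E v / (\<Prod>u\<in>V k - {v}. v - u) *
      prod_list (map (\<lambda>l. v - l) c) * row_sum ?E d (v # c))"
  proof (rule sum.cong)
    fix v assume v: "v \<in> V k - set c"
    have sub: "set c \<subseteq> V k - {v}" using v Suc.prems Vk k by auto
    have "(\<Prod>u\<in>V k - {v}. v - u) = (\<Prod>u\<in>V k - {v} - set c. v - u) * (\<Prod>u\<in>set c. v - u)"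
      by (rule prod.subset_diff[OF sub]) (simp add: finite_V)
    moreover have "V k - {v} - set c = V k - set c - {v}" by blast
    moreover have "(\<Prod>u\<in>set c. v - u) \<noteq> 0" using v by auto
    moreover have "prod_list (map (\<lambda>l. v - l) c) = (\<Prod>u\<in>set c. v - u)"
      by (rule distinct_prod_list) (rule Suc.prems)
    ultimately show "?E v / (\<Prod>u\<in>V k - set c - {v}. v - u) * row_sum ?E d (v # c) =
        ?E v / (\<Prod>u\<in>V k - {v}. v - u) * prod_list (map (\<lambda>l. v - l) c) * row_sum ?E d (v # c)"
      by simp
  qed simp
  also have "\<dots> = (\<Sum>v\<in>V k. ?E v / (\<Prod>u\<in>V k - {v}. v - u) *
      prod_list (map (\<lambda>l. v - l) c) * row_sum ?E d (v # c))"
  proof (rule sum.mono_neutral_left)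
    have "prod_list (map (\<lambda>l. v - l) c) = 0" if "v \<in> set c" for v
      using that by (auto simp: prod_list_zero_iff)
    then show "\<forall>v\<in>V k - (V k - set c). ?E v / (\<Prod>u\<in>V k - {v}. v - u) *
        prod_list (map (\<lambda>l. v - l) c) * row_sum ?E d (v # c) = 0" by auto
  qed (auto simp: finite_V)
  finally show ?case by (simp add: k_def)
qed

lemma row_sum_PiE:
  assumes "d < n"
  shows "row_sum E d c = (\<Sum>f\<in>Pi\<^sub>E {n - d..<n} V. \<Prod>i\<in>{n - d..<n}.
    E (f i) / (\<Prod>u\<in>V i - {f i}. f i - u) * prod_list (map (\<lambda>l. f i - l) c) * (\<Prod>l\<in>{n - d..<i}. f i - f l))"
  using assms
proof (induction d arbitrary: c)
  case (Suc d)
  define k where "k = n - Suc d"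
  have k: "n - d = Suc k" "k < n" using Suc.prems by (auto simp: k_def)
  have iv: "{k..<n} = insert k {Suc k..<n}" using k by auto
  let ?t = "\<lambda>c j f i. E (f i) / (\<Prod>u\<in>V i - {f i}. f i - u) * prod_list (map (\<lambda>l. f i - l) c) *
      (\<Prod>l\<in>{j..<i}. f i - f l)"
  have upd: "(\<Prod>i\<in>{k..<n}. ?t c k (g(k := v)) i) =
      E v / (\<Prod>u\<in>V k - {v}. v - u) * prod_list (map (\<lambda>l. v - l) c) * (\<Prod>i\<in>{Suc k..<n}. ?t (v # c) (Suc k) g i)"
    for g v
  proof -
    have "(\<Prod>i\<in>{Suc k..<n}. ?t c k (g(k := v)) i) = (\<Prod>i\<in>{Suc k..<n}. ?t (v # c) (Suc k) g i)"
    proof (rule prod.cong)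
      fix i assume i: "i \<in> {Suc k..<n}"
      then have "{k..<i} = insert k {Suc k..<i}" by auto
      then have "(\<Prod>l\<in>{k..<i}. (g(k := v)) i - (g(k := v)) l) = (g i - v) * (\<Prod>l\<in>{Suc k..<i}. g i - g l)"
        using i by simp
      then show "?t c k (g(k := v)) i = ?t (v # c) (Suc k) g i" using i by simp
    qed simp
    then show ?thesis unfolding iv by simp
  qed
  have "row_sum E (Suc d) c = (\<Sum>v\<in>V k. \<Sum>g\<in>Pi\<^sub>E {Suc k..<n} V.
      E v / (\<Prod>u\<in>V k - {v}. v - u) * prod_list (map (\<lambda>l. v - l) c) * (\<Prod>i\<in>{Suc k..<n}. ?t (v # c) (Suc k) g i))"
    using Suc by (simp add: k_def[symmetric] k(1) sum_distrib_left)
  also have "\<dots> = (\<Sum>(v, g)\<in>V k \<times> Pi\<^sub>E {Suc k..<n} V. \<Prod>i\<in>{k..<n}. ?t c k (g(k := v)) i)"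
    by (simp only: upd sum.cartesian_product)
  also have "\<dots> = (\<Sum>f\<in>Pi\<^sub>E {k..<n} V. \<Prod>i\<in>{k..<n}. ?t c k f i)"
  proof -
    have inj: "inj_on (\<lambda>(v, g). g(k := v)) (V k \<times> Pi\<^sub>E {Suc k..<n} V)"
      by (rule inj_combinator) simp
    have "(\<lambda>(v, g). g(k := v)) ` (V k \<times> Pi\<^sub>E {Suc k..<n} V) = Pi\<^sub>E {k..<n} V"
      unfolding iv PiE_insert_eq by simp
    then show ?thesis using sum.reindex[OF inj, of "\<lambda>f. \<Prod>i\<in>{k..<n}. ?t c k f i"]
      by (simp add: case_prod_unfold)
  qed
  finally show ?case by (simp add: k_def)
qed simp

lemma psi_yz_factor:
  assumes "length xs = n"
  shows "psi n (prodl (Up n 1) xs * yz_factor y z n 1) = (\<Sum>f\<in>Pi\<^sub>E {1..<n} V. \<Prod>i\<in>{1..<n}.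
    prod_list (map (\<lambda>x. x + f i) xs) / (\<Prod>u\<in>V i - {f i}. f i - u) * (\<Prod>l\<in>{1..<i}. f i - f l))"
proof -
  have "psik n (n - (n - 1)) (prodl (Up n (n - (n - 1))) xs * prodl (Dn n (n - (n - 1))) [] * yz_factor y z n (n - (n - 1))) =
    row_sum (\<lambda>v. prod_list (map (\<lambda>x. x + v) xs)) (n - 1) []"
    by (rule psik_row_sum) (use n_pos assms V_0 in auto)
  then have "psi n (prodl (Up n 1) xs * yz_factor y z n 1) = row_sum (\<lambda>v. prod_list (map (\<lambda>x. x + v) xs)) (n - 1) []"
    using n_pos by (simp add: psik_1[unfolded One_nat_def])
  also have "\<dots> = (\<Sum>f\<in>Pi\<^sub>E {1..<n} V. \<Prod>i\<in>{1..<n}.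
    prod_list (map (\<lambda>x. x + f i) xs) / (\<Prod>u\<in>V i - {f i}. f i - u) * (\<Prod>l\<in>{1..<i}. f i - f l))"
    using row_sum_PiE[of "n - 1" "\<lambda>v. prod_list (map (\<lambda>x. x + v) xs)" "[]"] n_pos by simp
  finally show ?thesis .
qed

end

section \<open>Antisymmetric residue sums\<close>

text \<open>
  \<open>resid k X \<phi>\<close> sums \<open>\<phi>\<close> over the sequences of \<open>k\<close> distinct elements of \<open>X\<close>, with the weights of
  the iterated residue formula for Schur \<open>Q\<close>-functions.
\<close>

fun resid :: "nat \<Rightarrow> 'k :: field set \<Rightarrow> ('k list \<Rightarrow> 'k) \<Rightarrow> 'k" where
  "resid 0 X \<phi> = \<phi> []"
| "resid (Suc k) X \<phi> = (\<Sum>x\<in>X. 2 * (\<Prod>y\<in>X - {x}. (x + y) / (x - y)) * resid k (X - {x}) (\<lambda>s. \<phi> (x # s)))"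

lemma resid_cong:
  assumes "finite X" "\<And>s. length s = k \<Longrightarrow> distinct s \<Longrightarrow> set s \<subseteq> X \<Longrightarrow> \<phi> s = \<phi>' s"
  shows "resid k X \<phi> = resid k X \<phi>'"
  using assms
proof (induction k arbitrary: X \<phi> \<phi>')
  case (Suc k)
  have "resid k (X - {x}) (\<lambda>s. \<phi> (x # s)) = resid k (X - {x}) (\<lambda>s. \<phi>' (x # s))" if "x \<in> X" for x
  proof (rule Suc.IH)
    fix s assume "length s = k" "distinct s" "set s \<subseteq> X - {x}"
    then show "\<phi> (x # s) = \<phi>' (x # s)" using that by (intro Suc.prems(2)) auto
  qed (use Suc.prems in simp)
  then show ?case by simp
qed simp

lemma resid_add: "resid k X (\<lambda>s. \<phi> s + \<phi>' s) = resid k X \<phi> + resid k X \<phi>'"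
  by (induction k arbitrary: X \<phi> \<phi>') (simp_all add: distrib_left sum.distrib)

lemma resid_scale: "resid k X (\<lambda>s. c * \<phi> s) = c * resid k X \<phi>"
  by (induction k arbitrary: X \<phi>) (simp_all add: sum_distrib_left mult_ac)

lemma resid_sum: "finite I \<Longrightarrow> resid k X (\<lambda>s. \<Sum>i\<in>I. \<phi> i s) = (\<Sum>i\<in>I. resid k X (\<phi> i))"
proof (induction I rule: finite_induct)
  case empty
  then show ?case using resid_scale[of k X 0 "\<lambda>_. 0"] by simp
qed (simp add: resid_add)

fun dmono :: "'k :: field list \<Rightarrow> 'k" where
  "dmono [] = 1"
| "dmono (x # s) = x ^ length (x # s) * dmono s"

lemma res_eq_resid:
  fixes X :: "'k :: field set"
  assumes "finite X"
  shows "res n k X \<xi> = resid k X (\<lambda>s. dmono s * psi n (prodl (Up n 1) s * \<xi>))"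
  using assms
proof (induction k arbitrary: X \<xi>)
  case (Suc k)
  have step: "x ^ Suc k * res n k (X - {x}) (Up n 1 x * \<xi>) =
      resid k (X - {x}) (\<lambda>s. dmono (x # s) * psi n (prodl (Up n 1) (x # s) * \<xi>))" for x
  proof -
    have comm: "prodl (Up n 1) s * (Up n 1 x * \<xi>) = prodl (Up n 1) (x # s) * \<xi>" for s
    proof -
      have "prodl (Up n 1) s * Up n 1 x = Up n 1 x * prodl (Up n 1) s"
        by (rule prodl_commute1) (rule Up_commute, simp)
      then show ?thesis by (simp add: mult.assoc[symmetric])
    qed
    have "x ^ Suc k * res n k (X - {x}) (Up n 1 x * \<xi>) =
        resid k (X - {x}) (\<lambda>s. x ^ Suc k * (dmono s * psi n (prodl (Up n 1) s * (Up n 1 x * \<xi>))))"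
      using Suc by (simp add: resid_scale)
    also have "\<dots> = resid k (X - {x}) (\<lambda>s. dmono (x # s) * psi n (prodl (Up n 1) (x # s) * \<xi>))"
    proof (rule resid_cong)
      fix s :: "'k list" assume "length s = k"
      then have "dmono (x # s) = x ^ Suc k * dmono s" by simp
      then show "x ^ Suc k * (dmono s * psi n (prodl (Up n 1) s * (Up n 1 x * \<xi>)))
          = dmono (x # s) * psi n (prodl (Up n 1) (x # s) * \<xi>)"
        by (simp only: comm mult.assoc)
    qed (use Suc.prems in auto)
    finally show ?thesis .
  qed
  have "res n (Suc k) X \<xi> = (\<Sum>x\<in>X. 2 * (\<Prod>y\<in>X - {x}. (x + y) / (x - y)) *
      (x ^ Suc k * res n k (X - {x}) (Up n 1 x * \<xi>)))"
    unfolding res.simps by (rule sum.cong) (simp_all only: mult_ac)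
  then show ?case by (simp only: step resid.simps)
qed simp

section \<open>Alternating sums and Laplace expansion\<close>

definition psum :: "nat set \<Rightarrow> ((nat \<Rightarrow> nat) \<Rightarrow> 'k :: comm_ring_1) \<Rightarrow> 'k" where
  "psum A F = (\<Sum>p\<in>{p. p permutes A}. of_int (sign p) * F p)"

definition vdm :: "nat \<Rightarrow> (nat \<Rightarrow> 'k :: comm_ring_1) \<Rightarrow> 'k" where
  "vdm m r = (\<Prod>j\<in>{0..<m}. \<Prod>i\<in>{0..<j}. r j - r i)"

lemma psum_cong: "(\<And>p. p permutes A \<Longrightarrow> F p = F' p) \<Longrightarrow> psum A F = psum A F'"
  unfolding psum_def by (rule sum.cong) auto

lemma psum_scale: "psum A (\<lambda>p. c * F p) = c * psum A F"
  unfolding psum_def sum_distrib_left by (rule sum.cong) (auto simp: mult_ac)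

lemma psum_sum: "psum A (\<lambda>p. \<Sum>i\<in>I. F i p) = (\<Sum>i\<in>I. psum A (F i))"
  unfolding psum_def sum_distrib_left by (rule sum.swap)

lemma psum_inverse:
  assumes "finite A"
  shows "psum A F = psum A (\<lambda>p. F (inv_into UNIV p))"
proof -
  have "sign (inv_into UNIV p) = sign p" if "p permutes A" for p
    using that assms by (intro sign_inverse) (auto simp: permutation_permutes)
  then show ?thesis
    unfolding psum_def by (subst sum_permutations_inverse, intro sum.cong) auto
qed

lemma psum_compose_left:
  assumes "finite A" "q permutes A"
  shows "psum A (\<lambda>p. F (q \<circ> p)) = of_int (sign q) * psum A F"
proof -
  have pq: "permutation p" if "p permutes A" for p
    using that assms(1) by (auto simp: permutation_permutes)
  have "psum A F = (\<Sum>p\<in>{p. p permutes A}. of_int (sign (q \<circ> p)) * F (q \<circ> p))"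
    unfolding psum_def by (rule setum_permutations_compose_left[OF assms(2)])
  also have "\<dots> = of_int (sign q) * psum A (\<lambda>p. F (q \<circ> p))"
    unfolding psum_def sum_distrib_left
    by (rule sum.cong) (auto simp: sign_compose pq assms(2) mult.assoc)
  finally have "of_int (sign q) * psum A F
      = (of_int (sign q * sign q) :: 'a) * psum A (\<lambda>p. F (q \<circ> p))"
    by (simp only: mult.assoc of_int_mult)
  then show ?thesis by simp
qed

lemma vdm_Suc: "vdm (Suc m) r = vdm m r * (\<Prod>i\<in>{0..<m}. r m - r i)"
  by (simp add: vdm_def mult.commute)

text \<open>
  Vandermonde's determinant: as a polynomial in the last node it vanishes at the other nodes, and its
  leading coefficient is the smaller determinant.
\<close>

lemma vandermonde:
  fixes r :: "nat \<Rightarrow> 'k :: field"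
  shows "psum {0..<m} (\<lambda>p. \<Prod>i\<in>{0..<m}. r i ^ p i) = vdm m r"
proof -
  define M where "M m r = mat m m (\<lambda>(i, j). r i ^ j)" for m and r :: "nat \<Rightarrow> 'k"
  have detM: "det (M m r) = psum {0..<m} (\<lambda>p. \<Prod>i\<in>{0..<m}. r i ^ p i)" for m and r :: "nat \<Rightarrow> 'k"
  proof -
    have "M m r \<in> carrier_mat m m" by (simp add: M_def)
    then have "det (M m r) = (\<Sum>p\<in>{p. p permutes {0..<m}}. signof p * (\<Prod>i = 0..<m. M m r $$ (i, p i)))"
      by (rule det_def')
    also have "\<dots> = psum {0..<m} (\<lambda>p. \<Prod>i\<in>{0..<m}. r i ^ p i)"
      unfolding psum_def
    proof (intro sum.cong refl arg_cong2[of _ _ _ _ "(*)"] prod.cong)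
      fix p i assume "p \<in> {p. p permutes {0..<m}}" "i \<in> {0..<m}"
      then have "p i \<in> {0..<m}" using permutes_in_image[of p "{0..<m}" i] by simp
      then show "M m r $$ (i, p i) = r i ^ p i" using \<open>i \<in> {0..<m}\<close> by (simp add: M_def)
    qed
    finally show ?thesis .
  qed
  have "det (M m r) = vdm m r"
  proof (induction m)
    case 0
    then show ?case by (simp add: M_def vdm_def)
  next
    case (Suc m)
    let ?upd = "\<lambda>t. M (Suc m) (r(m := t))"
    define q where "q = (\<Sum>j<Suc m. monom (cofactor (M (Suc m) r) m j) j)"
    have cof: "cofactor (?upd t) m j = cofactor (M (Suc m) r) m j" for t j
    proof -
      have "mat_delete (?upd t) m j = mat_delete (M (Suc m) r) m j"
        unfolding mat_delete_def M_def by (rule eq_matI) auto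
      then show ?thesis by (simp add: cofactor_def)
    qed
    have poly_q: "poly q t = det (?upd t)" for t
    proof -
      have "det (?upd t) = (\<Sum>j<Suc m. ?upd t $$ (m, j) * cofactor (?upd t) m j)"
        by (rule laplace_expansion_row) (auto simp: M_def)
      also have "\<dots> = (\<Sum>j<Suc m. t ^ j * cofactor (M (Suc m) r) m j)"
      proof (intro sum.cong refl)
        fix j assume "j \<in> {..<Suc m}"
        then have "?upd t $$ (m, j) = t ^ j" by (simp add: M_def)
        then show "?upd t $$ (m, j) * cofactor (?upd t) m j = t ^ j * cofactor (M (Suc m) r) m j"
          by (simp only: cof)
      qed
      finally show ?thesis by (simp add: q_def poly_sum poly_monom mult.commute del: sum.lessThan_Suc)
    qed
    have roots: "poly q (r i) = 0" if "i < m" for i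
      unfolding poly_q using that
      by (intro det_identical_rows[of _ "Suc m" i m]) (auto simp: M_def intro!: eq_vecI)
    have top: "cofactor (M (Suc m) r) m m = vdm m r"
    proof -
      have "mat_delete (M (Suc m) r) m m = M m r"
        unfolding mat_delete_def M_def by (rule eq_matI) auto
      then show ?thesis using Suc by (simp add: cofactor_def)
    qed
    show ?case
    proof (cases "inj_on r {0..<m}")
      case True
      define s where "s = smult (vdm m r) (\<Prod>i\<in>{0..<m}. [:- r i, 1:])"
      have degP: "Polynomial.degree (\<Prod>i\<in>{0..<m}. [:- r i, 1:]) = m"
        by (subst degree_prod_eq_sum_degree) auto
      have "q = s"
      proof (rule poly_eqI_degree_lead_coeff[of _ m _ "r ` {0..<m}"])
        show "Polynomial.degree q \<le> m"
          unfolding q_def by (rule degree_sum_le) (auto intro: order_trans[OF degree_monom_le])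
        show "Polynomial.degree s \<le> m" unfolding s_def using degP degree_smult_le by metis
        have "lead_coeff (\<Prod>i\<in>{0..<m}. [:- r i, 1:]) = 1"
          by (simp add: lead_coeff_prod)
        then show "poly.coeff q m = poly.coeff s m"
          by (simp add: q_def s_def coeff_sum degP top)
        show "poly q t = poly s t" if "t \<in> r ` {0..<m}" for t
        proof -
          have "(\<Prod>i\<in>{0..<m}. t - r i) = 0" using that by (intro prod_zero) auto
          then have "poly s t = 0" by (simp only: s_def poly_prod poly_smult poly_pCons poly_0) simp
          moreover have "poly q t = 0" using that roots by auto
          ultimately show ?thesis by simp
        qed
      qed (use True in \<open>simp add: card_image\<close>)
      then have "poly q (r m) = poly s (r m)" by simp
      then show ?thesis by (simp add: poly_q s_def poly_prod vdm_Suc)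
    next
      case False
      then obtain i j where ij: "i < j" "j < m" "r i = r j"
        unfolding inj_on_def by (metis atLeastLessThan_iff nat_neq_iff)
      have "det (M (Suc m) r) = 0"
        by (rule det_identical_rows[of _ "Suc m" i j]) (use ij in \<open>auto simp: M_def intro!: eq_vecI\<close>)
      moreover have "vdm (Suc m) r = 0"
        unfolding vdm_def using ij
        by (intro prod_zero bexI[of _ j] bexI[of _ i]) auto
      ultimately show ?thesis by simp
    qed
  qed
  then show ?thesis by (simp add: detM)
qed

lemma prod_permute:
  fixes m :: nat
  assumes "p permutes {0..<m}"
  shows "(\<Prod>i\<in>{0..<m}. f (p i)) = (\<Prod>i\<in>{0..<m}. f i)"
  using prod.permute[OF assms, of f] by (simp add: o_def)

lemma vdm_permute:
  fixes r :: "nat \<Rightarrow> 'k :: field"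
  assumes q: "q permutes {0..<m}"
  shows "vdm m (r \<circ> q) = of_int (sign q) * vdm m r"
proof -
  let ?A = "{0..<m}"
  have inv: "inv_into UNIV q permutes ?A" using q by (rule permutes_inv)
  have "(\<Prod>i\<in>?A. (r \<circ> q) i ^ p i) = (\<Prod>i\<in>?A. r i ^ (p \<circ> inv_into UNIV q) i)" for p
    using prod_permute[OF q, of "\<lambda>i. r i ^ (p \<circ> inv_into UNIV q) i"]
    by (simp add: permutes_inverses[OF q])
  then have "vdm m (r \<circ> q) = psum ?A (\<lambda>p. \<Prod>i\<in>?A. r i ^ (p \<circ> inv_into UNIV q) i)"
    by (simp only: vandermonde[symmetric])
  also have "\<dots> = (\<Sum>p\<in>{p. p permutes ?A}. of_int (sign ((p \<circ> q) \<circ> inv_into UNIV q)) *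
      of_int (sign q) * (\<Prod>i\<in>?A. r i ^ (p \<circ> inv_into UNIV q) i)) * of_int (sign q)"
  proof -
    have "(p \<circ> q) \<circ> inv_into UNIV q = p" for p :: "nat \<Rightarrow> nat"
      by (simp only: comp_assoc permutes_inv_o(1)[OF q] comp_id)
    then show ?thesis
      unfolding psum_def sum_distrib_right
      by (intro sum.cong) (auto simp: sign_idempotent mult_ac simp flip: of_int_mult)
  qed
  also have "\<dots> = of_int (sign q) * psum ?A (\<lambda>p. \<Prod>i\<in>?A. r i ^ p i)"
  proof -
    have perm: "permutation p" if "p permutes ?A" for p
      using that by (auto simp: permutation_permutes)
    have "psum ?A (\<lambda>p. \<Prod>i\<in>?A. r i ^ p i) = (\<Sum>p\<in>{p. p permutes ?A}.
        of_int (sign (p \<circ> inv_into UNIV q)) * (\<Prod>i\<in>?A. r i ^ (p \<circ> inv_into UNIV q) i))"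
      unfolding psum_def by (rule sum_permutations_compose_right[OF inv])
    also have "\<dots> = (\<Sum>p\<in>{p. p permutes ?A}. of_int (sign ((p \<circ> q) \<circ> inv_into UNIV q)) *
      of_int (sign q) * (\<Prod>i\<in>?A. r i ^ (p \<circ> inv_into UNIV q) i))"
    proof (rule sum.cong)
      fix p assume "p \<in> {p. p permutes ?A}"
      then have p: "permutation p" by (simp add: perm)
      have "(p \<circ> q) \<circ> inv_into UNIV q = p"
        by (simp only: comp_assoc permutes_inv_o(1)[OF q] comp_id)
      moreover have "sign (p \<circ> inv_into UNIV q) = sign p * sign q"
        using sign_compose[OF p perm[OF inv]] sign_inverse[OF perm[OF q]] by simp
      ultimately show "of_int (sign (p \<circ> inv_into UNIV q)) * (\<Prod>i\<in>?A. r i ^ (p \<circ> inv_into UNIV q) i) =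
          of_int (sign ((p \<circ> q) \<circ> inv_into UNIV q)) * of_int (sign q) * (\<Prod>i\<in>?A. r i ^ (p \<circ> inv_into UNIV q) i)"
        by simp
    qed simp
    finally show ?thesis by (simp only: mult.commute)
  qed
  finally show ?thesis by (simp only: vandermonde)
qed

text \<open>The sign of a permutation is the product of the signs of all differences.\<close>

lemma sign_eq_prod:
  fixes q :: "nat \<Rightarrow> nat" and m :: nat
  assumes q: "q permutes {0..<m}"
  shows "real_of_int (sign q) = (\<Prod>j\<in>{0..<m}. \<Prod>i\<in>{0..<j}. if q i < q j then 1 else - 1)"
proof -
  let ?r = "\<lambda>i. real i"
  have pos: "vdm m ?r > 0" unfolding vdm_def by (intro prod_pos) auto
  have "sgn (vdm m (?r \<circ> q)) = real_of_int (sign q)"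
    using vdm_permute[OF q, of ?r] pos by (cases q rule: sign_cases) (auto simp: sgn_mult)
  moreover have "sgn (vdm m (?r \<circ> q)) = (\<Prod>j\<in>{0..<m}. \<Prod>i\<in>{0..<j}. sgn (?r (q j) - ?r (q i)))"
  proof -
    have "sgn (prod f A) = (\<Prod>x\<in>A. sgn (f x))" for f :: "nat \<Rightarrow> real" and A
      by (induction A rule: infinite_finite_induct) (auto simp: sgn_mult)
    then show ?thesis by (simp add: vdm_def o_def)
  qed
  moreover have "(\<Prod>j\<in>{0..<m}. \<Prod>i\<in>{0..<j}. sgn (?r (q j) - ?r (q i))) =
      (\<Prod>j\<in>{0..<m}. \<Prod>i\<in>{0..<j}. if q i < q j then 1 else - 1)"
  proof (intro prod.cong refl)
    fix i j assume "j \<in> {0..<m}" "i \<in> {0..<j}"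
    then have "q i \<noteq> q j" using permutes_inj[OF q] by (auto dest: injD)
    then show "sgn (?r (q j) - ?r (q i)) = (if q i < q j then 1 else - 1)" by auto
  qed
  ultimately show ?thesis by simp
qed

lemma block_permutations:
  fixes A B :: "nat set"
  assumes "A \<inter> B = {}" "finite A" "finite B"
  shows "bij_betw (\<lambda>(s, t). s \<circ> t) ({s. s permutes A} \<times> {t. t permutes B})
    {p. p permutes A \<union> B \<and> p ` A = A}"
proof (rule bij_betwI[where g = "\<lambda>p. (restrict_id p A, restrict_id p B)"])
  have fixA: "s x = x" if "s permutes A" "x \<notin> A" for s :: "nat \<Rightarrow> nat" and x
    using that by (auto simp: permutes_def)
  have fixB: "t x = x" if "t permutes B" "x \<notin> B" for t :: "nat \<Rightarrow> nat" and x
    using that by (auto simp: permutes_def)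
  show "(\<lambda>(s, t). s \<circ> t) \<in> {s. s permutes A} \<times> {t. t permutes B} \<rightarrow> {p. p permutes A \<union> B \<and> p ` A = A}"
  proof clarify
    fix s t assume s: "s permutes A" and t: "t permutes B"
    have "s \<circ> t permutes A \<union> B"
      using permutes_compose[OF permutes_subset[OF t, of "A \<union> B"] permutes_subset[OF s, of "A \<union> B"]] by auto
    moreover have "(s \<circ> t) ` A = s ` A" using fixB[OF t] assms(1) by (force simp: image_def)
    ultimately show "s \<circ> t permutes A \<union> B \<and> (s \<circ> t) ` A = A" using permutes_image[OF s] by simp
  qed
  show "(\<lambda>p. (restrict_id p A, restrict_id p B)) \<in> {p. p permutes A \<union> B \<and> p ` A = A} \<rightarrow>
      {s. s permutes A} \<times> {t. t permutes B}"
  proof (rule funcsetI)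
    fix p assume "p \<in> {p. p permutes A \<union> B \<and> p ` A = A}"
    then have p: "p permutes A \<union> B" "p ` A = A" by auto
    have complement: "C = B" if "A \<union> C = A \<union> B" "A \<inter> C = {}" for C :: "nat set"
      using that assms(1) by blast
    have "A \<union> p ` B = A \<union> B" using permutes_image[OF p(1)] p(2) by (simp add: image_Un)
    moreover have "p ` A \<inter> p ` B = {}" using permutes_inj[OF p(1)] assms(1) by (auto dest: injD)
    ultimately have "p ` B = B" using p(2) by (intro complement) auto
    then show "(restrict_id p A, restrict_id p B) \<in> {s. s permutes A} \<times> {t. t permutes B}"
      using p inj_on_subset[OF permutes_inj[OF p(1)]]
      by (auto intro!: permutes_restrict_id simp: bij_betw_def)
  qed
  show "(\<lambda>p. (restrict_id p A, restrict_id p B)) ((\<lambda>(s, t). s \<circ> t) st) = st"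
    if "st \<in> {s. s permutes A} \<times> {t. t permutes B}" for st
  proof -
    obtain s t where st: "st = (s, t)" "s permutes A" "t permutes B"
      using \<open>st \<in> {s. s permutes A} \<times> {t. t permutes B}\<close> by auto
    have "restrict_id (s \<circ> t) A = s"
    proof
      fix x show "restrict_id (s \<circ> t) A x = s x"
        using fixA[OF st(2), of x] fixB[OF st(3), of x] assms(1)
        by (cases "x \<in> A") (auto simp: restrict_id_def disjoint_iff)
    qed
    moreover have "restrict_id (s \<circ> t) B = t"
    proof
      fix x show "restrict_id (s \<circ> t) B x = t x"
        using fixA[OF st(2), of "t x"] fixB[OF st(3), of x] assms(1) permutes_in_image[OF st(3), of x]
        by (auto simp: restrict_id_def)
    qed
    ultimately show ?thesis using st by simp
  qed
  show "(\<lambda>(s, t). s \<circ> t) ((\<lambda>p. (restrict_id p A, restrict_id p B)) p) = p"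
    if "p \<in> {p. p permutes A \<union> B \<and> p ` A = A}" for p
  proof -
    have p: "p permutes A \<union> B" "p ` A = A" using that by auto
    have "p x \<notin> A" if "x \<in> B" for x
    proof
      assume "p x \<in> A"
      then obtain a where "a \<in> A" "p a = p x" using p(2) by (metis imageE)
      then show False using permutes_inj[OF p(1)] that assms(1) by (auto dest: injD)
    qed
    moreover have "p x = x" if "x \<notin> A" "x \<notin> B" for x using p(1) that by (auto simp: permutes_def)
    ultimately have "restrict_id p A (restrict_id p B x) = p x" for x
      using assms(1) by (auto simp: restrict_id_def)
    then show ?thesis by (auto simp: fun_eq_iff)
  qed
qed

text \<open>
  Laplace expansion along the first \<open>n\<close> rows.  The subsets of \<open>n\<close> columns are enumerated by
  permutations \<open>\<rho> l\<close>; subsets that are not listed are assumed to contribute nothing.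
\<close>

lemma laplace_blocks:
  fixes a :: "nat \<Rightarrow> nat \<Rightarrow> 'k :: comm_ring_1"
  assumes "n \<le> N" "finite T" "\<And>l. l \<in> T \<Longrightarrow> \<rho> l permutes {0..<N}"
    and inj: "inj_on (\<lambda>l. \<rho> l ` {0..<n}) T"
    and zero: "\<And>p. p permutes {0..<N} \<Longrightarrow> p ` {0..<n} \<notin> (\<lambda>l. \<rho> l ` {0..<n}) ` T \<Longrightarrow>
      (\<Prod>i\<in>{n..<N}. a i (p i)) = 0"
  shows "psum {0..<N} (\<lambda>p. \<Prod>i\<in>{0..<N}. a i (p i)) =
    (\<Sum>l\<in>T. of_int (sign (\<rho> l)) * psum {0..<n} (\<lambda>s. \<Prod>i\<in>{0..<n}. a i (\<rho> l (s i))) *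
      psum {n..<N} (\<lambda>t. \<Prod>i\<in>{n..<N}. a i (\<rho> l (t i))))"
proof -
  let ?P = "{p. p permutes {0..<N}}" and ?S = "\<lambda>l. \<rho> l ` {0..<n}"
  let ?F = "\<lambda>p. of_int (sign p) * (\<Prod>i\<in>{0..<N}. a i (p i))"
  have fin: "finite ?P" by (rule finite_permutations) simp
  have split: "{0..<N} = {0..<n} \<union> {n..<N}" using assms(1) by auto
  have prod_split: "(\<Prod>i\<in>{0..<N}. f i) = (\<Prod>i\<in>{0..<n}. f i) * (\<Prod>i\<in>{n..<N}. f i)" for f :: "nat \<Rightarrow> 'k"
    unfolding split by (rule prod.union_disjoint) auto
  have perm: "permutation p" if "p permutes A" "finite A" for p :: "nat \<Rightarrow> nat" and A
    using that by (auto simp: permutation_permutes)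
  have "psum {0..<N} (\<lambda>p. \<Prod>i\<in>{0..<N}. a i (p i)) = (\<Sum>p\<in>{p\<in>?P. p ` {0..<n} \<in> ?S ` T}. ?F p)"
    unfolding psum_def
    by (rule sum.mono_neutral_right[OF fin]) (auto simp: prod_split zero)
  also have "\<dots> = (\<Sum>S\<in>?S ` T. \<Sum>p\<in>{p\<in>{p\<in>?P. p ` {0..<n} \<in> ?S ` T}. p ` {0..<n} = S}. ?F p)"
    by (rule sum.group[symmetric]) (use fin assms(2) in auto)
  also have "\<dots> = (\<Sum>l\<in>T. \<Sum>p\<in>{p\<in>{p\<in>?P. p ` {0..<n} \<in> ?S ` T}. p ` {0..<n} = ?S l}. ?F p)"
    by (rule sum.reindex_cong[OF inj]) auto
  also have "\<dots> = (\<Sum>l\<in>T. of_int (sign (\<rho> l)) * psum {0..<n} (\<lambda>s. \<Prod>i\<in>{0..<n}. a i (\<rho> l (s i))) *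
      psum {n..<N} (\<lambda>t. \<Prod>i\<in>{n..<N}. a i (\<rho> l (t i))))"
  proof (rule sum.cong)
    fix l assume l: "l \<in> T"
    let ?r = "\<rho> l"
    have r: "?r permutes {0..<N}" by (rule assms(3)[OF l])
    let ?K = "{p. p permutes {0..<n} \<union> {n..<N} \<and> p ` {0..<n} = {0..<n}}"
    have bij: "bij_betw (\<lambda>p. ?r \<circ> p) ?K {p\<in>{p\<in>?P. p ` {0..<n} \<in> ?S ` T}. p ` {0..<n} = ?S l}"
    proof (rule bij_betwI[where g = "\<lambda>p. inv_into UNIV ?r \<circ> p"])
      show "(\<lambda>p. ?r \<circ> p) \<in> ?K \<rightarrow> {p\<in>{p\<in>?P. p ` {0..<n} \<in> ?S ` T}. p ` {0..<n} = ?S l}"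
      proof
        fix p assume "p \<in> ?K"
        then have p: "p permutes {0..<N}" "p ` {0..<n} = {0..<n}" unfolding split[symmetric] by auto
        have "(?r \<circ> p) ` {0..<n} = ?S l" by (simp only: image_comp[symmetric] p(2))
        then show "?r \<circ> p \<in> {p\<in>{p\<in>?P. p ` {0..<n} \<in> ?S ` T}. p ` {0..<n} = ?S l}"
          using permutes_compose[OF p(1) r] l by auto
      qed
      show "(\<lambda>p. inv_into UNIV ?r \<circ> p) \<in> {p\<in>{p\<in>?P. p ` {0..<n} \<in> ?S ` T}. p ` {0..<n} = ?S l} \<rightarrow> ?K"
      proof
        fix p assume "p \<in> {p\<in>{p\<in>?P. p ` {0..<n} \<in> ?S ` T}. p ` {0..<n} = ?S l}"
        then have p: "p permutes {0..<N}" "p ` {0..<n} = ?S l" by auto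
        have "(inv_into UNIV ?r \<circ> p) ` {0..<n} = inv_into UNIV ?r ` ?S l"
          by (simp only: image_comp[symmetric] p(2))
        also have "\<dots> = {0..<n}"
          by (simp add: image_comp permutes_inv_o(2)[OF r])
        finally show "inv_into UNIV ?r \<circ> p \<in> ?K"
          unfolding split[symmetric] using permutes_compose[OF p(1) permutes_inv[OF r]] by simp
      qed
    qed (simp_all add: comp_assoc[symmetric] permutes_inv_o[OF r])
    have "(\<Sum>p\<in>{p\<in>{p\<in>?P. p ` {0..<n} \<in> ?S ` T}. p ` {0..<n} = ?S l}. ?F p) = (\<Sum>p\<in>?K. ?F (?r \<circ> p))"
      by (rule sum.reindex_bij_betw[OF bij, symmetric])
    also have "\<dots> = (\<Sum>(s, t)\<in>{s. s permutes {0..<n}} \<times> {t. t permutes {n..<N}}. ?F (?r \<circ> (s \<circ> t)))"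
      using sum.reindex_bij_betw[OF block_permutations[of "{0..<n}" "{n..<N}"], of "\<lambda>p. ?F (?r \<circ> p)"]
      by (simp add: case_prod_unfold)
    also have "\<dots> = (\<Sum>(s, t)\<in>{s. s permutes {0..<n}} \<times> {t. t permutes {n..<N}}. of_int (sign ?r) *
        ((of_int (sign s) * (\<Prod>i\<in>{0..<n}. a i (?r (s i)))) * (of_int (sign t) * (\<Prod>i\<in>{n..<N}. a i (?r (t i))))))"
    proof (rule sum.cong)
      fix st assume "st \<in> {s. s permutes {0..<n}} \<times> {t. t permutes {n..<N}}"
      then obtain s t where st: "st = (s, t)" "s permutes {0..<n}" "t permutes {n..<N}" by auto
      have "sign (?r \<circ> (s \<circ> t)) = sign ?r * (sign s * sign t)"
        using perm[OF r] perm[OF st(2)] perm[OF st(3)] by (simp add: sign_compose permutation_compose)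
      moreover have "(\<Prod>i\<in>{0..<n}. a i ((?r \<circ> (s \<circ> t)) i)) = (\<Prod>i\<in>{0..<n}. a i (?r (s i)))"
        using st(3) by (intro prod.cong) (auto simp: permutes_def)
      moreover have "(\<Prod>i\<in>{n..<N}. a i ((?r \<circ> (s \<circ> t)) i)) = (\<Prod>i\<in>{n..<N}. a i (?r (t i)))"
      proof (rule prod.cong)
        fix i assume "i \<in> {n..<N}"
        then have "t i \<notin> {0..<n}" using permutes_in_image[OF st(3), of i] by auto
        then show "a i ((?r \<circ> (s \<circ> t)) i) = a i (?r (t i))" using st(2) by (simp add: permutes_def)
      qed simp
      ultimately show "(case st of (s, t) \<Rightarrow> ?F (?r \<circ> (s \<circ> t))) = (case st of (s, t) \<Rightarrow> of_int (sign ?r) *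
        ((of_int (sign s) * (\<Prod>i\<in>{0..<n}. a i (?r (s i)))) * (of_int (sign t) * (\<Prod>i\<in>{n..<N}. a i (?r (t i))))))"
        unfolding st(1) prod.case prod_split by (simp only: of_int_mult mult_ac)
    qed simp
    also have "\<dots> = of_int (sign ?r) * (psum {0..<n} (\<lambda>s. \<Prod>i\<in>{0..<n}. a i (?r (s i))) *
        psum {n..<N} (\<lambda>t. \<Prod>i\<in>{n..<N}. a i (?r (t i))))"
      unfolding psum_def sum_product sum.cartesian_product
      by (simp add: sum_distrib_left case_prod_unfold)
    finally show "(\<Sum>p\<in>{p\<in>{p\<in>?P. p ` {0..<n} \<in> ?S ` T}. p ` {0..<n} = ?S l}. ?F p) =
        of_int (sign ?r) * psum {0..<n} (\<lambda>s. \<Prod>i\<in>{0..<n}. a i (?r (s i))) *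
        psum {n..<N} (\<lambda>t. \<Prod>i\<in>{n..<N}. a i (?r (t i)))"
      by (simp only: mult.assoc)
  qed simp
  finally show ?thesis .
qed

section \<open>Partitions inside a staircase\<close>

lemma part_pos_iff:
  assumes "is_partition l"
  shows "0 < part l i \<longleftrightarrow> 1 \<le> i \<and> i \<le> length l"
proof (cases "1 \<le> i \<and> i \<le> length l")
  case True
  then have "l ! (i - 1) \<in> set l" by (intro nth_mem) auto
  then have "0 < l ! (i - 1)" using assms by (intro gr0I) (auto simp: is_partition_def)
  then show ?thesis using True by (simp add: part_def)
qed (auto simp: part_def)

lemma part_antimono:
  assumes "is_partition l" "1 \<le> i" "i \<le> j"
  shows "part l j \<le> part l i"
proof (cases "j \<le> length l \<and> i < j")
  case True
  then show ?thesis
    using assms sorted_wrt_nth_less[of "(\<ge>)" l "i - 1" "j - 1"] by (auto simp: is_partition_def part_def)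
next
  case False
  then show ?thesis using assms by (cases "i = j") (auto simp: part_def)
qed

lemma partition_eqI:
  assumes "is_partition l" "is_partition m" "\<And>i. 1 \<le> i \<Longrightarrow> part l i = part m i"
  shows "l = m"
proof (rule nth_equalityI)
  have "1 \<le> i \<and> i \<le> length l \<longleftrightarrow> 1 \<le> i \<and> i \<le> length m" for i
    using part_pos_iff[OF assms(1), of i] part_pos_iff[OF assms(2), of i] assms(3)[of i] by (cases "1 \<le> i") auto
  from this[of "length l"] this[of "length m"] show len: "length l = length m" by linarith
  fix i assume "i < length l"
  then show "l ! i = m ! i" using assms(3)[of "Suc i"] len by (simp add: part_def)
qed

lemma part_conj_eq:
  assumes "is_partition l" "1 \<le> j"
  shows "part (part_conj l) j = card {i. 1 \<le> i \<and> j \<le> part l i}"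
proof (cases "j \<le> part l 1")
  case True
  have "length (part_conj l) = part l 1" by (simp add: part_conj_def del: upt_Suc)
  then have "part (part_conj l) j = part_conj l ! (j - 1)"
    using True assms(2) by (simp add: part_def[of "part_conj l"])
  also have "\<dots> = map (\<lambda>j. card {i. 1 \<le> i \<and> j \<le> part l i}) [1..<Suc (part l 1)] ! (j - 1)"
    by (simp only: part_conj_def)
  also have "\<dots> = card {i. 1 \<le> i \<and> 1 + (j - 1) \<le> part l i}"
    by (rule nth_map_upt) (use True assms(2) in simp)
  finally show ?thesis using assms(2) by simp
next
  case False
  then have empty: "{i. 1 \<le> i \<and> j \<le> part l i} = {}"
    using part_antimono[OF assms(1), of 1] by (auto, meson le_trans)
  show ?thesis unfolding empty using False by (simp add: part_def part_conj_def del: upt_Suc)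
qed

text \<open>A partition and its conjugate form a Galois connection, as \<open>{i. j \<le> part l i}\<close> is an initial segment.\<close>

lemma part_conj_galois:
  assumes l: "is_partition l" and "1 \<le> i" "1 \<le> j"
  shows "i \<le> part (part_conj l) j \<longleftrightarrow> j \<le> part l i"
proof -
  let ?S = "{i. 1 \<le> i \<and> j \<le> part l i}"
  have sub: "?S \<subseteq> {1..length l}"
  proof
    fix i assume "i \<in> ?S"
    then have "0 < part l i" using assms(3) by simp
    then show "i \<in> {1..length l}" using part_pos_iff[OF l] by simp
  qed
  then have fin: "finite ?S" by (rule finite_subset) simp
  show ?thesis unfolding part_conj_eq[OF l assms(3)]
  proof
    assume "j \<le> part l i"
    then have "{1..i} \<subseteq> ?S" using part_antimono[OF l] by (auto intro: le_trans)
    from card_mono[OF fin this] show "i \<le> card ?S" by simp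
  next
    assume i: "i \<le> card ?S"
    show "j \<le> part l i"
    proof (rule ccontr)
      assume "\<not> j \<le> part l i"
      then have "?S \<subseteq> {1..<i}" using part_antimono[OF l assms(2)] by (force simp: not_le)
      then have "card ?S \<le> i - 1" using card_mono[of "{1..<i}" ?S] by simp
      then show False using i assms(2) by simp
    qed
  qed
qed

lemma part_delta: "part (delta r) i = (if 1 \<le> i then Suc r - i else 0)"
  by (auto simp: part_def delta_def rev_nth simp del: upt_Suc)

definition staircase_parts :: "nat \<Rightarrow> nat list set" where
  "staircase_parts n = {l. is_partition l \<and> part_sub l (delta (n - 1))}"

lemma staircase_partsD:
  assumes "l \<in> staircase_parts n" "1 \<le> n" "1 \<le> i"
  shows "is_partition l" "part l i \<le> n - i"
  using assms by (auto simp: staircase_parts_def part_sub_def part_delta dest: spec[of _ i])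

lemma strict_decrease:
  fixes f :: "nat \<Rightarrow> nat"
  assumes "\<And>k. Suc k < n \<Longrightarrow> f (Suc k) < f k" "i \<le> j" "j < n"
  shows "f j + j \<le> f i + i"
  using assms(2,3)
proof (induction j rule: dec_induct)
  case (step j)
  then show ?case using assms(1)[of j] by simp
qed simp

lemma strict_decrease_image_eq:
  fixes f g :: "nat \<Rightarrow> nat"
  assumes f: "\<And>i j. i < j \<Longrightarrow> j < n \<Longrightarrow> f j < f i" and g: "\<And>i j. i < j \<Longrightarrow> j < n \<Longrightarrow> g j < g i"
    and "f ` {0..<n} = g ` {0..<n}" "i < n"
  shows "f i = g i"
proof -
  have *: "sorted (rev (map h [0..<n])) \<and> distinct (rev (map h [0..<n]))"
    if h: "\<And>i j. i < j \<Longrightarrow> j < n \<Longrightarrow> h j < h i" for h :: "nat \<Rightarrow> nat"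
  proof
    show "sorted (rev (map h [0..<n]))"
      unfolding sorted_rev_iff_nth_mono
    proof (intro allI impI)
      fix i j assume "i \<le> j" "j < length (map h [0..<n])"
      then show "map h [0..<n] ! j \<le> map h [0..<n] ! i" using h[of i j] by (cases "i = j") auto
    qed
    have "inj_on h {0..<n}"
      by (rule inj_onI) (metis atLeastLessThan_iff h less_irrefl nat_neq_iff)
    then show "distinct (rev (map h [0..<n]))" by (simp add: distinct_map)
  qed
  have "rev (map f [0..<n]) = rev (map g [0..<n])"
    using *[of f, OF f] *[of g, OF g] assms(3) by (intro sorted_distinct_set_unique) auto
  then have "map f [0..<n] = map g [0..<n]" by (simp only: rev_is_rev_conv)
  then show ?thesis using assms(4) by simp
qed

text \<open>
  The columns of \<open>l\<close>: the first block lists the beta-numbers of \<open>l\<close>, the second block their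
  complement, which is governed by the conjugate partition.
\<close>

definition beta_perm :: "nat \<Rightarrow> nat list \<Rightarrow> nat \<Rightarrow> nat" where
  "beta_perm n l i = (if i < n then part l (Suc i) + (n - 1 - i)
     else if i < 2 * n - 1 then i - part (part_conj l) (Suc (i - n)) else i)"

locale staircase_partition =
  fixes n :: nat and l :: "nat list"
  assumes n_pos: "1 \<le> n" and l: "l \<in> staircase_parts n"
begin

lemmas partition = staircase_partsD(1)[OF l n_pos order_refl]
lemmas part_le = staircase_partsD(2)[OF l n_pos]

lemma first_block: "i < j \<Longrightarrow> j < n \<Longrightarrow> beta_perm n l j < beta_perm n l i"
  using part_antimono[OF partition, of "Suc i" "Suc j"] by (simp add: beta_perm_def)

lemma conj_le: "part (part_conj l) (Suc j) \<le> n"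
proof (rule ccontr)
  assume "\<not> part (part_conj l) (Suc j) \<le> n"
  then have "Suc n \<le> part (part_conj l) (Suc j)" by simp
  then have "Suc j \<le> part l (Suc n)" using part_conj_galois[OF partition, of "Suc n" "Suc j"] by simp
  then show False using part_le[of "Suc n"] by simp
qed

lemma beta_second: "j < n - 1 \<Longrightarrow> beta_perm n l (n + j) = n + j - part (part_conj l) (Suc j)"
  unfolding beta_perm_def by (cases "n + j < 2 * n - 1") auto

lemma second_block:
  assumes "i < j" "j < n - 1"
  shows "beta_perm n l (n + i) < beta_perm n l (n + j)"
proof -
  have "part (part_conj l) (Suc j) \<le> part (part_conj l) (Suc i)"
  proof (cases "part (part_conj l) (Suc j) = 0")
    case False
    let ?c = "part (part_conj l) (Suc j)"
    have "Suc j \<le> part l ?c" using part_conj_galois[OF partition, of ?c "Suc j"] False by simp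
    then have "Suc i \<le> part l ?c" using assms by simp
    then show ?thesis using part_conj_galois[OF partition, of ?c "Suc i"] False by simp
  qed simp
  then show ?thesis using assms conj_le[of i] by (simp add: beta_second)
qed

lemma cross_blocks:
  assumes "i < n" "j < n - 1"
  shows "beta_perm n l i < beta_perm n l (n + j) \<longleftrightarrow> part (part_conj l) (Suc j) \<le> i"
    and "beta_perm n l i \<noteq> beta_perm n l (n + j)"
proof -
  have *: "Suc i \<le> part (part_conj l) (Suc j) \<longleftrightarrow> Suc j \<le> part l (Suc i)"
    by (rule part_conj_galois[OF partition]) auto
  show "beta_perm n l i < beta_perm n l (n + j) \<longleftrightarrow> part (part_conj l) (Suc j) \<le> i"
    "beta_perm n l i \<noteq> beta_perm n l (n + j)"
    using assms conj_le[of j] * unfolding beta_perm_def by (auto simp: not_le)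
qed

lemma beta_perm_permutes: "beta_perm n l permutes {0..<2 * n - 1}"
proof -
  let ?A = "{0..<2 * n - 1}" and ?\<rho> = "beta_perm n l"
  have sub: "?\<rho> ` ?A \<subseteq> ?A"
  proof (intro image_subsetI)
    fix i assume i: "i \<in> ?A"
    show "?\<rho> i \<in> ?A"
    proof (cases "i < n")
      case True
      then show ?thesis using part_le[of "Suc i"] by (auto simp: beta_perm_def)
    qed (use i in \<open>auto simp: beta_perm_def\<close>)
  qed
  have "inj_on ?\<rho> ?A"
  proof (rule linorder_inj_onI')
    fix i j assume ij: "i \<in> ?A" "j \<in> ?A" "i < j"
    consider "j < n" | "i < n" "n \<le> j" | "n \<le> i" using ij by linarith
    then show "?\<rho> i \<noteq> ?\<rho> j"
    proof cases
      case 2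
      then show ?thesis using cross_blocks(2)[of i "j - n"] ij by simp
    next
      case 3
      then have "i - n < j - n" "j - n < n - 1" using ij by auto
      then show ?thesis using second_block[of "i - n" "j - n"] 3 ij by simp
    qed (use first_block[of i j] ij in simp)
  qed
  then have "bij_betw ?\<rho> ?A ?A"
    unfolding bij_betw_def by (intro conjI endo_inj_surj[OF _ sub]) simp_all
  then show ?thesis
    by (rule bij_imp_permutes) (auto simp: beta_perm_def)
qed

lemma sign_beta_perm:
  "of_int (sign (beta_perm n l)) * (\<Prod>k\<in>{0..<n - 1}. (- 1) ^ beta_perm n l (n + k)) =
    (\<Prod>j\<in>{0..<n}. (- 1) ^ j) * (\<Prod>k\<in>{0..<n - 1}. (- 1 :: 'a :: comm_ring_1) ^ (n + k))"
proof -
  let ?\<rho> = "beta_perm n l" and ?N = "2 * n - 1"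
  let ?e = "\<lambda>i j. (if ?\<rho> i < ?\<rho> j then 1 else - 1 :: int)"
  have N: "?N = n + (n - 1)" using n_pos by simp
  have "real_of_int (sign ?\<rho>) = real_of_int (\<Prod>j\<in>{0..<?N}. \<Prod>i\<in>{0..<j}. ?e i j)"
    unfolding sign_eq_prod[OF beta_perm_permutes] of_int_prod by (intro prod.cong refl) auto
  then have "sign ?\<rho> = (\<Prod>j\<in>{0..<?N}. \<Prod>i\<in>{0..<j}. ?e i j)" by (simp only: of_int_eq_iff)
  also have "\<dots> = (\<Prod>j\<in>{0..<n}. \<Prod>i\<in>{0..<j}. ?e i j) * (\<Prod>j\<in>{0..<n - 1}. \<Prod>i\<in>{0..<n + j}. ?e i (n + j))"
    unfolding N using prod.atLeastLessThan_concat[of 0 n "n + (n - 1)" "\<lambda>j. \<Prod>i\<in>{0..<j}. ?e i j"]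
      prod.shift_bounds_nat_ivl[of "\<lambda>j. \<Prod>i\<in>{0..<j}. ?e i j" 0 n "n - 1"]
    by (simp add: add.commute)
  also have "(\<Prod>j\<in>{0..<n}. \<Prod>i\<in>{0..<j}. ?e i j) = (\<Prod>j\<in>{0..<n}. (- 1) ^ j)"
  proof (rule prod.cong)
    fix j assume "j \<in> {0..<n}"
    then have "(\<Prod>i\<in>{0..<j}. ?e i j) = (\<Prod>i\<in>{0..<j}. - 1)"
      using first_block by (intro prod.cong) (auto dest: less_asym)
    then show "(\<Prod>i\<in>{0..<j}. ?e i j) = (- 1) ^ j" by simp
  qed simp
  also have "(\<Prod>j\<in>{0..<n - 1}. \<Prod>i\<in>{0..<n + j}. ?e i (n + j)) =
      (\<Prod>j\<in>{0..<n - 1}. (- 1) ^ part (part_conj l) (Suc j))"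
  proof (rule prod.cong)
    fix j assume j: "j \<in> {0..<n - 1}"
    let ?c = "part (part_conj l) (Suc j)"
    have "(\<Prod>i\<in>{0..<n + j}. ?e i (n + j)) = (\<Prod>i\<in>{0..<?c}. ?e i (n + j)) * (\<Prod>i\<in>{?c..<n + j}. ?e i (n + j))"
      using prod.atLeastLessThan_concat[of 0 ?c "n + j" "\<lambda>i. ?e i (n + j)"] conj_le[of j] by simp
    also have "(\<Prod>i\<in>{0..<?c}. ?e i (n + j)) = (\<Prod>i\<in>{0..<?c}. - 1)"
      using cross_blocks(1)[of _ j] j conj_le[of j] by (intro prod.cong) auto
    also have "(\<Prod>i\<in>{?c..<n + j}. ?e i (n + j)) = 1"
    proof (rule prod.neutral, rule ballI)
      fix i assume i: "i \<in> {?c..<n + j}"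
      show "?e i (n + j) = 1"
      proof (cases "i < n")
        case True
        then show ?thesis using cross_blocks(1)[of i j] j i by simp
      next
        case False
        then have "i - n < j" using i by auto
        then show ?thesis using second_block[of "i - n" j] j False by simp
      qed
    qed
    finally show "(\<Prod>i\<in>{0..<n + j}. ?e i (n + j)) = (- 1) ^ ?c" by simp
  qed simp
  finally have sign: "(of_int (sign ?\<rho>) :: 'a) = (\<Prod>j\<in>{0..<n}. (- 1) ^ j) * (\<Prod>j\<in>{0..<n - 1}. (- 1) ^ part (part_conj l) (Suc j))"
    by simp
  have "(- 1 :: 'a) ^ part (part_conj l) (Suc j) * (- 1) ^ ?\<rho> (n + j) = (- 1) ^ (n + j)"
    if "j \<in> {0..<n - 1}" for j
    using that conj_le[of j] unfolding power_add[symmetric] by (simp add: beta_perm_def)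
  then show ?thesis unfolding sign by (simp add: mult.assoc flip: prod.distrib)
qed

end

lemma inj_beta_perm:
  assumes "1 \<le> n"
  shows "inj_on (\<lambda>l. beta_perm n l ` {0..<n}) (staircase_parts n)"
proof (rule inj_onI)
  fix l m assume lm: "l \<in> staircase_parts n" "m \<in> staircase_parts n"
    and eq: "beta_perm n l ` {0..<n} = beta_perm n m ` {0..<n}"
  interpret L: staircase_partition n l by standard fact+
  interpret M: staircase_partition n m by standard fact+
  show "l = m"
  proof (rule partition_eqI[OF L.partition M.partition])
    fix i :: nat assume i: "1 \<le> i"
    show "part l i = part m i"
    proof (cases "i \<le> n")
      case True
      then have "beta_perm n l (i - 1) = beta_perm n m (i - 1)"
        using i by (intro strict_decrease_image_eq[OF L.first_block M.first_block eq]) auto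
      moreover have "i - 1 < n" "Suc (i - 1) = i" using i True by auto
      ultimately show ?thesis unfolding beta_perm_def by simp
    next
      case False
      then show ?thesis using L.part_le[OF i] M.part_le[OF i] by simp
    qed
  qed
qed

lemma finite_staircase_parts:
  assumes "1 \<le> n"
  shows "finite (staircase_parts n)"
proof (rule finite_imageD[OF _ inj_beta_perm[OF assms]])
  have "(\<lambda>l. beta_perm n l ` {0..<n}) ` staircase_parts n \<subseteq> Pow {0..<2 * n - 1}"
  proof (rule image_subsetI, rule PowI)
    fix l assume l: "l \<in> staircase_parts n"
    interpret staircase_partition n l by standard fact+
    show "beta_perm n l ` {0..<n} \<subseteq> {0..<2 * n - 1}"
      using permutes_image[OF beta_perm_permutes] assms image_mono[of "{0..<n}" "{0..<2 * n - 1}" "beta_perm n l"] by auto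
  qed
  then show "finite ((\<lambda>l. beta_perm n l ` {0..<n}) ` staircase_parts n)" by (rule finite_subset) simp
qed

text \<open>
  A set of columns whose complement is large enough is that of a partition in the staircase: the
  bound on the complement says that few elements of the set are large.
\<close>

lemma beta_perm_surj:
  assumes n: "1 \<le> n" and p: "p permutes {0..<2 * n - 1}"
    and large: "\<And>k. k < n - 1 \<Longrightarrow> 2 * k + 1 \<le> p (n + k)"
  shows "p ` {0..<n} \<in> (\<lambda>l. beta_perm n l ` {0..<n}) ` staircase_parts n"
proof -
  let ?S = "p ` {0..<n}"
  define s where "s k = rev (sorted_list_of_set ?S) ! k" for k
  have inj: "inj p" by (rule permutes_inj[OF p])
  have cardS: "card ?S = n" by (simp add: card_image inj_on_subset[OF inj])
  then have len: "length (sorted_list_of_set ?S) = n" by simp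
  have s_mem: "s k \<in> ?S" if "k < n" for k
  proof -
    have "s k \<in> set (sorted_list_of_set ?S)" unfolding s_def using that len
      by (metis length_rev nth_mem set_rev)
    then show ?thesis by simp
  qed
  have s_less: "s j < s i" if "i < j" "j < n" for i j
    using that len sorted_wrt_nth_less[OF strict_sorted_list_of_set[of ?S], of "n - Suc j" "n - Suc i"]
    by (simp add: s_def rev_nth)
  have s_image: "s ` {0..<n} = ?S"
  proof (rule card_subset_eq)
    show "s ` {0..<n} \<subseteq> ?S" using s_mem by auto
    have "inj_on s {0..<n}"
      by (rule linorder_inj_onI') (use s_less in fastforce)
    then show "card (s ` {0..<n}) = card ?S" by (simp add: card_image cardS)
  qed simp
  have shift: "s j + j \<le> s i + i" if "i \<le> j" "j < n" for i j
    using that s_less by (intro strict_decrease[of n s i j]) auto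
  have ge: "n - 1 - k \<le> s k" if "k < n" for k using shift[of k "n - 1"] that by linarith
  have le: "s k \<le> 2 * (n - 1 - k)" if k: "k < n" for k
  proof (rule ccontr)
    assume "\<not> s k \<le> 2 * (n - 1 - k)"
    then have big: "2 * (n - 1 - k) + 1 \<le> s k" by simp
    let ?B = "{2 * (n - 1 - k) + 1..<2 * n - 1}"
    have "s ` {0..k} \<union> p ` {n + (n - 1 - k)..<n + (n - 1)} \<subseteq> ?B"
    proof
      fix x assume "x \<in> s ` {0..k} \<union> p ` {n + (n - 1 - k)..<n + (n - 1)}"
      then show "x \<in> ?B"
      proof
        assume "x \<in> s ` {0..k}"
        then obtain i where i: "x = s i" "i \<le> k" by auto
        then have "s k \<le> s i" using s_less[of i k] k by (cases "i = k") auto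
        moreover have "s i < 2 * n - 1"
        proof -
          have "s i \<in> p ` {0..<2 * n - 1}" using s_mem[of i] i k by auto
          then show ?thesis using permutes_image[OF p] by simp
        qed
        ultimately show ?thesis using big i by simp
      next
        assume "x \<in> p ` {n + (n - 1 - k)..<n + (n - 1)}"
        then obtain i where i: "x = p i" "n + (n - 1 - k) \<le> i" "i < n + (n - 1)" by auto
        then have "2 * (i - n) + 1 \<le> p i" using large[of "i - n"] by simp
        moreover have "p i < 2 * n - 1" using permutes_in_image[OF p, of i] i by simp
        ultimately show ?thesis using i by auto
      qed
    qed
    then have "card (s ` {0..k} \<union> p ` {n + (n - 1 - k)..<n + (n - 1)}) \<le> card ?B" by (rule card_mono[rotated]) simp
    moreover have "card (s ` {0..k} \<union> p ` {n + (n - 1 - k)..<n + (n - 1)}) = Suc k + k"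
    proof -
      have disjoint: "A \<inter> C = {}" if "A \<subseteq> B" "B \<inter> C = {}" for A B C :: "nat set"
        using that by blast
      have "s ` {0..k} \<subseteq> ?S" using s_mem k by auto
      moreover have "?S \<inter> p ` {n + (n - 1 - k)..<n + (n - 1)} = {}"
        unfolding image_Int[OF inj, symmetric] by (subst Int_emptyI) auto
      ultimately have "s ` {0..k} \<inter> p ` {n + (n - 1 - k)..<n + (n - 1)} = {}" by (rule disjoint)
      moreover have "inj_on s {0..k}"
        by (rule linorder_inj_onI') (use s_less k in fastforce)
      ultimately show ?thesis using k by (subst card_Un_disjoint) (auto simp: card_image inj_on_subset[OF inj])
    qed
    ultimately show False using k by simp
  qed
  define f where "f k = s k - (n - 1 - k)" for k
  define l where "l = filter (\<lambda>c. c \<noteq> 0) (map f [0..<n])"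
  have f_anti: "f j \<le> f i" if "i \<le> j" "j < n" for i j
    using shift[OF that] ge[of i] ge[of j] that by (simp add: f_def)
  have zeros: "\<exists>m\<le>n. (\<forall>i<n. f i \<noteq> 0 \<longleftrightarrow> i < m)"
  proof (cases "\<exists>i<n. f i = 0")
    case True
    define m where "m = (LEAST i. i < n \<and> f i = 0)"
    have m: "m < n" "f m = 0" using LeastI_ex[of "\<lambda>i. i < n \<and> f i = 0"] True by (auto simp: m_def)
    have "f i \<noteq> 0 \<longleftrightarrow> i < m" if "i < n" for i
    proof
      show "i < m" if "f i \<noteq> 0"
      proof (rule ccontr)
        assume "\<not> i < m"
        then show False using f_anti[of m i] m that \<open>i < n\<close> by simp
      qed
      show "f i \<noteq> 0" if "i < m"
        using not_less_Least[of i "\<lambda>i. i < n \<and> f i = 0"] that \<open>i < n\<close> by (simp add: m_def)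
    qed
    then show ?thesis using m by (intro exI[of _ m]) auto
  qed auto
  then obtain m where m: "m \<le> n" "\<And>i. i < n \<Longrightarrow> f i \<noteq> 0 \<longleftrightarrow> i < m" by blast
  have m_zero: "f i = 0" if "m \<le> i" "i < n" for i using m(2)[of i] that by linarith
  have l_eq: "l = map f [0..<m]"
  proof -
    have "[0..<n] = [0..<m] @ [m..<n]" using m(1) upt_add_eq_append[of 0 m "n - m"] by simp
    moreover have "filter (\<lambda>c. c \<noteq> 0) (map f [0..<m]) = map f [0..<m]"
      using m by (auto simp: filter_id_conv)
    moreover have "filter (\<lambda>c. c \<noteq> 0) (map f [m..<n]) = []"
      using m_zero by (auto simp: filter_empty_conv)
    ultimately show ?thesis by (simp add: l_def)
  qed
  have part_l: "part l (Suc i) = (if i < n then f i else 0)" for i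
    using m(1) m_zero[of i] by (auto simp: part_def l_eq not_less_eq_eq)
  have part_l': "part l i = (if 1 \<le> i \<and> i \<le> n then f (i - 1) else 0)" for i
    using part_l[of "i - 1"] by (cases i) (auto simp: part_def)
  have "is_partition l"
    unfolding is_partition_def
  proof
    show "sorted_wrt (\<ge>) l" unfolding l_eq sorted_wrt_iff_nth_less
      using f_anti m(1) by simp
    show "0 \<notin> set l" by (simp add: l_def)
  qed
  moreover have "part_sub l (delta (n - 1))"
    unfolding part_sub_def
  proof
    fix i show "part l i \<le> part (delta (n - 1)) i"
    proof (cases "1 \<le> i \<and> i \<le> n")
      case True
      then have "i - 1 < n" by linarith
      then have "f (i - 1) \<le> n - i" using le[of "i - 1"] True unfolding f_def by linarith
      then show ?thesis unfolding part_l' part_delta using True n by simp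
    next
      case False
      then show ?thesis unfolding part_l' by (simp only: if_False zero_le)
    qed
  qed
  ultimately have "l \<in> staircase_parts n" by (simp add: staircase_parts_def)
  moreover have "beta_perm n l ` {0..<n} = ?S"
    unfolding s_image[symmetric]
  proof (rule image_cong)
    fix k assume "k \<in> {0..<n}"
    then show "beta_perm n l k = s k" using ge[of k] by (simp add: beta_perm_def part_l f_def)
  qed simp
  ultimately show ?thesis by (intro image_eqI[of _ _ l]) simp_all
qed

section \<open>Complete homogeneous polynomials as divided differences\<close>

lemma finite_compositions: "finite {e :: nat list. length e = m \<and> sum_list e = k}"
proof (rule finite_subset)
  show "{e :: nat list. length e = m \<and> sum_list e = k} \<subseteq> {e. set e \<subseteq> {..k} \<and> length e = m}"
    by (auto dest: member_le_sum_list)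
qed (rule finite_lists_length_eq, simp)

lemma complete_h_neg: "p < 0 \<Longrightarrow> complete_h p xs = 0"
  by (simp add: complete_h_def)

lemma complete_h_Nil: "complete_h p [] = (if p = 0 then 1 else 0)"
proof -
  have "{e :: nat list. length e = length ([] :: 'a list) \<and> sum_list e = nat p} = (if nat p = 0 then {[]} else {})"
    by auto
  then have *: "complete_h p ([] :: 'a list) = (if p < 0 then 0 else \<Sum>e\<in>(if nat p = 0 then {[] :: nat list} else {}). 1)"
    unfolding complete_h_def by (simp only: list.size lessThan_0 prod.empty)
  show ?thesis unfolding * by simp
qed

lemma complete_h_Cons: "complete_h p (a # xs) = complete_h p xs + a * complete_h (p - 1) (a # xs)"
proof (cases "p < 0")
  case False
  let ?C = "\<lambda>m k. {e :: nat list. length e = m \<and> sum_list e = k}"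
  let ?w = "\<lambda>xs e. \<Prod>i < length xs. (xs ! i) ^ (e ! i)"
  let ?m = "length xs" and ?k = "nat p"
  have w_Cons: "?w (a # xs) (c # e) = a ^ c * ?w xs e" for c e
    by (simp add: prod.lessThan_Suc_shift del: prod.lessThan_Suc)
  have "complete_h p (a # xs) = (\<Sum>e\<in>?C (Suc ?m) ?k. ?w (a # xs) e)"
    using False by (simp add: complete_h_def)
  also have "\<dots> = (\<Sum>e\<in>{e \<in> ?C (Suc ?m) ?k. hd e = 0}. ?w (a # xs) e) +
      (\<Sum>e\<in>{e \<in> ?C (Suc ?m) ?k. hd e \<noteq> 0}. ?w (a # xs) e)"
    by (subst sum.union_disjoint[symmetric]) (auto intro!: sum.cong finite_subset[OF _ finite_compositions])
  also have "(\<Sum>e\<in>{e \<in> ?C (Suc ?m) ?k. hd e = 0}. ?w (a # xs) e) = (\<Sum>e\<in>?C ?m ?k. ?w xs e)"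
  proof (rule sum.reindex_bij_witness[of _ "Cons 0" tl])
    fix e assume "e \<in> {e \<in> ?C (Suc ?m) ?k. hd e = 0}"
    then obtain e' where "e = 0 # e'" "length e' = ?m" "sum_list e' = ?k" by (cases e) auto
    then show "0 # tl e = e" "tl e \<in> ?C ?m ?k" by auto
    show "?w xs (tl e) = ?w (a # xs) e" unfolding \<open>e = 0 # e'\<close> list.sel w_Cons by simp
  qed auto
  also have "(\<Sum>e\<in>{e \<in> ?C (Suc ?m) ?k. hd e \<noteq> 0}. ?w (a # xs) e) = a * complete_h (p - 1) (a # xs)"
  proof (cases "p = 0")
    case True
    have "{e \<in> ?C (Suc ?m) ?k. hd e \<noteq> 0} = {}"
    proof (rule equals0I)
      fix e assume "e \<in> {e \<in> ?C (Suc ?m) ?k. hd e \<noteq> 0}"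
      then show False using True by (cases e) auto
    qed
    then show ?thesis unfolding complete_h_def using True by (simp only: sum.empty) simp
  next
    case p: False
    have "(\<Sum>e\<in>{e \<in> ?C (Suc ?m) ?k. hd e \<noteq> 0}. ?w (a # xs) e) =
        (\<Sum>e\<in>?C (Suc ?m) (nat (p - 1)). a * ?w (a # xs) e)"
    proof (rule sum.reindex_bij_witness[of _ "\<lambda>e. Suc (hd e) # tl e" "\<lambda>e. (hd e - 1) # tl e"])
      fix e assume "e \<in> {e \<in> ?C (Suc ?m) ?k. hd e \<noteq> 0}"
      then obtain c e' where e: "e = Suc c # e'" "length e' = ?m" "Suc c + sum_list e' = ?k"
        by (cases e; cases "hd e") auto
      then show "Suc (hd ((hd e - 1) # tl e)) # tl ((hd e - 1) # tl e) = e"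
        "(hd e - 1) # tl e \<in> ?C (Suc ?m) (nat (p - 1))" by auto
      show "a * ?w (a # xs) ((hd e - 1) # tl e) = ?w (a # xs) e"
        unfolding e(1) list.sel w_Cons by (simp add: mult_ac)
    next
      fix e assume "e \<in> ?C (Suc ?m) (nat (p - 1))"
      then obtain c e' where e: "e = c # e'" "length e' = ?m" "c + sum_list e' = nat (p - 1)" by (cases e) auto
      then show "(hd (Suc (hd e) # tl e) - 1) # tl (Suc (hd e) # tl e) = e" by simp
      have "Suc (c + sum_list e') = ?k" using e(3) p False by simp
      then show "Suc (hd e) # tl e \<in> {e \<in> ?C (Suc ?m) ?k. hd e \<noteq> 0}" using e by auto
    qed
    then show ?thesis using p False by (simp add: complete_h_def sum_distrib_left)
  qed
  finally show ?thesis using False by (simp add: complete_h_def)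
qed (simp add: complete_h_def)

text \<open>Both sides satisfy the same recursion in the degree and the number of variables.\<close>

lemma complete_h_eq_hsum:
  assumes "distinct xs" "xs \<noteq> []"
  shows "complete_h (int c + 1 - int (length xs)) xs = hsum c (set xs)"
  using assms
proof (induction xs arbitrary: c)
  case (Cons a xs)
  show ?case
  proof (cases "xs = []")
    case True
    have "complete_h (int c) [a] = a ^ c"
    proof (induction c)
      case 0
      then show ?case by (subst complete_h_Cons) (simp add: complete_h_Nil complete_h_neg)
    next
      case (Suc c)
      then show ?case by (subst complete_h_Cons) (simp add: complete_h_Nil)
    qed
    then show ?thesis using True by (simp add: hsum_def)
  next
    case False
    show ?thesis
    proof (induction c)
      case 0
      have "Suc 0 < card (set (a # xs))" using distinct_card[OF Cons.prems(1)] False by simp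
      then have "hsum 0 (set (a # xs)) = 0" using hsum_low[of "set (a # xs)" 0] by blast
      then show ?case using False by (simp add: complete_h_def)
    next
      case (Suc c)
      have "set (a # xs) - {a} = set xs" using Cons.prems(1) by auto
      then have "hsum (Suc c) (set (a # xs)) = a * hsum c (set (a # xs)) + hsum c (set xs)"
        using hsum_rec[of "set (a # xs)" a c] by simp
      also have "\<dots> = a * complete_h (int c + 1 - int (length (a # xs))) (a # xs) + complete_h (int c + 1 - int (length xs)) xs"
        using Suc Cons.IH[of c] Cons.prems(1) False by simp
      also have "\<dots> = complete_h (int (Suc c) + 1 - int (length (a # xs))) (a # xs)"
        by (subst (2) complete_h_Cons) (simp add: algebra_simps)
      finally show ?case by simp
    qed
  qed
qed simp

section \<open>Antisymmetry of the residue sums\<close>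

fun rweight :: "'k :: field set \<Rightarrow> 'k list \<Rightarrow> 'k" where
  "rweight X [] = 1"
| "rweight X (x # s) = 2 * (\<Prod>y\<in>X - {x}. (x + y) / (x - y)) * rweight (X - {x}) s"

definition tuples :: "nat \<Rightarrow> 'k set \<Rightarrow> 'k list set" where
  "tuples k X = {s. length s = k \<and> distinct s \<and> set s \<subseteq> X}"

lemma finite_tuples: "finite X \<Longrightarrow> finite (tuples k X)"
  by (rule finite_subset[OF _ finite_lists_length_eq[of X k]]) (auto simp: tuples_def)

lemma resid_eq_sum:
  assumes "finite X"
  shows "resid k X \<phi> = (\<Sum>s\<in>tuples k X. rweight X s * \<phi> s)"
  using assms
proof (induction k arbitrary: X \<phi>)
  case 0
  have "tuples 0 X = {[]}" by (auto simp: tuples_def)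
  then show ?case by simp
next
  case (Suc k)
  have "resid (Suc k) X \<phi> = (\<Sum>x\<in>X. \<Sum>s\<in>tuples k (X - {x}). rweight X (x # s) * \<phi> (x # s))"
    using Suc by (simp add: sum_distrib_left mult.assoc)
  also have "\<dots> = (\<Sum>(x, s)\<in>(SIGMA x:X. tuples k (X - {x})). rweight X (x # s) * \<phi> (x # s))"
    using Suc.prems by (intro sum.Sigma) (auto simp: finite_tuples)
  also have "\<dots> = (\<Sum>s\<in>tuples (Suc k) X. rweight X s * \<phi> s)"
  proof (rule sum.reindex_bij_witness[of _ "\<lambda>s. (hd s, tl s)" "\<lambda>(x, s). x # s"])
    fix s assume "s \<in> tuples (Suc k) X"
    then show "(case (hd s, tl s) of (x, s) \<Rightarrow> x # s) = s" "(hd s, tl s) \<in> (SIGMA x:X. tuples k (X - {x}))"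
      by (cases s; auto simp: tuples_def)+
  qed (auto simp: tuples_def)
  finally show ?case .
qed

lemma rweight_eq:
  assumes "finite X" "distinct s" "set s \<subseteq> X"
  shows "rweight X s = 2 ^ length s * pair_prod s (\<lambda>a b. (a + b) / (a - b)) *
    (\<Prod>x\<in>set s. \<Prod>y\<in>X - set s. (x + y) / (x - y))"
  using assms
proof (induction s arbitrary: X)
  case (Cons x s)
  let ?g = "\<lambda>a b. (a + b) / (a - b)"
  have split: "X - {x} = set s \<union> (X - set (x # s))" using Cons.prems by auto
  have e1: "(\<Prod>y\<in>X - {x}. ?g x y) = (\<Prod>y\<in>set s. ?g x y) * (\<Prod>y\<in>X - set (x # s). ?g x y)"
    by (subst split, rule prod.union_disjoint) (use Cons.prems in auto)
  have e2: "rweight (X - {x}) s = 2 ^ length s * pair_prod s ?g * (\<Prod>x'\<in>set s. \<Prod>y\<in>X - set (x # s). ?g x' y)"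
  proof -
    have "X - {x} - set s = X - set (x # s)" by auto
    moreover have "finite (X - {x})" "distinct s" "set s \<subseteq> X - {x}" using Cons.prems by auto
    ultimately show ?thesis using Cons.IH[of "X - {x}"] by simp
  qed
  have e3: "prod_list (map (?g x) s) = (\<Prod>y\<in>set s. ?g x y)"
    using Cons.prems(2) by (intro distinct_prod_list) simp
  have e4: "(\<Prod>x'\<in>set (x # s). \<Prod>y\<in>X - set (x # s). ?g x' y) =
      (\<Prod>y\<in>X - set (x # s). ?g x y) * (\<Prod>x'\<in>set s. \<Prod>y\<in>X - set (x # s). ?g x' y)"
    using Cons.prems(2) by simp
  show ?case
    unfolding rweight.simps pair_prod.simps e1 e2 e3 e4 by (simp add: mult_ac)
qed simp

lemma pair_prod_eq_nth: "pair_prod s g = (\<Prod>j\<in>{0..<length s}. \<Prod>i\<in>{0..<j}. g (s ! i) (s ! j))"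
proof (induction s)
  case (Cons x s)
  have "(\<Prod>j\<in>{0..<length (x # s)}. \<Prod>i\<in>{0..<j}. g ((x # s) ! i) ((x # s) ! j)) =
      (\<Prod>j\<in>{0..<length s}. \<Prod>i\<in>{0..<Suc j}. g ((x # s) ! i) (s ! j))"
    by (simp add: prod.atLeast0_lessThan_Suc_shift del: prod.op_ivl_Suc)
  also have "\<dots> = (\<Prod>j\<in>{0..<length s}. g x (s ! j) * (\<Prod>i\<in>{0..<j}. g (s ! i) (s ! j)))"
    by (simp add: prod.atLeast0_lessThan_Suc_shift del: prod.op_ivl_Suc)
  also have "\<dots> = pair_prod (x # s) g"
    using prod.list_conv_set_nth[of "map (g x) s"] by (simp add: prod.distrib Cons)
  finally show ?case by simp
qed simp

lemma vdm_cong: "(\<And>i. i < m \<Longrightarrow> r i = r' i) \<Longrightarrow> vdm m r = vdm m r'"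
  unfolding vdm_def by (intro prod.cong refl) auto

text \<open>
  The pairs contribute \<open>(s\<^sub>i + s\<^sub>j) / (s\<^sub>i - s\<^sub>j)\<close>; up to a constant sign this is the
  Vandermonde product of the squares divided by the square of that of the \<open>s\<^sub>i\<close>.
\<close>

lemma pair_prod_quotient:
  fixes s :: "'k :: field list"
  assumes "distinct s"
  shows "pair_prod s (\<lambda>a b. (a + b) / (a - b)) =
    vdm (length s) (\<lambda>i. (s ! i)\<^sup>2) / (vdm (length s) (nth s))\<^sup>2 * (\<Prod>j\<in>{0..<length s}. (- 1) ^ j)"
proof -
  let ?n = "length s"
  have "pair_prod s (\<lambda>a b. (a + b) / (a - b)) = (\<Prod>j\<in>{0..<?n}. \<Prod>i\<in>{0..<j}.
      ((s ! j)\<^sup>2 - (s ! i)\<^sup>2) / ((s ! j - s ! i) * (s ! j - s ! i)) * (- 1))"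
    unfolding pair_prod_eq_nth
  proof (intro prod.cong refl)
    fix i j assume "j \<in> {0..<?n}" "i \<in> {0..<j}"
    then have "s ! i \<noteq> s ! j" using assms by (simp add: nth_eq_iff_index_eq)
    then have "s ! j - s ! i \<noteq> 0" by simp
    moreover have "(s ! i + s ! j) / (s ! i - s ! j) = - ((s ! i + s ! j) / (s ! j - s ! i))"
      unfolding minus_divide_right by simp
    moreover have "(s ! j)\<^sup>2 - (s ! i)\<^sup>2 = (s ! j - s ! i) * (s ! i + s ! j)"
      by (simp add: power2_eq_square algebra_simps)
    ultimately show "(s ! i + s ! j) / (s ! i - s ! j) =
        ((s ! j)\<^sup>2 - (s ! i)\<^sup>2) / ((s ! j - s ! i) * (s ! j - s ! i)) * (- 1)" by simp
  qed
  also have "\<dots> = vdm ?n (\<lambda>i. (s ! i)\<^sup>2) / (vdm ?n (nth s) * vdm ?n (nth s)) * (\<Prod>j\<in>{0..<?n}. (- 1) ^ j)"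
    unfolding vdm_def prod.distrib prod_dividef by (simp add: prod_constant)
  finally show ?thesis by (simp only: power2_eq_square)
qed

text \<open>Only the product over pairs inside the tuple changes, and it is antisymmetric.\<close>

lemma rweight_permute:
  assumes "finite X" "s \<in> tuples k X" "\<sigma> permutes {0..<k}"
  shows "rweight X (permute_list \<sigma> s) = of_int (sign \<sigma>) * rweight X s"
proof -
  let ?p = "permute_list \<sigma> s"
  have s: "length s = k" "distinct s" "set s \<subseteq> X" using assms(2) by (auto simp: tuples_def)
  have \<sigma>: "\<sigma> permutes {..<length s}" using assms(3) s by (simp add: atLeast0LessThan)
  have p: "length ?p = k" "distinct ?p" "set ?p = set s" using s \<sigma> by auto
  have nth: "?p ! i = s ! \<sigma> i" if "i < k" for i
    using permute_list_nth[OF \<sigma>] that s by simp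
  have "vdm k (\<lambda>i. (?p ! i)\<^sup>2) = of_int (sign \<sigma>) * vdm k (\<lambda>i. (s ! i)\<^sup>2)"
    using vdm_permute[OF assms(3), of "\<lambda>i. (s ! i)\<^sup>2"] vdm_cong[of k "\<lambda>i. (?p ! i)\<^sup>2" "(\<lambda>i. (s ! i)\<^sup>2) \<circ> \<sigma>"] nth
    by simp
  moreover have "vdm k (nth ?p) = of_int (sign \<sigma>) * vdm k (nth s)"
    using vdm_permute[OF assms(3), of "nth s"] vdm_cong[of k "nth ?p" "nth s \<circ> \<sigma>"] nth by simp
  moreover have "(of_int (sign \<sigma>) :: 'a)\<^sup>2 = 1" by (cases \<sigma> rule: sign_cases) auto
  ultimately have "pair_prod ?p (\<lambda>a b. (a + b) / (a - b)) = of_int (sign \<sigma>) * pair_prod s (\<lambda>a b. (a + b) / (a - b))"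
    using pair_prod_quotient[OF p(2)] pair_prod_quotient[OF s(2)] p(1) s(1) by (simp add: power_mult_distrib)
  then show ?thesis
    using rweight_eq[OF assms(1) s(2,3)] rweight_eq[OF assms(1) p(2)] p s by simp
qed

lemma resid_permute:
  assumes "finite X" "\<sigma> permutes {0..<k}"
  shows "resid k X (\<lambda>s. \<phi> (permute_list \<sigma> s)) = of_int (sign \<sigma>) * resid k X \<phi>"
proof -
  let ?\<tau> = "inv_into UNIV \<sigma>"
  have \<sigma>: "\<sigma> permutes {..<k}" using assms(2) by (simp add: atLeast0LessThan)
  have \<tau>: "?\<tau> permutes {..<k}" by (rule permutes_inv[OF \<sigma>])
  have sq: "(of_int (sign \<sigma>) * of_int (sign \<sigma>) :: 'a) = 1" by (cases \<sigma> rule: sign_cases) auto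
  have "resid k X (\<lambda>s. \<phi> (permute_list \<sigma> s)) =
      (\<Sum>s\<in>tuples k X. of_int (sign \<sigma>) * (rweight X (permute_list \<sigma> s) * \<phi> (permute_list \<sigma> s)))"
    unfolding resid_eq_sum[OF assms(1)]
  proof (rule sum.cong)
    fix s assume "s \<in> tuples k X"
    then show "rweight X s * \<phi> (permute_list \<sigma> s) =
        of_int (sign \<sigma>) * (rweight X (permute_list \<sigma> s) * \<phi> (permute_list \<sigma> s))"
      using rweight_permute[OF assms(1) _ assms(2)] sq by (simp add: mult.assoc[symmetric])
  qed simp
  also have "\<dots> = (\<Sum>s\<in>tuples k X. of_int (sign \<sigma>) * (rweight X s * \<phi> s))"
  proof (rule sum.reindex_bij_witness[of _ "permute_list ?\<tau>" "permute_list \<sigma>"])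
    fix s assume s: "s \<in> tuples k X"
    then have len: "length s = k" by (simp add: tuples_def)
    show "permute_list ?\<tau> (permute_list \<sigma> s) = s"
      using permute_list_compose[of ?\<tau> s \<sigma>] \<tau> len by (simp add: permutes_inv_o[OF \<sigma>])
    show "permute_list \<sigma> (permute_list ?\<tau> s) = s"
      using permute_list_compose[of \<sigma> s ?\<tau>] \<sigma> len by (simp add: permutes_inv_o[OF \<sigma>])
    show "permute_list \<sigma> s \<in> tuples k X" "permute_list ?\<tau> s \<in> tuples k X"
      using s \<sigma> \<tau> by (auto simp: tuples_def)
  qed simp
  finally show ?thesis by (simp add: resid_eq_sum[OF assms(1)] sum_distrib_left)
qed

text \<open>Each of the \<open>k!\<close> permutations contributes the same, its sign cancelling against that of the weights.\<close>

lemma resid_alternating: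
  assumes "finite X"
  shows "resid k X (\<lambda>s. psum {0..<k} (\<lambda>\<sigma>. \<phi> (permute_list \<sigma> s))) = of_nat (fact k) * resid k X \<phi>"
proof -
  let ?P = "{\<sigma>. \<sigma> permutes {0..<k}}"
  have fin: "finite ?P" by (rule finite_permutations) simp
  have "resid k X (\<lambda>s. psum {0..<k} (\<lambda>\<sigma>. \<phi> (permute_list \<sigma> s))) =
      (\<Sum>\<sigma>\<in>?P. of_int (sign \<sigma>) * (of_int (sign \<sigma>) * resid k X \<phi>))"
    unfolding psum_def resid_sum[OF fin] resid_scale
    by (rule sum.cong) (auto simp: resid_permute[OF assms])
  also have "\<dots> = (\<Sum>\<sigma>\<in>?P. resid k X \<phi>)"
  proof (rule sum.cong)
    fix \<sigma> :: "nat \<Rightarrow> nat"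
    show "of_int (sign \<sigma>) * (of_int (sign \<sigma>) * resid k X \<phi>) = resid k X \<phi>"
      by (cases \<sigma> rule: sign_cases) auto
  qed simp
  also have "card ?P = fact k" by (rule card_permutations) auto
  then have "(\<Sum>\<sigma>\<in>?P. resid k X \<phi>) = of_nat (fact k) * resid k X \<phi>" by simp
  finally show ?thesis .
qed

section \<open>From the row sums to minors\<close>

lemma psum_swap: "psum {0..<m} (\<lambda>p. \<Prod>i\<in>{0..<m}. b (p i) i) = psum {0..<m} (\<lambda>p. \<Prod>i\<in>{0..<m}. b i (p i))"
proof -
  have "psum {0..<m} (\<lambda>p. \<Prod>i\<in>{0..<m}. b (p i) i) =
      psum {0..<m} (\<lambda>p. \<Prod>i\<in>{0..<m}. b (inv_into UNIV p i) i)"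
    by (rule psum_inverse) simp
  also have "\<dots> = psum {0..<m} (\<lambda>p. \<Prod>i\<in>{0..<m}. b i (p i))"
  proof (rule psum_cong)
    fix p assume p: "p permutes {0..<m}"
    show "(\<Prod>i\<in>{0..<m}. b (inv_into UNIV p i) i) = (\<Prod>i\<in>{0..<m}. b i (p i))"
      using prod_permute[OF p, of "\<lambda>i. b (inv_into UNIV p i) i"] by (simp add: permutes_inverses[OF p])
  qed
  finally show ?thesis .
qed

text \<open>Translating the index set of a permutation does not change its inversions.\<close>

lemma psum_shift:
  "psum {n..<n + m} (\<lambda>t. \<Prod>i\<in>{n..<n + m}. b i (t i)) =
    psum {0..<m} (\<lambda>t. \<Prod>i\<in>{0..<m}. b (n + i) (n + t i))"
proof -
  let ?A = "{n..<n + m}"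
  define up where "up t i = (if i < n then i else n + t (i - n))" for t :: "nat \<Rightarrow> nat" and i
  define down where "down t i = t (n + i) - n" for t :: "nat \<Rightarrow> nat" and i
  have up_perm: "up t permutes ?A" if t: "t permutes {0..<m}" for t
  proof (rule bij_imp_permutes)
    have "inj_on (up t) ?A"
    proof (rule inj_onI)
      fix i j assume ij: "i \<in> ?A" "j \<in> ?A" "up t i = up t j"
      then have "t (i - n) = t (j - n)" by (simp add: up_def)
      then have "i - n = j - n" using permutes_inj[OF t] by (simp add: inj_eq)
      moreover have "n \<le> i" "n \<le> j" using ij by auto
      ultimately show "i = j" by linarith
    qed
    moreover have "up t ` ?A \<subseteq> ?A"
    proof (rule image_subsetI)
      fix i assume i: "i \<in> ?A"
      then have "t (i - n) \<in> {0..<m}" using permutes_in_image[OF t, of "i - n"] by auto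
      then show "up t i \<in> ?A" using i by (simp add: up_def)
    qed
    ultimately show "bij_betw (up t) ?A ?A"
      unfolding bij_betw_def by (intro conjI endo_inj_surj) simp_all
    show "up t i = i" if "i \<notin> ?A" for i
      using that t by (auto simp: up_def permutes_def)
  qed
  have fix_low: "t i = i" if "t permutes ?A" "i < n" for t i
    using that by (simp add: permutes_def)
  have down_perm: "down t permutes {0..<m}" if t: "t permutes ?A" for t
  proof (rule bij_imp_permutes)
    have ge: "n \<le> t (n + i)" for i
    proof (cases "i < m")
      case True
      then show ?thesis using permutes_in_image[OF t, of "n + i"] by simp
    next
      case False
      then show ?thesis using t by (simp add: permutes_def)
    qed
    have "inj_on (down t) {0..<m}"
    proof (rule inj_onI)
      fix i j assume "down t i = down t j"
      then have "t (n + i) = t (n + j)" using ge[of i] ge[of j] by (simp add: down_def)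
      then show "i = j" using permutes_inj[OF t] by (simp add: inj_eq)
    qed
    moreover have "down t ` {0..<m} \<subseteq> {0..<m}"
    proof (rule image_subsetI)
      fix i assume i: "i \<in> {0..<m}"
      then show "down t i \<in> {0..<m}" using permutes_in_image[OF t, of "n + i"] by (auto simp: down_def)
    qed
    ultimately show "bij_betw (down t) {0..<m} {0..<m}"
      unfolding bij_betw_def by (intro conjI endo_inj_surj) simp_all
    show "down t i = i" if "i \<notin> {0..<m}" for i
      using that t by (auto simp: down_def permutes_def)
  qed
  have sign: "sign (up t) = sign t" if t: "t permutes {0..<m}" for t
  proof -
    have perm: "up t permutes {0..<n + m}" by (rule permutes_subset[OF up_perm[OF t]]) auto
    let ?e = "\<lambda>t i j. (if t i < t j then 1 else - 1 :: real)"
    have "real_of_int (sign (up t)) = (\<Prod>j\<in>{0..<n}. \<Prod>i\<in>{0..<j}. ?e (up t) i j) *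
        (\<Prod>j\<in>{n..<n + m}. \<Prod>i\<in>{0..<j}. ?e (up t) i j)"
      unfolding sign_eq_prod[OF perm] by (rule prod.atLeastLessThan_concat[symmetric]) auto
    also have "(\<Prod>j\<in>{0..<n}. \<Prod>i\<in>{0..<j}. ?e (up t) i j) = 1"
      by (intro prod.neutral ballI) (auto simp: up_def)
    also have "(\<Prod>j\<in>{n..<n + m}. \<Prod>i\<in>{0..<j}. ?e (up t) i j) = (\<Prod>j\<in>{0..<m}. \<Prod>i\<in>{0..<n + j}. ?e (up t) i (n + j))"
      using prod.shift_bounds_nat_ivl[of "\<lambda>j. \<Prod>i\<in>{0..<j}. ?e (up t) i j" 0 n m] by (simp add: add.commute)
    also have "\<dots> = (\<Prod>j\<in>{0..<m}. \<Prod>i\<in>{0..<j}. ?e t i j)"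
    proof (rule prod.cong)
      fix j assume "j \<in> {0..<m}"
      have "(\<Prod>i\<in>{0..<n + j}. ?e (up t) i (n + j)) =
          (\<Prod>i\<in>{0..<n}. ?e (up t) i (n + j)) * (\<Prod>i\<in>{n..<n + j}. ?e (up t) i (n + j))"
        by (rule prod.atLeastLessThan_concat[symmetric]) auto
      also have "(\<Prod>i\<in>{0..<n}. ?e (up t) i (n + j)) = 1"
        by (intro prod.neutral ballI) (simp add: up_def)
      also have "(\<Prod>i\<in>{n..<n + j}. ?e (up t) i (n + j)) = (\<Prod>i\<in>{0..<j}. ?e t i j)"
        using prod.shift_bounds_nat_ivl[of "\<lambda>i. ?e (up t) i (n + j)" 0 n j] by (simp add: up_def add.commute)
      finally show "(\<Prod>i\<in>{0..<n + j}. ?e (up t) i (n + j)) = (\<Prod>i\<in>{0..<j}. ?e t i j)" by simp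
    qed simp
    also have "\<dots> = real_of_int (sign t)" by (rule sign_eq_prod[OF t, symmetric])
    finally show ?thesis by simp
  qed
  have prod_up: "(\<Prod>i\<in>?A. b i (up t i)) = (\<Prod>i\<in>{0..<m}. b (n + i) (n + t i))" for t
    using prod.shift_bounds_nat_ivl[of "\<lambda>i. b i (up t i)" 0 n m] by (simp add: up_def add.commute)
  show ?thesis
    unfolding psum_def
  proof (rule sum.reindex_bij_witness[of _ up down])
    fix t assume "t \<in> {t. t permutes {0..<m}}"
    then have t: "t permutes {0..<m}" by simp
    show "down (up t) = t" by (auto simp: up_def down_def)
    show "up t \<in> {t. t permutes ?A}" using up_perm[OF t] by simp
  next
    fix t assume "t \<in> {t. t permutes ?A}"
    then have t: "t permutes ?A" by simp
    show inv: "up (down t) = t"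
    proof
      fix i
      show "up (down t) i = t i"
      proof (cases "i < n")
        case True
        then show ?thesis using fix_low[OF t] by (simp add: up_def)
      next
        case False
        then have "n \<le> t i"
          using permutes_in_image[OF t, of i] t by (cases "i < n + m") (auto simp: permutes_def)
        then show ?thesis using False by (simp add: up_def down_def)
      qed
    qed
    show d: "down t \<in> {t. t permutes {0..<m}}" using down_perm[OF t] by simp
    show "of_int (sign (down t)) * (\<Prod>i\<in>{0..<m}. b (n + i) (n + down t i)) = of_int (sign t) * (\<Prod>i\<in>?A. b i (t i))"
      using sign[of "down t"] d prod_up[of "down t"] unfolding inv by simp
  qed
qed

context generic_flag
begin

definition flag_minor :: "nat list \<Rightarrow> 'k" where
  "flag_minor l = det (mat (n - 1) (n - 1) (\<lambda>(i, j). hsum (beta_perm n l (n + j)) (V (Suc i))))"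

lemma flag_minor_psum:
  "flag_minor l = psum {0..<n - 1} (\<lambda>t. \<Prod>i\<in>{0..<n - 1}. hsum (beta_perm n l (n + t i)) (V (Suc i)))"
proof -
  let ?M = "mat (n - 1) (n - 1) (\<lambda>(i, j). hsum (beta_perm n l (n + j)) (V (Suc i)))"
  have "det ?M = (\<Sum>p\<in>{p. p permutes {0..<n - 1}}. signof p * (\<Prod>i = 0..<n - 1. ?M $$ (i, p i)))"
    by (rule det_def') simp
  also have "\<dots> = psum {0..<n - 1} (\<lambda>t. \<Prod>i\<in>{0..<n - 1}. hsum (beta_perm n l (n + t i)) (V (Suc i)))"
    unfolding psum_def
  proof (rule sum.cong)
    fix p assume "p \<in> {p. p permutes {0..<n - 1}}"
    then have p: "p permutes {0..<n - 1}" by simp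
    have "(\<Prod>i = 0..<n - 1. ?M $$ (i, p i)) = (\<Prod>i\<in>{0..<n - 1}. hsum (beta_perm n l (n + p i)) (V (Suc i)))"
    proof (rule prod.cong)
      fix i assume i: "i \<in> {0..<n - 1}"
      then have "p i \<in> {0..<n - 1}" using permutes_in_image[OF p, of i] by simp
      then show "?M $$ (i, p i) = hsum (beta_perm n l (n + p i)) (V (Suc i))" using i by simp
    qed simp
    then show "signof p * (\<Prod>i = 0..<n - 1. ?M $$ (i, p i)) =
        of_int (sign p) * (\<Prod>i\<in>{0..<n - 1}. hsum (beta_perm n l (n + p i)) (V (Suc i)))" by simp
  qed simp
  finally show ?thesis by (simp add: flag_minor_def)
qed

text \<open>
  The factors \<open>x + f i\<close> and \<open>f i - f l\<close> of the row sums complete the Vandermonde product of \<open>s\<close> to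
  the one in the \<open>2 n - 1\<close> numbers \<open>s\<^sub>i\<close> and \<open>- f i\<close>.  Summing over the \<open>f i\<close> row by row
  turns this determinant into one whose last \<open>n - 1\<close> rows consist of complete homogeneous
  polynomials; Laplace expansion separates the two kinds of rows.
\<close>

lemma vandermonde_row_sum:
  fixes s :: "'k list"
  assumes len: "length s = n"
  shows "vdm n (nth s) * psi n (prodl (Up n 1) s * yz_factor y z n 1) * (\<Prod>k\<in>{0..<n - 1}. (- 1) ^ (n + k)) =
    psum {0..<2 * n - 1} (\<lambda>p. \<Prod>i\<in>{0..<2 * n - 1}.
      (if i < n then (s ! i) ^ p i else (- 1) ^ p i * hsum (p i) (V (Suc (i - n)))))"
proof -
  define m where "m = n - 1"
  have N: "2 * n - 1 = n + m" and n: "n = Suc m" using n_pos by (auto simp: m_def)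
  let ?F = "Pi\<^sub>E {1..<n} V"
  let ?wt = "\<lambda>f k. inverse (\<Prod>u\<in>V k - {f k}. f k - u)"
  define r where "r f i = (if i < n then s ! i else - f (Suc (i - n)))" for f :: "nat \<Rightarrow> 'k" and i
  have split: "(\<Prod>i\<in>{0..<n + m}. g i) = (\<Prod>i\<in>{0..<n}. g i) * (\<Prod>k\<in>{0..<m}. g (n + k))" for g :: "nat \<Rightarrow> 'k"
  proof -
    have "(\<Prod>i\<in>{0..<n + m}. g i) = (\<Prod>i\<in>{0..<n}. g i) * (\<Prod>i\<in>{n..<n + m}. g i)"
      by (rule prod.atLeastLessThan_concat[symmetric]) auto
    also have "(\<Prod>i\<in>{n..<n + m}. g i) = (\<Prod>k\<in>{0..<m}. g (n + k))"
      using prod.shift_bounds_nat_ivl[of g 0 n m] by (simp add: add.commute)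
    finally show ?thesis .
  qed
  have one: "(\<Prod>i\<in>{1..<n}. g i) = (\<Prod>k\<in>{0..<m}. g (Suc k))" for g :: "nat \<Rightarrow> 'k"
    unfolding n One_nat_def by (rule prod.shift_bounds_Suc_ivl)
  have vdm_r: "vdm (n + m) (r f) = vdm n (nth s) * (\<Prod>k\<in>{0..<m}. (- 1) ^ (n + k)) *
      (\<Prod>i\<in>{1..<n}. prod_list (map (\<lambda>x. x + f i) s) * (\<Prod>l\<in>{1..<i}. f i - f l))" for f
  proof -
    have row: "(\<Prod>i\<in>{0..<n + k}. r f (n + k) - r f i) = (- 1) ^ (n + k) *
        (prod_list (map (\<lambda>x. x + f (Suc k)) s) * (\<Prod>l\<in>{1..<Suc k}. f (Suc k) - f l))" for k
    proof -
      have "(\<Prod>i\<in>{0..<n + k}. r f (n + k) - r f i) =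
          (\<Prod>i\<in>{0..<n}. r f (n + k) - r f i) * (\<Prod>l\<in>{n..<n + k}. r f (n + k) - r f l)"
        by (rule prod.atLeastLessThan_concat[symmetric]) auto
      also have "(\<Prod>l\<in>{n..<n + k}. r f (n + k) - r f l) = (\<Prod>l\<in>{0..<k}. r f (n + k) - r f (n + l))"
        using prod.shift_bounds_nat_ivl[of "\<lambda>i. r f (n + k) - r f i" 0 n k] by (simp add: add.commute)
      also have "(\<Prod>i\<in>{0..<n}. r f (n + k) - r f i) = (\<Prod>i\<in>{0..<n}. (- 1) * (s ! i + f (Suc k)))"
        by (rule prod.cong) (auto simp: r_def)
      also have "\<dots> = (- 1) ^ n * prod_list (map (\<lambda>x. x + f (Suc k)) s)"
        unfolding prod.distrib using prod.list_conv_set_nth[of "map (\<lambda>x. x + f (Suc k)) s"] len by simp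
      also have "(\<Prod>l\<in>{0..<k}. r f (n + k) - r f (n + l)) = (\<Prod>l\<in>{0..<k}. (- 1) * (f (Suc k) - f (Suc l)))"
        by (rule prod.cong) (auto simp: r_def)
      also have "\<dots> = (- 1) ^ k * (\<Prod>l\<in>{1..<Suc k}. f (Suc k) - f l)"
        unfolding prod.distrib One_nat_def prod.shift_bounds_Suc_ivl by simp
      finally show ?thesis by (simp add: power_add mult_ac)
    qed
    have "vdm (n + m) (r f) = vdm n (r f) * (\<Prod>k\<in>{0..<m}. \<Prod>i\<in>{0..<n + k}. r f (n + k) - r f i)"
      unfolding vdm_def by (rule split)
    also have "vdm n (r f) = vdm n (nth s)" by (rule vdm_cong) (simp add: r_def)
    finally show ?thesis unfolding row prod.distrib one[of "\<lambda>i. prod_list (map (\<lambda>x. x + f i) s)"]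
        one[of "\<lambda>i. \<Prod>l\<in>{1..<i}. f i - f l"] by (simp only: mult.assoc)
  qed
  have "vdm n (nth s) * psi n (prodl (Up n 1) s * yz_factor y z n 1) * (\<Prod>k\<in>{0..<m}. (- 1) ^ (n + k)) =
      (\<Sum>f\<in>?F. (\<Prod>i\<in>{1..<n}. ?wt f i) * vdm (n + m) (r f))"
    unfolding psi_yz_factor[OF len] sum_distrib_left sum_distrib_right vdm_r
    by (rule sum.cong) (simp_all add: divide_inverse prod.distrib mult_ac)
  also have "\<dots> = psum {0..<n + m} (\<lambda>p. \<Sum>f\<in>?F. (\<Prod>i\<in>{1..<n}. ?wt f i) * (\<Prod>i\<in>{0..<n + m}. r f i ^ p i))"
    unfolding psum_sum psum_scale vandermonde ..
  also have "\<dots> = psum {0..<n + m} (\<lambda>p. \<Prod>i\<in>{0..<n + m}.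
      (if i < n then (s ! i) ^ p i else (- 1) ^ p i * hsum (p i) (V (Suc (i - n)))))"
  proof (rule psum_cong)
    fix p :: "nat \<Rightarrow> nat"
    have low: "(\<Prod>i\<in>{0..<n}. r f i ^ p i) = (\<Prod>i\<in>{0..<n}. (s ! i) ^ p i)" for f
      by (rule prod.cong) (auto simp: r_def)
    have high: "(\<Prod>k\<in>{0..<m}. r f (n + k) ^ p (n + k)) = (\<Prod>i\<in>{1..<n}. (- f i) ^ p (n + i - 1))" for f
      unfolding one by (simp add: r_def)
    have "(\<Sum>f\<in>?F. (\<Prod>i\<in>{1..<n}. ?wt f i) * (\<Prod>i\<in>{0..<n + m}. r f i ^ p i)) =
        (\<Prod>i\<in>{0..<n}. (s ! i) ^ p i) * (\<Sum>f\<in>?F. \<Prod>i\<in>{1..<n}. ?wt f i * (- f i) ^ p (n + i - 1))"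
      unfolding split low high sum_distrib_left prod.distrib by (rule sum.cong) (simp_all only: mult_ac)
    also have "(\<Sum>f\<in>?F. \<Prod>i\<in>{1..<n}. ?wt f i * (- f i) ^ p (n + i - 1)) =
        (\<Prod>i\<in>{1..<n}. \<Sum>v\<in>V i. inverse (\<Prod>u\<in>V i - {v}. v - u) * (- v) ^ p (n + i - 1))"
      by (rule prod_sum_PiE[symmetric]) (auto simp: finite_V)
    also have "\<dots> = (\<Prod>i\<in>{1..<n}. (- 1) ^ p (n + i - 1) * hsum (p (n + i - 1)) (V i))"
    proof (rule prod.cong)
      fix i
      show "(\<Sum>v\<in>V i. inverse (\<Prod>u\<in>V i - {v}. v - u) * (- v) ^ p (n + i - 1)) =
          (- 1) ^ p (n + i - 1) * hsum (p (n + i - 1)) (V i)"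
        unfolding hsum_def sum_distrib_left
      proof (rule sum.cong)
        fix v assume "v \<in> V i"
        have "(- v) ^ p (n + i - 1) = (- 1) ^ p (n + i - 1) * v ^ p (n + i - 1)" by (rule power_minus)
        then show "inverse (\<Prod>u\<in>V i - {v}. v - u) * (- v) ^ p (n + i - 1) =
            (- 1) ^ p (n + i - 1) * (v ^ p (n + i - 1) / (\<Prod>u\<in>V i - {v}. v - u))"
          by (simp only: divide_inverse mult_ac)
      qed simp
    qed simp
    also have "\<dots> = (\<Prod>k\<in>{0..<m}. (- 1) ^ p (n + k) * hsum (p (n + k)) (V (Suc k)))"
      unfolding one by simp
    finally show "(\<Sum>f\<in>?F. (\<Prod>i\<in>{1..<n}. ?wt f i) * (\<Prod>i\<in>{0..<n + m}. r f i ^ p i)) =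
        (\<Prod>i\<in>{0..<n + m}. (if i < n then (s ! i) ^ p i else (- 1) ^ p i * hsum (p i) (V (Suc (i - n)))))"
      unfolding split by simp
  qed
  finally show ?thesis unfolding N m_def[symmetric] .
qed

text \<open>
  A minor in the last rows can only be nonzero for columns \<open>\<ge> 2 k + 1\<close> in row \<open>n + k\<close>, because the
  divided difference of a power of too low degree vanishes; this is the bound that singles out the
  partitions inside the staircase.
\<close>

lemma alternant_expansion:
  fixes s :: "'k list"
  assumes len: "length s = n"
  shows "vdm n (nth s) * psi n (prodl (Up n 1) s * yz_factor y z n 1) = (\<Prod>j\<in>{0..<n}. (- 1) ^ j) *
    (\<Sum>l\<in>staircase_parts n. flag_minor l * psum {0..<n} (\<lambda>p. \<Prod>i\<in>{0..<n}. (s ! i) ^ beta_perm n l (p i)))"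
proof -
  define m where "m = n - 1"
  have N: "2 * n - 1 = n + m" using n_pos by (auto simp: m_def)
  let ?a = "\<lambda>i c. (if i < n then (s ! i) ^ c else (- 1) ^ c * hsum c (V (Suc (i - n))))"
  let ?E = "\<Prod>k\<in>{0..<m}. (- 1 :: 'k) ^ (n + k)"
  let ?\<rho> = "beta_perm n"
  have "vdm n (nth s) * psi n (prodl (Up n 1) s * yz_factor y z n 1) * ?E =
      psum {0..<n + m} (\<lambda>p. \<Prod>i\<in>{0..<n + m}. ?a i (p i))"
    using vandermonde_row_sum[OF len] unfolding N m_def[symmetric] .
  also have "\<dots> = (\<Sum>l\<in>staircase_parts n. of_int (sign (?\<rho> l)) *
      psum {0..<n} (\<lambda>p. \<Prod>i\<in>{0..<n}. ?a i (?\<rho> l (p i))) *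
      psum {n..<n + m} (\<lambda>t. \<Prod>i\<in>{n..<n + m}. ?a i (?\<rho> l (t i))))"
  proof (rule laplace_blocks)
    show "finite (staircase_parts n)" by (rule finite_staircase_parts[OF n_pos])
    show "inj_on (\<lambda>l. ?\<rho> l ` {0..<n}) (staircase_parts n)" by (rule inj_beta_perm[OF n_pos])
    show "?\<rho> l permutes {0..<n + m}" if "l \<in> staircase_parts n" for l
    proof -
      interpret staircase_partition n l by standard (rule n_pos, rule that)
      show ?thesis using beta_perm_permutes unfolding N .
    qed
    fix p assume p: "p permutes {0..<n + m}" "p ` {0..<n} \<notin> (\<lambda>l. ?\<rho> l ` {0..<n}) ` staircase_parts n"
    have "\<not> (\<forall>k<m. 2 * k + 1 \<le> p (n + k))"
      using beta_perm_surj[OF n_pos, of p] p unfolding N m_def[symmetric] by blast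
    then obtain k where k: "k < m" "p (n + k) < 2 * k + 1" by (auto simp: not_le)
    have "hsum (p (n + k)) (V (Suc k)) = 0"
    proof -
      have "Suc (p (n + k)) < card (V (Suc k))" using card_V[of "Suc k"] k by (simp add: m_def)
      then show ?thesis using hsum_low[OF finite_V, of "p (n + k)" "Suc k"] by blast
    qed
    then have "?a (n + k) (p (n + k)) = 0" by simp
    then show "(\<Prod>i\<in>{n..<n + m}. ?a i (p i)) = 0"
      by (intro prod_zero bexI[of _ "n + k"]) (use k in auto)
  qed simp
  also have "\<dots> = (\<Sum>l\<in>staircase_parts n. ((\<Prod>j\<in>{0..<n}. (- 1) ^ j) * ?E) *
      (flag_minor l * psum {0..<n} (\<lambda>p. \<Prod>i\<in>{0..<n}. (s ! i) ^ ?\<rho> l (p i))))"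
  proof (rule sum.cong)
    fix l assume "l \<in> staircase_parts n"
    then interpret staircase_partition n l by (intro staircase_partition.intro n_pos)
    have first: "psum {0..<n} (\<lambda>p. \<Prod>i\<in>{0..<n}. ?a i (?\<rho> l (p i))) = psum {0..<n} (\<lambda>p. \<Prod>i\<in>{0..<n}. (s ! i) ^ ?\<rho> l (p i))"
      by (intro psum_cong prod.cong) auto
    have "psum {n..<n + m} (\<lambda>t. \<Prod>i\<in>{n..<n + m}. ?a i (?\<rho> l (t i))) =
        psum {0..<m} (\<lambda>t. \<Prod>i\<in>{0..<m}. ?a (n + i) (?\<rho> l (n + t i)))"
      by (rule psum_shift)
    also have "\<dots> = psum {0..<m} (\<lambda>t. (\<Prod>i\<in>{0..<m}. (- 1) ^ ?\<rho> l (n + i)) * (\<Prod>i\<in>{0..<m}. hsum (?\<rho> l (n + t i)) (V (Suc i))))"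
    proof (rule psum_cong)
      fix t assume t: "t permutes {0..<m}"
      have "(\<Prod>i\<in>{0..<m}. ?a (n + i) (?\<rho> l (n + t i))) =
          (\<Prod>i\<in>{0..<m}. (- 1) ^ ?\<rho> l (n + t i)) * (\<Prod>i\<in>{0..<m}. hsum (?\<rho> l (n + t i)) (V (Suc i)))"
        by (simp add: prod.distrib)
      then show "(\<Prod>i\<in>{0..<m}. ?a (n + i) (?\<rho> l (n + t i))) =
          (\<Prod>i\<in>{0..<m}. (- 1) ^ ?\<rho> l (n + i)) * (\<Prod>i\<in>{0..<m}. hsum (?\<rho> l (n + t i)) (V (Suc i)))"
        using prod_permute[OF t, of "\<lambda>i. (- 1 :: 'k) ^ ?\<rho> l (n + i)"] by simp
    qed
    also have "\<dots> = (\<Prod>i\<in>{0..<m}. (- 1) ^ ?\<rho> l (n + i)) * flag_minor l"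
      unfolding psum_scale flag_minor_psum m_def ..
    finally have second: "psum {n..<n + m} (\<lambda>t. \<Prod>i\<in>{n..<n + m}. ?a i (?\<rho> l (t i))) =
      (\<Prod>i\<in>{0..<m}. (- 1) ^ ?\<rho> l (n + i)) * flag_minor l" .
    have sgn: "of_int (sign (?\<rho> l)) * (\<Prod>k\<in>{0..<m}. (- 1) ^ ?\<rho> l (n + k)) = (\<Prod>j\<in>{0..<n}. (- 1) ^ j) * ?E"
      using sign_beta_perm[where ?'a = 'k] by (simp only: m_def)
    show "of_int (sign (?\<rho> l)) * psum {0..<n} (\<lambda>p. \<Prod>i\<in>{0..<n}. ?a i (?\<rho> l (p i))) *
        psum {n..<n + m} (\<lambda>t. \<Prod>i\<in>{n..<n + m}. ?a i (?\<rho> l (t i))) = ((\<Prod>j\<in>{0..<n}. (- 1) ^ j) * ?E) *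
        (flag_minor l * psum {0..<n} (\<lambda>p. \<Prod>i\<in>{0..<n}. (s ! i) ^ ?\<rho> l (p i)))"
      unfolding first second sgn[symmetric] by (simp only: mult_ac)
  qed simp
  finally have eq: "vdm n (nth s) * psi n (prodl (Up n 1) s * yz_factor y z n 1) * ?E = ((\<Prod>j\<in>{0..<n}. (- 1) ^ j) *
      (\<Sum>l\<in>staircase_parts n. flag_minor l * psum {0..<n} (\<lambda>p. \<Prod>i\<in>{0..<n}. (s ! i) ^ ?\<rho> l (p i)))) * ?E"
    unfolding sum_distrib_left[symmetric] by (simp only: mult_ac)
  have "?E \<noteq> 0" by simp
  then show ?thesis using eq by (simp only: mult_cancel_right)  blast
qed

lemma dmono_eq: "dmono s = (\<Prod>i\<in>{0..<length s}. (s ! i) ^ (length s - i))"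
proof (induction s)
  case (Cons x s)
  then show ?case by (simp add: prod.atLeast0_lessThan_Suc_shift del: prod.op_ivl_Suc)
qed simp

text \<open>The exponents \<open>n - i\<close> are those of a Vandermonde product in reversed order, shifted by one.\<close>

lemma staircase_alternant:
  fixes s :: "'k list"
  assumes len: "length s = n"
  shows "psum {0..<n} (\<lambda>p. \<Prod>i\<in>{0..<n}. (s ! p i) ^ (n - i)) = (\<Prod>j\<in>{0..<n}. (- 1) ^ j) * prod_list s * vdm n (nth s)"
proof -
  define w where "w i = (if i < n then n - 1 - i else i)" for i
  have w: "w permutes {0..<n}"
  proof (rule bij_imp_permutes)
    show "bij_betw w {0..<n} {0..<n}" by (rule bij_betwI[of _ _ _ w]) (auto simp: w_def)
  qed (auto simp: w_def)
  have "real_of_int (sign w) = (\<Prod>j\<in>{0..<n}. \<Prod>i\<in>{0..<j}. - 1)"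
    unfolding sign_eq_prod[OF w] by (intro prod.cong refl) (auto simp: w_def)
  also have "\<dots> = real_of_int (\<Prod>j\<in>{0..<n}. (- 1) ^ j)" by simp
  finally have "sign w = (\<Prod>j\<in>{0..<n}. (- 1) ^ j)" by (simp only: of_int_eq_iff)
  then have sgn: "of_int (sign w) = (\<Prod>j\<in>{0..<n}. (- 1 :: 'k) ^ j)" by simp
  have "psum {0..<n} (\<lambda>p. \<Prod>i\<in>{0..<n}. (s ! p i) ^ (n - i)) =
      psum {0..<n} (\<lambda>p. prod_list s * (\<Prod>i\<in>{0..<n}. (s ! p i) ^ w i))"
  proof (rule psum_cong)
    fix p assume p: "p permutes {0..<n}"
    have "(\<Prod>i\<in>{0..<n}. (s ! p i) ^ (n - i)) = (\<Prod>i\<in>{0..<n}. s ! p i * (s ! p i) ^ w i)"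
    proof (rule prod.cong)
      fix i assume "i \<in> {0..<n}"
      then have "n - i = Suc (w i)" by (simp add: w_def)
      then show "(s ! p i) ^ (n - i) = s ! p i * (s ! p i) ^ w i" by simp
    qed simp
    also have "\<dots> = (\<Prod>i\<in>{0..<n}. s ! p i) * (\<Prod>i\<in>{0..<n}. (s ! p i) ^ w i)" by (rule prod.distrib)
    also have "(\<Prod>i\<in>{0..<n}. s ! p i) = prod_list s"
      using prod_permute[OF p, of "nth s"] prod.list_conv_set_nth[of s] len by simp
    finally show "(\<Prod>i\<in>{0..<n}. (s ! p i) ^ (n - i)) = prod_list s * (\<Prod>i\<in>{0..<n}. (s ! p i) ^ w i)" .
  qed
  also have "\<dots> = prod_list s * psum {0..<n} (\<lambda>p. \<Prod>i\<in>{0..<n}. (s ! i) ^ (w \<circ> p) i)"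
    unfolding psum_scale psum_swap[of n "\<lambda>i j. (s ! i) ^ w j"] by simp
  also have "psum {0..<n} (\<lambda>p. \<Prod>i\<in>{0..<n}. (s ! i) ^ (w \<circ> p) i) = of_int (sign w) * vdm n (nth s)"
    by (subst psum_compose_left[OF _ w]) (simp_all add: vandermonde)
  finally show ?thesis unfolding sgn by (simp only: mult_ac)
qed

text \<open>
  The integrand is a symmetric function times \<open>dmono\<close>; since the weights are antisymmetric, \<open>dmono\<close>
  may be replaced by its antisymmetrisation, a Vandermonde product.  After the expansion each
  alternant is replaced by a single monomial in the same way.
\<close>

lemma resid_yz_factor:
  assumes X: "finite X"
  shows "resid n X (\<lambda>s. dmono s * psi n (prodl (Up n 1) s * yz_factor y z n 1)) =
    (\<Sum>l\<in>staircase_parts n. flag_minor l * resid n X (\<lambda>s. \<Prod>i\<in>{0..<n}. (s ! i) ^ Suc (beta_perm n l i)))"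
proof -
  let ?\<epsilon> = "\<Prod>j\<in>{0..<n}. (- 1 :: 'k) ^ j"
  let ?\<Psi> = "\<lambda>s. psi n (prodl (Up n 1) s * yz_factor y z n 1)"
  let ?M = "\<lambda>l s. \<Prod>i\<in>{0..<n}. (s ! i) ^ Suc (beta_perm n l i)"
  have key: "psum {0..<n} (\<lambda>p. dmono (permute_list p s) * ?\<Psi> (permute_list p s)) =
      (\<Sum>l\<in>staircase_parts n. flag_minor l * psum {0..<n} (\<lambda>p. ?M l (permute_list p s)))"
    if len: "length s = n" for s :: "'k list"
  proof -
    have perm: "p permutes {..<length s}" if "p permutes {0..<n}" for p
      using that len by (simp add: atLeast0LessThan)
    have mono: "(\<Prod>i\<in>{0..<n}. (permute_list p s ! i) ^ e i) = (\<Prod>i\<in>{0..<n}. (s ! p i) ^ e i)"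
      if "p permutes {0..<n}" for p e
      using permute_list_nth[OF perm[OF that]] len by (intro prod.cong) auto
    have sq: "?\<epsilon> * ?\<epsilon> = 1" by (simp flip: prod.distrib power_mult_distrib)
    have mono_l: "prod_list s * psum {0..<n} (\<lambda>p. \<Prod>i\<in>{0..<n}. (s ! i) ^ beta_perm n l (p i)) =
        psum {0..<n} (\<lambda>p. ?M l (permute_list p s))" for l
      unfolding psum_swap[of n "\<lambda>i j. (s ! i) ^ beta_perm n l j", symmetric] psum_scale[symmetric]
    proof (rule psum_cong)
      fix p assume p: "p permutes {0..<n}"
      have "prod_list s = (\<Prod>i\<in>{0..<n}. s ! p i)"
        using prod_permute[OF p, of "nth s"] prod.list_conv_set_nth[of s] len by simp
      then show "prod_list s * (\<Prod>i\<in>{0..<n}. (s ! p i) ^ beta_perm n l i) = ?M l (permute_list p s)"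
        unfolding mono[OF p] by (simp add: prod.distrib)
    qed
    have "psum {0..<n} (\<lambda>p. dmono (permute_list p s) * ?\<Psi> (permute_list p s)) =
        psum {0..<n} (\<lambda>p. ?\<Psi> s * (\<Prod>i\<in>{0..<n}. (s ! p i) ^ (n - i)))"
    proof (rule psum_cong)
      fix p assume p: "p permutes {0..<n}"
      have "prodl (Up n 1 :: 'k \<Rightarrow> 'k lop) (permute_list p s) = prodl (Up n 1) s"
        by (rule prodl_perm) (auto intro: Up_commute simp: perm[OF p])
      then show "dmono (permute_list p s) * ?\<Psi> (permute_list p s) = ?\<Psi> s * (\<Prod>i\<in>{0..<n}. (s ! p i) ^ (n - i))"
        using mono[OF p] len by (simp add: dmono_eq mult.commute)
    qed
    also have "\<dots> = ?\<epsilon> * prod_list s * (vdm n (nth s) * ?\<Psi> s)"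
      unfolding psum_scale staircase_alternant[OF len] by (simp only: mult_ac)
    also have "\<dots> = (?\<epsilon> * ?\<epsilon>) * (\<Sum>l\<in>staircase_parts n. flag_minor l *
        (prod_list s * psum {0..<n} (\<lambda>p. \<Prod>i\<in>{0..<n}. (s ! i) ^ beta_perm n l (p i))))"
      unfolding alternant_expansion[OF len] sum_distrib_left by (rule sum.cong) (simp_all only: mult_ac)
    also have "\<dots> = (\<Sum>l\<in>staircase_parts n. flag_minor l *
        (prod_list s * psum {0..<n} (\<lambda>p. \<Prod>i\<in>{0..<n}. (s ! i) ^ beta_perm n l (p i))))"
      unfolding sq by simp
    also have "\<dots> = (\<Sum>l\<in>staircase_parts n. flag_minor l * psum {0..<n} (\<lambda>p. ?M l (permute_list p s)))"
      unfolding mono_l ..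
    finally show ?thesis .
  qed
  have alt: "resid n X (\<lambda>s. psum {0..<n} (\<lambda>p. ?M l (permute_list p s))) = of_nat (fact n) * resid n X (?M l)" for l
    by (rule resid_alternating[OF X])
  have "of_nat (fact n) * resid n X (\<lambda>s. dmono s * ?\<Psi> s) =
      resid n X (\<lambda>s. \<Sum>l\<in>staircase_parts n. flag_minor l * psum {0..<n} (\<lambda>p. ?M l (permute_list p s)))"
    unfolding resid_alternating[OF X, symmetric] by (rule resid_cong[OF X]) (rule key)
  also have "\<dots> = of_nat (fact n) * (\<Sum>l\<in>staircase_parts n. flag_minor l * resid n X (?M l))"
    unfolding resid_sum[OF finite_staircase_parts[OF n_pos]] resid_scale alt
      sum_distrib_left by (rule sum.cong) (simp_all only: mult_ac)
  finally show ?thesis by simp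
qed

end

section \<open>Coefficients of the raising operator series\<close>

lemma mps_nth_Abs [simp]: "mps_nth (Abs_mps f) = f"
  by (simp add: Abs_mps_inverse)

lemma mps_nth_mult: "mps_nth (f * g) m = (\<Sum>(a, b) | a + b = m. mps_nth f a * mps_nth g b)"
  by (simp add: times_mps.rep_eq)

lemma mps_nth_var: "mps_nth (mps_var v) m = (if m = Poly_Mapping.single v 1 then 1 else 0)"
  by (simp add: mps_var_def)

lemma keys_minus_single:
  "Poly_Mapping.keys (m - Poly_Mapping.single v (Poly_Mapping.lookup m v)) = Poly_Mapping.keys m - {v}"
  by (auto simp: in_keys_iff lookup_minus lookup_single when_def split: if_splits)

definition cc :: "nat \<Rightarrow> int" where
  "cc k = (if k = 0 then 1 else 2 * (- 1) ^ k)"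

text \<open>A series in which only the powers of a single variable occur.\<close>

definition useries :: "'v \<Rightarrow> (nat \<Rightarrow> 'a) \<Rightarrow> ('v, 'a :: comm_ring_1) mps" where
  "useries v c = Abs_mps (\<lambda>m. if Poly_Mapping.keys m \<subseteq> {v} then c (Poly_Mapping.lookup m v) else 0)"

lemma useries_nth: "mps_nth (useries v c) m = (if Poly_Mapping.keys m \<subseteq> {v} then c (Poly_Mapping.lookup m v) else 0)"
  by (simp add: useries_def)

lemma single_of_keys: "Poly_Mapping.keys m \<subseteq> {v} \<Longrightarrow> m = Poly_Mapping.single v (Poly_Mapping.lookup m v)"
  by (rule poly_mapping_eqI) (auto simp: lookup_single when_def in_keys_iff)

lemma useries_mult:
  fixes g :: "('v, 'a :: comm_ring_1) mps"
  assumes "\<And>b. mps_nth g b \<noteq> 0 \<Longrightarrow> Poly_Mapping.lookup b v = 0"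
  shows "mps_nth (useries v c * g) m =
    c (Poly_Mapping.lookup m v) * mps_nth g (m - Poly_Mapping.single v (Poly_Mapping.lookup m v))"
proof -
  let ?k = "Poly_Mapping.lookup m v"
  let ?s = "Poly_Mapping.single v ?k"
  have sum: "?s + (m - ?s) = m"
    by (rule poly_mapping_eqI) (auto simp: lookup_add lookup_minus lookup_single when_def)
  have "mps_nth (useries v c * g) m = (\<Sum>(a, b)\<in>{(?s, m - ?s)}. mps_nth (useries v c) a * mps_nth g b)"
    unfolding mps_nth_mult
  proof (rule sum.mono_neutral_right[OF finite_mono_antidiag])
    show "{(?s, m - ?s)} \<subseteq> {(a, b). a + b = m}" using sum by simp
    show "\<forall>ab\<in>{(a, b). a + b = m} - {(?s, m - ?s)}. (case ab of (a, b) \<Rightarrow> mps_nth (useries v c) a * mps_nth g b) = 0"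
    proof
      fix ab assume ab: "ab \<in> {(a, b). a + b = m} - {(?s, m - ?s)}"
      obtain a b where ab': "ab = (a, b)" by (cases ab)
      have m: "a + b = m" and ne: "(a, b) \<noteq> (?s, m - ?s)" using ab ab' by auto
      have "mps_nth (useries v c) a = 0 \<or> mps_nth g b = 0"
      proof (rule ccontr)
        assume "\<not> ?thesis"
        then have a: "Poly_Mapping.keys a \<subseteq> {v}" and b: "Poly_Mapping.lookup b v = 0"
          using assms by (auto simp: useries_nth split: if_splits)
        have "Poly_Mapping.lookup a v = ?k" using b m by (auto simp: lookup_add)
        then have "a = ?s" using single_of_keys[OF a] by simp
        moreover have "b = m - a" using m by auto
        ultimately show False using ne by simp
      qed
      then show "(case ab of (a, b) \<Rightarrow> mps_nth (useries v c) a * mps_nth g b) = 0" using ab' by auto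
    qed
  qed
  also have "\<dots> = mps_nth (useries v c) ?s * mps_nth g (m - ?s)" by simp
  also have "mps_nth (useries v c) ?s = c ?k" by (simp add: useries_nth lookup_single)
  finally show ?thesis .
qed

lemma mps_var_mult:
  fixes g :: "('v, 'a :: comm_ring_1) mps"
  shows "mps_nth (mps_var v * g) m =
    (if Poly_Mapping.lookup m v = 0 then 0 else mps_nth g (m - Poly_Mapping.single v 1))"
proof -
  let ?s = "Poly_Mapping.single v (1 :: nat)"
  have "mps_nth (mps_var v * g) m = (\<Sum>(a, b)\<in>{(a, b). a + b = m \<and> a = ?s}. mps_nth g b)"
    unfolding mps_nth_mult
    by (rule sum.mono_neutral_cong_right[OF finite_mono_antidiag]) (auto simp: mps_nth_var split: if_splits)
  also have "{(a, b). a + b = m \<and> a = ?s} = (if Poly_Mapping.lookup m v = 0 then {} else {(?s, m - ?s)})"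
  proof (cases "Poly_Mapping.lookup m v = 0")
    case True
    have "a + b \<noteq> m" if "a = ?s" for a b
    proof
      assume "a + b = m"
      then have "Poly_Mapping.lookup m v = Poly_Mapping.lookup a v + Poly_Mapping.lookup b v"
        using lookup_add by metis
      then show False using True that by (simp add: lookup_single)
    qed
    then show ?thesis using True by auto
  next
    case False
    then have eq: "?s + (m - ?s) = m"
      by (intro poly_mapping_eqI) (auto simp: lookup_add lookup_minus lookup_single when_def)
    have "{(a, b). a + b = m \<and> a = ?s} = {(?s, m - ?s)}"
    proof (rule Set.set_eqI)
      fix ab :: "('v \<Rightarrow>\<^sub>0 nat) \<times> ('v \<Rightarrow>\<^sub>0 nat)"
      obtain a b where ab: "ab = (a, b)" by (cases ab)
      have "a + b = m \<and> a = ?s \<longleftrightarrow> a = ?s \<and> b = m - ?s"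
      proof
        assume h: "a + b = m \<and> a = ?s"
        then have m: "m = ?s + b" by blast
        have "b = m - ?s" unfolding m by (simp only: add_diff_cancel_left')
        then show "a = ?s \<and> b = m - ?s" using h by blast
      next
        assume h: "a = ?s \<and> b = m - ?s"
        show "a + b = m \<and> a = ?s" unfolding h[THEN conjunct1] h[THEN conjunct2] using eq by blast
      qed
      then show "ab \<in> {(a, b). a + b = m \<and> a = ?s} \<longleftrightarrow> ab \<in> {(?s, m - ?s)}" unfolding ab by simp
    qed
    then show ?thesis using False by simp
  qed
  finally show ?thesis by simp
qed

lemma mps_raising_factor:
  fixes v :: 'v
  shows "(1 - mps_var v) * unit_inv (1 + mps_var v :: ('v, int) mps) = useries v cc"
proof -
  have keys: "Poly_Mapping.keys (m - Poly_Mapping.single v 1) \<subseteq> {v} \<longleftrightarrow> Poly_Mapping.keys m \<subseteq> {v}" for m :: "'v \<Rightarrow>\<^sub>0 nat"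
    by (auto simp: in_keys_iff lookup_minus lookup_single when_def subset_iff split: if_splits)
  have zero: "m = 0" if "Poly_Mapping.keys m \<subseteq> {v}" "Poly_Mapping.lookup m v = 0" for m :: "'v \<Rightarrow>\<^sub>0 nat"
    using single_of_keys[OF that(1)] that(2) by simp
  let ?E = "useries v (\<lambda>k. (- 1) ^ k) :: ('v, int) mps"
  have "(1 + mps_var v) * ?E = 1"
  proof (rule mps_eqI)
    fix m :: "'v \<Rightarrow>\<^sub>0 nat"
    have "mps_nth ((1 + mps_var v) * ?E) m = mps_nth ?E m + mps_nth (mps_var v * ?E) m"
      by (simp add: distrib_right plus_mps.rep_eq)
    also have "\<dots> = mps_nth 1 m"
      using zero[of m] keys[of m] unfolding mps_var_mult useries_nth one_mps.rep_eq
      by (cases "Poly_Mapping.lookup m v") (auto simp: lookup_minus lookup_single)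
    finally show "mps_nth ((1 + mps_var v) * ?E) m = mps_nth 1 m" .
  qed
  then have "unit_inv (1 + mps_var v) = ?E" by (rule unit_inv_eqI)
  moreover have "(1 - mps_var v) * ?E = useries v cc"
  proof (rule mps_eqI)
    fix m :: "'v \<Rightarrow>\<^sub>0 nat"
    have "mps_nth ((1 - mps_var v) * ?E) m = mps_nth ?E m - mps_nth (mps_var v * ?E) m"
      by (simp add: left_diff_distrib minus_mps.rep_eq)
    also have "\<dots> = mps_nth (useries v cc) m"
      using keys[of m] unfolding mps_var_mult useries_nth
      by (cases "Poly_Mapping.lookup m v") (auto simp: lookup_minus lookup_single cc_def)
    finally show "mps_nth ((1 - mps_var v) * ?E) m = mps_nth (useries v cc) m" .
  qed
  ultimately show ?thesis by simp
qed

text \<open>The factors involve distinct variables, so every coefficient of the product is a single product.\<close>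

lemma raising_product_nth:
  fixes P :: "'v set"
  assumes "finite P"
  shows "mps_nth (\<Prod>p\<in>P. (1 - mps_var p) * unit_inv (1 + mps_var p)) m =
    (if Poly_Mapping.keys m \<subseteq> P then \<Prod>p\<in>P. cc (Poly_Mapping.lookup m p) else 0)"
  using assms
proof (induction P arbitrary: m rule: finite_induct)
  case empty
  then show ?case by (auto simp: one_mps.rep_eq)
next
  case (insert v P)
  let ?G = "\<Prod>p\<in>P. (1 - mps_var p) * unit_inv (1 + mps_var p) :: ('v, int) mps"
  let ?m = "m - Poly_Mapping.single v (Poly_Mapping.lookup m v)"
  have "Poly_Mapping.lookup b v = 0" if "mps_nth ?G b \<noteq> 0" for b
    using that insert by (auto simp: insert.IH in_keys_iff split: if_splits)
  then have "mps_nth (useries v cc * ?G) m = cc (Poly_Mapping.lookup m v) * mps_nth ?G ?m"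
    by (rule useries_mult)
  moreover have "(\<Prod>p\<in>P. cc (Poly_Mapping.lookup ?m p)) = (\<Prod>p\<in>P. cc (Poly_Mapping.lookup m p))"
    using insert.hyps by (intro prod.cong) (auto simp: lookup_minus lookup_single when_def)
  moreover have "Poly_Mapping.keys m - {v} \<subseteq> P \<longleftrightarrow> Poly_Mapping.keys m \<subseteq> insert v P" by auto
  moreover have "mps_nth (\<Prod>p\<in>insert v P. (1 - mps_var p) * unit_inv (1 + mps_var p)) m = mps_nth (useries v cc * ?G) m"
    by (simp only: prod.insert[OF insert.hyps] mps_raising_factor[of v])
  ultimately show ?case
    unfolding insert.IH keys_minus_single prod.insert[OF insert.hyps] by simp
qed

section \<open>The raising operator formula as a finite sum\<close>

definition raise_by :: "(nat \<times> nat \<Rightarrow> nat) \<Rightarrow> int list \<Rightarrow> int list" where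
  "raise_by M \<alpha> = map (\<lambda>k. \<alpha> ! k + (\<Sum>j<length \<alpha>. int (M (k, j))) - (\<Sum>i<length \<alpha>. int (M (i, k)))) [0..<length \<alpha>]"

definition exponents :: "nat \<Rightarrow> nat \<Rightarrow> (nat \<times> nat \<Rightarrow> nat) set" where
  "exponents l B = {M. \<forall>p. (p \<in> raising_pairs l \<longrightarrow> M p \<in> {..B}) \<and> (p \<notin> raising_pairs l \<longrightarrow> M p = 0)}"

definition Q_sum :: "(int \<Rightarrow> 'a :: comm_ring_1) \<Rightarrow> nat \<Rightarrow> int list \<Rightarrow> 'a" where
  "Q_sum q B \<alpha> = (\<Sum>M\<in>exponents (length \<alpha>) B.
     of_int (\<Prod>p\<in>raising_pairs (length \<alpha>). cc (M p)) * prod_list (map q (raise_by M \<alpha>)))"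

lemma finite_raising_pairs: "finite (raising_pairs l)"
  by (rule finite_subset[of _ "{..<l} \<times> {..<l}"]) (auto simp: raising_pairs_def)

lemma finite_exponents: "finite (exponents l B)"
  unfolding exponents_def by (rule finite_set_of_finite_funs) (simp_all add: finite_raising_pairs)

lemma exponents_out: "M \<in> exponents l B \<Longrightarrow> p \<notin> raising_pairs l \<Longrightarrow> M p = 0"
  unfolding exponents_def mem_Collect_eq by (drule spec[of _ p]) blast

lemma exponents_le: "M \<in> exponents l B \<Longrightarrow> M p \<le> B"
  unfolding exponents_def mem_Collect_eq by (drule spec[of _ p]) (cases "p \<in> raising_pairs l", auto)

lemma length_raise_by [simp]: "length (raise_by M \<alpha>) = length \<alpha>"
  by (simp add: raise_by_def)

lemma raise_by_nth: "k < length \<alpha> \<Longrightarrow> raise_by M \<alpha> ! k =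
    \<alpha> ! k + (\<Sum>j<length \<alpha>. int (M (k, j))) - (\<Sum>i<length \<alpha>. int (M (i, k)))"
  by (simp add: raise_by_def)

lemma sum_raise_by: "(\<Sum>k<length \<alpha>. raise_by M \<alpha> ! k) = (\<Sum>k<length \<alpha>. \<alpha> ! k)"
proof -
  have "(\<Sum>k<length \<alpha>. raise_by M \<alpha> ! k) = (\<Sum>k<length \<alpha>. \<alpha> ! k) +
      (\<Sum>k<length \<alpha>. \<Sum>j<length \<alpha>. int (M (k, j))) - (\<Sum>k<length \<alpha>. \<Sum>i<length \<alpha>. int (M (i, k)))"
    by (simp add: raise_by_nth sum.distrib sum_subtractf)
  also have "(\<Sum>k<length \<alpha>. \<Sum>i<length \<alpha>. int (M (i, k))) = (\<Sum>k<length \<alpha>. \<Sum>j<length \<alpha>. int (M (k, j)))"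
    by (rule sum.swap)
  finally show ?thesis by simp
qed

text \<open>
  If no entry becomes negative, then neither does the sum of the entries from position \<open>j\<close> on, and
  \<open>R\<^sub>i\<^sub>j\<close> lowers this sum by one: this bounds all exponents.
\<close>

lemma exponent_bound:
  assumes M: "\<And>p. p \<notin> raising_pairs (length \<alpha>) \<Longrightarrow> M p = 0"
    and pos: "\<And>k. k < length \<alpha> \<Longrightarrow> 0 \<le> raise_by M \<alpha> ! k" and \<alpha>: "\<And>k. k < length \<alpha> \<Longrightarrow> 0 \<le> \<alpha> ! k"
    and ij: "i < j" "j < length \<alpha>"
  shows "int (M (i, j)) \<le> (\<Sum>k<length \<alpha>. \<alpha> ! k)"
proof -
  let ?l = "length \<alpha>" and ?J = "{j..<length \<alpha>}"
  let ?low = "\<Sum>k\<in>?J. \<Sum>i<j. int (M (i, k))" and ?high = "\<Sum>k\<in>?J. \<Sum>i\<in>?J. int (M (i, k))"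
  have "(\<Sum>k\<in>?J. \<Sum>j'<?l. int (M (k, j'))) = (\<Sum>k\<in>?J. \<Sum>j'\<in>?J. int (M (k, j')))"
  proof (rule sum.cong)
    fix k assume "k \<in> ?J"
    then have zero: "int (M (k, j')) = 0" if "j' \<in> {..<?l} - ?J" for j'
      using that M[of "(k, j')"] by (auto simp: raising_pairs_def)
    show "(\<Sum>j'<?l. int (M (k, j'))) = (\<Sum>j'\<in>?J. int (M (k, j')))"
    proof (rule sum.mono_neutral_right)
      show "?J \<subseteq> {..<?l}" by auto
      show "\<forall>j'\<in>{..<?l} - ?J. int (M (k, j')) = 0" using zero by (rule ballI)
    qed simp
  qed simp
  also have "\<dots> = ?high" by (rule sum.swap)
  finally have up: "(\<Sum>k\<in>?J. \<Sum>j'<?l. int (M (k, j'))) = ?high" .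
  have split: "{..<?l} = {..<j} \<union> ?J" using ij by auto
  have "(\<Sum>i<?l. int (M (i, k))) = (\<Sum>i<j. int (M (i, k))) + (\<Sum>i\<in>?J. int (M (i, k)))" for k
    unfolding split by (rule sum.union_disjoint) auto
  then have down: "(\<Sum>k\<in>?J. \<Sum>i<?l. int (M (i, k))) = ?low + ?high" by (simp add: sum.distrib)
  have "0 \<le> (\<Sum>k\<in>?J. raise_by M \<alpha> ! k)" using pos by (intro sum_nonneg) auto
  also have "\<dots> = (\<Sum>k\<in>?J. \<alpha> ! k) + (\<Sum>k\<in>?J. \<Sum>j'<?l. int (M (k, j'))) - (\<Sum>k\<in>?J. \<Sum>i<?l. int (M (i, k)))"
    by (simp add: raise_by_nth sum.distrib sum_subtractf)
  also have "\<dots> = (\<Sum>k\<in>?J. \<alpha> ! k) + ?high - (?low + ?high)"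
    unfolding up down ..
  finally have "?low \<le> (\<Sum>k\<in>?J. \<alpha> ! k)" by simp
  moreover have "(\<Sum>k\<in>?J. \<alpha> ! k) \<le> (\<Sum>k<?l. \<alpha> ! k)" using \<alpha> by (intro sum_mono2) auto
  moreover have "(\<Sum>i<j. int (M (i, j))) \<le> ?low"
    using ij by (intro member_le_sum[of j ?J "\<lambda>k. \<Sum>i<j. int (M (i, k))"]) (auto intro: sum_nonneg)
  moreover have "int (M (i, j)) \<le> (\<Sum>i<j. int (M (i, j)))"
    using ij by (intro member_le_sum[of i "{..<j}" "\<lambda>i. int (M (i, j))"]) auto
  ultimately show ?thesis by linarith
qed

lemma prod_list_eq_zero: "0 \<in> set xs \<Longrightarrow> prod_list xs = (0 :: 'a :: semiring_1)"
  by (induction xs) auto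

lemma Q_fun_eq_sum:
  assumes \<alpha>: "\<And>k. k < length \<alpha> \<Longrightarrow> 0 \<le> \<alpha> ! k" and B: "(\<Sum>k<length \<alpha>. \<alpha> ! k) \<le> int B"
  shows "Q_fun \<alpha> = Q_sum q_fun B \<alpha>"
proof -
  let ?l = "length \<alpha>"
  let ?T = "\<lambda>m. of_int (mps_nth (R_infinity ?l) m) * q_seq (raise_mono m \<alpha>)"
  let ?S = "Poly_Mapping.lookup -` exponents ?l B"
  have raise: "raise_mono m \<alpha> = raise_by (Poly_Mapping.lookup m) \<alpha>" for m
    by (simp add: raise_mono_def raise_by_def)
  have coeff: "mps_nth (R_infinity ?l) m = (if Poly_Mapping.keys m \<subseteq> raising_pairs ?l
      then \<Prod>p\<in>raising_pairs ?l. cc (Poly_Mapping.lookup m p) else 0)" for m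
    unfolding R_infinity_def by (rule raising_product_nth[OF finite_raising_pairs])
  have supp: "{m. ?T m \<noteq> 0} \<subseteq> ?S"
  proof
    fix m assume "m \<in> {m. ?T m \<noteq> 0}"
    then have "mps_nth (R_infinity ?l) m \<noteq> 0" and q: "q_seq (raise_mono m \<alpha>) \<noteq> 0" by auto
    then have keys: "Poly_Mapping.keys m \<subseteq> raising_pairs ?l" unfolding coeff by (auto split: if_splits)
    have out: "Poly_Mapping.lookup m p = 0" if "p \<notin> raising_pairs ?l" for p
      using keys that by (auto simp: in_keys_iff)
    have nonneg: "0 \<le> raise_by (Poly_Mapping.lookup m) \<alpha> ! k" if "k < ?l" for k
    proof (rule ccontr)
      assume neg: "\<not> ?thesis"
      have "raise_by (Poly_Mapping.lookup m) \<alpha> ! k \<in> set (raise_mono m \<alpha>)" unfolding raise using that by simp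
      moreover have "q_fun (raise_by (Poly_Mapping.lookup m) \<alpha> ! k) = 0" using neg by (simp add: q_fun_def)
      ultimately have "0 \<in> set (map q_fun (raise_mono m \<alpha>))" by (metis image_eqI set_map)
      then show False using q prod_list_eq_zero[of "map q_fun (raise_mono m \<alpha>)"] by (simp add: q_seq_def)
    qed
    have "Poly_Mapping.lookup m p \<le> B" if p: "p \<in> raising_pairs ?l" for p
    proof -
      obtain i j where p': "p = (i, j)" "i < j" "j < ?l" using p by (auto simp: raising_pairs_def)
      have "int (Poly_Mapping.lookup m (i, j)) \<le> (\<Sum>k<?l. \<alpha> ! k)"
        by (rule exponent_bound) (use out nonneg \<alpha> p' in auto)
      then show ?thesis using B p' by simp
    qed
    then show "m \<in> ?S" using out by (auto simp: exponents_def)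
  qed
  have "finite ?S"
    by (rule finite_vimageI[OF finite_exponents]) (simp add: inj_def poly_mapping_eqI)
  then have "Q_fun \<alpha> = (\<Sum>m\<in>?S. ?T m)"
    unfolding Q_fun_def using supp by (rule Sum_any.expand_superset)
  also have "\<dots> = Q_sum q_fun B \<alpha>"
    unfolding Q_sum_def
  proof (rule sum.reindex_bij_witness[of _ Abs_poly_mapping Poly_Mapping.lookup])
    fix m assume m: "m \<in> ?S"
    show "Abs_poly_mapping (Poly_Mapping.lookup m) = m" by (rule Poly_Mapping.lookup_inverse)
    show "Poly_Mapping.lookup m \<in> exponents ?l B" using m by simp
    have "Poly_Mapping.keys m \<subseteq> raising_pairs ?l"
    proof
      fix p assume "p \<in> Poly_Mapping.keys m"
      then show "p \<in> raising_pairs ?l" using m exponents_out[of "Poly_Mapping.lookup m" ?l B p] by (auto simp: in_keys_iff)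
    qed
    then show "of_int (\<Prod>p\<in>raising_pairs ?l. cc (Poly_Mapping.lookup m p)) *
        prod_list (map q_fun (raise_by (Poly_Mapping.lookup m) \<alpha>)) = ?T m"
      unfolding coeff raise q_seq_def by simp
  next
    fix M assume M: "M \<in> exponents ?l B"
    have "{p. M p \<noteq> 0} \<subseteq> raising_pairs ?l"
    proof (rule subsetI)
      fix p assume "p \<in> {p. M p \<noteq> 0}"
      then have nz: "M p \<noteq> 0" by (rule CollectD)
      show "p \<in> raising_pairs ?l"
      proof (rule ccontr)
        assume "p \<notin> raising_pairs ?l"
        then have "M p = 0" by (rule exponents_out[OF M])
        with nz show False by (rule notE)
      qed
    qed
    then have "finite {p. M p \<noteq> 0}" by (rule finite_subset) (rule finite_raising_pairs)
    then show inv: "Poly_Mapping.lookup (Abs_poly_mapping M) = M" by (simp add: Abs_poly_mapping_inverse)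
    show "Abs_poly_mapping M \<in> ?S" using M by (simp add: inv)
  qed
  finally show ?thesis .
qed

text \<open>The factors \<open>R\<^sub>0\<^sub>j\<close> act last: they raise the first entry and lower the entries of the rest.\<close>

lemma Q_sum_Cons:
  "Q_sum q B (a # \<alpha>) = (\<Sum>k\<in>Pi\<^sub>E {..<length \<alpha>} (\<lambda>_. {..B}). of_int (\<Prod>j<length \<alpha>. cc (k j)) *
     q (a + (\<Sum>j<length \<alpha>. int (k j))) * Q_sum q B (map (\<lambda>j. \<alpha> ! j - int (k j)) [0..<length \<alpha>]))"
proof -
  let ?l = "length \<alpha>" and ?K = "Pi\<^sub>E {..<length \<alpha>} (\<lambda>_. {..B})"
  let ?sub = "\<lambda>k. map (\<lambda>j. \<alpha> ! j - int (k j)) [0..<?l]"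
  define join where "join k M = (\<lambda>(i, j). if i = 0 then (if 1 \<le> j \<and> j \<le> ?l then k (j - 1) else 0)
    else if j = 0 then 0 else M (i - 1, j - 1))" for k :: "nat \<Rightarrow> nat" and M :: "nat \<times> nat \<Rightarrow> nat"
  define first where "first M = restrict (\<lambda>j. M (0, Suc j)) {..<?l}" for M :: "nat \<times> nat \<Rightarrow> nat"
  define rest where "rest M = (\<lambda>(i, j). M (Suc i, Suc j))" for M :: "nat \<times> nat \<Rightarrow> nat"
  have pairs: "raising_pairs (Suc ?l) = (\<lambda>j. (0, Suc j)) ` {..<?l} \<union> (\<lambda>(i, j). (Suc i, Suc j)) ` raising_pairs ?l" (is "?P = ?P1 \<union> ?P2")
  proof (rule Set.set_eqI, rule iffI)
    fix p assume p: "p \<in> ?P"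
    obtain i j where ij: "p = (i, j)" "i < j" "j < Suc ?l" using p by (auto simp: raising_pairs_def)
    then obtain j' where j': "j = Suc j'" by (cases j) auto
    show "p \<in> ?P1 \<union> ?P2"
    proof (cases i)
      case 0
      then show ?thesis using ij j' by auto
    next
      case (Suc i')
      then have "(i', j') \<in> raising_pairs ?l" using ij j' by (simp add: raising_pairs_def)
      then have "(\<lambda>(i, j). (Suc i, Suc j)) (i', j') \<in> ?P2" by (rule imageI)
      then show ?thesis using ij(1) j' Suc by simp
    qed
  qed (auto simp: raising_pairs_def)
  have weight: "(\<Prod>p\<in>?P. cc (join k M p)) = (\<Prod>j<?l. cc (k j)) * (\<Prod>p\<in>raising_pairs ?l. cc (M p))" for k M
  proof -
    have "(\<Prod>p\<in>?P. cc (join k M p)) = (\<Prod>p\<in>?P1. cc (join k M p)) * (\<Prod>p\<in>?P2. cc (join k M p))"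
      unfolding pairs by (rule prod.union_disjoint) (auto simp: finite_raising_pairs)
    also have "(\<Prod>p\<in>?P1. cc (join k M p)) = (\<Prod>j<?l. cc (k j))"
      by (subst prod.reindex) (auto simp: inj_on_def join_def)
    also have "(\<Prod>p\<in>?P2. cc (join k M p)) = (\<Prod>p\<in>raising_pairs ?l. cc (M p))"
      by (subst prod.reindex) (auto simp: inj_on_def join_def intro!: prod.cong)
    finally show ?thesis .
  qed
  have raise: "raise_by (join k M) (a # \<alpha>) = (a + (\<Sum>j<?l. int (k j))) # raise_by M (?sub k)" for k M
  proof (rule nth_equalityI)
    fix t assume t: "t < length (raise_by (join k M) (a # \<alpha>))"
    show "raise_by (join k M) (a # \<alpha>) ! t = ((a + (\<Sum>j<?l. int (k j))) # raise_by M (?sub k)) ! t"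
    proof (cases t)
      case 0
      have "raise_by (join k M) (a # \<alpha>) ! 0 = a + (\<Sum>j<Suc ?l. int (join k M (0, j))) - (\<Sum>i<Suc ?l. int (join k M (i, 0)))"
        by (simp add: raise_by_nth del: sum.lessThan_Suc)
      also have "\<dots> = a + (\<Sum>j<?l. int (k j))"
        unfolding sum.lessThan_Suc_shift by (simp add: join_def)
      finally show ?thesis using 0 by simp
    next
      case (Suc t')
      have t': "t' < ?l" using t Suc by simp
      have "raise_by (join k M) (a # \<alpha>) ! Suc t' =
          \<alpha> ! t' + (\<Sum>j<Suc ?l. int (join k M (Suc t', j))) - (\<Sum>i<Suc ?l. int (join k M (i, Suc t')))"
        using t' by (simp add: raise_by_nth del: sum.lessThan_Suc)
      also have "\<dots> = \<alpha> ! t' - int (k t') + (\<Sum>j<?l. int (M (t', j))) - (\<Sum>i<?l. int (M (i, t')))"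
        unfolding sum.lessThan_Suc_shift using t' by (simp add: join_def)
      also have "\<dots> = raise_by M (?sub k) ! t'" using t' by (simp add: raise_by_nth)
      finally show ?thesis using Suc by simp
    qed
  qed simp
  have "Q_sum q B (a # \<alpha>) = (\<Sum>M\<in>exponents (Suc ?l) B. of_int (\<Prod>p\<in>?P. cc (M p)) * prod_list (map q (raise_by M (a # \<alpha>))))"
    by (simp add: Q_sum_def)
  also have "\<dots> = (\<Sum>(k, M)\<in>?K \<times> exponents ?l B. of_int (\<Prod>p\<in>?P. cc (join k M p)) *
      prod_list (map q (raise_by (join k M) (a # \<alpha>))))"
  proof (rule sum.reindex_bij_witness[of _ "\<lambda>(k, M). join k M" "\<lambda>M. (first M, rest M)"])
    fix M assume M: "M \<in> exponents (Suc ?l) B"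
    have zero: "M p = 0" if "p \<notin> ?P" for p by (rule exponents_out[OF M that])
    have le: "M p \<le> B" for p by (rule exponents_le[OF M])
    show join: "(case (first M, rest M) of (k, M) \<Rightarrow> join k M) = M"
    proof
      fix p :: "nat \<times> nat"
      obtain i j where p: "p = (i, j)" by (cases p)
      show "(case (first M, rest M) of (k, M) \<Rightarrow> join k M) p = M p"
        using zero[of p] unfolding p
        by (cases i; cases j) (auto simp: join_def first_def rest_def raising_pairs_def)
    qed
    show "(first M, rest M) \<in> ?K \<times> exponents ?l B"
    proof (rule SigmaI)
      show "first M \<in> ?K" using le by (auto simp: first_def)
      show "rest M \<in> exponents ?l B"
        unfolding exponents_def rest_def using le zero by (auto simp: raising_pairs_def)
    qed
    show "(case (first M, rest M) of (k, M) \<Rightarrow> of_int (\<Prod>p\<in>?P. cc (join k M p)) * prod_list (map q (raise_by (join k M) (a # \<alpha>)))) =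
        of_int (\<Prod>p\<in>?P. cc (M p)) * prod_list (map q (raise_by M (a # \<alpha>)))"
      using join by (simp only: prod.case)
  next
    fix kM assume "kM \<in> ?K \<times> exponents ?l B"
    then obtain k M where kM: "kM = (k, M)" "k \<in> ?K" "M \<in> exponents ?l B" by auto
    have "first (join k M) = k"
    proof
      fix j show "first (join k M) j = k j"
        using PiE_arb[OF kM(2), of j] by (auto simp: first_def join_def)
    qed
    moreover have "rest (join k M) = M" by (auto simp: rest_def join_def)
    ultimately show "(first (case kM of (k, M) \<Rightarrow> join k M), rest (case kM of (k, M) \<Rightarrow> join k M)) = kM"
      using kM(1) by simp
    have "join k M p \<in> {..B}" if "p \<in> ?P" for p
    proof -
      from that consider j where "p = (0, Suc j)" "j < ?l" | i j where "p = (Suc i, Suc j)" "(i, j) \<in> raising_pairs ?l"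
        unfolding pairs by auto
      then show ?thesis
      proof cases
        case 1
        then show ?thesis using PiE_mem[OF kM(2), of j] by (simp add: join_def)
      next
        case 2
        then show ?thesis using kM(3) by (simp add: join_def exponents_def)
      qed
    qed
    moreover have "join k M p = 0" if "p \<notin> ?P" for p
    proof -
      obtain i j where p: "p = (i, j)" by (cases p)
      show ?thesis
      proof (cases "i = 0 \<or> j = 0")
        case True
        then show ?thesis using that p by (auto simp: join_def raising_pairs_def)
      next
        case False
        then have "(i - 1, j - 1) \<notin> raising_pairs ?l" using that p by (auto simp: raising_pairs_def)
        then have "M (i - 1, j - 1) = 0" using kM(3) by (simp add: exponents_def)
        then show ?thesis using False p by (simp add: join_def)
      qed
    qed
    ultimately show "(case kM of (k, M) \<Rightarrow> join k M) \<in> exponents (Suc ?l) B"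
      unfolding exponents_def kM(1) by simp
  qed
  also have "\<dots> = (\<Sum>k\<in>?K. \<Sum>M\<in>exponents ?l B. of_int (\<Prod>p\<in>?P. cc (join k M p)) *
      prod_list (map q (raise_by (join k M) (a # \<alpha>))))"
    by (rule sum.cartesian_product[symmetric])
  also have "\<dots> = (\<Sum>k\<in>?K. of_int (\<Prod>j<?l. cc (k j)) * q (a + (\<Sum>j<?l. int (k j))) * Q_sum q B (?sub k))"
    unfolding weight raise Q_sum_def sum_distrib_left
    by (intro sum.cong) (simp_all add: mult_ac)
  finally show ?thesis .
qed

text \<open>
  Multiplying the generating series of \<open>q\<close> by a fixed series commutes with raising operators.
\<close>

lemma Q_sum_convolution:
  fixes x :: "'a :: comm_ring_1"
  assumes conv: "\<And>r. r \<le> int B \<Longrightarrow> q' r = (\<Sum>k\<le>B. of_int (cc k) * x ^ k * q (r - int k))"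
    and neg: "\<And>r. r < 0 \<Longrightarrow> q r = 0" "\<And>r. r < 0 \<Longrightarrow> q' r = 0"
    and B: "(\<Sum>k<length \<alpha>. \<alpha> ! k) \<le> int B"
  shows "Q_sum q' B \<alpha> = (\<Sum>k\<in>Pi\<^sub>E {..<length \<alpha>} (\<lambda>_. {..B}). of_int (\<Prod>j<length \<alpha>. cc (k j)) *
     x ^ (\<Sum>j<length \<alpha>. k j) * Q_sum q B (map (\<lambda>j. \<alpha> ! j - int (k j)) [0..<length \<alpha>]))"
proof -
  let ?l = "length \<alpha>" and ?K = "Pi\<^sub>E {..<length \<alpha>} (\<lambda>_. {..B})"
  let ?sub = "\<lambda>k. map (\<lambda>j. \<alpha> ! j - int (k j)) [0..<?l]"
  have pl: "prod_list (map f xs) = (\<Prod>t<length xs. f (xs ! t))" for f :: "int \<Rightarrow> 'a" and xs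
    using prod.list_conv_set_nth[of "map f xs"] by (simp add: atLeast0LessThan)
  have step: "prod_list (map q' (raise_by M \<alpha>)) = (\<Sum>k\<in>?K. of_int (\<Prod>j<?l. cc (k j)) * x ^ (\<Sum>j<?l. k j) *
      prod_list (map q (raise_by M (?sub k))))" for M
  proof -
    let ?r = "\<lambda>t. raise_by M \<alpha> ! t"
    have sub: "raise_by M (?sub k) ! t = ?r t - int (k t)" if "t < ?l" for k t
      using that by (simp add: raise_by_nth)
    have right: "of_int (\<Prod>j<?l. cc (k j)) * x ^ (\<Sum>j<?l. k j) * prod_list (map q (raise_by M (?sub k))) =
        (\<Prod>t<?l. of_int (cc (k t)) * x ^ k t * q (?r t - int (k t)))" for k
      unfolding pl by (simp add: sub prod.distrib power_sum)
    show ?thesis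
    proof (cases "\<exists>t<?l. ?r t < 0")
      case True
      then obtain t where t: "t < ?l" "?r t < 0" by blast
      have "(\<Prod>t<?l. q' (?r t)) = 0"
        by (intro prod_zero bexI[of _ t]) (use t neg(2) in auto)
      moreover have "(\<Prod>t<?l. of_int (cc (k t)) * x ^ k t * q (?r t - int (k t))) = 0" for k
        by (intro prod_zero bexI[of _ t]) (use t neg(1)[of "?r t - int (k t)"] in auto)
      ultimately show ?thesis unfolding right unfolding pl by simp
    next
      case False
      have nonneg: "0 \<le> ?r t" if "t < ?l" for t using False that by (meson not_less)
      have le: "?r t \<le> int B" if t: "t < ?l" for t
      proof -
        have "?r t \<le> (\<Sum>k<?l. ?r k)"
          by (rule member_le_sum) (use t nonneg in auto)
        then show ?thesis using B by (simp add: sum_raise_by)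
      qed
      have "(\<Prod>t<?l. q' (?r t)) = (\<Prod>t<?l. \<Sum>k\<le>B. of_int (cc k) * x ^ k * q (?r t - int k))"
        using conv le by (intro prod.cong) auto
      also have "\<dots> = (\<Sum>k\<in>?K. \<Prod>t<?l. of_int (cc (k t)) * x ^ k t * q (?r t - int (k t)))"
        by (rule prod_sum_PiE) auto
      finally show ?thesis unfolding right unfolding pl by simp
    qed
  qed
  have "Q_sum q' B \<alpha> = (\<Sum>M\<in>exponents ?l B. \<Sum>k\<in>?K. of_int (\<Prod>p\<in>raising_pairs ?l. cc (M p)) *
      (of_int (\<Prod>j<?l. cc (k j)) * x ^ (\<Sum>j<?l. k j) * prod_list (map q (raise_by M (?sub k)))))"
    unfolding Q_sum_def step sum_distrib_left ..
  also have "\<dots> = (\<Sum>k\<in>?K. \<Sum>M\<in>exponents ?l B. of_int (\<Prod>p\<in>raising_pairs ?l. cc (M p)) *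
      (of_int (\<Prod>j<?l. cc (k j)) * x ^ (\<Sum>j<?l. k j) * prod_list (map q (raise_by M (?sub k)))))"
    by (rule sum.swap)
  also have "\<dots> = (\<Sum>k\<in>?K. of_int (\<Prod>j<?l. cc (k j)) * x ^ (\<Sum>j<?l. k j) * Q_sum q B (?sub k))"
    unfolding Q_sum_def sum_distrib_left by (intro sum.cong) (simp_all only: length_map length_upt diff_zero mult_ac)
  finally show ?thesis .
qed

section \<open>Schur Q-functions as residue sums\<close>

definition geometric :: "'a :: comm_ring_1 \<Rightarrow> 'a fps" where
  "geometric x = Abs_fps (\<lambda>k. x ^ k)"

definition q_series :: "'a :: comm_ring_1 \<Rightarrow> 'a fps" where
  "q_series x = Abs_fps (\<lambda>k. if k = 0 then 1 else 2 * x ^ k)"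

definition fps_coeff :: "'a :: comm_ring_1 fps \<Rightarrow> int \<Rightarrow> 'a" where
  "fps_coeff F r = (if r < 0 then 0 else fps_nth F (nat r))"

lemma geometric_inverse: "(1 - fps_const x * fps_X) * geometric x = 1"
proof (rule fps_ext)
  fix k show "fps_nth ((1 - fps_const x * fps_X) * geometric x) k = fps_nth 1 k"
    by (cases k) (simp_all add: left_diff_distrib mult.assoc geometric_def)
qed

lemma q_series_eq: "q_series x = (1 + fps_const x * fps_X) * geometric x"
proof (rule fps_ext)
  fix k show "fps_nth (q_series x) k = fps_nth ((1 + fps_const x * fps_X) * geometric x) k"
    by (cases k) (simp_all add: distrib_right mult.assoc geometric_def q_series_def)
qed

lemma q_series_cancel: "q_series (- x) * q_series x = 1"
proof -
  have "q_series (- x) * q_series x = ((1 - fps_const (- x) * fps_X) * geometric (- x)) * ((1 - fps_const x * fps_X) * geometric x)"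
    unfolding q_series_eq by (simp add: mult_ac flip: fps_const_neg)
  then show ?thesis by (simp only: geometric_inverse mult_1)
qed

lemma fps_coeff_convolution:
  assumes "r \<le> int B"
  shows "fps_coeff (q_series (- x) * F) r = (\<Sum>k\<le>B. of_int (cc k) * x ^ k * fps_coeff F (r - int k))"
proof (cases "r < 0")
  case False
  then obtain s where r: "r = int s" by (metis int_nat_eq not_less)
  have q: "fps_nth (q_series (- x)) k = of_int (cc k) * x ^ k" for k
    using power_minus[of x k] by (simp add: q_series_def cc_def)
  have "fps_coeff (q_series (- x) * F) r = (\<Sum>k\<in>{0..s}. of_int (cc k) * x ^ k * fps_nth F (s - k))"
    using r by (simp add: fps_coeff_def fps_mult_nth q)
  also have "\<dots> = (\<Sum>k\<in>{0..s}. of_int (cc k) * x ^ k * fps_coeff F (r - int k))"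
    by (rule sum.cong) (auto simp: fps_coeff_def r nat_diff_distrib)
  also have "\<dots> = (\<Sum>k\<le>B. of_int (cc k) * x ^ k * fps_coeff F (r - int k))"
    by (rule sum.mono_neutral_left) (use assms r in \<open>auto simp: fps_coeff_def\<close>)
  finally show ?thesis .
qed (simp add: fps_coeff_def)

text \<open>Partial fractions for \<open>\<Prod>\<^sub>x (1 + x t) / (1 - x t)\<close>, as an identity of polynomials.\<close>

lemma q_partial_fraction_poly:
  fixes X :: "'k :: field set"
  assumes X: "finite X" "0 \<notin> X"
  shows "(\<Prod>x\<in>X. [:1, x:]) = smult ((- 1) ^ card X) (\<Prod>x\<in>X. [:1, - x:]) +
    (\<Sum>x\<in>X. smult (2 * (\<Prod>y\<in>X - {x}. (x + y) / (x - y))) (\<Prod>y\<in>X - {x}. [:1, - y:]))"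
    (is "?p = smult _ ?D + ?S")
proof (rule poly_eqI_degree_lead_coeff[of _ "card X" _ "inverse ` X"])
  have nz: "x \<noteq> 0" if "x \<in> X" for x using X that by auto
  have deg: "Polynomial.degree (\<Prod>x\<in>Y. [:1, f x:]) \<le> card Y" if "finite Y" for Y :: "'k set" and f
  proof -
    have "Polynomial.degree (\<Prod>x\<in>Y. [:1, f x:]) \<le> (\<Sum>x\<in>Y. Polynomial.degree [:1, f x:])"
      by (rule degree_prod_sum_le[unfolded o_def]) (rule that)
    also have "\<dots> \<le> (\<Sum>x\<in>Y. 1)" by (rule sum_mono) (auto intro: order_trans[OF degree_pCons_le])
    finally show ?thesis by simp
  qed
  have lead: "poly.coeff (\<Prod>x\<in>X. [:1, f x:]) (card X) = (\<Prod>x\<in>X. f x)" if "\<And>x. x \<in> X \<Longrightarrow> f x \<noteq> 0" for f :: "'k \<Rightarrow> 'k"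
  proof -
    have "Polynomial.degree (\<Prod>x\<in>X. [:1, f x:]) = (\<Sum>x\<in>X. Polynomial.degree [:1, f x:])"
      by (rule degree_prod_eq_sum_degree) auto
    also have "\<dots> = card X" using that by simp
    finally have "poly.coeff (\<Prod>x\<in>X. [:1, f x:]) (card X) = lead_coeff (\<Prod>x\<in>X. [:1, f x:])" by simp
    also have "\<dots> = (\<Prod>x\<in>X. f x)" unfolding lead_coeff_prod using that by (intro prod.cong) auto
    finally show ?thesis .
  qed
  show "Polynomial.degree ?p \<le> card X" by (rule deg[OF X(1)])
  have S: "Polynomial.degree (smult c (\<Prod>y\<in>X - {x}. [:1, - y:])) \<le> card X - 1" if "x \<in> X" for x c
    using deg[of "X - {x}" "\<lambda>y. - y"] that X by (auto intro: order_trans[OF degree_smult_le])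
  show "Polynomial.degree (smult ((- 1) ^ card X) ?D + ?S) \<le> card X"
    by (intro degree_add_le degree_sum_le[OF X(1)] order_trans[OF degree_smult_le deg[OF X(1)]] order_trans[OF S diff_le_self])
  have "poly.coeff ?S (card X) = 0"
    unfolding coeff_sum
  proof (rule sum.neutral, rule ballI, rule coeff_eq_0)
    fix x assume "x \<in> X"
    then have "0 < card X" using X by (auto simp: card_gt_0_iff)
    then show "Polynomial.degree (smult (2 * (\<Prod>y\<in>X - {x}. (x + y) / (x - y))) (\<Prod>y\<in>X - {x}. [:1, - y:])) < card X"
      using S[OF \<open>x \<in> X\<close>, of "2 * (\<Prod>y\<in>X - {x}. (x + y) / (x - y))"] by simp
  qed
  then show "poly.coeff ?p (card X) = poly.coeff (smult ((- 1) ^ card X) ?D + ?S) (card X)"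
    using lead[of "\<lambda>x. x"] lead[of "\<lambda>x. - x"] nz prod.distrib[of "\<lambda>_. - 1 :: 'k" "\<lambda>x. x" X]
    by (simp flip: power_mult_distrib mult.assoc)
  show "card (inverse ` X) \<ge> card X" by (simp add: card_image inj_on_def)
  show "poly ?p t = poly (smult ((- 1) ^ card X) ?D + ?S) t" if t: "t \<in> inverse ` X" for t
  proof -
    obtain a where a: "a \<in> X" "t = inverse a" "a \<noteq> 0" using t nz by auto
    have D: "(\<Prod>y\<in>Y. 1 - y * t) = 0" if "a \<in> Y" "finite Y" for Y
      by (intro prod_zero bexI[of _ a]) (use that a in auto)
    have eval: "poly (\<Prod>y\<in>Y. [:1, f y:]) t = (\<Prod>y\<in>Y. 1 + f y * t)" for Y :: "'k set" and f
      by (simp add: poly_prod mult.commute)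
    have "poly ?S t = (\<Sum>x\<in>X. 2 * (\<Prod>y\<in>X - {x}. (x + y) / (x - y)) * (\<Prod>y\<in>X - {x}. 1 - y * t))"
      by (simp add: poly_sum eval)
    also have "\<dots> = (\<Sum>x\<in>{a}. 2 * (\<Prod>y\<in>X - {x}. (x + y) / (x - y)) * (\<Prod>y\<in>X - {x}. 1 - y * t))"
      by (rule sum.mono_neutral_right) (use a X D in auto)
    also have "\<dots> = 2 * (\<Prod>y\<in>X - {a}. (a + y) / (a - y) * (1 - y * t))"
      by (subst prod.distrib) (simp add: mult.assoc)
    also have "(\<Prod>y\<in>X - {a}. (a + y) / (a - y) * (1 - y * t)) = (\<Prod>y\<in>X - {a}. 1 + y * t)"
    proof (rule prod.cong)
      fix y assume "y \<in> X - {a}"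
      then have "a - y \<noteq> 0" by auto
      then show "(a + y) / (a - y) * (1 - y * t) = 1 + y * t" using a(2,3) by (simp add: field_simps)
    qed simp
    also have "2 * (\<Prod>y\<in>X - {a}. 1 + y * t) = (\<Prod>y\<in>X. 1 + y * t)"
      using prod.remove[OF X(1) a(1), of "\<lambda>y. 1 + y * t"] a by simp
    finally have "poly ?S t = (\<Prod>y\<in>X. 1 + y * t)" .
    then show ?thesis using D[OF a(1) X(1)] by (simp add: eval)
  qed
qed

lemma q_partial_fraction:
  fixes X :: "'k :: field set"
  assumes X: "finite X" "0 \<notin> X" and r: "1 \<le> r"
  shows "fps_coeff (\<Prod>x\<in>X. q_series x) r = (\<Sum>x\<in>X. 2 * (\<Prod>y\<in>X - {x}. (x + y) / (x - y)) * x ^ nat r)"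
proof -
  let ?P = "\<lambda>x. 2 * (\<Prod>y\<in>X - {x}. (x + y) / (x - y))"
  have lin: "fps_of_poly [:1, c:] = 1 + fps_const c * fps_X" for c :: 'k
    by (simp add: fps_of_poly_pCons)
  have inv: "fps_of_poly [:1, - x:] * geometric x = 1" for x :: 'k
    unfolding lin using geometric_inverse[of x] by (simp flip: fps_const_neg)
  have "(\<Prod>x\<in>X. q_series x) = fps_of_poly (\<Prod>x\<in>X. [:1, x:]) * (\<Prod>x\<in>X. geometric x)"
    by (simp add: q_series_eq fps_of_poly_prod lin prod.distrib)
  also have "\<dots> = fps_const ((- 1) ^ card X) * (\<Prod>x\<in>X. fps_of_poly [:1, - x:] * geometric x) +
      (\<Sum>x\<in>X. fps_const (?P x) * (fps_of_poly (\<Prod>y\<in>X - {x}. [:1, - y:]) * (\<Prod>x\<in>X. geometric x)))"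
    unfolding q_partial_fraction_poly[OF X] fps_of_poly_add fps_of_poly_sum fps_of_poly_smult fps_of_poly_prod
      distrib_right sum_distrib_right prod.distrib by (simp only: mult.assoc)
  also have "(\<Sum>x\<in>X. fps_const (?P x) * (fps_of_poly (\<Prod>y\<in>X - {x}. [:1, - y:]) * (\<Prod>x\<in>X. geometric x))) =
      (\<Sum>x\<in>X. fps_const (?P x) * geometric x)"
  proof (rule sum.cong)
    fix x assume x: "x \<in> X"
    have "fps_of_poly (\<Prod>y\<in>X - {x}. [:1, - y:]) * (\<Prod>x\<in>X. geometric x) =
        (\<Prod>y\<in>X - {x}. fps_of_poly [:1, - y:] * geometric y) * geometric x"
      unfolding prod.remove[OF X(1) x, of geometric] fps_of_poly_prod prod.distrib by (simp only: mult_ac)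
    then show "fps_const (?P x) * (fps_of_poly (\<Prod>y\<in>X - {x}. [:1, - y:]) * (\<Prod>x\<in>X. geometric x)) =
        fps_const (?P x) * geometric x" by (simp only: inv prod.neutral_const mult_1)
  qed simp
  finally have "(\<Prod>x\<in>X. q_series x) = fps_const ((- 1) ^ card X) + (\<Sum>x\<in>X. fps_const (?P x) * geometric x)"
    by (simp only: inv prod.neutral_const mult_1_right)
  then show ?thesis using r by (simp add: fps_coeff_def fps_sum_nth geometric_def)
qed

text \<open>
  Expanding the first factor in partial fractions, the powers of \<open>x\<close> that the raising operators
  distribute over the remaining entries remove \<open>x\<close> from the generating series.
\<close>

lemma Q_sum_eq_resid:
  fixes X :: "'k :: field set"
  assumes "finite X" "0 \<notin> X" "\<And>k. k < length \<alpha> \<Longrightarrow> 1 \<le> \<alpha> ! k" "(\<Sum>k<length \<alpha>. \<alpha> ! k) \<le> int B"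
  shows "Q_sum (fps_coeff (\<Prod>x\<in>X. q_series x)) B \<alpha> =
    resid (length \<alpha>) X (\<lambda>s. \<Prod>i\<in>{0..<length \<alpha>}. (s ! i) ^ nat (\<alpha> ! i))"
  using assms
proof (induction \<alpha> arbitrary: X)
  case Nil
  have "exponents 0 B = {\<lambda>_. 0}" by (auto simp: exponents_def raising_pairs_def)
  then show ?case by (simp add: Q_sum_def raising_pairs_def raise_by_def)
next
  case (Cons a \<alpha>)
  let ?l = "length \<alpha>" and ?K = "Pi\<^sub>E {..<length \<alpha>} (\<lambda>_. {..B})"
  let ?sub = "\<lambda>k. map (\<lambda>j. \<alpha> ! j - int (k j)) [0..<?l]"
  let ?q = "\<lambda>X. fps_coeff (\<Prod>x\<in>X. q_series x)"
  let ?P = "\<lambda>x. 2 * (\<Prod>y\<in>X - {x}. (x + y) / (x - y))"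
  let ?mon = "\<lambda>\<alpha> s. \<Prod>i\<in>{0..<length \<alpha>}. (s ! i) ^ nat (\<alpha> ! i)"
  have a: "1 \<le> a" using Cons.prems(3)[of 0] by simp
  have \<alpha>: "1 \<le> \<alpha> ! k" if "k < ?l" for k using Cons.prems(3)[of "Suc k"] that by simp
  have B: "(\<Sum>k<?l. \<alpha> ! k) \<le> int B"
    using Cons.prems(4) a by (simp add: sum.lessThan_Suc_shift del: sum.lessThan_Suc)
  have mon: "?mon (a # \<alpha>) (x # s) = x ^ nat a * ?mon \<alpha> s" for x s
    by (simp add: prod.atLeast0_lessThan_Suc_shift del: prod.op_ivl_Suc)
  have remove: "(\<Sum>k\<in>?K. of_int (\<Prod>j<?l. cc (k j)) * x ^ (\<Sum>j<?l. k j) * Q_sum (?q X) B (?sub k)) =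
      resid ?l (X - {x}) (?mon \<alpha>)" if x: "x \<in> X" for x
  proof -
    have "(\<Prod>y\<in>X - {x}. q_series y) = q_series (- x) * (\<Prod>y\<in>X. q_series y)"
      unfolding prod.remove[OF Cons.prems(1) x] by (simp add: mult.assoc[symmetric] q_series_cancel)
    then have "?q (X - {x}) r = (\<Sum>k\<le>B. of_int (cc k) * x ^ k * ?q X (r - int k))" if "r \<le> int B" for r
      using fps_coeff_convolution[OF that] by simp
    then have "Q_sum (?q (X - {x})) B \<alpha> = (\<Sum>k\<in>?K. of_int (\<Prod>j<?l. cc (k j)) * x ^ (\<Sum>j<?l. k j) * Q_sum (?q X) B (?sub k))"
      by (rule Q_sum_convolution) (simp_all add: fps_coeff_def B)
    moreover have "Q_sum (?q (X - {x})) B \<alpha> = resid ?l (X - {x}) (?mon \<alpha>)"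
      by (rule Cons.IH) (use Cons.prems \<alpha> B in auto)
    ultimately show ?thesis by simp
  qed
  have "Q_sum (?q X) B (a # \<alpha>) = (\<Sum>k\<in>?K. of_int (\<Prod>j<?l. cc (k j)) *
      (\<Sum>x\<in>X. ?P x * x ^ (nat a + (\<Sum>j<?l. k j))) * Q_sum (?q X) B (?sub k))"
    unfolding Q_sum_Cons
  proof (rule sum.cong)
    fix k
    have "nat (a + (\<Sum>j<?l. int (k j))) = nat a + (\<Sum>j<?l. k j)"
      using a by (simp add: nat_add_distrib flip: of_nat_sum)
    moreover have "1 \<le> a + (\<Sum>j<?l. int (k j))" using a sum_nonneg[of "{..<?l}" "\<lambda>j. int (k j)"] by simp
    ultimately show "of_int (\<Prod>j<?l. cc (k j)) * ?q X (a + (\<Sum>j<?l. int (k j))) * Q_sum (?q X) B (?sub k) =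
        of_int (\<Prod>j<?l. cc (k j)) * (\<Sum>x\<in>X. ?P x * x ^ (nat a + (\<Sum>j<?l. k j))) * Q_sum (?q X) B (?sub k)"
      using q_partial_fraction[OF Cons.prems(1,2), of "a + (\<Sum>j<?l. int (k j))"] by simp
  qed simp
  also have "\<dots> = (\<Sum>k\<in>?K. \<Sum>x\<in>X. ?P x * x ^ nat a *
      (of_int (\<Prod>j<?l. cc (k j)) * x ^ (\<Sum>j<?l. k j) * Q_sum (?q X) B (?sub k)))"
    unfolding sum_distrib_left sum_distrib_right power_add by (intro sum.cong) (simp_all only: mult_ac)
  also have "\<dots> = (\<Sum>x\<in>X. \<Sum>k\<in>?K. ?P x * x ^ nat a *
      (of_int (\<Prod>j<?l. cc (k j)) * x ^ (\<Sum>j<?l. k j) * Q_sum (?q X) B (?sub k)))"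
    by (rule sum.swap)
  also have "\<dots> = (\<Sum>x\<in>X. ?P x * x ^ nat a * resid ?l (X - {x}) (?mon \<alpha>))"
    unfolding sum_distrib_left[symmetric] by (rule sum.cong) (simp_all only: remove)
  also have "\<dots> = (\<Sum>x\<in>X. ?P x * resid ?l (X - {x}) (\<lambda>s. ?mon (a # \<alpha>) (x # s)))"
    unfolding mon resid_scale by (simp only: mult.assoc)
  finally show ?case by (simp only: list.size resid.simps Nat.add_0_right add_Suc_right)
qed

section \<open>Power series form an integral domain\<close>

lemma keys_add_nat: "Poly_Mapping.keys (a + b :: 'v \<Rightarrow>\<^sub>0 nat) = Poly_Mapping.keys a \<union> Poly_Mapping.keys b"
  by (auto simp: in_keys_iff lookup_add)

lemma finite_bounded_monomials:
  assumes "finite W"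
  shows "finite {m :: 'v \<Rightarrow>\<^sub>0 nat. Poly_Mapping.keys m \<subseteq> W \<and> (\<Sum>v\<in>W. Poly_Mapping.lookup m v) = d}"
proof (rule finite_imageD)
  let ?F = "{f. \<forall>x. (x \<in> W \<longrightarrow> f x \<in> {..d}) \<and> (x \<notin> W \<longrightarrow> f x = (0 :: nat))}"
  have "Poly_Mapping.lookup ` {m. Poly_Mapping.keys m \<subseteq> W \<and> (\<Sum>v\<in>W. Poly_Mapping.lookup m v) = d} \<subseteq> ?F"
  proof (rule image_subsetI)
    fix m assume "m \<in> {m. Poly_Mapping.keys m \<subseteq> W \<and> (\<Sum>v\<in>W. Poly_Mapping.lookup m v) = d}"
    then have m: "Poly_Mapping.keys m \<subseteq> W" "(\<Sum>v\<in>W. Poly_Mapping.lookup m v) = d" by auto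
    have "Poly_Mapping.lookup m x \<le> d" if "x \<in> W" for x
      unfolding m(2)[symmetric] by (rule member_le_sum[OF that]) (use assms in auto)
    moreover have "Poly_Mapping.lookup m x = 0" if "x \<notin> W" for x
      using m(1) that by (auto simp: in_keys_iff)
    ultimately show "Poly_Mapping.lookup m \<in> ?F" by simp
  qed
  then show "finite (Poly_Mapping.lookup ` {m :: 'v \<Rightarrow>\<^sub>0 nat. Poly_Mapping.keys m \<subseteq> W \<and> (\<Sum>v\<in>W. Poly_Mapping.lookup m v) = d})"
    by (rule finite_subset) (rule finite_set_of_finite_funs, auto simp: assms)
qed (simp add: inj_on_def poly_mapping_eqI)

text \<open>
  Among the monomials of a series in the variables \<open>W\<close> there need not be a largest one, but there
  is a largest one among those of minimal degree.
\<close>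

lemma leading_monomial:
  fixes h :: "('v :: linorder, 'a :: comm_ring_1) mps"
  assumes W: "finite W" and "Poly_Mapping.keys m0 \<subseteq> W" "mps_nth h m0 \<noteq> 0"
  obtains m where "Poly_Mapping.keys m \<subseteq> W" "mps_nth h m \<noteq> 0"
    "\<And>a. Poly_Mapping.keys a \<subseteq> W \<Longrightarrow> mps_nth h a \<noteq> 0 \<Longrightarrow>
      (\<Sum>v\<in>W. Poly_Mapping.lookup m v) \<le> (\<Sum>v\<in>W. Poly_Mapping.lookup a v)"
    "\<And>a. Poly_Mapping.keys a \<subseteq> W \<Longrightarrow> mps_nth h a \<noteq> 0 \<Longrightarrow>
      (\<Sum>v\<in>W. Poly_Mapping.lookup m v) = (\<Sum>v\<in>W. Poly_Mapping.lookup a v) \<Longrightarrow> a \<le> m"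
proof -
  define S where "S = {m. Poly_Mapping.keys m \<subseteq> W \<and> mps_nth h m \<noteq> 0}"
  define deg where "deg m = (\<Sum>v\<in>W. Poly_Mapping.lookup m v)" for m :: "'v \<Rightarrow>\<^sub>0 nat"
  define d where "d = (LEAST d. \<exists>m\<in>S. deg m = d)"
  let ?T = "{m \<in> S. deg m = d}"
  have "\<exists>d. \<exists>m\<in>S. deg m = d" using assms by (auto simp: S_def)
  then have ex: "\<exists>m\<in>S. deg m = d" unfolding d_def by (rule LeastI_ex)
  have least: "d \<le> deg a" if "a \<in> S" for a
    unfolding d_def by (rule Least_le) (use that in blast)
  have fin: "finite ?T"
    by (rule finite_subset[OF _ finite_bounded_monomials[OF W, of d]]) (auto simp: S_def deg_def)
  have "Max ?T \<in> ?T" using fin ex by (intro Max_in) auto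
  then have "Max ?T \<in> S" "deg (Max ?T) = d" by auto
  moreover have "a \<le> Max ?T" if "a \<in> S" "d = deg a" for a
    using fin that by (intro Max_ge) auto
  ultimately show ?thesis using least by (intro that[of "Max ?T"]) (auto simp: S_def deg_def)
qed

instance mps :: (linorder, idom) idom
proof
  fix f g :: "('a, 'b) mps"
  assume "f \<noteq> 0" "g \<noteq> 0"
  then obtain m0 k0 where m0: "mps_nth f m0 \<noteq> 0" and k0: "mps_nth g k0 \<noteq> 0"
    by (metis mps_eqI zero_mps.rep_eq)
  define W where "W = Poly_Mapping.keys m0 \<union> Poly_Mapping.keys k0"
  let ?deg = "\<lambda>m. \<Sum>v\<in>W. Poly_Mapping.lookup m v"
  have W: "finite W" "Poly_Mapping.keys m0 \<subseteq> W" "Poly_Mapping.keys k0 \<subseteq> W" by (auto simp: W_def)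
  obtain m where m: "Poly_Mapping.keys m \<subseteq> W" "mps_nth f m \<noteq> 0"
    "\<And>a. Poly_Mapping.keys a \<subseteq> W \<Longrightarrow> mps_nth f a \<noteq> 0 \<Longrightarrow> ?deg m \<le> ?deg a"
    "\<And>a. Poly_Mapping.keys a \<subseteq> W \<Longrightarrow> mps_nth f a \<noteq> 0 \<Longrightarrow> ?deg m = ?deg a \<Longrightarrow> a \<le> m"
    by (rule leading_monomial[OF W(1,2) m0]) blast
  obtain k where k: "Poly_Mapping.keys k \<subseteq> W" "mps_nth g k \<noteq> 0"
    "\<And>a. Poly_Mapping.keys a \<subseteq> W \<Longrightarrow> mps_nth g a \<noteq> 0 \<Longrightarrow> ?deg k \<le> ?deg a"
    "\<And>a. Poly_Mapping.keys a \<subseteq> W \<Longrightarrow> mps_nth g a \<noteq> 0 \<Longrightarrow> ?deg k = ?deg a \<Longrightarrow> a \<le> k"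
    by (rule leading_monomial[OF W(1,3) k0]) blast
  have zero: "mps_nth f a * mps_nth g b = 0" if ab: "a + b = m + k" and ne: "(a, b) \<noteq> (m, k)" for a b
  proof (rule ccontr)
    assume "mps_nth f a * mps_nth g b \<noteq> 0"
    then have nz: "mps_nth f a \<noteq> 0" "mps_nth g b \<noteq> 0" by auto
    have "Poly_Mapping.keys a \<union> Poly_Mapping.keys b \<subseteq> W"
      using m(1) k(1) unfolding keys_add_nat[symmetric] ab unfolding keys_add_nat by blast
    then have keys: "Poly_Mapping.keys a \<subseteq> W" "Poly_Mapping.keys b \<subseteq> W" by auto
    have "?deg a + ?deg b = ?deg (a + b)" by (simp add: lookup_add sum.distrib)
    also have "\<dots> = ?deg m + ?deg k" unfolding ab by (simp add: lookup_add sum.distrib)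
    finally have "?deg m = ?deg a" "?deg k = ?deg b"
      using m(3)[OF keys(1) nz(1)] k(3)[OF keys(2) nz(2)] by linarith+
    then have le: "a \<le> m" "b \<le> k" using m(4)[OF keys(1) nz(1)] k(4)[OF keys(2) nz(2)] by auto
    have "a = m"
    proof (rule ccontr)
      assume "a \<noteq> m"
      then have "a < m" using le(1) by simp
      then have "a + b < m + k" using le(2) by (rule add_less_le_mono)
      then show False using ab by simp
    qed
    then show False using ab ne by simp
  qed
  have "mps_nth (f * g) (m + k) = (\<Sum>(a, b)\<in>{(m, k)}. mps_nth f a * mps_nth g b)"
    unfolding mps_nth_mult
  proof (rule sum.mono_neutral_right[OF finite_mono_antidiag])
    show "\<forall>ab\<in>{(a, b). a + b = m + k} - {(m, k)}. (case ab of (a, b) \<Rightarrow> mps_nth f a * mps_nth g b) = 0"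
    proof
      fix ab assume ab: "ab \<in> {(a, b). a + b = m + k} - {(m, k)}"
      obtain a b where ab_eq: "ab = (a, b)" by (cases ab)
      have "a + b = m + k" "(a, b) \<noteq> (m, k)" using ab unfolding ab_eq by auto
      then show "(case ab of (a, b) \<Rightarrow> mps_nth f a * mps_nth g b) = 0" unfolding ab_eq prod.case by (rule zero)
    qed
  qed simp
  then have "mps_nth (f * g) (m + k) \<noteq> 0" using m(2) k(2) by simp
  then show "f * g \<noteq> 0" by (auto simp: zero_mps.rep_eq)
qed

instance mps :: (type, "{comm_ring_1, ring_char_0}") ring_char_0
proof
  have "mps_nth (of_nat k :: ('a, 'b) mps) 0 = of_nat k" for k
    by (induction k) (simp_all add: zero_mps.rep_eq plus_mps.rep_eq one_mps.rep_eq)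
  then show "inj (of_nat :: nat \<Rightarrow> ('a, 'b) mps)"
    by (metis injI of_nat_eq_iff)
qed

instance fract :: ("{idom, ring_char_0}") field_char_0
proof
  show "inj (of_nat :: nat \<Rightarrow> 'a fract)"
    by (rule injI) (simp add: of_nat_fract eq_fract)
qed

text \<open>Any linear order on the variables will do.\<close>

fun xyz_code :: "xyz \<Rightarrow> nat" where
  "xyz_code (VX i) = 3 * i"
| "xyz_code (VY i) = 3 * i + 1"
| "xyz_code (VZ i) = 3 * i + 2"

lemma xyz_code_inject: "xyz_code a = xyz_code b \<Longrightarrow> a = b"
  by (cases a; cases b) (simp_all, presburger+)

instantiation xyz :: linorder
begin

definition less_eq_xyz :: "xyz \<Rightarrow> xyz \<Rightarrow> bool" where "a \<le> b \<longleftrightarrow> xyz_code a \<le> xyz_code b"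
definition less_xyz :: "xyz \<Rightarrow> xyz \<Rightarrow> bool" where "a < b \<longleftrightarrow> xyz_code a < xyz_code b"

instance
  by standard (auto simp: less_eq_xyz_def less_xyz_def intro: xyz_code_inject)

end

section \<open>Truncation to finitely many variables\<close>

definition truncated :: "nat \<Rightarrow> (xyz \<Rightarrow>\<^sub>0 nat) \<Rightarrow> bool" where
  "truncated N m \<longleftrightarrow> (\<forall>i>N. Poly_Mapping.lookup m (VX i) = 0)"

text \<open>The substitution \<open>x\<^sub>i = 0\<close> for all \<open>i > N\<close>.\<close>

definition trunc :: "nat \<Rightarrow> ser \<Rightarrow> ser" where
  "trunc N f = Abs_mps (\<lambda>m. if truncated N m then mps_nth f m else 0)"

lemma trunc_nth: "mps_nth (trunc N f) m = (if truncated N m then mps_nth f m else 0)"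
  by (simp add: trunc_def)

lemma truncated_add: "truncated N (a + b) \<longleftrightarrow> truncated N a \<and> truncated N b"
  by (auto simp: truncated_def lookup_add)

lemma trunc_mult: "trunc N (f * g) = trunc N f * trunc N g"
proof (rule mps_eqI)
  fix m
  have "mps_nth (trunc N f * trunc N g) m =
      (\<Sum>(a, b) | a + b = m. if truncated N m then mps_nth f a * mps_nth g b else 0)"
    unfolding mps_nth_mult by (rule sum.cong) (auto simp: trunc_nth truncated_add)
  then show "mps_nth (trunc N (f * g)) m = mps_nth (trunc N f * trunc N g) m"
    by (simp add: trunc_nth mps_nth_mult)
qed

definition eval_frac :: "nat \<Rightarrow> ser \<Rightarrow> ser fract" where
  "eval_frac N f = Fract (trunc N f) 1"

interpretation eval: scalar_hom "eval_frac N" for N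
proof
  fix f g :: ser
  have "trunc N (f + g) = trunc N f + trunc N g"
    by (rule mps_eqI) (simp add: trunc_nth plus_mps.rep_eq)
  then show "eval_frac N (f + g) = eval_frac N f + eval_frac N g" by (simp add: eval_frac_def)
  show "eval_frac N (f * g) = eval_frac N f * eval_frac N g" by (simp add: eval_frac_def trunc_mult)
  have "trunc N 1 = 1"
    by (rule mps_eqI) (auto simp: trunc_nth one_mps.rep_eq truncated_def)
  then show "eval_frac N 1 = 1" by (simp add: eval_frac_def One_fract_def)
qed

lemma eval_frac_eq_iff: "eval_frac N f = eval_frac N g \<longleftrightarrow> trunc N f = trunc N g"
  by (simp add: eval_frac_def eq_fract)

lemma trunc_eq_iff: "trunc N f = trunc N g \<longleftrightarrow> (\<forall>m. truncated N m \<longrightarrow> mps_nth f m = mps_nth g m)"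
proof
  assume eq: "trunc N f = trunc N g"
  show "\<forall>m. truncated N m \<longrightarrow> mps_nth f m = mps_nth g m"
  proof (intro allI impI)
    fix m assume "truncated N m"
    then show "mps_nth f m = mps_nth g m"
      using arg_cong[OF eq, of "\<lambda>f. mps_nth f m"] by (simp add: trunc_nth)
  qed
qed (auto intro: mps_eqI simp: trunc_nth)

lemma eq_if_eval_frac_eq:
  assumes "\<And>N. eval_frac N f = eval_frac N g"
  shows "f = g"
proof (rule mps_eqI)
  fix m :: "xyz \<Rightarrow>\<^sub>0 nat"
  have "finite (VX -` Poly_Mapping.keys m)"
    by (rule finite_vimageI) (auto simp: inj_def)
  then obtain N where N: "\<forall>i \<in> VX -` Poly_Mapping.keys m. i \<le> N"
    by (metis finite_nat_set_iff_bounded_le)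
  have "truncated N m"
    unfolding truncated_def
  proof (intro allI impI)
    fix i assume "N < i"
    have "\<not> i \<in> VX -` Poly_Mapping.keys m"
    proof
      assume "i \<in> VX -` Poly_Mapping.keys m"
      then have "i \<le> N" by (rule bspec[OF N])
      then show False using \<open>N < i\<close> by simp
    qed
    then show "Poly_Mapping.lookup m (VX i) = 0" by (simp add: in_keys_iff)
  qed
  then show "mps_nth f m = mps_nth g m" using assms[of N] unfolding eval_frac_eq_iff trunc_eq_iff by blast
qed

text \<open>
  Coefficientwise limits are reached at a finite stage if the truncations are eventually constant;
  a monomial that survives the truncation already has its limit coefficient there.
\<close>

lemma eval_frac_lim:
  assumes "\<And>M. N \<le> M \<Longrightarrow> eval_frac N (F M) = eval_frac N (F N)"
  shows "eval_frac N (mps_lim F) = eval_frac N (F N)"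
  unfolding eval_frac_eq_iff trunc_eq_iff
proof (intro allI impI)
  fix m assume m: "truncated N m"
  have const: "mps_nth (F M) m = mps_nth (F N) m" if "N \<le> M" for M
    using assms[OF that] m unfolding eval_frac_eq_iff trunc_eq_iff by blast
  have "(THE c. \<forall>\<^sub>F M in sequentially. mps_nth (F M) m = c) = mps_nth (F N) m"
  proof (rule the_equality)
    show "\<forall>\<^sub>F M in sequentially. mps_nth (F M) m = mps_nth (F N) m"
      unfolding eventually_sequentially using const by blast
    fix c assume "\<forall>\<^sub>F M in sequentially. mps_nth (F M) m = c"
    then obtain M where "\<And>k. M \<le> k \<Longrightarrow> mps_nth (F k) m = c" unfolding eventually_sequentially by blast
    from this[of "max M N"] show "c = mps_nth (F N) m" using const[of "max M N"] by simp
  qed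
  then show "mps_nth (mps_lim F) m = mps_nth (F N) m" by (simp add: mps_lim_def)
qed

abbreviation "xv N i \<equiv> eval_frac N (x_var i)"
abbreviation "yv N i \<equiv> eval_frac N (y_var i)"
abbreviation "zv N i \<equiv> eval_frac N (z_var i)"

lemma single_eq_single_iff: "Poly_Mapping.single u (1 :: nat) = Poly_Mapping.single v 1 \<longleftrightarrow> u = v"
proof
  assume "Poly_Mapping.single u (1 :: nat) = Poly_Mapping.single v 1"
  then have "Poly_Mapping.lookup (Poly_Mapping.single u (1 :: nat)) u = Poly_Mapping.lookup (Poly_Mapping.single v 1) u"
    by simp
  then show "u = v" by (simp add: lookup_single when_def split: if_splits)
qed simp

text \<open>Variables that survive the truncation stay algebraically as generic as needed.\<close>

lemma eval_var_generic:
  assumes u: "truncated N (Poly_Mapping.single u 1)" and v: "truncated N (Poly_Mapping.single v 1)"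
  shows "eval_frac N (mps_var u) = eval_frac N (mps_var v) \<longleftrightarrow> u = v"
    and "eval_frac N (mps_var u) \<noteq> 0" and "eval_frac N (mps_var u) + eval_frac N (mps_var v) \<noteq> 0"
proof -
  have nz: "eval_frac N f \<noteq> 0" if "mps_nth f (Poly_Mapping.single u 1) \<noteq> 0" for f
  proof
    assume "eval_frac N f = 0"
    then have "eval_frac N f = eval_frac N 0" by simp
    then have "mps_nth f (Poly_Mapping.single u 1) = mps_nth 0 (Poly_Mapping.single u 1)"
      using u unfolding eval_frac_eq_iff trunc_eq_iff by blast
    then show False using that by (simp add: zero_mps.rep_eq)
  qed
  show "eval_frac N (mps_var u) = eval_frac N (mps_var v) \<longleftrightarrow> u = v"
  proof
    assume "eval_frac N (mps_var u) = eval_frac N (mps_var v)"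
    then have "eval_frac N (mps_var u - mps_var v) = 0" by (simp add: eval.hom_diff)
    then have "mps_nth (mps_var u - mps_var v :: ser) (Poly_Mapping.single u 1) = 0" using nz by blast
    then show "u = v" unfolding minus_mps.rep_eq mps_nth_var single_eq_single_iff by (simp split: if_splits)
  qed simp
  show "eval_frac N (mps_var u) \<noteq> 0" by (rule nz) (simp only: mps_nth_var, simp)
  have "mps_nth (mps_var u + mps_var v :: ser) (Poly_Mapping.single u 1) \<noteq> 0"
    unfolding plus_mps.rep_eq mps_nth_var by simp
  then show "eval_frac N (mps_var u) + eval_frac N (mps_var v) \<noteq> 0"
    unfolding eval.hom_add[symmetric] by (rule nz)
qed

lemma truncated_var:
  "truncated N (Poly_Mapping.single (VX i) 1) \<longleftrightarrow> i \<le> N" "truncated N (Poly_Mapping.single (VY i) 1)"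
  "truncated N (Poly_Mapping.single (VZ i) 1)"
  by (auto simp: truncated_def lookup_single when_def not_less)

lemma xv_generic:
  assumes "i \<le> N" "j \<le> N"
  shows "xv N i = xv N j \<longleftrightarrow> i = j" "xv N i \<noteq> 0" "xv N i + xv N j \<noteq> 0"
  using eval_var_generic[of N "VX i" "VX j"] assms unfolding x_var_def truncated_var by simp_all

lemma xv_zero:
  assumes "N < i"
  shows "xv N i = 0"
proof -
  have "trunc N (x_var i) = trunc N 0"
    unfolding trunc_eq_iff x_var_def
    using truncated_var(1)[of N i] assms by (auto simp: mps_nth_var zero_mps.rep_eq)
  then have "xv N i = eval_frac N 0" by (simp only: eval_frac_eq_iff)
  then show ?thesis by simp
qed

lemma generic_flag_eval:
  assumes "1 \<le> n"
  shows "generic_flag (yv N) (zv N) n"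
proof
  show "inj_on (yv N) {1..<n}" "inj_on (zv N) {1..<n}"
    unfolding inj_on_def y_var_def z_var_def eval_var_generic(1)[OF truncated_var(2) truncated_var(2)]
      eval_var_generic(1)[OF truncated_var(3) truncated_var(3)] by auto
  show "yv N i \<noteq> - zv N j" for i j
    using eval_var_generic(3)[OF truncated_var(2) truncated_var(3), of N i j]
    unfolding y_var_def z_var_def by (simp add: eq_neg_iff_add_eq_0)
  show "yv N i \<noteq> 0" "zv N i \<noteq> 0" for i
    unfolding y_var_def z_var_def
    using eval_var_generic(2)[OF truncated_var(2) truncated_var(2)] eval_var_generic(2)[OF truncated_var(3) truncated_var(3)] by auto
qed (rule assms)

section \<open>Truncation of the two sides\<close>

context scalar_hom
begin

lemma hom_of_int: "\<iota> (of_int k) = of_int k"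
  by (induction k rule: int_induct[of _ 0]) (auto simp: hom_add hom_diff)

lemma hom_2: "\<iota> 2 = 2"
  using hom_of_int[of 2] by simp

lemma hom_prod_list: "\<iota> (prod_list xs) = prod_list (map \<iota> xs)"
  by (induction xs) (auto simp: hom_mult)

lemma hom_q_series: "\<iota> (fps_nth (\<Prod>i\<in>I. q_series (f i)) k) = fps_nth (\<Prod>i\<in>I. q_series (\<iota> (f i))) k"
proof (induction I arbitrary: k rule: infinite_finite_induct)
  case (insert i I)
  have "\<iota> (fps_nth (q_series (f i)) j) = fps_nth (q_series (\<iota> (f i))) j" for j
    by (simp add: q_series_def hom_mult hom_power hom_2)
  then show ?case using insert by (simp add: fps_mult_nth hom_sum hom_mult)
qed auto

lemma hom_Q_sum: "\<iota> (Q_sum q B \<alpha>) = Q_sum (\<lambda>r. \<iota> (q r)) B \<alpha>"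
  unfolding Q_sum_def by (simp add: hom_sum hom_mult hom_of_int hom_prod_list o_def del: of_int_prod)

lemma hom_complete_h: "\<iota> (complete_h p xs) = complete_h p (map \<iota> xs)"
  by (simp add: complete_h_def hom_sum hom_prod hom_power)

lemma ev_lin_fac: "ev n (lin_fac t i) = H n i (\<iota> t)"
  by (simp add: lin_fac_def ev_add ev_mult ev_scal ev_u_gen H_def)

lemma ev_A_fac: "ev n (A_fac n k t) = Dn n k (\<iota> t)"
  by (simp add: A_fac_def ev_prod_list ev_lin_fac Dn_def o_def)

lemma ev_A_fac_tilde: "ev n (A_fac_tilde n k t) = Up n k (- \<iota> t)"
  by (simp add: A_fac_tilde_def ev_prod_list ev_lin_fac Up_def hom_minus o_def)

lemma ev_C_fac: "ev n (C_fac n t) = Cc n (\<iota> t)"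
proof -
  have "ev n (C_fac n t) = Dn n 0 (\<iota> t) * Up n 0 (\<iota> t)"
    by (simp add: C_fac_def ev_mult ev_prod_list ev_lin_fac Dn_def Up_def o_def)
  also have "\<dots> = Dn n 1 (\<iota> t) * (H n 0 (\<iota> t) * H n 0 (\<iota> t)) * Up n 1 (\<iota> t)"
    unfolding Dn_Suc[of n 0] Up_Suc[of n 0] One_nat_def by (simp only: mult.assoc)
  finally show ?thesis by (simp only: H_mult Cc_def mult_2)
qed

lemma ev_nil_eq: "nil_eq n x y \<Longrightarrow> ev n x = ev n y"
  using ev_nil_ideal[of "x - y" n] by (simp add: nil_eq_def ev_diff)

end

lemma lin_fac_carrier: "i < n \<Longrightarrow> lin_fac t i \<in> free_carrier n"
  unfolding lin_fac_def u_gen_def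
  by (intro free_carrier_add free_carrier_1 free_carrier_mult free_carrier_scal free_carrier_single) simp

lemma factor_carriers:
  "A_fac n k t \<in> free_carrier n" "A_fac_tilde n k t \<in> free_carrier n" "C_fac n t \<in> free_carrier n"
  unfolding A_fac_def A_fac_tilde_def C_fac_def
  by (auto intro!: free_carrier_prod_list free_carrier_mult lin_fac_carrier)

lemma det_mat_psum: "det (mat m m f) = psum {0..<m} (\<lambda>p. \<Prod>i\<in>{0..<m}. f (i, p i))"
proof -
  have "det (mat m m f) = (\<Sum>p\<in>{p. p permutes {0..<m}}. signof p * (\<Prod>i = 0..<m. mat m m f $$ (i, p i)))"
    by (rule det_def') simp
  also have "\<dots> = psum {0..<m} (\<lambda>p. \<Prod>i\<in>{0..<m}. f (i, p i))"
    unfolding psum_def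
  proof (rule sum.cong)
    fix p assume "p \<in> {p. p permutes {0..<m}}"
    then have p: "p permutes {0..<m}" by simp
    have "(\<Prod>i = 0..<m. mat m m f $$ (i, p i)) = (\<Prod>i\<in>{0..<m}. f (i, p i))"
    proof (rule prod.cong)
      fix i assume i: "i \<in> {0..<m}"
      then have "p i \<in> {0..<m}" using permutes_in_image[OF p, of i] by simp
      then show "mat m m f $$ (i, p i) = f (i, p i)" using i by simp
    qed simp
    then show "signof p * (\<Prod>i = 0..<m. mat m m f $$ (i, p i)) = of_int (sign p) * (\<Prod>i\<in>{0..<m}. f (i, p i))"
      by simp
  qed simp
  finally show ?thesis .
qed

lemma (in scalar_hom) hom_det: "\<iota> (det (mat m m f)) = det (mat m m (\<lambda>p. \<iota> (f p)))"
  unfolding det_mat_psum psum_def by (simp add: hom_sum hom_mult hom_prod hom_of_int)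

lemma q_fun_eq_lim:
  "q_fun r = (if r < 0 then 0 else mps_lim (\<lambda>N. fps_nth (\<Prod>i = 1..N. q_series (x_var i)) (nat r)))"
proof -
  have "unit_inv (1 - fps_const x * fps_X) = geometric x" for x :: ser
    by (rule unit_inv_eqI[OF geometric_inverse])
  then show ?thesis unfolding q_fun_def q_series_eq by simp
qed

text \<open>The factors of the variables set to zero are \<open>1\<close>.\<close>

lemma eval_q_fun: "eval_frac N (q_fun r) = fps_coeff (\<Prod>x\<in>xv N ` {1..N}. q_series x) r"
proof (cases "r < 0")
  case False
  let ?F = "\<lambda>M. fps_nth (\<Prod>i = 1..M. q_series (x_var i)) (nat r)"
  have stable: "eval_frac N (?F M) = fps_nth (\<Prod>i = 1..N. q_series (xv N i)) (nat r)" if "N \<le> M" for M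
  proof -
    have "(\<Prod>i = 1..M. q_series (xv N i)) = (\<Prod>i = 1..N. q_series (xv N i))"
    proof (rule prod.mono_neutral_right)
      have "q_series (0 :: ser fract) = 1" by (rule fps_ext) (simp add: q_series_def)
      then show "\<forall>i\<in>{1..M} - {1..N}. q_series (xv N i) = 1" using xv_zero by auto
    qed (use that in auto)
    then show ?thesis by (simp only: eval.hom_q_series)
  qed
  have "eval_frac N (mps_lim ?F) = eval_frac N (?F N)"
    by (rule eval_frac_lim) (simp only: stable order_refl)
  then have "eval_frac N (q_fun r) = eval_frac N (?F N)"
    using False by (simp only: q_fun_eq_lim if_False)
  also have "\<dots> = fps_nth (\<Prod>i = 1..N. q_series (xv N i)) (nat r)" by (rule stable) simp
  also have "(\<Prod>i = 1..N. q_series (xv N i)) = (\<Prod>x\<in>xv N ` {1..N}. q_series x)"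
    by (subst prod.reindex) (auto simp: inj_on_def xv_generic(1))
  finally show ?thesis using False by (simp add: fps_coeff_def)
qed (simp add: q_fun_eq_lim fps_coeff_def)

lemma prod_list_ones: "(\<And>x. x \<in> set xs \<Longrightarrow> x = 1) \<Longrightarrow> prod_list xs = 1"
  by (induction xs) auto

definition x_list :: "nat \<Rightarrow> ser fract list" where
  "x_list N = map (xv N) [1..<Suc N]"

lemma set_x_list: "set (x_list N) = xv N ` {1..N}"
  by (auto simp: x_list_def)

lemma x_list_generic:
  "distinct (x_list N)" "0 \<notin> set (x_list N)"
  "x \<in> set (x_list N) \<Longrightarrow> y \<in> set (x_list N) \<Longrightarrow> x + y \<noteq> 0"
proof -
  show "distinct (x_list N)"
    unfolding x_list_def distinct_map by (auto simp: inj_on_def xv_generic(1) simp del: upt_Suc)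
  show "0 \<notin> set (x_list N)" 
  proof
    assume "0 \<in> set (x_list N)"
    then obtain i where "0 = xv N i" "i \<in> {1..N}" unfolding set_x_list by (rule imageE)
    then show False using xv_generic(2)[of i N i] by simp
  qed
  show "x + y \<noteq> 0" if xy: "x \<in> set (x_list N)" "y \<in> set (x_list N)"
  proof -
    obtain i where i: "x = xv N i" "i \<in> {1..N}" using xy(1) unfolding set_x_list by (rule imageE)
    obtain j where j: "y = xv N j" "j \<in> {1..N}" using xy(2) unfolding set_x_list by (rule imageE)
    show ?thesis unfolding i(1) j(1) by (rule xv_generic(3)) (use i j in auto)
  qed
qed

text \<open>Modulo the variables \<open>x\<^sub>i\<close> with \<open>i > N\<close> the infinite product is the product of its first \<open>N\<close> factors.\<close>

lemma eval_CX: "eval.ev N n (CX n) = prodl (Cc n) (x_list N)"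
proof -
  let ?\<xi> = "\<lambda>M. prod_list (map (\<lambda>k. C_fac n (x_var k)) [1..<Suc M]) :: ser free_alg"
  have carrier: "?\<xi> M \<in> free_carrier n" for M
    by (rule free_carrier_prod_list) (auto intro: factor_carriers)
  have ev: "eval.ev N n (?\<xi> M) = prodl (Cc n) (map (xv N) [1..<Suc M])" for M
    unfolding eval.ev_prod_list prodl_def by (simp add: eval.ev_C_fac o_def del: upt_Suc)
  have stable: "eval.ev N n (?\<xi> M) = prodl (Cc n) (x_list N)" if "N \<le> M" for M
  proof -
    have "[1..<Suc M] = [1..<Suc N] @ [Suc N..<Suc M]"
      using upt_add_eq_append[of 1 "Suc N" "M - N"] that by simp
    moreover have "prodl (Cc n :: ser fract \<Rightarrow> ser fract lop) (map (xv N) [Suc N..<Suc M]) = 1"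
    proof -
      have "prod_list (map (\<lambda>_. 1 :: ser fract lop) a) = 1" for a :: "nat list"
        by (rule prod_list_ones) auto
      then have "Cc n (0 :: ser fract) = 1" by (simp add: Cc_def Dn_def Up_def)
      moreover have "xv N i = 0" if "i \<in> set [Suc N..<Suc M]" for i
        by (rule xv_zero) (use that in auto)
      ultimately have "Cc n (xv N i) = 1" if "i \<in> set [Suc N..<Suc M]" for i using that by (simp only:)
      then show ?thesis unfolding prodl_def by (intro prod_list_ones) (auto simp del: upt_Suc)
    qed
    ultimately show ?thesis unfolding ev x_list_def by (simp only: map_append prodl_append mult_1_right)
  qed
  have lim: "eval_frac N (mps_lim (\<lambda>M. nil_coeff n (?\<xi> M) v)) = eval_frac N (nil_coeff n (?\<xi> N) v)" for v
    by (rule eval_frac_lim) (simp only: eval.hom_nil_coeff[OF carrier] stable order_refl)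
  have "eval.ev N n (CX n) = eval.ev N n (\<Sum>v\<in>signed_perms n. scal (nil_coeff n (?\<xi> N) v) * u_elt n v)"
    unfolding CX_def eval.ev_sum eval.ev_mult eval.ev_scal lim ..
  also have "\<dots> = eval.ev N n (?\<xi> N)"
    by (rule eval.ev_nil_eq, rule nil_eq_sym) (rule conjunct2[OF nil_coeff_expansion[OF carrier]])
  finally show ?thesis using stable by simp
qed

lemma CX_carrier: "CX n \<in> free_carrier n"
  unfolding CX_def by (intro free_carrier_sum free_carrier_mult free_carrier_scal u_elt_carrier)

text \<open>
  The coefficient of the longest element is a trace, because this element is central; hence the
  outer factors may be collected on the right.
\<close>

lemma eval_double_schubert:
  "eval_frac N (double_schubert_C n (negate n)) = top_coeff n (prodl (Cc n) (x_list N) * yz_factor (yv N) (zv N) n 1)"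
proof -
  let ?C = "prodl (Cc n) (x_list N)"
  let ?\<zeta> = "prod_list (map (\<lambda>i. A_fac_tilde n i (z_var i)) (rev [1..<n])) :: ser free_alg"
  let ?\<eta> = "prod_list (map (\<lambda>i. A_fac n i (y_var i)) [1..<n]) :: ser free_alg"
  have zeta: "eval.ev N n ?\<zeta> = prodl (\<lambda>i. Up n i (- zv N i)) (rev [1..<n])"
    unfolding eval.ev_prod_list prodl_def by (simp add: eval.ev_A_fac_tilde o_def)
  have eta: "eval.ev N n ?\<eta> = prodl (\<lambda>i. Dn n i (yv N i)) [1..<n]"
    unfolding eval.ev_prod_list prodl_def by (simp add: eval.ev_A_fac o_def)
  have words: "eval.ev N n ?\<zeta> \<in> wspan n (\<lambda>_. True)" "?C * eval.ev N n ?\<eta> \<in> wspan n (\<lambda>_. True)"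
    unfolding zeta eta
    by (rule few_zeros_words[of _ _ 0], rule prodl_few_zeros_0, rule Up_few_zeros, simp)
      (rule few_zeros_words, rule few_zeros_mult[OF prodl_Cc_few_zeros prodl_few_zeros_0[OF Dn_few_zeros] order_refl], simp)
  have carrier: "?\<zeta> * CX n * ?\<eta> \<in> free_carrier n"
    by (intro free_carrier_mult CX_carrier free_carrier_prod_list) (auto intro: factor_carriers)
  have "eval_frac N (double_schubert_C n (negate n)) = coeff_at (negate n) (eval.ev N n ?\<zeta> * (?C * eval.ev N n ?\<eta>))"
    unfolding double_schubert_C_def eval.hom_nil_coeff[OF carrier] eval.ev_mult eval_CX by (simp only: mult.assoc)
  also have "\<dots> = coeff_at (negate n) (?C * eval.ev N n ?\<eta> * eval.ev N n ?\<zeta>)"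
    by (rule coeff_at_trace[OF negate_central words])
  finally show ?thesis
    unfolding top_coeff_def yz_factor_def zeta eta prodl_def by (simp only: mult.assoc)
qed

lemma part_add_delta:
  assumes n: "1 \<le> n" and l: "l \<in> staircase_parts n"
  shows "length (part_add (delta n) l) = n"
    and "i < n \<Longrightarrow> part_add (delta n) l ! i = Suc (beta_perm n l i)"
proof -
  have "length l \<le> n"
  proof (rule ccontr)
    assume "\<not> length l \<le> n"
    then have "0 < part l (length l)" "n \<le> length l" "1 \<le> length l"
      using part_pos_iff[OF staircase_partsD(1)[OF l n order_refl], of "length l"] by auto
    then show False using staircase_partsD(2)[OF l n, of "length l"] by simp
  qed
  moreover have "length (delta n) = n" by (simp add: delta_def)
  ultimately have eq: "part_add (delta n) l = map (\<lambda>i. part (delta n) i + part l i) [1..<Suc n]"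
    unfolding part_add_def by (simp add: max_def del: upt_Suc)
  show "length (part_add (delta n) l) = n" unfolding eq by (simp del: upt_Suc)
  show "part_add (delta n) l ! i = Suc (beta_perm n l i)" if "i < n"
  proof -
    have "part_add (delta n) l ! i = part (delta n) (1 + i) + part l (1 + i)"
      unfolding eq by (rule nth_map_upt) (use that in simp)
    also have "\<dots> = Suc (beta_perm n l i)" using that by (simp add: part_delta beta_perm_def)
    finally show ?thesis .
  qed
qed

lemma eval_Q_fun:
  assumes n: "1 \<le> n" and l: "l \<in> staircase_parts n"
  shows "eval_frac N (Q_fun (map int (part_add (delta n) l))) =
    resid n (set (x_list N)) (\<lambda>s. \<Prod>i\<in>{0..<n}. (s ! i) ^ Suc (beta_perm n l i))"
proof -
  let ?\<alpha> = "map int (part_add (delta n) l)"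
  have len: "length ?\<alpha> = n" by (simp add: part_add_delta(1)[OF n l])
  have nth: "?\<alpha> ! i = int (Suc (beta_perm n l i))" if "i < n" for i
    using part_add_delta[OF n l] that by simp
  define B where "B = (\<Sum>k<n. Suc (beta_perm n l k))"
  have B: "(\<Sum>k<length ?\<alpha>. ?\<alpha> ! k) \<le> int B"
    unfolding len B_def of_nat_sum using nth by (intro sum_mono) auto
  have "eval_frac N (Q_fun ?\<alpha>) = eval_frac N (Q_sum q_fun B ?\<alpha>)"
    using B by (intro arg_cong[of _ _ "eval_frac N"] Q_fun_eq_sum) (use len nth in auto)
  also have "\<dots> = Q_sum (fps_coeff (\<Prod>x\<in>set (x_list N). q_series x)) B ?\<alpha>"
    unfolding eval.hom_Q_sum eval_q_fun set_x_list ..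
  also have "\<dots> = resid (length ?\<alpha>) (set (x_list N)) (\<lambda>s. \<Prod>i\<in>{0..<length ?\<alpha>}. (s ! i) ^ nat (?\<alpha> ! i))"
    by (rule Q_sum_eq_resid[OF _ x_list_generic(2) _ B]) (use len nth in auto)
  also have "\<dots> = resid n (set (x_list N)) (\<lambda>s. \<Prod>i\<in>{0..<n}. (s ! i) ^ Suc (beta_perm n l i))"
    unfolding len
  proof (rule resid_cong)
    fix s :: "ser fract list"
    show "(\<Prod>i\<in>{0..<n}. (s ! i) ^ nat (?\<alpha> ! i)) = (\<Prod>i\<in>{0..<n}. (s ! i) ^ Suc (beta_perm n l i))"
    proof (rule prod.cong)
      fix i assume "i \<in> {0..<n}"
      then have "nat (?\<alpha> ! i) = Suc (beta_perm n l i)" using nth[of i] by (simp only: nat_int atLeastLessThan_iff)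
      then show "(s ! i) ^ nat (?\<alpha> ! i) = (s ! i) ^ Suc (beta_perm n l i)" by (simp only:)
    qed simp
  qed simp
  finally show ?thesis .
qed

lemma eval_flagged_schur:
  assumes n: "1 \<le> n" and l: "l \<in> staircase_parts n"
  shows "eval_frac N (flagged_schur n (part_conj l)) = generic_flag.flag_minor (yv N) (zv N) n l"
proof -
  interpret generic_flag "yv N" "zv N" n by (rule generic_flag_eval[OF n])
  interpret staircase_partition n l by standard (rule n, rule l)
  have entry: "eval_frac N (complete_h (int (n - Suc i) - int (part (part_conj l) (Suc j)) + int (Suc j) - int (Suc i)) (flag_vars (Suc i))) =
      hsum (beta_perm n l (n + j)) (V (Suc i))" if ij: "i < n - 1" "j < n - 1" for i j
  proof -
    let ?xs = "map (eval_frac N) (flag_vars (Suc i))"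
    have set: "set ?xs = V (Suc i)"
      by (auto simp: flag_vars_def flag_set_def eval.hom_minus image_Un image_image simp del: upt_Suc)
    have len: "length ?xs = 2 * Suc i" by (simp add: flag_vars_def del: upt_Suc)
    have "card (set ?xs) = length ?xs" unfolding set len using card_V[of "Suc i"] ij by simp
    then have dist: "distinct ?xs" by (rule card_distinct)
    have ne: "?xs \<noteq> []"
    proof
      assume "?xs = []"
      then have "length ?xs = 0" by (simp only: list.size)
      then show False using len by simp
    qed
    have idx: "int (n - Suc i) - int (part (part_conj l) (Suc j)) + int (Suc j) - int (Suc i) =
        int (beta_perm n l (n + j)) + 1 - int (length ?xs)"
      unfolding beta_second[OF ij(2)] len using ij conj_le[of j] by (simp add: of_nat_diff)
    show ?thesis
      unfolding eval.hom_complete_h idx set[symmetric] by (rule complete_h_eq_hsum[OF dist ne])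
  qed
  show ?thesis
    unfolding flagged_schur_def flag_minor_def eval.hom_det
    by (intro arg_cong[of _ _ det] cong_mat refl) (simp only: prod.case Let_def entry)
qed

section \<open>Membership in the coefficient ring\<close>

context
  fixes S :: "'a :: comm_ring_1 set"
begin

lemma subring_zero: "0 \<in> subring_gen S"
  using subring_gen.diff[OF subring_gen.one subring_gen.one, of S] by simp

lemma subring_add: "a \<in> subring_gen S \<Longrightarrow> b \<in> subring_gen S \<Longrightarrow> a + b \<in> subring_gen S"
  using subring_gen.diff[OF _ subring_gen.diff[OF subring_zero], of a b] by simp

lemma subring_of_int: "of_int k \<in> subring_gen S"
  by (induction k rule: int_induct[of _ 0])
    (auto intro: subring_zero subring_add subring_gen.one subring_gen.diff)

lemma subring_sum: "(\<And>i. i \<in> I \<Longrightarrow> f i \<in> subring_gen S) \<Longrightarrow> sum f I \<in> subring_gen S"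
  by (induction I rule: infinite_finite_induct) (auto intro: subring_zero subring_add)

lemma subring_prod: "(\<And>i. i \<in> I \<Longrightarrow> f i \<in> subring_gen S) \<Longrightarrow> prod f I \<in> subring_gen S"
  by (induction I rule: infinite_finite_induct) (auto intro: subring_gen.one subring_gen.mult)

lemma subring_power: "a \<in> subring_gen S \<Longrightarrow> a ^ k \<in> subring_gen S"
  by (induction k) (auto intro: subring_gen.one subring_gen.mult)

lemma subring_prod_list: "(\<And>x. x \<in> set xs \<Longrightarrow> x \<in> subring_gen S) \<Longrightarrow> prod_list xs \<in> subring_gen S"
  by (induction xs) (auto intro: subring_gen.one subring_gen.mult)

lemma subring_complete_h: "(\<And>x. x \<in> set xs \<Longrightarrow> x \<in> subring_gen S) \<Longrightarrow> complete_h p xs \<in> subring_gen S"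
  unfolding complete_h_def by (auto intro!: subring_zero subring_sum subring_prod subring_power)

lemma subring_Q_sum: "(\<And>r. q r \<in> subring_gen S) \<Longrightarrow> Q_sum q B \<alpha> \<in> subring_gen S"
  unfolding Q_sum_def
  by (rule subring_sum, rule subring_gen.mult[OF subring_of_int], rule subring_prod_list) auto

lemma subring_det: "(\<And>p. f p \<in> subring_gen S) \<Longrightarrow> det (mat m m f) \<in> subring_gen S"
  unfolding det_mat_psum psum_def
  by (rule subring_sum, rule subring_gen.mult[OF subring_of_int], rule subring_prod) auto

end

lemma q_fun_Gamma_YZ: "q_fun r \<in> Gamma_YZ"
proof (cases "1 \<le> r")
  case True
  then have "q_fun r \<in> Gamma" unfolding Gamma_def by (intro subring_gen.gen) auto
  then show ?thesis unfolding Gamma_YZ_def by (intro subring_gen.gen) auto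
next
  case False
  have "fps_nth (\<Prod>i\<in>I. q_series (f i)) 0 = 1" for I and f :: "nat \<Rightarrow> ser"
    by (induction I rule: infinite_finite_induct) (auto simp: q_series_def)
  then have "mps_lim (\<lambda>N. fps_nth (\<Prod>i = 1..N. q_series (x_var i)) 0) = 1"
    by (intro mps_lim_eqI) simp
  then have "q_fun r = (if r < 0 then 0 else 1)" using False by (simp add: q_fun_eq_lim)
  then show ?thesis by (auto simp: Gamma_YZ_def intro: subring_zero subring_gen.one)
qed

lemma Q_fun_Gamma_YZ:
  assumes "1 \<le> n" "l \<in> staircase_parts n"
  shows "Q_fun (map int (part_add (delta n) l)) \<in> Gamma_YZ"
proof -
  let ?\<alpha> = "map int (part_add (delta n) l)"
  have "Q_fun ?\<alpha> = Q_sum q_fun (nat (\<Sum>k<length ?\<alpha>. ?\<alpha> ! k)) ?\<alpha>"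
    by (rule Q_fun_eq_sum) auto
  moreover have "Q_sum q_fun B ?\<alpha> \<in> Gamma_YZ" for B
    unfolding Gamma_YZ_def by (rule subring_Q_sum) (rule q_fun_Gamma_YZ[unfolded Gamma_YZ_def])
  ultimately show ?thesis by (simp only:)
qed

lemma flagged_schur_Gamma_YZ: "flagged_schur n \<mu> \<in> Gamma_YZ"
proof -
  have y: "y_var i \<in> Gamma_YZ" if "1 \<le> i" for i
    unfolding Gamma_YZ_def by (rule subring_gen.gen) (use that in simp)
  have z: "- z_var i \<in> Gamma_YZ" if "1 \<le> i" for i
  proof -
    have "z_var i \<in> Gamma_YZ" unfolding Gamma_YZ_def by (rule subring_gen.gen) (use that in simp)
    then have "0 - z_var i \<in> Gamma_YZ" unfolding Gamma_YZ_def by (rule subring_gen.diff[OF subring_zero])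
    then show ?thesis by simp
  qed
  have "x \<in> Gamma_YZ" if "x \<in> set (flag_vars i)" for x i
    using that y z by (auto simp: flag_vars_def simp del: upt_Suc)
  then have "complete_h p (flag_vars i) \<in> Gamma_YZ" for p i
    unfolding Gamma_YZ_def by (intro subring_complete_h) (simp only: Gamma_YZ_def[symmetric])
  then show ?thesis unfolding flagged_schur_def Gamma_YZ_def
    by (intro subring_det) (simp only: Let_def case_prod_unfold)
qed

theorem proposition3p1:
  fixes n :: nat and w0 :: "int \<Rightarrow> int"
  assumes "n \<ge> 1"
    and "is_arg_max (cox_length n) (\<lambda>w. w \<in> signed_perms n) w0"
  shows "double_schubert_C n w0 \<in> Gamma_YZ \<and>
    double_schubert_C n w0 =
      (\<Sum>l | is_partition l \<and> part_sub l (delta (n - 1)).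
         Q_fun (map int (part_add (delta n) l)) * flagged_schur n (part_conj l))"
proof -
  let ?rhs = "\<Sum>l\<in>staircase_parts n. Q_fun (map int (part_add (delta n) l)) * flagged_schur n (part_conj l)"
  have w0: "w0 = negate n" by (rule longest_element_unique[OF assms(2)])
  have "double_schubert_C n w0 = ?rhs"
  proof (rule eq_if_eval_frac_eq)
    fix N
    interpret generic_flag "yv N" "zv N" n by (rule generic_flag_eval[OF assms(1)])
    let ?X = "set (x_list N)" and ?\<xi> = "yz_factor (yv N) (zv N) n 1"
    have "eval_frac N (double_schubert_C n w0) = res n n ?X ?\<xi>"
      unfolding w0 eval_double_schubert
      by (rule top_coeff_eq_res[OF assms(1) x_list_generic upper_few_zeros[OF yz_factor_upper]]) simp_all
    also have "\<dots> = (\<Sum>l\<in>staircase_parts n. flag_minor l * resid n ?X (\<lambda>s. \<Prod>i\<in>{0..<n}. (s ! i) ^ Suc (beta_perm n l i)))"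
      unfolding res_eq_resid[OF finite_set] by (rule resid_yz_factor) simp
    also have "\<dots> = eval_frac N ?rhs"
      unfolding eval.hom_sum eval.hom_mult
      by (rule sum.cong) (simp_all only: eval_Q_fun[OF assms(1)] eval_flagged_schur[OF assms(1)] mult.commute)
    finally show "eval_frac N (double_schubert_C n w0) = eval_frac N ?rhs" .
  qed
  moreover have "?rhs \<in> Gamma_YZ"
    unfolding Gamma_YZ_def
    by (intro subring_sum subring_gen.mult)
      (simp_all only: Q_fun_Gamma_YZ[OF assms(1), unfolded Gamma_YZ_def] flagged_schur_Gamma_YZ[unfolded Gamma_YZ_def])
  ultimately show ?thesis unfolding staircase_parts_def by simp
qed

end
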